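(* Let $K$ be an algebraically closed field of prime characteristic $p>2$, and let $S=K[\![x_1,\dots,x_k]\!]$ where $k>2$. If $f\in S$ is a monomial of degree greater than $3$ and $R^{\bigstar}=S[\![u,v]\!]/(f+uv)$, where $u,v$ are new variables, then $R^{\bigstar}$ has FFRT but does not have finite CM representation type.
   Context: For a commutative ring $A$ of prime characteristic $p$, an $A$-module $M$ and $e\ge 0$, $F_*^eM$ is the $A$-module with elements $\{F_*^em : m\in M\}$, addition $F_*^em_1+F_*^em_2=F_*^e(m_1+m_2)$ and $A$-action $a\,F_*^em=F_*^e(a^{p^e}m)$. A ring $A$ of characteristic $p$ has finite F-representation type (FFRT) if there are finitely many finitely generated $A$-modules $M_1,\dots,M_s$ such that for every positive integer $e$ the $A$-module $F_*^e(A)$ is isomorphic to a finite direct sum $\bigoplus_{j=1}^sM_j^{\oplus t_{(e,j)}}$ with non-negative integers $t_{(e,j)}$. A finitely generated module $M$ over a Noetherian local ring $A$ is maximal Cohen-Macaulay (MCM) if $\operatorname{depth}_AM=\dim A$. A Cohen-Macaulay local ring $A$ has finite CM representation type if there are only finitely many isomorphism classes of indecomposable finitely generated MCM $A$-modules. *)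

theory Defs
  imports "HOL-Algebra.Algebra" "HOL-Library.Extended_Nat"
begin

section \<open>Formal power series in several variables\<close>

text \<open>
  Monomials are multisets of variables, as in \<^theory>\<open>HOL-Algebra.Indexed_Polynomials\<close>: the
  multiplicity of a variable is its exponent, \<open>+\<close> on multisets is the product of monomials, and
  the size of the multiset is the degree. A power series over \<open>R\<close> in the (finitely many) variables
  \<open>I\<close> is an arbitrary family of coefficients that vanishes on the monomials involving a variable
  outside \<open>I\<close>. Since \<open>R\<close> is any ring, the construction can be iterated to give \<open>K[[x]][[u,v]]\<close>.
\<close>

definition power_series_ring ::
    "('a, 'm) ring_scheme \<Rightarrow> 'v set \<Rightarrow> ('v multiset \<Rightarrow> 'a) ring" where
  "power_series_ring R I =
    \<lparr> carrier = {P. (\<forall>m. P m \<in> carrier R) \<and> (\<forall>m. \<not> set_mset m \<subseteq> I \<longrightarrow> P m = \<zero>\<^bsub>R\<^esub>)},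
      monoid.mult = (\<lambda>P Q m. finsum R (\<lambda>(a, b). P a \<otimes>\<^bsub>R\<^esub> Q b) {(a, b). a + b = m}),
      one = (\<lambda>m. if m = {#} then \<one>\<^bsub>R\<^esub> else \<zero>\<^bsub>R\<^esub>),
      ring.zero = (\<lambda>m. \<zero>\<^bsub>R\<^esub>),
      add = (\<lambda>P Q m. P m \<oplus>\<^bsub>R\<^esub> Q m) \<rparr>"

text \<open>\<open>ps_term R c m\<close> is the one-term series \<open>c x\<^sup>m\<close>; for \<open>m = {#}\<close> it is the constant \<open>c\<close>.\<close>

definition ps_term :: "('a, 'm) ring_scheme \<Rightarrow> 'a \<Rightarrow> 'v multiset \<Rightarrow> ('v multiset \<Rightarrow> 'a)" where
  "ps_term R c m = (\<lambda>m'. if m' = m then c else \<zero>\<^bsub>R\<^esub>)"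


section \<open>Modules\<close>

definition has_char :: "('a, 'm) ring_scheme \<Rightarrow> nat \<Rightarrow> bool" where
  "has_char R p \<longleftrightarrow> (\<forall>n::nat. [n] \<cdot>\<^bsub>R\<^esub> \<one>\<^bsub>R\<^esub> = \<zero>\<^bsub>R\<^esub> \<longleftrightarrow> p dvd n)"

definition fg_module :: "('a, 'm) ring_scheme \<Rightarrow> ('a, 'b, 'n) module_scheme \<Rightarrow> bool" where
  "fg_module R M \<longleftrightarrow> module R M \<and>
    (\<exists>G. finite G \<and> G \<subseteq> carrier M \<and>
      (\<forall>y\<in>carrier M. \<exists>c\<in>G \<rightarrow> carrier R. y = (\<Oplus>\<^bsub>M\<^esub>x\<in>G. c x \<odot>\<^bsub>M\<^esub> x)))"

definition module_iso ::
    "('a, 'm) ring_scheme \<Rightarrow> ('a, 'b, 'n) module_scheme \<Rightarrow> ('a, 'c, 'l) module_scheme \<Rightarrow> bool" where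
  "module_iso R M N \<longleftrightarrow>
    (\<exists>\<phi>. bij_betw \<phi> (carrier M) (carrier N) \<and>
      (\<forall>x\<in>carrier M. \<forall>y\<in>carrier M. \<phi> (x \<oplus>\<^bsub>M\<^esub> y) = \<phi> x \<oplus>\<^bsub>N\<^esub> \<phi> y) \<and>
      (\<forall>a\<in>carrier R. \<forall>x\<in>carrier M. \<phi> (a \<odot>\<^bsub>M\<^esub> x) = a \<odot>\<^bsub>N\<^esub> \<phi> x))"

text \<open>
  The record type of modules extends that of rings; the fields \<open>mult\<close> and \<open>one\<close> play no role for a
  module and are left \<open>undefined\<close>.
\<close>

definition self_module :: "('a, 'm) ring_scheme \<Rightarrow> ('a, 'a) module" where
  "self_module R =
    \<lparr> carrier = carrier R, monoid.mult = undefined, one = undefined,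
      ring.zero = \<zero>\<^bsub>R\<^esub>, add = add R, smult = monoid.mult R \<rparr>"

definition direct_sum ::
    "'i set \<Rightarrow> ('i \<Rightarrow> ('a, 'b, 'n) module_scheme) \<Rightarrow> ('a, 'i \<Rightarrow> 'b) module" where
  "direct_sum I M =
    \<lparr> carrier = (\<Pi>\<^sub>E i\<in>I. carrier (M i)), monoid.mult = undefined, one = undefined,
      ring.zero = (\<lambda>i\<in>I. \<zero>\<^bsub>M i\<^esub>),
      add = (\<lambda>x y. \<lambda>i\<in>I. x i \<oplus>\<^bsub>M i\<^esub> y i),
      smult = (\<lambda>a x. \<lambda>i\<in>I. a \<odot>\<^bsub>M i\<^esub> x i) \<rparr>"

definition frobenius_pushforward ::
    "nat \<Rightarrow> nat \<Rightarrow> ('a, 'm) ring_scheme \<Rightarrow> ('a, 'b, 'n) module_scheme \<Rightarrow> ('a, 'b) module" where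
  "frobenius_pushforward p e R M =
    \<lparr> carrier = carrier M, monoid.mult = undefined, one = undefined,
      ring.zero = \<zero>\<^bsub>M\<^esub>, add = add M,
      smult = (\<lambda>a x. (a [^]\<^bsub>R\<^esub> (p ^ e)) \<odot>\<^bsub>M\<^esub> x) \<rparr>"

definition indecomposable_module ::
    "('a, 'm) ring_scheme \<Rightarrow> ('a, 'b, 'n) module_scheme \<Rightarrow> bool" where
  "indecomposable_module R M \<longleftrightarrow> module R M \<and> carrier M \<noteq> {\<zero>\<^bsub>M\<^esub>} \<and>
    (\<forall>A B. submodule A R M \<longrightarrow> submodule B R M \<longrightarrow>
      A <+>\<^bsub>M\<^esub> B = carrier M \<longrightarrow> A \<inter> B = {\<zero>\<^bsub>M\<^esub>} \<longrightarrow> A = {\<zero>\<^bsub>M\<^esub>} \<or> B = {\<zero>\<^bsub>M\<^esub>})"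

text \<open>
  A type that contains an isomorphic copy of every finitely generated module over a ring with
  elements of type \<open>'a\<close> (a quotient of \<open>R\<^sup>n\<close> consists of sets of coefficient vectors); see lemma
  \<open>fg_module_copy\<close> below. Quantification over modules up to isomorphism is over this type.
\<close>

type_synonym 'a fg_mod = "('a, (nat \<Rightarrow> 'a) set) module"

lemma fg_module_copy:
  fixes R :: "('a, 'm) ring_scheme" and M :: "('a, 'b, 'n) module_scheme"
  assumes "fg_module R M"
  shows "\<exists>N :: 'a fg_mod. fg_module R N \<and> module_iso R M N"
proof -
  obtain G where M: "module R M" and G: "finite G" "G \<subseteq> carrier M"
    and gen: "\<And>y. y \<in> carrier M \<Longrightarrow> \<exists>c\<in>G \<rightarrow> carrier R. y = (\<Oplus>\<^bsub>M\<^esub>x\<in>G. c x \<odot>\<^bsub>M\<^esub> x)"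
    using assms unfolding fg_module_def by blast
  interpret M: module R M by (rule M)
  obtain h where h: "bij_betw h G {..<card G}"
    using G(1) finite_same_card_bij[of G "{..<card G}"] by auto
  define \<Phi> where "\<Phi> y = {c :: nat \<Rightarrow> 'a. (\<Oplus>\<^bsub>M\<^esub>x\<in>G. c (h x) \<odot>\<^bsub>M\<^esub> x) = y}" for y
  define \<Psi> where "\<Psi> = inv_into (carrier M) \<Phi>"
  have ne: "\<Phi> y \<noteq> {}" if y: "y \<in> carrier M" for y
  proof -
    obtain c where c: "c \<in> G \<rightarrow> carrier R" "y = (\<Oplus>\<^bsub>M\<^esub>x\<in>G. c x \<odot>\<^bsub>M\<^esub> x)"
      using gen[OF y] by blast
    have "(\<Oplus>\<^bsub>M\<^esub>x\<in>G. (c \<circ> inv_into G h) (h x) \<odot>\<^bsub>M\<^esub> x) = (\<Oplus>\<^bsub>M\<^esub>x\<in>G. c x \<odot>\<^bsub>M\<^esub> x)"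
      using c(1) G(2) h by (intro M.finsum_cong') (auto simp: bij_betw_def)
    then show ?thesis unfolding \<Phi>_def using c(2) by blast
  qed
  have inj: "inj_on \<Phi> (carrier M)"
  proof (rule inj_onI)
    fix x y assume "x \<in> carrier M" "y \<in> carrier M" "\<Phi> x = \<Phi> y"
    then show "x = y" using ne[of x] unfolding \<Phi>_def by auto
  qed
  have \<Psi>: "\<Psi> (\<Phi> x) = x" if "x \<in> carrier M" for x
    unfolding \<Psi>_def using inj that by simp
  define N :: "'a fg_mod" where
    "N = \<lparr> carrier = \<Phi> ` carrier M, monoid.mult = undefined, one = undefined,
      ring.zero = \<Phi> \<zero>\<^bsub>M\<^esub>, add = (\<lambda>x y. \<Phi> (\<Psi> x \<oplus>\<^bsub>M\<^esub> \<Psi> y)),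
      smult = (\<lambda>a x. \<Phi> (a \<odot>\<^bsub>M\<^esub> \<Psi> x)) \<rparr>"
  have Ns: "carrier N = \<Phi> ` carrier M" "ring.zero N = \<Phi> \<zero>\<^bsub>M\<^esub>"
    "\<And>x y. x \<oplus>\<^bsub>N\<^esub> y = \<Phi> (\<Psi> x \<oplus>\<^bsub>M\<^esub> \<Psi> y)" "\<And>a x. a \<odot>\<^bsub>N\<^esub> x = \<Phi> (a \<odot>\<^bsub>M\<^esub> \<Psi> x)"
    by (simp_all add: N_def)
  have "abelian_group N"
  proof (rule abelian_groupI)
    fix x assume "x \<in> carrier N"
    then obtain x' where "x' \<in> carrier M" "x = \<Phi> x'" by (auto simp: Ns)
    then show "\<exists>y\<in>carrier N. y \<oplus>\<^bsub>N\<^esub> x = \<zero>\<^bsub>N\<^esub>"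
      by (intro bexI[of _ "\<Phi> (\<ominus>\<^bsub>M\<^esub> x')"]) (auto simp: Ns \<Psi> M.l_neg)
  qed (auto simp: Ns \<Psi> M.a_ac)
  then have N: "module R N"
    by (intro moduleI M.is_cring)
       (auto simp: Ns \<Psi> M.smult_l_distr M.smult_r_distr M.smult_assoc1)
  interpret N: module R N by (rule N)
  have sum: "\<Phi> (\<Oplus>\<^bsub>M\<^esub>x\<in>Y. g x) = (\<Oplus>\<^bsub>N\<^esub>x\<in>Y. \<Phi> (g x))"
    if "finite Y" "g \<in> Y \<rightarrow> carrier M" for g and Y :: "'b set"
    using that
  proof (induction Y rule: finite_induct)
    case (insert y Y)
    then have "(\<lambda>x. \<Phi> (g x)) \<in> Y \<rightarrow> carrier N" "\<Phi> (g y) \<in> carrier N" by (auto simp: Ns)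
    with insert show ?case
      by (simp add: M.finsum_insert N.finsum_insert Ns(3) \<Psi> flip: insert.IH)
  qed (simp add: Ns)
  have "\<exists>c\<in>\<Phi> ` G \<rightarrow> carrier R. y = (\<Oplus>\<^bsub>N\<^esub>x\<in>\<Phi> ` G. c x \<odot>\<^bsub>N\<^esub> x)" if y: "y \<in> carrier N" for y
  proof -
    obtain y' where y': "y' \<in> carrier M" "y = \<Phi> y'" using y by (auto simp: Ns)
    obtain c where c: "c \<in> G \<rightarrow> carrier R" "y' = (\<Oplus>\<^bsub>M\<^esub>x\<in>G. c x \<odot>\<^bsub>M\<^esub> x)"
      using gen[OF y'(1)] by blast
    have mem: "c x \<odot>\<^bsub>M\<^esub> x \<in> carrier M" if "x \<in> G" for x using c G that by auto
    have "(\<Oplus>\<^bsub>N\<^esub>x\<in>\<Phi> ` G. (c \<circ> \<Psi>) x \<odot>\<^bsub>N\<^esub> x) = (\<Oplus>\<^bsub>N\<^esub>x\<in>G. (c \<circ> \<Psi>) (\<Phi> x) \<odot>\<^bsub>N\<^esub> \<Phi> x)"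
      using G(2) mem by (intro N.finsum_reindex inj_on_subset[OF inj]) (auto simp: Ns \<Psi> subsetD)
    also have "\<dots> = (\<Oplus>\<^bsub>N\<^esub>x\<in>G. \<Phi> (c x \<odot>\<^bsub>M\<^esub> x))"
      using G(2) mem by (intro N.finsum_cong') (auto simp: Ns \<Psi> subsetD)
    also have "\<dots> = y" using sum[of G "\<lambda>x. c x \<odot>\<^bsub>M\<^esub> x"] mem G(1) c(2) y'(2) by auto
    finally show ?thesis using c(1) G(2) by (intro bexI[of _ "c \<circ> \<Psi>"]) (auto simp: \<Psi> subsetD)
  qed
  then have "fg_module R N"
    unfolding fg_module_def using N G by (intro conjI exI[of _ "\<Phi> ` G"]) (auto simp: Ns)
  moreover have "module_iso R M N"
    unfolding module_iso_def using inj
    by (intro exI[of _ \<Phi>]) (auto simp: bij_betw_def Ns \<Psi>)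
  ultimately show ?thesis by blast
qed


section \<open>Finite F-representation type\<close>

definition FFRT :: "nat \<Rightarrow> ('a, 'm) ring_scheme \<Rightarrow> bool" where
  "FFRT p R \<longleftrightarrow> cring R \<and> Factorial_Ring.prime p \<and> has_char R p \<and>
    (\<exists>s (M :: nat \<Rightarrow> 'a fg_mod). (\<forall>j<s. fg_module R (M j)) \<and>
      (\<forall>e\<ge>1. \<exists>t :: nat \<Rightarrow> nat.
        module_iso R (frobenius_pushforward p e R (self_module R))
          (direct_sum (SIGMA j:{..<s}. {..<t j}) (\<lambda>(j, l). M j))))"


section \<open>Maximal Cohen-Macaulay modules\<close>

definition local_ring :: "('a, 'm) ring_scheme \<Rightarrow> bool" where
  "local_ring R \<longleftrightarrow> cring R \<and> (\<exists>!m. maximalideal m R)"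

definition max_ideal :: "('a, 'm) ring_scheme \<Rightarrow> 'a set" where
  "max_ideal R = (THE m. maximalideal m R)"

definition krull_dim :: "('a, 'm) ring_scheme \<Rightarrow> enat" where
  "krull_dim R =
    Sup {enat n | n. \<exists>P :: nat \<Rightarrow> 'a set. (\<forall>i\<le>n. primeideal (P i) R) \<and> (\<forall>i<n. P i \<subset> P (Suc i))}"

text \<open>\<open>seq_submodule M [x\<^sub>1, \<dots>, x\<^sub>n]\<close> is \<open>x\<^sub>1 M + \<dots> + x\<^sub>n M = (x\<^sub>1, \<dots>, x\<^sub>n) M\<close>.\<close>

fun seq_submodule :: "('a, 'b, 'n) module_scheme \<Rightarrow> 'a list \<Rightarrow> 'b set" where
  "seq_submodule M [] = {\<zero>\<^bsub>M\<^esub>}"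
| "seq_submodule M (x # xs) =
    {x \<odot>\<^bsub>M\<^esub> y \<oplus>\<^bsub>M\<^esub> z | y z. y \<in> carrier M \<and> z \<in> seq_submodule M xs}"

text \<open>
  \<open>x\<^sub>i\<^sub>+\<^sub>1\<close> is a nonzerodivisor on \<open>M / (x\<^sub>1, \<dots>, x\<^sub>i) M\<close> for all \<open>i < n\<close>, and
  \<open>M / (x\<^sub>1, \<dots>, x\<^sub>n) M \<noteq> 0\<close>; both are written in terms of representatives in \<open>M\<close>.
\<close>

definition regular_seq :: "('a, 'b, 'n) module_scheme \<Rightarrow> 'a list \<Rightarrow> bool" where
  "regular_seq M xs \<longleftrightarrow>
    (\<forall>i<length xs. \<forall>y\<in>carrier M.
      xs ! i \<odot>\<^bsub>M\<^esub> y \<in> seq_submodule M (take i xs) \<longrightarrow> y \<in> seq_submodule M (take i xs)) \<and>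
    seq_submodule M xs \<noteq> carrier M"

text \<open>Depth over a local ring, with the convention that the zero module has infinite depth.\<close>

definition depth :: "('a, 'm) ring_scheme \<Rightarrow> ('a, 'b, 'n) module_scheme \<Rightarrow> enat" where
  "depth R M =
    (if carrier M = {\<zero>\<^bsub>M\<^esub>} then \<infinity>
     else Sup {enat (length xs) | xs. set xs \<subseteq> max_ideal R \<and> regular_seq M xs})"

definition MCM :: "('a, 'm) ring_scheme \<Rightarrow> ('a, 'b, 'n) module_scheme \<Rightarrow> bool" where
  "MCM R M \<longleftrightarrow> noetherian_ring R \<and> local_ring R \<and> fg_module R M \<and> depth R M = krull_dim R"

text \<open>
  The notion is meant for Cohen-Macaulay local rings. That requirement is not a conjunct of the
  definition, so that the negation says that there are infinitely many isomorphism classes and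
  cannot hold merely because \<open>R\<close> is not a Cohen-Macaulay local ring.
\<close>

definition finite_CM_type :: "('a, 'm) ring_scheme \<Rightarrow> bool" where
  "finite_CM_type R \<longleftrightarrow>
    (\<exists>\<N> :: 'a fg_mod set. finite \<N> \<and>
      (\<forall>M :: 'a fg_mod. MCM R M \<and> indecomposable_module R M \<longrightarrow> (\<exists>N\<in>\<N>. module_iso R M N)))"


section \<open>The hypersurface\<close>

datatype uv = U | V

text \<open>\<open>uv_hypersurface S f\<close> is \<open>S[[u,v]]/(f + uv)\<close>.\<close>

definition uv_hypersurface :: "('a, 'm) ring_scheme \<Rightarrow> 'a \<Rightarrow> (uv multiset \<Rightarrow> 'a) set ring" where
  "uv_hypersurface S f =
    (let T = power_series_ring S {U, V};
         u = ps_term S \<one>\<^bsub>S\<^esub> {#U#};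
         v = ps_term S \<one>\<^bsub>S\<^esub> {#V#}
     in T Quot (PIdl\<^bsub>T\<^esub> (ps_term S f {#} \<oplus>\<^bsub>T\<^esub> u \<otimes>\<^bsub>T\<^esub> v)))"

end

theory Submission
  imports Defs "HOL-Library.Multiset_Order" "HOL-Library.Function_Algebras" "HOL-Library.Product_Lexorder"
begin

text \<open>
  After the substitution \<open>u \<mapsto> -u\<close> the ring is \<open>A = K[[x\<^sub>1, \<dots>, x\<^sub>k, u, v]]/(x\<^sup>d - u v)\<close>. It consists of the
  power series over the monoid of those \<open>\<xi>\<close> with \<open>\<xi>\<^sub>i \<ge> 0\<close> and \<open>\<xi>\<^sub>i + \<xi>\<^sub>u d\<^sub>i \<ge> 0\<close> for all \<open>i \<le> k\<close>, where
  \<open>\<xi>\<^sub>i\<close> and \<open>\<xi>\<^sub>u\<close> are the exponents of \<open>x\<^sub>i\<close> and \<open>u\<close>. Sorting exponents by their residues \<open>\<rho>\<close> modulo \<open>q = p\<^sup>e\<close>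
  splits \<open>F\<^sub>*\<^sup>e A\<close> into the modules of power series over the sets \<open>\<xi>\<^sub>i \<ge> 0\<close>, \<open>\<xi>\<^sub>i + \<xi>\<^sub>u d\<^sub>i + g\<^sub>i \<ge> 0\<close> with \<open>g\<^sub>i\<close>
  the integral part of \<open>(\<rho>\<^sub>i + \<rho>\<^sub>u d\<^sub>i) / q\<close>. Since \<open>g\<^sub>i \<le> d\<^sub>i\<close>, only finitely many of them occur.

  As \<open>d\<close> has degree at least 4, \<open>x\<^sup>d = y z\<close> for monomials \<open>y\<close>, \<open>z\<close> of degree at least 2. For \<open>c \<in> K\<close> put
  \<open>l = x\<^sub>1 + c x\<^sub>2\<close>. The 4 by 4 matrix factorization of \<open>y z - u v\<close> with entries \<open>0\<close>, \<open>u\<close>, \<open>v\<close>, \<open>y\<close>, \<open>z\<close>, \<open>l\<close> up to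
  sign has a maximal Cohen-Macaulay cokernel \<open>Q\<close>. Along a tangent vector at the closed point of \<open>A\<close> all
  linear maps from \<open>Q\<close> to \<open>K\<close> lift if and only if the vector annihilates the linear parts of these entries.
  Among the tangent vectors of the \<open>x\<^sub>1 x\<^sub>2\<close>-plane this determines \<open>c\<close>, and it passes to an
  indecomposable summand of \<open>Q\<close>. So different \<open>c\<close> yield nonisomorphic modules, and \<open>K\<close> is infinite.
\<close>

section \<open>Power series and modules over them\<close>

text \<open>The tangent vectors along which a module lifts form a linear subspace, and lifting
  passes to direct summands. For \<open>c \<noteq> 0\<close> the module Q lifts along (c, -1) but
  not along (0, -1), so some indecomposable summand fails along (0, -1) as well. If the summands for
  c and e were isomorphic with c different from e, that module would lift along (c, -1) and (e, -1),
  hence along (0, -1), which they span. Degree at least 4 lets both y and z have no linear part, so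
  that within this plane only l is seen. The matrix is Knoerrer's double of the factorization of
  \<open>y z\<close> by the triangular matrices (y l; 0 z) and (z -l; 0 y). Being maximal
  Cohen-Macaulay is an equality of depth and dimension. It is squeezed between a regular sequence of
  length k + 1, the bound k + 1 for the dimension of A, and the general bound of depth by dimension.
  The middle bound needs that prime chains in a power series ring are no longer than its number of
  variables, which is proved by counting monomials. On the Frobenius side K contains all q-th roots,
  so the pushforward of the coefficient field is one-dimensional and only exponents have to be
  sorted.\<close>

lemma (in abelian_monoid) finsum_Sigma:
  assumes "finite A" and "\<And>a. a \<in> A \<Longrightarrow> finite (B a)"
    and "\<And>a b. a \<in> A \<Longrightarrow> b \<in> B a \<Longrightarrow> f a b \<in> carrier G"
  shows "(\<Oplus>a\<in>A. \<Oplus>b\<in>B a. f a b) = finsum G (\<lambda>(a, b). f a b) (Sigma A B)"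
proof -
  have "(\<Oplus>z\<in>(\<Union>a\<in>A. Pair a ` B a). case_prod f z) = (\<Oplus>a\<in>A. \<Oplus>z\<in>Pair a ` B a. case_prod f z)"
    using assms
    by (intro add.finprod_UN_disjoint) (auto simp: pairwise_def disjnt_def)
  also have "\<dots> = (\<Oplus>a\<in>A. \<Oplus>b\<in>B a. f a b)"
  proof (intro finsum_cong' refl)
    fix a assume a: "a \<in> A"
    show "(\<Oplus>z\<in>Pair a ` B a. case_prod f z) = (\<Oplus>b\<in>B a. f a b)"
      using assms(3)[OF a] finsum_reindex[of "case_prod f" "Pair a" "B a"]
      by (auto simp: inj_on_def Pi_def)
  qed (use assms in \<open>auto intro!: finsum_closed\<close>)
  also have "(\<Union>a\<in>A. Pair a ` B a) = Sigma A B" by auto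
  finally show ?thesis by simp
qed

lemma (in abelian_monoid) finsum_bij:
  assumes "bij_betw h A B" and "\<And>b. b \<in> B \<Longrightarrow> f b \<in> carrier G"
    and "\<And>a. a \<in> A \<Longrightarrow> g a = f (h a)"
  shows "(\<Oplus>a\<in>A. g a) = (\<Oplus>b\<in>B. f b)"
proof -
  have "(\<Oplus>b\<in>B. f b) = (\<Oplus>a\<in>A. f (h a))"
    using finsum_reindex[of f h A] assms(1,2) by (auto simp: bij_betw_def)
  then show ?thesis
    using assms by (auto intro!: finsum_cong' simp: bij_betw_def)
qed

lemma (in abelian_monoid) finsum_single:
  assumes "finite A" and "a \<in> A" and "f a \<in> carrier G"
    and "\<And>x. x \<in> A \<Longrightarrow> x \<noteq> a \<Longrightarrow> f x = \<zero>"
  shows "(\<Oplus>x\<in>A. f x) = f a"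
proof -
  have "(\<Oplus>x\<in>A. f x) = (\<Oplus>x\<in>{a}. f x)"
    using assms by (intro add.finprod_mono_neutral_cong_right) (auto, metis zero_closed)
  then show ?thesis using assms by simp
qed

lemma finite_multisets_size: "finite A \<Longrightarrow> finite {m. set_mset m \<subseteq> A \<and> size m = n}"
proof (rule finite_subset)
  assume "finite A"
  then show "finite (mset ` {xs. set xs \<subseteq> A \<and> length xs = n})"
    using finite_lists_length_eq by blast
  show "{m. set_mset m \<subseteq> A \<and> size m = n} \<subseteq> mset ` {xs. set xs \<subseteq> A \<and> length xs = n}"
  proof
    fix m assume "m \<in> {m. set_mset m \<subseteq> A \<and> size m = n}"
    moreover obtain xs where "mset xs = m" by (rule ex_mset[THEN exE])
    ultimately show "m \<in> mset ` {xs. set xs \<subseteq> A \<and> length xs = n}" by force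
  qed
qed

lemma finite_submultisets: "finite {a. a \<subseteq># m}"
proof (rule finite_subset)
  show "finite (\<Union>n\<le>size m. {a. set_mset a \<subseteq> set_mset m \<and> size a = n})"
    using finite_multisets_size by blast
qed (auto dest: size_mset_mono set_mset_mono)

lemma finite_splits: "finite {(a, b). a + b = (m :: 'v multiset)}"
proof -
  have "{(a, b). a + b = m} \<subseteq> {a. a \<subseteq># m} \<times> {a. a \<subseteq># m}" by auto
  then show ?thesis
    by (rule finite_subset) (intro finite_cartesian_product finite_submultisets)
qed

lemma finite_splits': "finite {p. fst p + snd p = (m :: 'v multiset)}"
  using finite_splits[of m] by (simp add: case_prod_unfold)

definition supp_funs :: "('a, 'm) ring_scheme \<Rightarrow> 'g set \<Rightarrow> ('g \<Rightarrow> 'a) set" where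
  "supp_funs R Y = {r. (\<forall>\<xi>. r \<xi> \<in> carrier R) \<and> (\<forall>\<xi>. \<xi> \<notin> Y \<longrightarrow> r \<xi> = \<zero>\<^bsub>R\<^esub>)}"

text \<open>Convolution along \<open>\<pi>\<close>: a monomial \<open>a\<close> moves the exponent
  \<open>\<eta>\<close> to \<open>\<pi> a + \<eta>\<close>. With \<open>\<pi>\<close> the identity
  this is the product of the series ring itself, with \<open>wt\<close> it is the action on series
  over a cone, so the module laws are proved once for both. Restricting \<open>a\<close> to
  monomials in \<open>I\<close> and \<open>\<eta>\<close> to \<open>Y\<close> is what makes the
  index set finite in these cases.\<close>

definition ps_act :: "('a, 'm) ring_scheme \<Rightarrow> 'v set \<Rightarrow> ('v multiset \<Rightarrow> 'g::comm_monoid_add) \<Rightarrow> 'g set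
    \<Rightarrow> ('v multiset \<Rightarrow> 'a) \<Rightarrow> ('g \<Rightarrow> 'a) \<Rightarrow> 'g \<Rightarrow> 'a" where
  "ps_act R I \<pi> Y P r =
    (\<lambda>\<xi>. finsum R (\<lambda>(a, \<eta>). P a \<otimes>\<^bsub>R\<^esub> r \<eta>) {(a, \<eta>). set_mset a \<subseteq> I \<and> \<eta> \<in> Y \<and> \<pi> a + \<eta> = \<xi>})"

lemma ps_simps:
  "carrier (power_series_ring R I) = supp_funs R {m. set_mset m \<subseteq> I}"
  "\<zero>\<^bsub>power_series_ring R I\<^esub> = (\<lambda>m. \<zero>\<^bsub>R\<^esub>)"
  "\<one>\<^bsub>power_series_ring R I\<^esub> = (\<lambda>m. if m = {#} then \<one>\<^bsub>R\<^esub> else \<zero>\<^bsub>R\<^esub>)"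
  "P \<oplus>\<^bsub>power_series_ring R I\<^esub> Q = (\<lambda>m. P m \<oplus>\<^bsub>R\<^esub> Q m)"
  "P \<otimes>\<^bsub>power_series_ring R I\<^esub> Q = (\<lambda>m. finsum R (\<lambda>(a, b). P a \<otimes>\<^bsub>R\<^esub> Q b) {(a, b). a + b = m})"
  by (simp_all add: power_series_ring_def supp_funs_def)

locale ps_action = cring R for R (structure) +
  fixes I :: "'v set" and \<pi> :: "'v multiset \<Rightarrow> 'g::comm_monoid_add" and Y :: "'g set"
  assumes \<pi>_add: "\<pi> (a + b) = \<pi> a + \<pi> b" and \<pi>_zero: "\<pi> {#} = 0"
    and closed: "set_mset a \<subseteq> I \<Longrightarrow> \<eta> \<in> Y \<Longrightarrow> \<pi> a + \<eta> \<in> Y"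
    and fin: "finite {(a, \<eta>). set_mset a \<subseteq> I \<and> \<eta> \<in> Y \<and> \<pi> a + \<eta> = \<xi>}"
begin

abbreviation D where "D \<xi> \<equiv> {(a, \<eta>). set_mset a \<subseteq> I \<and> \<eta> \<in> Y \<and> \<pi> a + \<eta> = \<xi>}"

lemma act_closed:
  assumes "P \<in> carrier (power_series_ring R I)" "r \<in> supp_funs R Y"
  shows "ps_act R I \<pi> Y P r \<in> supp_funs R Y"
proof -
  have "ps_act R I \<pi> Y P r \<xi> = \<zero>" if "\<xi> \<notin> Y" for \<xi>
  proof -
    have "D \<xi> = {}" using closed that by auto
    then show ?thesis by (simp only: ps_act_def finsum_empty)
  qed
  with assms show ?thesis
    by (auto simp: supp_funs_def ps_simps ps_act_def intro!: finsum_closed)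
qed

text \<open>Both sides are sums over triples (a, b, \<eta>) with
  \<open>\<pi> a + \<pi> b + \<eta> = \<xi>\<close>, grouped once by the monomial
  \<open>a + b\<close> and once by the exponent \<open>\<pi> b + \<eta>\<close>.\<close>

lemma act_assoc:
  assumes P: "P \<in> carrier (power_series_ring R I)" and Q: "Q \<in> carrier (power_series_ring R I)"
    and r: "r \<in> supp_funs R Y"
  shows "ps_act R I \<pi> Y (P \<otimes>\<^bsub>power_series_ring R I\<^esub> Q) r = ps_act R I \<pi> Y P (ps_act R I \<pi> Y Q r)"
proof
  fix \<xi>
  have c: "P a \<in> carrier R" "Q a \<in> carrier R" "r \<eta> \<in> carrier R" for a \<eta>
    using assms by (auto simp: supp_funs_def ps_simps)
  have "ps_act R I \<pi> Y (P \<otimes>\<^bsub>power_series_ring R I\<^esub> Q) r \<xi>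
      = (\<Oplus>z\<in>D \<xi>. \<Oplus>w\<in>{(a, b). a + b = fst z}. P (fst w) \<otimes> Q (snd w) \<otimes> r (snd z))"
    unfolding ps_act_def ps_simps
    by (intro finsum_cong' refl)
      (auto simp: c case_prod_unfold finite_splits' finsum_ldistr intro!: finsum_closed)
  also have "\<dots> = finsum R (\<lambda>(z, w). P (fst w) \<otimes> Q (snd w) \<otimes> r (snd z)) (SIGMA z:D \<xi>. {(a, b). a + b = fst z})"
    by (rule finsum_Sigma) (use fin in \<open>auto simp: c finite_splits\<close>)
  also have "\<dots> = finsum R (\<lambda>(z, w). P (fst z) \<otimes> (Q (fst w) \<otimes> r (snd w))) (SIGMA z:D \<xi>. D (snd z))"
  proof (rule finsum_bij[where h = "\<lambda>((c, \<eta>), (a, b)). ((a, \<pi> b + \<eta>), (b, \<eta>))"])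
    show "bij_betw (\<lambda>((c, \<eta>), (a, b)). ((a, \<pi> b + \<eta>), (b, \<eta>))) (SIGMA z:D \<xi>. {(a, b). a + b = fst z})
        (SIGMA z:D \<xi>. D (snd z))"
      by (rule bij_betwI[where g = "\<lambda>((a, \<zeta>), (b, \<eta>)). ((a + b, \<eta>), (a, b))"])
        (auto simp: \<pi>_add add.assoc closed, (meson subsetD)+)
  qed (auto simp: c m_assoc)
  also have "\<dots> = (\<Oplus>z\<in>D \<xi>. \<Oplus>w\<in>D (snd z). P (fst z) \<otimes> (Q (fst w) \<otimes> r (snd w)))"
    by (rule finsum_Sigma[symmetric]) (use fin in \<open>auto simp: c\<close>)
  also have "\<dots> = (\<Oplus>z\<in>D \<xi>. P (fst z) \<otimes> (\<Oplus>w\<in>D (snd z). Q (fst w) \<otimes> r (snd w)))"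
    by (intro finsum_cong' refl) (use fin in \<open>auto simp: c finsum_rdistr intro!: finsum_closed\<close>)
  also have "\<dots> = ps_act R I \<pi> Y P (ps_act R I \<pi> Y Q r) \<xi>"
    unfolding ps_act_def by (intro finsum_cong' refl) (auto simp: c case_prod_unfold intro!: finsum_closed)
  finally show "ps_act R I \<pi> Y (P \<otimes>\<^bsub>power_series_ring R I\<^esub> Q) r \<xi> = ps_act R I \<pi> Y P (ps_act R I \<pi> Y Q r) \<xi>" .
qed

lemma act_add_left:
  assumes P: "P \<in> carrier (power_series_ring R I)" and Q: "Q \<in> carrier (power_series_ring R I)"
    and r: "r \<in> supp_funs R Y"
  shows "ps_act R I \<pi> Y (P \<oplus>\<^bsub>power_series_ring R I\<^esub> Q) r = (\<lambda>\<xi>. ps_act R I \<pi> Y P r \<xi> \<oplus> ps_act R I \<pi> Y Q r \<xi>)"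
proof
  fix \<xi>
  have c: "P a \<in> carrier R" "Q a \<in> carrier R" "r \<eta> \<in> carrier R" for a \<eta>
    using assms by (auto simp: supp_funs_def ps_simps)
  show "ps_act R I \<pi> Y (P \<oplus>\<^bsub>power_series_ring R I\<^esub> Q) r \<xi> = ps_act R I \<pi> Y P r \<xi> \<oplus> ps_act R I \<pi> Y Q r \<xi>"
    unfolding ps_act_def ps_simps
    by (subst finsum_addf[symmetric]) (auto simp: c l_distr case_prod_unfold intro!: finsum_cong')
qed

lemma act_add_right:
  assumes P: "P \<in> carrier (power_series_ring R I)" and r: "r \<in> supp_funs R Y" and s: "s \<in> supp_funs R Y"
  shows "ps_act R I \<pi> Y P (\<lambda>\<xi>. r \<xi> \<oplus> s \<xi>) = (\<lambda>\<xi>. ps_act R I \<pi> Y P r \<xi> \<oplus> ps_act R I \<pi> Y P s \<xi>)"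
proof
  fix \<xi>
  have c: "P a \<in> carrier R" "s \<eta> \<in> carrier R" "r \<eta> \<in> carrier R" for a \<eta>
    using assms by (auto simp: supp_funs_def ps_simps)
  show "ps_act R I \<pi> Y P (\<lambda>\<xi>. r \<xi> \<oplus> s \<xi>) \<xi> = ps_act R I \<pi> Y P r \<xi> \<oplus> ps_act R I \<pi> Y P s \<xi>"
    unfolding ps_act_def ps_simps
    by (subst finsum_addf[symmetric]) (auto simp: c r_distr case_prod_unfold intro!: finsum_cong')
qed

lemma act_one:
  assumes r: "r \<in> supp_funs R Y"
  shows "ps_act R I \<pi> Y \<one>\<^bsub>power_series_ring R I\<^esub> r = r"
proof
  fix \<xi>
  have c: "r \<eta> \<in> carrier R" for \<eta> using assms by (auto simp: supp_funs_def)
  show "ps_act R I \<pi> Y \<one>\<^bsub>power_series_ring R I\<^esub> r \<xi> = r \<xi>"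
  proof (cases "\<xi> \<in> Y")
    case True
    have "ps_act R I \<pi> Y \<one>\<^bsub>power_series_ring R I\<^esub> r \<xi>
        = (case ({#}, \<xi>) of (a, \<eta>) \<Rightarrow> \<one>\<^bsub>power_series_ring R I\<^esub> a \<otimes> r \<eta>)"
      unfolding ps_act_def
      by (rule finsum_single) (use True fin in \<open>auto simp: \<pi>_zero c ps_simps split: if_splits\<close>)
    then show ?thesis by (simp add: c ps_simps)
  next
    case False
    have "D \<xi> = {}" using closed False by auto
    then have "ps_act R I \<pi> Y \<one>\<^bsub>power_series_ring R I\<^esub> r \<xi> = \<zero>" by (simp only: ps_act_def finsum_empty)
    with False show ?thesis using r by (simp add: supp_funs_def)
  qed
qed

end

lemma (in cring) ps_action_self: "ps_action R I (\<lambda>a. a) {m. set_mset m \<subseteq> I}"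
proof
  fix \<xi> :: "'c multiset"
  show "finite {(a, \<eta>). set_mset a \<subseteq> I \<and> \<eta> \<in> {m. set_mset m \<subseteq> I} \<and> a + \<eta> = \<xi>}"
    by (rule finite_subset[OF _ finite_splits[of \<xi>]]) auto
qed auto

text \<open>The ring product sums over all splittings of a monomial, the action only over those
  inside \<open>I\<close>; the remaining ones contribute zero. This turns associativity and the unit
  law of the ring into instances of \<open>act_assoc\<close> and \<open>act_one\<close>.\<close>

lemma (in cring) ps_mult_eq_act:
  assumes "P \<in> carrier (power_series_ring R I)" "Q \<in> carrier (power_series_ring R I)"
  shows "P \<otimes>\<^bsub>power_series_ring R I\<^esub> Q = ps_act R I (\<lambda>a. a) {m. set_mset m \<subseteq> I} P Q"
proof
  fix m
  show "(P \<otimes>\<^bsub>power_series_ring R I\<^esub> Q) m = ps_act R I (\<lambda>a. a) {m. set_mset m \<subseteq> I} P Q m"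
    unfolding ps_simps ps_act_def
    by (rule add.finprod_mono_neutral_cong_right[OF finite_splits])
      (use assms in \<open>auto simp: ps_simps supp_funs_def\<close>)
qed

lemma (in cring) ps_mult_closed:
  assumes "P \<in> carrier (power_series_ring R I)" "Q \<in> carrier (power_series_ring R I)"
  shows "P \<otimes>\<^bsub>power_series_ring R I\<^esub> Q \<in> carrier (power_series_ring R I)"
  unfolding ps_mult_eq_act[OF assms]
  using ps_action.act_closed[OF ps_action_self] assms by (auto simp: ps_simps)

lemma (in cring) supp_funs_abelian_group:
  assumes "carrier M = supp_funs R Y" "\<zero>\<^bsub>M\<^esub> = (\<lambda>m. \<zero>)" "\<And>P Q. P \<oplus>\<^bsub>M\<^esub> Q = (\<lambda>m. P m \<oplus> Q m)"
  shows "abelian_group M"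
proof (rule abelian_groupI)
  fix P assume "P \<in> carrier M"
  then show "\<exists>Q\<in>carrier M. Q \<oplus>\<^bsub>M\<^esub> P = \<zero>\<^bsub>M\<^esub>"
    by (intro bexI[of _ "\<lambda>m. \<ominus> P m"]) (auto simp: assms supp_funs_def l_neg)
qed (auto simp: assms supp_funs_def a_ac)

lemma (in cring) ps_abelian_group: "abelian_group (power_series_ring R I)"
  by (rule supp_funs_abelian_group) (auto simp: ps_simps)

lemma (in cring) ps_cring: "cring (power_series_ring R I)"
proof -
  interpret A: ps_action R I "\<lambda>a. a" "{m. set_mset m \<subseteq> I}" by (rule ps_action_self)
  have comm: "P \<otimes>\<^bsub>power_series_ring R I\<^esub> Q = Q \<otimes>\<^bsub>power_series_ring R I\<^esub> P"
    if "P \<in> carrier (power_series_ring R I)" "Q \<in> carrier (power_series_ring R I)" for P Q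
  proof
    fix m
    show "(P \<otimes>\<^bsub>power_series_ring R I\<^esub> Q) m = (Q \<otimes>\<^bsub>power_series_ring R I\<^esub> P) m"
      unfolding ps_simps
      by (rule finsum_bij[where h = "\<lambda>(a, b). (b, a)"])
        (use that in \<open>auto simp: bij_betw_def inj_on_def image_def add.commute m_comm ps_simps supp_funs_def\<close>)
  qed
  have one: "\<one>\<^bsub>power_series_ring R I\<^esub> \<in> carrier (power_series_ring R I)"
    by (auto simp: ps_simps supp_funs_def)
  have "comm_monoid (power_series_ring R I)"
  proof (rule comm_monoidI)
    fix P Q W assume PQW: "P \<in> carrier (power_series_ring R I)" "Q \<in> carrier (power_series_ring R I)"
      "W \<in> carrier (power_series_ring R I)"
    show "P \<otimes>\<^bsub>power_series_ring R I\<^esub> Q \<otimes>\<^bsub>power_series_ring R I\<^esub> W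
        = P \<otimes>\<^bsub>power_series_ring R I\<^esub> (Q \<otimes>\<^bsub>power_series_ring R I\<^esub> W)"
      using A.act_assoc[OF PQW(1,2), of W] PQW
        ps_mult_eq_act[OF ps_mult_closed[OF PQW(1,2)] PQW(3)]
        ps_mult_eq_act[OF PQW(1) ps_mult_closed[OF PQW(2,3)]] ps_mult_eq_act[OF PQW(2,3)]
      by (metis ps_simps(1))
  next
    fix P assume "P \<in> carrier (power_series_ring R I)"
    then show "\<one>\<^bsub>power_series_ring R I\<^esub> \<otimes>\<^bsub>power_series_ring R I\<^esub> P = P"
      using A.act_one[of P] one by (simp add: ps_mult_eq_act) (simp add: ps_simps)
  qed (use comm one ps_mult_closed in auto)
  moreover have "(P \<oplus>\<^bsub>power_series_ring R I\<^esub> Q) \<otimes>\<^bsub>power_series_ring R I\<^esub> W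
     = P \<otimes>\<^bsub>power_series_ring R I\<^esub> W \<oplus>\<^bsub>power_series_ring R I\<^esub> Q \<otimes>\<^bsub>power_series_ring R I\<^esub> W"
    if "P \<in> carrier (power_series_ring R I)" "Q \<in> carrier (power_series_ring R I)"
      "W \<in> carrier (power_series_ring R I)" for P Q W
  proof -
    have "P \<oplus>\<^bsub>power_series_ring R I\<^esub> Q \<in> carrier (power_series_ring R I)"
      using that by (auto simp: ps_simps supp_funs_def)
    then show ?thesis
      using A.act_add_left[of P Q W] that by (simp add: ps_mult_eq_act) (simp add: ps_simps)
  qed
  ultimately show ?thesis using ps_abelian_group by (intro cringI)
qed

definition ps_module :: "('a, 'm) ring_scheme \<Rightarrow> 'v set \<Rightarrow> ('v multiset \<Rightarrow> 'g::comm_monoid_add) \<Rightarrow> 'g set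
    \<Rightarrow> ('v multiset \<Rightarrow> 'a, 'g \<Rightarrow> 'a) module" where
  "ps_module R I \<pi> Y =
    \<lparr> carrier = supp_funs R Y, monoid.mult = undefined, one = undefined,
      ring.zero = (\<lambda>\<xi>. \<zero>\<^bsub>R\<^esub>), add = (\<lambda>r s \<xi>. r \<xi> \<oplus>\<^bsub>R\<^esub> s \<xi>), smult = ps_act R I \<pi> Y \<rparr>"

lemma ps_module_simps:
  "carrier (ps_module R I \<pi> Y) = supp_funs R Y"
  "\<zero>\<^bsub>ps_module R I \<pi> Y\<^esub> = (\<lambda>\<xi>. \<zero>\<^bsub>R\<^esub>)"
  "r \<oplus>\<^bsub>ps_module R I \<pi> Y\<^esub> s = (\<lambda>\<xi>. r \<xi> \<oplus>\<^bsub>R\<^esub> s \<xi>)"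
  "P \<odot>\<^bsub>ps_module R I \<pi> Y\<^esub> r = ps_act R I \<pi> Y P r"
  by (simp_all add: ps_module_def)

lemma (in ps_action) module_ps_module: "module (power_series_ring R I) (ps_module R I \<pi> Y)"
proof (intro moduleI ps_cring)
  show "abelian_group (ps_module R I \<pi> Y)"
    by (rule supp_funs_abelian_group) (auto simp: ps_module_simps)
qed (auto simp: ps_module_simps act_closed act_add_left act_add_right act_assoc act_one)

lemma (in ideal) I_finsum_closed:
  assumes "\<And>i. i \<in> A \<Longrightarrow> f i \<in> I"
  shows "finsum R f A \<in> I"
  using assms
proof (induction A rule: infinite_finite_induct)
  case (insert i A)
  then have "f \<in> A \<rightarrow> carrier R" "f i \<in> carrier R" using Icarr by auto
  then show ?case using insert by (simp add: a_closed)
qed auto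

locale power_series = cring R for R (structure) + fixes I :: "'v set"
begin

abbreviation T where "T \<equiv> power_series_ring R I"

sublocale T: cring T by (rule ps_cring)

lemma coeff_closed [simp, intro]: "P \<in> carrier T \<Longrightarrow> P m \<in> carrier R"
  unfolding ps_simps(1) supp_funs_def by blast

lemma coeff_outside: "P \<in> carrier T \<Longrightarrow> \<not> set_mset m \<subseteq> I \<Longrightarrow> P m = \<zero>"
  unfolding ps_simps(1) supp_funs_def by blast

lemma T_memI: "(\<And>m. P m \<in> carrier R) \<Longrightarrow> (\<And>m. \<not> set_mset m \<subseteq> I \<Longrightarrow> P m = \<zero>) \<Longrightarrow> P \<in> carrier T"
  unfolding ps_simps(1) supp_funs_def by blast

lemma coeff_add [simp]: "(P \<oplus>\<^bsub>T\<^esub> Q) m = P m \<oplus> Q m" by (simp add: ps_simps)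
lemma coeff_zero [simp]: "\<zero>\<^bsub>T\<^esub> m = \<zero>" by (simp add: ps_simps)
lemma coeff_one: "\<one>\<^bsub>T\<^esub> m = (if m = {#} then \<one> else \<zero>)" by (simp add: ps_simps)

lemma coeff_minus [simp]:
  assumes "P \<in> carrier T" shows "(\<ominus>\<^bsub>T\<^esub> P) m = \<ominus> P m"
proof -
  have "(\<ominus>\<^bsub>T\<^esub> P) m \<oplus> P m = \<zero>"
    using T.l_neg[OF assms] by (metis coeff_add coeff_zero)
  then show ?thesis using assms by (metis T.a_inv_closed coeff_closed minus_equality)
qed

lemma coeff_diff [simp]:
  "P \<in> carrier T \<Longrightarrow> Q \<in> carrier T \<Longrightarrow> (P \<ominus>\<^bsub>T\<^esub> Q) m = P m \<ominus> Q m"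
  by (simp add: a_minus_def)

lemma coeff_mult: "(P \<otimes>\<^bsub>T\<^esub> Q) m = finsum R (\<lambda>(a, b). P a \<otimes> Q b) {(a, b). a + b = m}"
  by (simp add: ps_simps)

lemma coeff_finsum:
  assumes "\<And>i. i \<in> A \<Longrightarrow> F i \<in> carrier T"
  shows "(\<Oplus>\<^bsub>T\<^esub>i\<in>A. F i) m = (\<Oplus>i\<in>A. F i m)"
  using assms
proof (induction A rule: infinite_finite_induct)
  case (insert i A)
  then have "F \<in> A \<rightarrow> carrier T" "F i \<in> carrier T" by auto
  moreover have "(\<lambda>j. F j m) \<in> A \<rightarrow> carrier R" using insert by auto
  ultimately show ?case using insert by simp
qed auto

lemma ps_term_closed [simp, intro]:
  "c \<in> carrier R \<Longrightarrow> set_mset m \<subseteq> I \<Longrightarrow> ps_term R c m \<in> carrier T"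
  by (auto simp: ps_term_def intro!: T_memI split: if_splits)

lemma coeff_term_mult:
  assumes "c \<in> carrier R" "P \<in> carrier T"
  shows "(ps_term R c a \<otimes>\<^bsub>T\<^esub> P) m = (if a \<subseteq># m then c \<otimes> P (m - a) else \<zero>)"
proof (cases "a \<subseteq># m")
  case True
  have "finsum R (\<lambda>(a', b). ps_term R c a a' \<otimes> P b) {(a, b). a + b = m}
      = (case (a, m - a) of (a', b) \<Rightarrow> ps_term R c a a' \<otimes> P b)"
    by (rule finsum_single[OF finite_splits]) (use True assms in \<open>auto simp: ps_term_def split: if_splits\<close>)
  with True show ?thesis by (simp add: coeff_mult ps_term_def)
next
  case False
  then show ?thesis
    unfolding coeff_mult using assms
    by (auto intro!: add.finprod_one_eqI simp: ps_term_def)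
qed

lemma coeff_mult_empty:
  assumes "P \<in> carrier T" "Q \<in> carrier T"
  shows "(P \<otimes>\<^bsub>T\<^esub> Q) {#} = P {#} \<otimes> Q {#}"
proof -
  have "{(a, b). a + b = ({#} :: 'v multiset)} = {({#}, {#})}" by auto
  then show ?thesis using assms by (simp add: coeff_mult)
qed

lemma coeff_mult_single:
  assumes "P \<in> carrier T" "Q \<in> carrier T"
  shows "(P \<otimes>\<^bsub>T\<^esub> Q) {#x#} = P {#} \<otimes> Q {#x#} \<oplus> P {#x#} \<otimes> Q {#}"
proof -
  have "{(a, b). a + b = {#x#}} = {({#}, {#x#}), ({#x#}, {#})}"
    by (auto simp: union_is_single)
  then show ?thesis using assms by (simp add: coeff_mult)
qed

text \<open>One notion for three families of ideals: the series of order at least n, the series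
  generated by a set of variables, and the series in which no divisor of a fixed monomial
  occurs.\<close>

definition mono_ideal :: "'v multiset set \<Rightarrow> ('v multiset \<Rightarrow> 'a) set" where
  "mono_ideal Y = {P \<in> carrier T. \<forall>m. m \<notin> Y \<longrightarrow> P m = \<zero>}"

lemma ideal_mono_ideal:
  assumes "\<And>a b. a \<in> Y \<Longrightarrow> a + b \<in> Y"
  shows "ideal (mono_ideal Y) T"
proof -
  have mult: "P \<otimes>\<^bsub>T\<^esub> Q \<in> mono_ideal Y" if "P \<in> mono_ideal Y" "Q \<in> carrier T" for P Q
  proof -
    have "(P \<otimes>\<^bsub>T\<^esub> Q) m = \<zero>" if "m \<notin> Y" for m
      using assms \<open>P \<in> mono_ideal Y\<close> \<open>Q \<in> carrier T\<close> that
      by (auto simp: coeff_mult mono_ideal_def intro!: add.finprod_one_eqI) (metis coeff_closed l_null)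
    with that show ?thesis by (auto simp: mono_ideal_def)
  qed
  have "additive_subgroup (mono_ideal Y) T"
  proof (intro additive_subgroup.intro T.add.subgroupI)
    show "\<And>a. a \<in> mono_ideal Y \<Longrightarrow> \<ominus>\<^bsub>T\<^esub> a \<in> mono_ideal Y"
      by (auto simp: mono_ideal_def)
    show "mono_ideal Y \<noteq> {}" using T.zero_closed by (auto simp: mono_ideal_def intro!: exI[of _ "\<zero>\<^bsub>T\<^esub>"])
  qed (auto simp: mono_ideal_def)
  then have "subgroup (mono_ideal Y) (add_monoid T)" by (simp add: additive_subgroup_def)
  then show ?thesis
  proof (intro idealI T.ring_axioms)
    fix a x assume a: "a \<in> mono_ideal Y" and x: "x \<in> carrier T"
    show "a \<otimes>\<^bsub>T\<^esub> x \<in> mono_ideal Y" by (rule mult[OF a x])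
    moreover have "a \<in> carrier T" using a by (simp add: mono_ideal_def)
    ultimately show "x \<otimes>\<^bsub>T\<^esub> a \<in> mono_ideal Y" using x by (simp add: T.m_comm)
  qed
qed

abbreviation ord_ideal :: "nat \<Rightarrow> ('v multiset \<Rightarrow> 'a) set" where
  "ord_ideal n \<equiv> mono_ideal {m. n \<le> size m}"

lemma ideal_ord_ideal: "ideal (ord_ideal n) T"
  by (rule ideal_mono_ideal) auto

lemma ord_ideal_antimono: "n \<le> n' \<Longrightarrow> ord_ideal n' \<subseteq> ord_ideal n"
  by (auto simp: mono_ideal_def)

end

section \<open>Division with remainder and its consequences\<close>

text \<open>Comparing the degree first makes quotients in a division small whenever the dividend has
  large order; this is what the proof of \<open>colon_order_bound\<close> relies on.\<close>

definition mkey :: "'v multiset \<Rightarrow> nat \<times> 'v multiset" where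
  "mkey m = (size m, m)"

lemma mkey_inj [simp]: "mkey a = mkey b \<longleftrightarrow> a = b"
  by (auto simp: mkey_def)

lemma mkey_add [simp]:
  "mkey (a + c) < mkey (b + c) \<longleftrightarrow> mkey a < mkey (b :: 'v::linorder multiset)"
  "mkey (c + a) < mkey (c + b) \<longleftrightarrow> mkey a < mkey b"
  "mkey (a + c) \<le> mkey (b + c) \<longleftrightarrow> mkey a \<le> mkey b"
  "mkey (c + a) \<le> mkey (c + b) \<longleftrightarrow> mkey a \<le> mkey b"
  by (auto simp: mkey_def less_prod_def less_eq_prod_def)

lemma mkey_size: "mkey a \<le> mkey (b :: 'v::linorder multiset) \<Longrightarrow> size a \<le> size b"
  by (auto simp: mkey_def less_eq_prod_def)

text \<open>For power series the leading term is the lowest one. It exists because the keys are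
  well-ordered, and lowest terms multiply because adding a fixed monomial preserves the order of the
  keys.\<close>

definition lead_at :: "('a, 'm) ring_scheme \<Rightarrow> ('v::linorder multiset \<Rightarrow> 'a) \<Rightarrow> 'v multiset \<Rightarrow> bool" where
  "lead_at R P m \<longleftrightarrow> P m \<noteq> \<zero>\<^bsub>R\<^esub> \<and> (\<forall>m'. P m' \<noteq> \<zero>\<^bsub>R\<^esub> \<longrightarrow> mkey m \<le> mkey m')"

lemma lead_exists:
  fixes P :: "'v::wellorder multiset \<Rightarrow> 'a"
  assumes "P m \<noteq> \<zero>\<^bsub>R\<^esub>"
  shows "\<exists>l. lead_at R P l"
proof -
  define k where "k = (LEAST k. \<exists>l. k = mkey l \<and> P l \<noteq> \<zero>\<^bsub>R\<^esub>)"
  have "\<exists>l. k = mkey l \<and> P l \<noteq> \<zero>\<^bsub>R\<^esub>"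
    unfolding k_def by (rule LeastI[of _ "mkey m"]) (use assms in blast)
  then obtain l where l: "k = mkey l" "P l \<noteq> \<zero>\<^bsub>R\<^esub>" by blast
  have "k \<le> mkey m'" if "P m' \<noteq> \<zero>\<^bsub>R\<^esub>" for m'
    unfolding k_def by (rule Least_le) (use that in blast)
  with l show ?thesis unfolding lead_at_def by blast
qed

locale power_series_field = power_series R I + field R for R (structure) and I :: "'v::wellorder set"
begin

text \<open>Every monomial m divisible by some lead is assigned to one index
  \<open>\<iota> m\<close> whose lead divides it, so that m is served by a single quotient. The
  coefficient \<open>c m\<close> of this quotient at \<open>m - l (\<iota> m)\<close> is found by
  recursion along the order: it is \<open>P m\<close> minus everything that earlier coefficients
  already contribute at m. The remainder is not named; the conclusion only says that it vanishes at
  the monomials divisible by a lead.\<close>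

lemma division:
  fixes g :: "'i \<Rightarrow> 'v multiset \<Rightarrow> 'a"
  assumes A: "finite A" and g: "\<And>i. i \<in> A \<Longrightarrow> g i \<in> carrier T"
    and lead: "\<And>i. i \<in> A \<Longrightarrow> lead_at R (g i) (l i)" and monic: "\<And>i. i \<in> A \<Longrightarrow> g i (l i) = \<one>"
    and P: "P \<in> carrier T"
  obtains h where "\<And>i. i \<in> A \<Longrightarrow> h i \<in> carrier T"
    "\<And>i m. i \<in> A \<Longrightarrow> l i \<subseteq># m \<Longrightarrow> P m = (\<Oplus>\<^bsub>T\<^esub>i\<in>A. h i \<otimes>\<^bsub>T\<^esub> g i) m"
    "\<And>i n. i \<in> A \<Longrightarrow> P \<in> ord_ideal n \<Longrightarrow> h i \<in> ord_ideal (n - size (l i))"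
proof -
  define \<iota> where "\<iota> m = (SOME i. i \<in> A \<and> l i \<subseteq># m)" for m
  have \<iota>: "\<iota> m \<in> A \<and> l (\<iota> m) \<subseteq># m" if "i \<in> A" "l i \<subseteq># m" for i m
    using someI[of "\<lambda>i. i \<in> A \<and> l i \<subseteq># m" i] that unfolding \<iota>_def by blast
  define r where "r = inv_image {(x, y). x < y} (mkey :: 'v multiset \<Rightarrow> _)"
  have wfr: "wf r" unfolding r_def by (rule wf_inv_image[OF wf])
  \<comment> \<open>The triples stand for products of a quotient coefficient at \<open>a\<close>
    with a coefficient of \<open>g i\<close> at \<open>b\<close> that land on m and stem from an
    earlier stage of the recursion.\<close>
  define S where "S m = {(i, a, b). i \<in> A \<and> a + b = m \<and> \<iota> (a + l i) = i \<and> mkey (a + l i) < mkey m}" for m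
  define F where "F c m = P m \<ominus> finsum R (\<lambda>(i, a, b). c (a + l i) \<otimes> g i b) (S m)" for c and m :: "'v multiset"
  define c where "c = wfrec r F"
  have gc [simp]: "g i m \<in> carrier R" if "i \<in> A" for i m using g[OF that] by auto
  have finS: "finite (S m)" for m
    by (rule finite_subset[OF _ finite_cartesian_product[OF A finite_splits[of m]]]) (auto simp: S_def)
  have c0: "c m = F (cut c r m) m" for m
    using wfrec[OF wfr, of F m] by (simp add: c_def)
  have cc: "c m \<in> carrier R" for m
    using wfr
  proof (induction m rule: wf_induct_rule)
    case (less m)
    then show ?case unfolding c0[of m] F_def using P
      by (auto simp: S_def cut_def r_def intro!: finsum_closed)
  qed
  have c: "c m = P m \<ominus> finsum R (\<lambda>(i, a, b). c (a + l i) \<otimes> g i b) (S m)" for m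
  proof -
    have "finsum R (\<lambda>(i, a, b). cut c r m (a + l i) \<otimes> g i b) (S m) = finsum R (\<lambda>(i, a, b). c (a + l i) \<otimes> g i b) (S m)"
      by (intro finsum_cong') (auto simp: S_def cut_def r_def cc)
    then show ?thesis using c0[of m] by (simp add: F_def)
  qed
  define h where "h i a = (if set_mset a \<subseteq> I \<and> \<iota> (a + l i) = i then c (a + l i) else \<zero>)" for i a
  have h: "h i \<in> carrier T" for i by (auto simp: h_def cc intro!: T_memI split: if_splits)
  have l_I: "set_mset (l i) \<subseteq> I" if "i \<in> A" for i
    using coeff_outside[OF g[OF that], of "l i"] monic[OF that] by auto
  have key: "mkey (l i) \<le> mkey b" if "i \<in> A" "g i b \<noteq> \<zero>" for i b
    using lead that by (auto simp: lead_at_def)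
  have main: "P m = (\<Oplus>\<^bsub>T\<^esub>i\<in>A. h i \<otimes>\<^bsub>T\<^esub> g i) m" if i: "i \<in> A" "l i \<subseteq># m" for i m
  proof (cases "set_mset m \<subseteq> I")
    case True
    let ?j = "\<iota> m" and ?E = "{(a, b). a + b = m}"
    let ?t = "\<lambda>(i, a, b). h i a \<otimes> g i b"
    have j: "?j \<in> A" "l ?j \<subseteq># m" using \<iota>[OF i] by auto
    have z: "(?j, m - l ?j, l ?j) \<notin> S m" using j by (auto simp: S_def)
    have "(\<Oplus>\<^bsub>T\<^esub>i\<in>A. h i \<otimes>\<^bsub>T\<^esub> g i) m = (\<Oplus>i\<in>A. \<Oplus>z\<in>?E. h i (fst z) \<otimes> g i (snd z))"
      using g h by (subst coeff_finsum) (auto simp: coeff_mult case_prod_unfold intro!: finsum_cong' finsum_closed)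
    also have "\<dots> = finsum R (\<lambda>(i, z). h i (fst z) \<otimes> g i (snd z)) (A \<times> ?E)"
      using h by (intro finsum_Sigma A finite_splits) auto
    \<comment> \<open>Since \<open>l i\<close> is the lowest monomial of \<open>g i\<close>, a
      nonzero product landing on m belongs to a monomial \<open>a + l i\<close> of key at most that
      of m. Either the key is smaller, which is \<open>S m\<close>, or \<open>a + l i = m\<close>
      and the product is the lead term of the responsible index.\<close>
    also have "\<dots> = finsum R ?t (insert (?j, m - l ?j, l ?j) (S m))"
    proof (rule add.finprod_mono_neutral_cong_right)
      show "insert (?j, m - l ?j, l ?j) (S m) \<subseteq> A \<times> ?E" using j by (auto simp: S_def)
      show "(case z of (i, z) \<Rightarrow> h i (fst z) \<otimes> g i (snd z)) = \<zero>"
        if zin: "z \<in> A \<times> ?E - insert (?j, m - l ?j, l ?j) (S m)" for z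
      proof -
        obtain i a b where z: "z = (i, a, b)" "i \<in> A" "a + b = m" using zin by auto
        consider "g i b = \<zero>" | "\<iota> (a + l i) \<noteq> i" | "g i b \<noteq> \<zero>" "\<iota> (a + l i) = i" by blast
        then show ?thesis
        proof cases
          case 3
          then have k: "mkey (a + l i) \<le> mkey m" using key[OF z(2)] z(3) by auto
          have "z \<notin> S m" using zin by blast
          then have "\<not> mkey (a + l i) < mkey m" using z 3 by (auto simp: S_def)
          with k have "a + l i = m" by simp
          then have "z = (?j, m - l ?j, l ?j)" using z 3 by auto
          with zin show ?thesis by blast
        qed (use z h cc in \<open>auto simp: h_def\<close>)
      qed
    qed (use A finite_splits h in auto)
    also have "\<dots> = ?t (?j, m - l ?j, l ?j) \<oplus> finsum R ?t (S m)"
      using h j(1) by (intro finsum_insert finS z) (auto simp: S_def)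
    also have "finsum R ?t (S m) = finsum R (\<lambda>(i, a, b). c (a + l i) \<otimes> g i b) (S m)"
      using True by (intro finsum_cong') (auto simp: S_def h_def cc)
    also have "?t (?j, m - l ?j, l ?j) = c m"
      using True j monic by (auto simp: h_def cc dest: in_diffD)
    finally have "(\<Oplus>\<^bsub>T\<^esub>i\<in>A. h i \<otimes>\<^bsub>T\<^esub> g i) m = c m \<oplus> finsum R (\<lambda>(i, a, b). c (a + l i) \<otimes> g i b) (S m)" .
    moreover have "finsum R (\<lambda>(i, a, b). c (a + l i) \<otimes> g i b) (S m) \<in> carrier R"
      by (intro finsum_closed) (auto simp: S_def cc)
    ultimately show ?thesis using c[of m] P cc by (simp add: minus_eq a_assoc l_neg)
  next
    case False
    have "(\<Oplus>\<^bsub>T\<^esub>i\<in>A. h i \<otimes>\<^bsub>T\<^esub> g i) \<in> carrier T" using h g by (intro T.finsum_closed) auto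
    from coeff_outside[OF this False] coeff_outside[OF P False] show ?thesis by simp
  qed
  have c_ord: "c m = \<zero>" if "P \<in> ord_ideal n" "size m < n" for m n
    using wfr that(2)
  proof (induction m rule: wf_induct_rule)
    case (less m)
    have "finsum R (\<lambda>(i, a, b). c (a + l i) \<otimes> g i b) (S m) = \<zero>"
    proof (rule add.finprod_one_eqI)
      fix z assume "z \<in> S m"
      then obtain i a b where z: "z = (i, a, b)" "i \<in> A" "mkey (a + l i) < mkey m" by (auto simp: S_def)
      moreover have "size (a + l i) < n" using mkey_size z(3) less(2) by (meson le_less_trans less_imp_le)
      ultimately show "(case z of (i, a, b) \<Rightarrow> c (a + l i) \<otimes> g i b) = \<zero>"
        using less(1)[of "a + l i"] by (simp add: r_def)
    qed
    moreover have "P m = \<zero>" using that(1) less(2) by (auto simp: mono_ideal_def)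
    ultimately show ?case using c[of m] by (simp add: minus_eq)
  qed
  have "h i \<in> ord_ideal (n - size (l i))" if "P \<in> ord_ideal n" for i n
    using h c_ord[OF that] unfolding mono_ideal_def by (auto simp: h_def)
  with that[of h] h main show thesis by blast
qed

end

section \<open>Dickson's lemma and standard bases\<close>

text \<open>\<open>p n\<close> is a position of the least value from n on. Jumping from each such
  position to the next one beyond it yields nondecreasing values.\<close>

lemma nat_seq_incseq_subseq:
  fixes s :: "nat \<Rightarrow> nat"
  obtains r :: "nat \<Rightarrow> nat" where "strict_mono r" "\<And>i j. i \<le> j \<Longrightarrow> s (r i) \<le> s (r j)"
proof -
  define p where "p n = arg_min s (\<lambda>m. n \<le> m)" for n
  have p: "n \<le> p n" "\<And>m. n \<le> m \<Longrightarrow> s (p n) \<le> s m" for n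
    using arg_min_nat_lemma[of "\<lambda>m. n \<le> m" n s] by (auto simp: p_def)
  define r where "r = rec_nat (p 0) (\<lambda>_ m. p (Suc m))"
  have r: "r 0 = p 0" "r (Suc i) = p (Suc (r i))" for i by (simp_all add: r_def)
  have sm: "strict_mono r" using p(1) by (simp add: strict_mono_Suc_iff r less_eq_Suc_le)
  have min: "s (r i) \<le> s m" if "r i \<le> m" for i m
    using that p by (cases i) (auto simp: r, meson le_trans not_less_eq_eq p(1) Suc_leD)
  show thesis using that[OF sm] min sm by (simp add: strict_mono_less_eq)
qed

text \<open>Passing to subsequences one variable at a time makes all exponents nondecreasing; then
  the first term of the final subsequence divides the second.\<close>

lemma dickson_sequence:
  assumes "finite I" and "\<And>n. set_mset (f n) \<subseteq> I"
  shows "\<exists>i j::nat. i < j \<and> f i \<subseteq># f j"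
proof -
  have "\<exists>r::nat \<Rightarrow> nat. strict_mono r \<and> (\<forall>x\<in>I. \<forall>i j. i \<le> j \<longrightarrow> count (f (r i)) x \<le> count (f (r j)) x)"
    using assms(1)
  proof (induction I)
    case empty
    show ?case by (rule exI[of _ id]) (simp add: strict_mono_def)
  next
    case (insert y J)
    obtain r :: "nat \<Rightarrow> nat" where
      "strict_mono r \<and> (\<forall>x\<in>J. \<forall>i j. i \<le> j \<longrightarrow> count (f (r i)) x \<le> count (f (r j)) x)"
      using insert.IH by (rule exE)
    note r = this[THEN conjunct1] this[THEN conjunct2, rule_format]
    obtain q :: "nat \<Rightarrow> nat" where q: "strict_mono q" "\<And>i j. i \<le> j \<Longrightarrow> count (f (r (q i))) y \<le> count (f (r (q j))) y"
      by (rule nat_seq_incseq_subseq[of "\<lambda>n. count (f (r n)) y"]) (rule that)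
    have qm: "q i \<le> q j" if "i \<le> j" for i j using that q(1) by (simp add: strict_mono_less_eq)
    show ?case
    proof (intro exI[of _ "r \<circ> q"] conjI ballI allI impI)
      show "strict_mono (r \<circ> q)" using r(1) q(1) by (rule strict_mono_o)
      fix x and i j :: nat assume "x \<in> insert y J" "i \<le> j"
      then show "count (f ((r \<circ> q) i)) x \<le> count (f ((r \<circ> q) j)) x"
        using r(2)[of x "q i" "q j"] q(2)[of i j] qm[of i j] by (cases "x = y") simp_all
    qed
  qed
  then obtain r :: "nat \<Rightarrow> nat" where
    "strict_mono r \<and> (\<forall>x\<in>I. \<forall>i j. i \<le> j \<longrightarrow> count (f (r i)) x \<le> count (f (r j)) x)"
    by (rule exE)
  note r = this[THEN conjunct1] this[THEN conjunct2, rule_format, of _ 0 1, simplified]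
  have "count (f (r 0)) x \<le> count (f (r (Suc 0))) x" for x
  proof (cases "x \<in> I")
    case False
    then have "x \<notin># f (r 0)" using assms(2) by blast
    then show ?thesis by (simp add: not_in_iff)
  qed (use r in simp)
  then have "f (r 0) \<subseteq># f (r (Suc 0))" by (simp add: subseteq_mset_def)
  moreover have "r 0 < r (Suc 0)" using r(1) by (simp add: strict_mono_less)
  ultimately show ?thesis by blast
qed

text \<open>The minimal elements of \<open>L\<close> under divisibility suffice. Infinitely many of
  them would form an injective sequence without a divisible pair.\<close>

lemma dickson:
  assumes "finite I" and "\<And>m. m \<in> L \<Longrightarrow> set_mset m \<subseteq> I"
  obtains B where "finite B" "B \<subseteq> L" "\<And>m. m \<in> L \<Longrightarrow> \<exists>b\<in>B. b \<subseteq># m"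
proof -
  define B where "B = {b \<in> L. \<forall>c\<in>L. c \<subseteq># b \<longrightarrow> c = b}"
  have "\<exists>b\<in>B. b \<subseteq># m" if "m \<in> L" for m
    using that
  proof (induction "size m" arbitrary: m rule: less_induct)
    case less
    show ?case
    proof (cases "m \<in> B")
      case False
      then obtain c where c: "c \<in> L" "c \<subset># m" using less(2) by (auto simp: B_def subset_mset.less_le)
      then show ?thesis using less(1)[of c] mset_subset_size[of c m] by (meson subset_mset.less_imp_le subset_mset.trans)
    qed auto
  qed
  moreover have "finite B"
  proof (rule ccontr)
    assume "infinite B"
    then obtain f :: "nat \<Rightarrow> _" where f: "inj f" "range f \<subseteq> B" by (meson infinite_countable_subset)
    then have fB: "f n \<in> B" for n by blast
    then have "set_mset (f n) \<subseteq> I" for n using assms(2) by (simp add: B_def)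
    then obtain i j where "i < j" "f i \<subseteq># f j" using dickson_sequence[OF assms(1), of f] by blast
    then show False using fB[of i] fB[of j] injD[OF f(1), of i j] by (auto simp: B_def)
  qed
  ultimately show thesis using that[of B] by (auto simp: B_def)
qed

context power_series_field
begin

lemma coeff_smult: "c \<in> carrier R \<Longrightarrow> P \<in> carrier T \<Longrightarrow> (ps_term R c {#} \<otimes>\<^bsub>T\<^esub> P) m = c \<otimes> P m"
  by (simp add: coeff_term_mult)

text \<open>\<open>B\<close> consists of finitely many leading monomials of \<open>J\<close>
  dividing all others. Dividing an element of \<open>J\<close> leaves a remainder in
  \<open>J\<close> that vanishes at every multiple of \<open>B\<close>; if it were nonzero, its
  leading monomial would be such a multiple. The order bound on the coefficients goes beyond finite
  generation and is what \<open>colon_order_bound\<close> relies on.\<close>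

lemma standard_basis:
  assumes "finite I" and J: "ideal J T"
  obtains B :: "'v multiset set" and g where "finite B" "\<And>b. b \<in> B \<Longrightarrow> g b \<in> J"
    "\<And>P. P \<in> J \<Longrightarrow> \<exists>h. h \<in> B \<rightarrow> carrier T \<and> P = (\<Oplus>\<^bsub>T\<^esub>b\<in>B. h b \<otimes>\<^bsub>T\<^esub> g b) \<and>
        (\<forall>n. P \<in> ord_ideal n \<longrightarrow> (\<forall>b\<in>B. h b \<in> ord_ideal (n - size b)))"
proof -
  interpret J: ideal J T by (rule J)
  define L where "L = {l. \<exists>P\<in>J. lead_at R P l}"
  have L: "set_mset l \<subseteq> I" if "l \<in> L" for l
    using that coeff_outside J.Icarr unfolding L_def lead_at_def by blast
  obtain B where B: "finite B" "B \<subseteq> L" "\<And>m. m \<in> L \<Longrightarrow> \<exists>b\<in>B. b \<subseteq># m"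
    using dickson[OF assms(1) L, of L] by blast
  have "\<exists>g\<in>J. lead_at R g b \<and> g b = \<one>" if b: "b \<in> L" for b
  proof -
    obtain P where P: "P \<in> J" "lead_at R P b" using b unfolding L_def by blast
    have c: "P b \<in> Units R" using P J.Icarr by (auto simp: lead_at_def field_Units)
    let ?c = "inv (P b)"
    let ?Q = "ps_term R ?c {#} \<otimes>\<^bsub>T\<^esub> P"
    have cc: "?c \<in> carrier R" "?c \<noteq> \<zero>" using c field_Units Units_inv_Units by auto
    have Q: "?Q m = ?c \<otimes> P m" for m using cc P(1) J.Icarr by (simp add: coeff_smult)
    have "?Q \<in> J" using P(1) cc by (intro J.I_l_closed) auto
    moreover have "lead_at R ?Q b"
      using P cc J.Icarr[OF P(1)] integral_iff by (auto simp: lead_at_def Q)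
    moreover have "?Q b = \<one>" using c by (simp add: Q)
    ultimately show ?thesis by blast
  qed
  then obtain g where g: "\<And>b. b \<in> L \<Longrightarrow> g b \<in> J \<and> lead_at R (g b) b \<and> g b b = \<one>" by metis
  have "\<exists>h. h \<in> B \<rightarrow> carrier T \<and> P = (\<Oplus>\<^bsub>T\<^esub>b\<in>B. h b \<otimes>\<^bsub>T\<^esub> g b) \<and>
        (\<forall>n. P \<in> ord_ideal n \<longrightarrow> (\<forall>b\<in>B. h b \<in> ord_ideal (n - size b)))" if P: "P \<in> J" for P
  proof -
    obtain h where h: "\<And>i. i \<in> B \<Longrightarrow> h i \<in> carrier T"
      "\<And>i m. i \<in> B \<Longrightarrow> i \<subseteq># m \<Longrightarrow> P m = (\<Oplus>\<^bsub>T\<^esub>i\<in>B. h i \<otimes>\<^bsub>T\<^esub> g i) m"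
      "\<And>i n. i \<in> B \<Longrightarrow> P \<in> ord_ideal n \<Longrightarrow> h i \<in> ord_ideal (n - size i)"
      using division[OF B(1), of g "\<lambda>b. b" P] g B(2) J.Icarr P by blast
    let ?S = "\<Oplus>\<^bsub>T\<^esub>i\<in>B. h i \<otimes>\<^bsub>T\<^esub> g i"
    have SJ: "?S \<in> J"
      using h(1) g B(2) by (intro J.I_finsum_closed J.I_l_closed) auto
    have D: "P \<ominus>\<^bsub>T\<^esub> ?S \<in> J" using SJ P by (simp add: a_minus_def J.a_closed J.a_inv_closed)
    have "P \<ominus>\<^bsub>T\<^esub> ?S = \<zero>\<^bsub>T\<^esub>"
    proof (rule ccontr)
      assume "P \<ominus>\<^bsub>T\<^esub> ?S \<noteq> \<zero>\<^bsub>T\<^esub>"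
      then obtain m where "(P \<ominus>\<^bsub>T\<^esub> ?S) m \<noteq> \<zero>" by (auto simp: ps_simps(2))
      then obtain l where l: "lead_at R (P \<ominus>\<^bsub>T\<^esub> ?S) l" using lead_exists by blast
      then have "l \<in> L" using D by (auto simp: L_def)
      then obtain b where "b \<in> B" "b \<subseteq># l" using B(3) by blast
      then have "P l = ?S l" using h(2) by blast
      then have "(P \<ominus>\<^bsub>T\<^esub> ?S) l = \<zero>" using P SJ J.Icarr by (simp add: a_minus_def r_neg)
      with l show False by (simp add: lead_at_def)
    qed
    then have "P = ?S" using P SJ J.Icarr T.r_right_minus_eq by blast
    with h show ?thesis by (intro exI[of _ h]) auto
  qed
  moreover have "g b \<in> J" if "b \<in> B" for b using that B(2) g by blast
  ultimately show thesis using that[of B g] B(1) by blast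
qed

lemma noetherian_T:
  assumes "finite I" shows "noetherian_ring T"
proof (rule T.noetherian_ringI)
  fix J assume J: "ideal J T"
  interpret J: ideal J T by (rule J)
  obtain B :: "'v multiset set" and g where B: "finite B" "\<And>b. b \<in> B \<Longrightarrow> g b \<in> J"
    "\<And>P. P \<in> J \<Longrightarrow> \<exists>h. h \<in> B \<rightarrow> carrier T \<and> P = (\<Oplus>\<^bsub>T\<^esub>b\<in>B. h b \<otimes>\<^bsub>T\<^esub> g b) \<and>
        (\<forall>n. P \<in> ord_ideal n \<longrightarrow> (\<forall>b\<in>B. h b \<in> ord_ideal (n - size b)))"
    by (rule standard_basis[OF assms J]) (rule that)
  have gB: "g ` B \<subseteq> carrier T" using B(2) J.Icarr by auto
  interpret G: ideal "Idl\<^bsub>T\<^esub> (g ` B)" T by (rule T.genideal_ideal[OF gB])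
  have "J \<subseteq> Idl\<^bsub>T\<^esub> (g ` B)"
  proof
    fix P assume "P \<in> J"
    then obtain h where h: "h \<in> B \<rightarrow> carrier T" "P = (\<Oplus>\<^bsub>T\<^esub>b\<in>B. h b \<otimes>\<^bsub>T\<^esub> g b)" using B(3) by blast
    have "(\<Oplus>\<^bsub>T\<^esub>b\<in>B. h b \<otimes>\<^bsub>T\<^esub> g b) \<in> Idl\<^bsub>T\<^esub> (g ` B)"
      using h(1) T.genideal_self[OF gB] by (intro G.I_finsum_closed G.I_l_closed) auto
    with h(2) show "P \<in> Idl\<^bsub>T\<^esub> (g ` B)" by blast
  qed
  moreover have "Idl\<^bsub>T\<^esub> (g ` B) \<subseteq> J" using B(2) by (intro T.genideal_minimal J) auto
  ultimately show "\<exists>A\<subseteq>carrier T. finite A \<and> J = Idl\<^bsub>T\<^esub> A" using gB B(1) by (intro exI[of _ "g ` B"]) auto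
qed

text \<open>After scaling, the leading monomial is the empty one. It divides every monomial, so
  dividing 1 leaves no remainder.\<close>

lemma T_Units:
  assumes P: "P \<in> carrier T" "P {#} \<noteq> \<zero>"
  shows "P \<in> Units T"
proof -
  have u: "P {#} \<in> Units R" using P by (auto simp: field_Units)
  let ?c = "inv (P {#})"
  have c: "?c \<in> carrier R" using u by auto
  define g where "g = ps_term R ?c {#} \<otimes>\<^bsub>T\<^esub> P"
  have cT: "ps_term R ?c {#} \<in> carrier T" using c by auto
  have g: "g \<in> carrier T" "g {#} = \<one>" unfolding g_def using P c cT u by (auto simp: coeff_smult)
  have lead: "lead_at R g {#}" using g by (auto simp: lead_at_def mkey_def less_eq_prod_def)
  obtain h where h: "h () \<in> carrier T" "\<And>m. \<one>\<^bsub>T\<^esub> m = (\<Oplus>\<^bsub>T\<^esub>i\<in>{()}. h i \<otimes>\<^bsub>T\<^esub> g) m"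
    by (rule division[of "{()}" "\<lambda>_. g" "\<lambda>_. {#}" "\<one>\<^bsub>T\<^esub>"]) (use g lead in \<open>(simp; fail | blast)+\<close>)
  have "(\<Oplus>\<^bsub>T\<^esub>i\<in>{()}. h i \<otimes>\<^bsub>T\<^esub> g) = h () \<otimes>\<^bsub>T\<^esub> g" using h(1) g by simp
  then have "\<one>\<^bsub>T\<^esub> = h () \<otimes>\<^bsub>T\<^esub> g" using h(2) by (metis ext)
  then have "\<one>\<^bsub>T\<^esub> = (h () \<otimes>\<^bsub>T\<^esub> ps_term R ?c {#}) \<otimes>\<^bsub>T\<^esub> P" using h(1) cT P by (simp add: g_def T.m_assoc)
  then show ?thesis using P h(1) cT unfolding Units_def
    by (auto intro!: bexI[of _ "h () \<otimes>\<^bsub>T\<^esub> ps_term R ?c {#}"] simp: T.m_comm)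
qed

end

section \<open>Prime ideals and orders of vanishing\<close>

lemma set_add_memI: "a \<in> A \<Longrightarrow> b \<in> B \<Longrightarrow> a \<oplus>\<^bsub>G\<^esub> b \<in> A <+>\<^bsub>G\<^esub> B"
  by (auto simp: set_add_def')

lemma set_add_memE:
  assumes "x \<in> A <+>\<^bsub>G\<^esub> B"
  obtains a b where "a \<in> A" "b \<in> B" "x = a \<oplus>\<^bsub>G\<^esub> b"
  using assms by (auto simp: set_add_def')

lemma set_add_mono: "A \<subseteq> A' \<Longrightarrow> B \<subseteq> B' \<Longrightarrow> A <+>\<^bsub>G\<^esub> B \<subseteq> A' <+>\<^bsub>G\<^esub> B'"
  by (auto simp: set_add_def' subset_iff)

context power_series_field
begin

definition var_ideal :: "'v set \<Rightarrow> ('v multiset \<Rightarrow> 'a) set" where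
  "var_ideal J = mono_ideal {m. set_mset m \<inter> J \<noteq> {}}"

lemma var_ideal_iff: "P \<in> var_ideal J \<longleftrightarrow> P \<in> carrier T \<and> (\<forall>m. set_mset m \<inter> J = {} \<longrightarrow> P m = \<zero>)"
  by (auto simp: var_ideal_def mono_ideal_def)

text \<open>Dropping all monomials that meet \<open>J\<close> gives representatives modulo the
  ideal. Among the monomials avoiding \<open>J\<close>, the lowest terms of two factors multiply to
  a term of the product that nothing else can cancel, because every splitting of an avoiding
  monomial consists of avoiding monomials.\<close>

lemma primeideal_var_ideal: "primeideal (var_ideal J) T"
proof (rule primeidealI)
  show "ideal (var_ideal J) T" unfolding var_ideal_def by (rule ideal_mono_ideal) auto
  have "\<one>\<^bsub>T\<^esub> {#} \<noteq> \<zero>" by (simp add: coeff_one)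
  then have "\<one>\<^bsub>T\<^esub> \<notin> var_ideal J" unfolding var_ideal_iff by fastforce
  then show "carrier T \<noteq> var_ideal J" by blast
  fix P Q assume PQ: "P \<in> carrier T" "Q \<in> carrier T" "P \<otimes>\<^bsub>T\<^esub> Q \<in> var_ideal J"
  show "P \<in> var_ideal J \<or> Q \<in> var_ideal J"
  proof (rule ccontr)
    assume "\<not> (P \<in> var_ideal J \<or> Q \<in> var_ideal J)"
    then obtain p q where pq: "set_mset p \<inter> J = {}" "P p \<noteq> \<zero>" "set_mset q \<inter> J = {}" "Q q \<noteq> \<zero>"
      using PQ unfolding var_ideal_iff by blast
    let ?r = "\<lambda>P m. if set_mset m \<inter> J = {} then P m else \<zero>"
    obtain l where l: "lead_at R (?r P) l" using lead_exists[of "?r P" p R] pq by auto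
    obtain l' where l': "lead_at R (?r Q) l'" using lead_exists[of "?r Q" q R] pq by auto
    have nz: "set_mset l \<inter> J = {}" "P l \<noteq> \<zero>" "set_mset l' \<inter> J = {}" "Q l' \<noteq> \<zero>"
      using l l' by (auto simp: lead_at_def split: if_splits)
    have "finsum R (\<lambda>(a, b). P a \<otimes> Q b) {(a, b). a + b = l + l'} = (case (l, l') of (a, b) \<Rightarrow> P a \<otimes> Q b)"
    proof (rule finsum_single[OF finite_splits])
      fix z assume "z \<in> {(a, b). a + b = l + l'}" "z \<noteq> (l, l')"
      then obtain a b where z: "z = (a, b)" "a + b = l + l'" "a \<noteq> l \<or> b \<noteq> l'" by auto
      have av: "set_mset a \<inter> J = {}" "set_mset b \<inter> J = {}"
        using arg_cong[OF z(2), of set_mset] nz by auto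
      have "P a = \<zero> \<or> Q b = \<zero>"
      proof (rule ccontr)
        assume "\<not> (P a = \<zero> \<or> Q b = \<zero>)"
        then have k: "mkey l \<le> mkey a" "mkey l' \<le> mkey b" using l l' av by (auto simp: lead_at_def)
        show False
        proof (cases "a = l")
          case True
          with z show False by auto
        next
          case False
          then have "mkey l < mkey a" using k by (simp add: order.strict_iff_order)
          then have "mkey (l + l') < mkey (a + l')" by simp
          also have "\<dots> \<le> mkey (a + b)" using k by simp
          finally show False using z by simp
        qed
      qed
      then show "(case z of (a, b) \<Rightarrow> P a \<otimes> Q b) = \<zero>" using z PQ by auto
    qed (use PQ in auto)
    then have "(P \<otimes>\<^bsub>T\<^esub> Q) (l + l') = P l \<otimes> Q l'" by (simp add: coeff_mult)
    moreover have "set_mset (l + l') \<inter> J = {}" using nz by auto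
    ultimately have "P l \<otimes> Q l' = \<zero>" using PQ(3) unfolding var_ideal_iff by metis
    then show False using nz PQ integral_iff by auto
  qed
qed (rule T.is_cring)

lemma var_ideal_empty: "var_ideal {} = {\<zero>\<^bsub>T\<^esub>}"
  by (auto simp: var_ideal_iff ps_simps(2) fun_eq_iff) (simp add: T_memI)

lemma primeideal_zero: "primeideal {\<zero>\<^bsub>T\<^esub>} T"
  using primeideal_var_ideal[of "{}"] by (simp add: var_ideal_empty)

text \<open>A bound of Artin-Rees type: cancelling g modulo \<pp> loses at most c orders. If
  \<open>a g = x + w\<close> with x in \<pp> and w of order n, then w lies in the ideal generated by
  \<pp> and g. A standard basis of that ideal expresses w as an element of \<pp> plus
  \<open>?q g\<close>, with \<open>?q\<close> of order at least \<open>n - c\<close>. Then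
  \<open>(a - ?q) g\<close> is in \<pp>, and primality removes g.\<close>

lemma colon_order_bound:
  assumes "finite I" and "primeideal \<pp> T" and g: "g \<in> carrier T" "g \<notin> \<pp>"
  obtains c where "\<And>n a. a \<in> carrier T \<Longrightarrow> a \<otimes>\<^bsub>T\<^esub> g \<in> \<pp> <+>\<^bsub>T\<^esub> ord_ideal n
    \<Longrightarrow> a \<in> \<pp> <+>\<^bsub>T\<^esub> ord_ideal (n - c)"
proof -
  interpret \<pp>: primeideal \<pp> T by (rule assms(2))
  have "ideal (\<pp> <+>\<^bsub>T\<^esub> PIdl\<^bsub>T\<^esub> g) T"
    by (intro T.add_ideals \<pp>.is_ideal T.cgenideal_ideal g)
  then obtain B :: "'v multiset set" and s where B: "finite B" "\<And>b. b \<in> B \<Longrightarrow> s b \<in> \<pp> <+>\<^bsub>T\<^esub> PIdl\<^bsub>T\<^esub> g"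
    "\<And>P. P \<in> \<pp> <+>\<^bsub>T\<^esub> PIdl\<^bsub>T\<^esub> g \<Longrightarrow> \<exists>h. h \<in> B \<rightarrow> carrier T \<and> P = (\<Oplus>\<^bsub>T\<^esub>b\<in>B. h b \<otimes>\<^bsub>T\<^esub> s b) \<and>
        (\<forall>n. P \<in> ord_ideal n \<longrightarrow> (\<forall>b\<in>B. h b \<in> ord_ideal (n - size b)))"
    by (rule standard_basis[OF assms(1)]) (rule that)
  have mem: "\<exists>p q. p \<in> \<pp> \<and> q \<in> carrier T \<and> x = p \<oplus>\<^bsub>T\<^esub> q \<otimes>\<^bsub>T\<^esub> g" if "x \<in> \<pp> <+>\<^bsub>T\<^esub> PIdl\<^bsub>T\<^esub> g" for x
    using that unfolding set_add_def' cgenideal_def by auto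
  obtain p q where pq: "\<And>b. b \<in> B \<Longrightarrow> p b \<in> \<pp> \<and> q b \<in> carrier T \<and> s b = p b \<oplus>\<^bsub>T\<^esub> q b \<otimes>\<^bsub>T\<^esub> g"
  proof -
    have "\<forall>b\<in>B. \<exists>p q. p \<in> \<pp> \<and> q \<in> carrier T \<and> s b = p \<oplus>\<^bsub>T\<^esub> q \<otimes>\<^bsub>T\<^esub> g"
      using mem[OF B(2)] by (rule ballI)
    then obtain p where "\<forall>b\<in>B. \<exists>q. p b \<in> \<pp> \<and> q \<in> carrier T \<and> s b = p b \<oplus>\<^bsub>T\<^esub> q \<otimes>\<^bsub>T\<^esub> g"
      by (rule bchoice[THEN exE])
    then obtain q where "\<forall>b\<in>B. p b \<in> \<pp> \<and> q b \<in> carrier T \<and> s b = p b \<oplus>\<^bsub>T\<^esub> q b \<otimes>\<^bsub>T\<^esub> g"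
      by (rule bchoice[THEN exE])
    then show thesis using that by blast
  qed
  have pc: "p b \<in> carrier T" if "b \<in> B" for b using pq[OF that] \<pp>.Icarr by blast
  \<comment> \<open>Any common upper bound of the degrees of the basis monomials would do; the sum
    is one.\<close>
  define c where "c = (\<Sum>b\<in>B. size b)"
  have "a \<in> \<pp> <+>\<^bsub>T\<^esub> ord_ideal (n - c)" if a: "a \<in> carrier T" "a \<otimes>\<^bsub>T\<^esub> g \<in> \<pp> <+>\<^bsub>T\<^esub> ord_ideal n" for n a
  proof -
    interpret O: ideal "ord_ideal (n - c)" T by (rule ideal_ord_ideal)
    obtain x w where xw: "x \<in> \<pp>" "w \<in> ord_ideal n" "a \<otimes>\<^bsub>T\<^esub> g = x \<oplus>\<^bsub>T\<^esub> w"
      using a(2) by (rule set_add_memE)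
    have xc: "x \<in> carrier T" "w \<in> carrier T" using \<pp>.Icarr[OF xw(1)] xw(2) unfolding mono_ideal_def by blast+
    have w: "w = \<ominus>\<^bsub>T\<^esub> x \<oplus>\<^bsub>T\<^esub> a \<otimes>\<^bsub>T\<^esub> g"
      unfolding xw(3) using xc by (simp add: T.a_assoc[symmetric] T.l_neg del: coeff_add)
    have "w \<in> \<pp> <+>\<^bsub>T\<^esub> PIdl\<^bsub>T\<^esub> g"
      unfolding set_add_def' cgenideal_def w using xw(1) a(1) \<pp>.a_inv_closed by blast
    from B(3)[OF this] obtain h where "h \<in> B \<rightarrow> carrier T \<and> w = (\<Oplus>\<^bsub>T\<^esub>b\<in>B. h b \<otimes>\<^bsub>T\<^esub> s b) \<and>
        (\<forall>n. w \<in> ord_ideal n \<longrightarrow> (\<forall>b\<in>B. h b \<in> ord_ideal (n - size b)))" by (rule exE)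
    note h = this[THEN conjunct1] this[THEN conjunct2, THEN conjunct1]
      this[THEN conjunct2, THEN conjunct2, rule_format, OF xw(2)]
    have hc: "h b \<in> carrier T" if "b \<in> B" for b using h(1) that by auto
    let ?p = "\<Oplus>\<^bsub>T\<^esub>b\<in>B. h b \<otimes>\<^bsub>T\<^esub> p b" and ?q = "\<Oplus>\<^bsub>T\<^esub>b\<in>B. h b \<otimes>\<^bsub>T\<^esub> q b"
    have qc: "?q \<in> carrier T" using hc pq by (intro T.finsum_closed) auto
    have "w = (\<Oplus>\<^bsub>T\<^esub>b\<in>B. h b \<otimes>\<^bsub>T\<^esub> p b \<oplus>\<^bsub>T\<^esub> (h b \<otimes>\<^bsub>T\<^esub> q b) \<otimes>\<^bsub>T\<^esub> g)"
      unfolding h(2) using hc pc pq g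
      by (intro T.finsum_cong') (auto simp: T.r_distr T.m_assoc simp del: coeff_add)
    also have "\<dots> = ?p \<oplus>\<^bsub>T\<^esub> (\<Oplus>\<^bsub>T\<^esub>b\<in>B. (h b \<otimes>\<^bsub>T\<^esub> q b) \<otimes>\<^bsub>T\<^esub> g)"
      using hc pc pq g by (intro T.finsum_addf) auto
    also have "(\<Oplus>\<^bsub>T\<^esub>b\<in>B. (h b \<otimes>\<^bsub>T\<^esub> q b) \<otimes>\<^bsub>T\<^esub> g) = ?q \<otimes>\<^bsub>T\<^esub> g"
      using hc pq g B(1) by (intro T.finsum_ldistr[symmetric]) auto
    finally have w2: "w = ?p \<oplus>\<^bsub>T\<^esub> ?q \<otimes>\<^bsub>T\<^esub> g" .
    have pp: "?p \<in> \<pp>" using hc pq by (intro \<pp>.I_finsum_closed \<pp>.I_l_closed) auto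
    have ppc: "?p \<in> carrier T" using pp \<pp>.Icarr by blast
    have "(a \<ominus>\<^bsub>T\<^esub> ?q) \<otimes>\<^bsub>T\<^esub> g = x \<oplus>\<^bsub>T\<^esub> ?p"
    proof -
      have "(a \<ominus>\<^bsub>T\<^esub> ?q) \<otimes>\<^bsub>T\<^esub> g = a \<otimes>\<^bsub>T\<^esub> g \<ominus>\<^bsub>T\<^esub> ?q \<otimes>\<^bsub>T\<^esub> g"
        using a qc g by (simp add: T.minus_eq T.l_distr T.l_minus)
      also have "\<dots> = x \<oplus>\<^bsub>T\<^esub> ?p"
        unfolding xw(3) w2 using xc ppc qc g by (simp add: T.minus_eq T.a_assoc T.r_neg del: coeff_add)
      finally show ?thesis .
    qed
    also have "\<dots> \<in> \<pp>" by (intro \<pp>.a_closed xw(1) pp)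
    finally have "a \<ominus>\<^bsub>T\<^esub> ?q \<in> \<pp>" using \<pp>.I_prime[of "a \<ominus>\<^bsub>T\<^esub> ?q" g] a qc g by blast
    moreover have "?q \<in> ord_ideal (n - c)"
    proof (intro O.I_finsum_closed O.I_r_closed)
      fix b assume b: "b \<in> B"
      then have "size b \<le> c" unfolding c_def using B(1) by (simp add: member_le_sum)
      then show "h b \<in> ord_ideal (n - c)" using subsetD[OF ord_ideal_antimono h(3)[OF b]] by simp
    qed (use pq in auto)
    moreover have "a = (a \<ominus>\<^bsub>T\<^esub> ?q) \<oplus>\<^bsub>T\<^esub> ?q" using a qc by (simp add: T.minus_eq T.a_assoc T.l_neg del: coeff_add)
    ultimately show ?thesis using set_add_memI[of "a \<ominus>\<^bsub>T\<^esub> ?q" \<pp> ?q "ord_ideal (n - c)" T] by (simp only:)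
  qed
  with that show thesis by blast
qed

end

section \<open>Counting independent series along a chain of primes\<close>

text \<open>Vectors of length \<open>n\<close> are functions on \<open>nat\<close> vanishing from \<open>n\<close> on.\<close>

abbreviation vecs :: "('a, 'm) ring_scheme \<Rightarrow> nat \<Rightarrow> (nat \<Rightarrow> 'a) set" where
  "vecs R n \<equiv> supp_funs R {..<n}"

definition lin_form :: "('a, 'm) ring_scheme \<Rightarrow> nat \<Rightarrow> ((nat \<Rightarrow> 'a) \<Rightarrow> 'a) \<Rightarrow> bool" where
  "lin_form R n f \<longleftrightarrow> (\<forall>x\<in>vecs R n. f x \<in> carrier R \<and> (\<forall>c\<in>carrier R. \<forall>y\<in>vecs R n.
     f (\<lambda>i. x i \<oplus>\<^bsub>R\<^esub> c \<otimes>\<^bsub>R\<^esub> y i) = f x \<oplus>\<^bsub>R\<^esub> c \<otimes>\<^bsub>R\<^esub> f y))"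

text \<open>Gaussian elimination. If some form \<open>f m0\<close> does not vanish on the last basis
  vector e, adding the multiple \<open>t x\<close> of e moves each shorter vector into its kernel,
  and the other forms become forms \<open>f'\<close> in one variable fewer. If all forms vanish on
  e, then e itself is the zero.\<close>

lemma (in field) common_zero_of_lin_forms:
  assumes "finite E" and "card E < n" and "\<And>m. m \<in> E \<Longrightarrow> lin_form R n (f m)"
  shows "\<exists>x\<in>vecs R n. x \<noteq> (\<lambda>_. \<zero>) \<and> (\<forall>m\<in>E. f m x = \<zero>)"
  using assms
proof (induction n arbitrary: E f)
  case (Suc n)
  define e where "e i = (if i = n then \<one> else \<zero>)" for i
  have e: "e \<in> vecs R (Suc n)" "e \<noteq> (\<lambda>_. \<zero>)" by (auto simp: e_def supp_funs_def fun_eq_iff)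
  have V: "vecs R n \<subseteq> vecs R (Suc n)" by (auto simp: supp_funs_def)
  have fc: "f m x \<in> carrier R" if "m \<in> E" "x \<in> vecs R (Suc n)" for m x
    using Suc.prems(3)[OF that(1)] that(2) by (auto simp: lin_form_def)
  have fl: "f m (\<lambda>i. x i \<oplus> c \<otimes> y i) = f m x \<oplus> c \<otimes> f m y"
    if "m \<in> E" "x \<in> vecs R (Suc n)" "c \<in> carrier R" "y \<in> vecs R (Suc n)" for m x y c
    using Suc.prems(3)[OF that(1)] that(2-) by (auto simp: lin_form_def)
  show ?case
  proof (cases "\<forall>m\<in>E. f m e = \<zero>")
    case True
    with e show ?thesis by blast
  next
    case False
    then obtain m0 where m0: "m0 \<in> E" "f m0 e \<noteq> \<zero>" by blast
    have u: "f m0 e \<in> Units R" using m0 fc e by (auto simp: field_Units)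
    define \<alpha> where "\<alpha> = inv (f m0 e)"
    have \<alpha>: "\<alpha> \<in> carrier R" "\<alpha> \<otimes> f m0 e = \<one>" using u by (auto simp: \<alpha>_def)
    define t where "t x = \<ominus> (\<alpha> \<otimes> f m0 x)" for x
    have tc: "t x \<in> carrier R" if "x \<in> vecs R n" for x using that V fc m0 \<alpha> by (auto simp: t_def)
    define f' where "f' m x = f m x \<oplus> t x \<otimes> f m e" for m x
    have "lin_form R n (f' m)" if "m \<in> E - {m0}" for m
      unfolding lin_form_def
    proof (intro ballI conjI)
      fix x assume x: "x \<in> vecs R n"
      show "f' m x \<in> carrier R" using that x V fc tc e by (auto simp: f'_def)
      fix c y assume c: "c \<in> carrier R" and y: "y \<in> vecs R n"
      have cl: "f m x \<in> carrier R" "f m y \<in> carrier R" "f m0 x \<in> carrier R" "f m0 y \<in> carrier R" "f m e \<in> carrier R"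
        using that x y V fc m0 e by auto
      have l: "f m (\<lambda>i. x i \<oplus> c \<otimes> y i) = f m x \<oplus> c \<otimes> f m y"
        "f m0 (\<lambda>i. x i \<oplus> c \<otimes> y i) = f m0 x \<oplus> c \<otimes> f m0 y"
        using that x y V m0 c by (auto intro!: fl)
      show "f' m (\<lambda>i. x i \<oplus> c \<otimes> y i) = f' m x \<oplus> c \<otimes> f' m y"
        unfolding f'_def t_def l using cl c \<alpha>(1) by algebra
    qed
    moreover have "card (E - {m0}) < n" using Suc.prems(1,2) m0(1)
      by (metis Suc_less_eq card_Suc_Diff1)
    ultimately obtain x where x: "x \<in> vecs R n" "x \<noteq> (\<lambda>_. \<zero>)" "\<And>m. m \<in> E - {m0} \<Longrightarrow> f' m x = \<zero>"
      using Suc.IH[of "E - {m0}" f'] Suc.prems(1) by auto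
    define x' where "x' i = x i \<oplus> t x \<otimes> e i" for i
    have f: "f m x' = f m x \<oplus> t x \<otimes> f m e" if "m \<in> E" for m
      unfolding x'_def by (rule fl) (use that x V tc e in auto)
    have fx: "f m0 x \<in> carrier R" "f m0 e \<in> carrier R" using x(1) V fc m0(1) e(1) by auto
    then have "f m0 x' = f m0 x \<oplus> \<ominus> (\<alpha> \<otimes> f m0 e) \<otimes> f m0 x"
      unfolding f[OF m0(1)] t_def using \<alpha>(1) by algebra
    then have "f m0 x' = \<zero>" using fx by (simp add: \<alpha>(2) l_minus r_neg)
    then have "f m x' = \<zero>" if "m \<in> E" for m
      using f[OF that] x(3)[of m] that by (cases "m = m0") (auto simp: f'_def)
    then have "\<forall>m\<in>E. f m x' = \<zero>" by blast
    moreover have "x' \<in> vecs R (Suc n)" using x(1) tc[OF x(1)] by (auto simp: x'_def e_def supp_funs_def)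
    moreover have "x' \<noteq> (\<lambda>_. \<zero>)"
    proof -
      obtain i where i: "x i \<noteq> \<zero>" using x(2) by (auto simp: fun_eq_iff)
      then have "i < n" using x(1) by (auto simp: supp_funs_def)
      then have "x' i = x i" using x(1) tc[OF x(1)] by (auto simp: x'_def e_def supp_funs_def)
      with i show ?thesis by auto
    qed
    ultimately show ?thesis by (intro bexI[of _ x'] conjI)
  qed
next
  case 0
  from \<open>card E < 0\<close> show ?case by (rule less_zeroE)
qed

text \<open>A monomial of degree below M is determined by \<open>card I\<close> exponents below M.
  The count is crude, but a polynomial bound of degree \<open>card I\<close> is all that the
  comparison of growth rates requires.\<close>

lemma card_monomials_le:
  assumes "finite I"
  shows "finite {m. set_mset m \<subseteq> I \<and> size m < M}" and "card {m. set_mset m \<subseteq> I \<and> size m < M} \<le> M ^ card I"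
proof -
  let ?E = "{m. set_mset m \<subseteq> I \<and> size m < M}" and ?h = "\<lambda>m. \<lambda>i\<in>I. count m i"
  have inj: "inj_on ?h ?E"
  proof (rule inj_onI)
    fix a b assume ab: "a \<in> ?E" "b \<in> ?E" "?h a = ?h b"
    show "a = b"
    proof (rule multiset_eqI)
      fix x show "count a x = count b x"
      proof (cases "x \<in> I")
        case True
        then show ?thesis using fun_cong[OF ab(3), of x] by simp
      next
        case False
        then have "x \<notin># a" "x \<notin># b" using ab by auto
        then show ?thesis by (simp add: not_in_iff)
      qed
    qed
  qed
  have im: "?h ` ?E \<subseteq> (\<Pi>\<^sub>E i\<in>I. {..<M})"
    by (auto simp: PiE_iff) (meson count_le_size le_less_trans)
  have fin: "finite (\<Pi>\<^sub>E i\<in>I. {..<M})" using assms by (intro finite_PiE) auto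
  show "finite ?E" by (rule inj_on_finite[OF inj im fin])
  show "card ?E \<le> M ^ card I"
    using card_inj_on_le[OF inj im fin] assms by (simp add: card_PiE)
qed

context power_series_field
begin

definition lin_map :: "nat \<Rightarrow> ((nat \<Rightarrow> 'a) \<Rightarrow> 'v multiset \<Rightarrow> 'a) \<Rightarrow> bool" where
  "lin_map n \<phi> \<longleftrightarrow> (\<forall>x\<in>vecs R n. \<phi> x \<in> carrier T \<and> (\<forall>c\<in>carrier R. \<forall>y\<in>vecs R n.
     \<phi> (\<lambda>i. x i \<oplus> c \<otimes> y i) = \<phi> x \<oplus>\<^bsub>T\<^esub> ps_term R c {#} \<otimes>\<^bsub>T\<^esub> \<phi> y))"

lemma lin_mapD:
  "lin_map n \<phi> \<Longrightarrow> x \<in> vecs R n \<Longrightarrow> c \<in> carrier R \<Longrightarrow> y \<in> vecs R n \<Longrightarrow>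
    \<phi> (\<lambda>i. x i \<oplus> c \<otimes> y i) = \<phi> x \<oplus>\<^bsub>T\<^esub> ps_term R c {#} \<otimes>\<^bsub>T\<^esub> \<phi> y"
  by (simp add: lin_map_def)

lemma lin_map_zero:
  assumes "lin_map n \<phi>" shows "\<phi> (\<lambda>_. \<zero>) = \<zero>\<^bsub>T\<^esub>"
proof -
  have z: "(\<lambda>_. \<zero>) \<in> vecs R n" by (simp add: supp_funs_def)
  have c: "\<phi> (\<lambda>_. \<zero>) \<in> carrier T" using assms z by (simp add: lin_map_def)
  have "\<phi> (\<lambda>i. \<zero> \<oplus> \<one> \<otimes> \<zero>) = \<phi> (\<lambda>_. \<zero>) \<oplus>\<^bsub>T\<^esub> ps_term R \<one> {#} \<otimes>\<^bsub>T\<^esub> \<phi> (\<lambda>_. \<zero>)"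
    by (rule lin_mapD[OF assms z one_closed z])
  moreover have "ps_term R \<one> {#} \<otimes>\<^bsub>T\<^esub> \<phi> (\<lambda>_. \<zero>) = \<phi> (\<lambda>_. \<zero>)"
    using c by (intro ext) (simp add: coeff_smult)
  ultimately show ?thesis using c T.add.l_cancel_one'[of "\<phi> (\<lambda>_. \<zero>)" "\<phi> (\<lambda>_. \<zero>)"] by simp
qed

text \<open>The passage from \<qq> down to the smaller \<pp>, adding one block of length L per power
  of g. A vector is cut into its first block and the rest, with image
  \<open>\<phi> lo + \<psi> hi g\<close>. Since g lies in \<qq>, independence modulo \<qq> forces
  the first block to vanish. What is left is a multiple of g; cancelling g costs c orders, which is
  why the order grows by c with every block.\<close>

lemma independent_powers:
  assumes \<pp>: "ideal \<pp> T" and \<qq>: "ideal \<qq> T" and "\<pp> \<subseteq> \<qq>" and g: "g \<in> \<qq>"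
    and colon: "\<And>n a. a \<in> carrier T \<Longrightarrow> a \<otimes>\<^bsub>T\<^esub> g \<in> \<pp> <+>\<^bsub>T\<^esub> ord_ideal n
      \<Longrightarrow> a \<in> \<pp> <+>\<^bsub>T\<^esub> ord_ideal (n - c)"
    and \<phi>: "lin_map L \<phi>" "\<And>x. x \<in> vecs R L \<Longrightarrow> \<phi> x \<in> \<qq> <+>\<^bsub>T\<^esub> ord_ideal M \<Longrightarrow> x = (\<lambda>_. \<zero>)"
  shows "\<exists>\<psi>. lin_map (n * L) \<psi> \<and>
    (\<forall>x\<in>vecs R (n * L). \<psi> x \<in> \<pp> <+>\<^bsub>T\<^esub> ord_ideal (M + n * c) \<longrightarrow> x = (\<lambda>_. \<zero>))"
proof (induction n)
  case 0
  have "lin_map 0 (\<lambda>_. \<zero>\<^bsub>T\<^esub>)" by (simp add: lin_map_def)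
  moreover have "vecs R 0 = {\<lambda>_. \<zero>}" by (auto simp: supp_funs_def)
  ultimately show ?case by auto
next
  case (Suc n)
  interpret \<qq>: ideal \<qq> T by (rule \<qq>)
  interpret \<qq>M: ideal "\<qq> <+>\<^bsub>T\<^esub> ord_ideal M" T by (rule T.add_ideals[OF \<qq> ideal_ord_ideal])
  from Suc.IH obtain \<psi> where "lin_map (n * L) \<psi> \<and>
    (\<forall>x\<in>vecs R (n * L). \<psi> x \<in> \<pp> <+>\<^bsub>T\<^esub> ord_ideal (M + n * c) \<longrightarrow> x = (\<lambda>_. \<zero>))" by (rule exE)
  note \<psi> = this[THEN conjunct1] this[THEN conjunct2, rule_format]
  have gc: "g \<in> carrier T" using g by (rule \<qq>.Icarr)
  define lo where "lo x i = (if i < L then x i else \<zero>)" for x and i :: nat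
  define hi where "hi x i = x (i + L)" for x :: "nat \<Rightarrow> 'a" and i
  have lo: "lo x \<in> vecs R L" and hi: "hi x \<in> vecs R (n * L)" if "x \<in> vecs R (Suc n * L)" for x
    using that by (auto simp: lo_def hi_def supp_funs_def)
  define \<psi>' where "\<psi>' x = \<phi> (lo x) \<oplus>\<^bsub>T\<^esub> \<psi> (hi x) \<otimes>\<^bsub>T\<^esub> g" for x
  have \<phi>c: "\<phi> (lo x) \<in> carrier T" and \<psi>c: "\<psi> (hi x) \<in> carrier T" if "x \<in> vecs R (Suc n * L)" for x
    using \<phi>(1) \<psi>(1) lo[OF that] hi[OF that] by (auto simp: lin_map_def)
  have "lin_map (Suc n * L) \<psi>'"
    unfolding lin_map_def
  proof (intro ballI conjI)
    fix x assume x: "x \<in> vecs R (Suc n * L)"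
    show "\<psi>' x \<in> carrier T" unfolding \<psi>'_def by (intro T.a_closed T.m_closed \<phi>c \<psi>c x gc)
    fix e y assume e: "e \<in> carrier R" and y: "y \<in> vecs R (Suc n * L)"
    let ?z = "\<lambda>i. x i \<oplus> e \<otimes> y i"
    have "lo ?z = (\<lambda>i. lo x i \<oplus> e \<otimes> lo y i)" "hi ?z = (\<lambda>i. hi x i \<oplus> e \<otimes> hi y i)"
      using e by (auto simp: lo_def hi_def)
    then have eq: "\<phi> (lo ?z) = \<phi> (lo x) \<oplus>\<^bsub>T\<^esub> ps_term R e {#} \<otimes>\<^bsub>T\<^esub> \<phi> (lo y)"
      "\<psi> (hi ?z) = \<psi> (hi x) \<oplus>\<^bsub>T\<^esub> ps_term R e {#} \<otimes>\<^bsub>T\<^esub> \<psi> (hi y)"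
      using \<phi>(1) \<psi>(1) lo[OF x] hi[OF x] lo[OF y] hi[OF y] e by (auto simp: lin_map_def)
    have ec: "ps_term R e {#} \<in> carrier T" using e by auto
    show "\<psi>' ?z = \<psi>' x \<oplus>\<^bsub>T\<^esub> ps_term R e {#} \<otimes>\<^bsub>T\<^esub> \<psi>' y"
      unfolding \<psi>'_def eq using ec gc \<phi>c[OF x] \<phi>c[OF y] \<psi>c[OF x] \<psi>c[OF y] by algebra
  qed
  moreover have "x = (\<lambda>_. \<zero>)"
    if x: "x \<in> vecs R (Suc n * L)" and mem: "\<psi>' x \<in> \<pp> <+>\<^bsub>T\<^esub> ord_ideal (M + Suc n * c)" for x
  proof -
    have "\<pp> <+>\<^bsub>T\<^esub> ord_ideal (M + Suc n * c) \<subseteq> \<qq> <+>\<^bsub>T\<^esub> ord_ideal M"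
      by (intro set_add_mono \<open>\<pp> \<subseteq> \<qq>\<close> ord_ideal_antimono) simp
    then have m1: "\<psi>' x \<in> \<qq> <+>\<^bsub>T\<^esub> ord_ideal M" using mem by blast
    have "\<zero>\<^bsub>T\<^esub> \<in> ord_ideal M" by (auto simp: mono_ideal_def)
    moreover have "\<psi> (hi x) \<otimes>\<^bsub>T\<^esub> g \<in> \<qq>" by (rule \<qq>.I_l_closed[OF g \<psi>c[OF x]])
    moreover have "\<psi> (hi x) \<otimes>\<^bsub>T\<^esub> g \<oplus>\<^bsub>T\<^esub> \<zero>\<^bsub>T\<^esub> = \<psi> (hi x) \<otimes>\<^bsub>T\<^esub> g"
      by (intro T.r_zero T.m_closed \<psi>c x gc)
    ultimately have m2: "\<psi> (hi x) \<otimes>\<^bsub>T\<^esub> g \<in> \<qq> <+>\<^bsub>T\<^esub> ord_ideal M"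
      using set_add_memI[of "\<psi> (hi x) \<otimes>\<^bsub>T\<^esub> g" \<qq> "\<zero>\<^bsub>T\<^esub>" "ord_ideal M" T] by (simp only:)
    have "\<phi> (lo x) = \<psi>' x \<ominus>\<^bsub>T\<^esub> \<psi> (hi x) \<otimes>\<^bsub>T\<^esub> g"
      unfolding \<psi>'_def using \<phi>c[OF x] \<psi>c[OF x] gc by algebra
    also have "\<dots> \<in> \<qq> <+>\<^bsub>T\<^esub> ord_ideal M"
      unfolding a_minus_def by (intro \<qq>M.a_closed \<qq>M.a_inv_closed m1 m2)
    finally have l0: "lo x = (\<lambda>_. \<zero>)" by (rule \<phi>(2)[OF lo[OF x]])
    have "\<psi>' x = \<psi> (hi x) \<otimes>\<^bsub>T\<^esub> g"
      unfolding \<psi>'_def l0 lin_map_zero[OF \<phi>(1)] by (intro T.l_zero T.m_closed \<psi>c x gc)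
    with mem have "\<psi> (hi x) \<otimes>\<^bsub>T\<^esub> g \<in> \<pp> <+>\<^bsub>T\<^esub> ord_ideal (M + Suc n * c)" by (simp only:)
    from colon[OF \<psi>c[OF x] this] have "\<psi> (hi x) \<in> \<pp> <+>\<^bsub>T\<^esub> ord_ideal (M + n * c)" by simp
    then have h0: "hi x = (\<lambda>_. \<zero>)" by (rule \<psi>(2)[OF hi[OF x]])
    have "x i = \<zero>" for i
      using fun_cong[OF l0, of i] fun_cong[OF h0, of "i - L"] by (cases "i < L") (auto simp: lo_def hi_def)
    then show ?thesis by (simp add: fun_eq_iff)
  qed
  ultimately show ?case by (intro exI[of _ \<psi>'] conjI ballI impI) (assumption | simp only:)+
qed

lemma proper_ideal_const_coeff:
  assumes "ideal J T" "J \<noteq> carrier T" "P \<in> J"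
  shows "P {#} = \<zero>"
proof (rule ccontr)
  interpret J: ideal J T by (rule assms)
  assume "P {#} \<noteq> \<zero>"
  then have "P \<in> Units T" using J.Icarr[OF assms(3)] by (intro T_Units)
  then have "\<one>\<^bsub>T\<^esub> \<in> J" using J.I_l_closed[OF assms(3), of "inv\<^bsub>T\<^esub> P"] by simp
  then show False using J.one_imp_carrier assms(2) by blast
qed

text \<open>If \<open>g\<^sub>i \<in> \<pp>\<^sub>i\<^sub>+\<^sub>1 - \<pp>\<^sub>i\<close>, the monomials in the \<open>g\<^sub>i\<close> with exponents below \<open>n\<close> are independent
  modulo the series of order \<open>1 + n C\<close>, which bounds their number by that of the monomials of
  smaller degree.\<close>

theorem prime_chain_length_le:
  assumes fin: "finite I" and prime: "\<And>i. i \<le> t \<Longrightarrow> primeideal (\<pp> i) T"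
    and chain: "\<And>i. i < t \<Longrightarrow> \<pp> i \<subset> \<pp> (Suc i)"
  shows "t \<le> card I"
proof (rule ccontr)
  have id: "ideal (\<pp> i) T" "\<pp> i \<noteq> carrier T" if "i \<le> t" for i
    using prime[OF that] primeideal.axioms(1) primeideal.I_notcarr by blast+
  \<comment> \<open>The induction descends from the top prime \<open>\<pp> t\<close>. It starts from
    the constants, which are independent modulo a proper ideal and order 1. The constant C depends
    on the chain but not on n.\<close>
  have "\<exists>C. \<forall>n. \<exists>\<phi>. lin_map (n ^ j) \<phi> \<and>
     (\<forall>x\<in>vecs R (n ^ j). \<phi> x \<in> \<pp> (t - j) <+>\<^bsub>T\<^esub> ord_ideal (1 + n * C) \<longrightarrow> x = (\<lambda>_. \<zero>))" if "j \<le> t" for j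
    using that
  proof (induction j)
    case 0
    define \<phi> :: "(nat \<Rightarrow> 'a) \<Rightarrow> 'v multiset \<Rightarrow> 'a" where "\<phi> x = ps_term R (x 0) {#}" for x
    have "lin_map 1 \<phi>"
      unfolding lin_map_def
    proof (intro ballI conjI)
      fix x assume x: "x \<in> vecs R 1"
      then show "\<phi> x \<in> carrier T" by (auto simp: \<phi>_def supp_funs_def)
      fix c y assume "c \<in> carrier R" "y \<in> vecs R 1"
      then show "\<phi> (\<lambda>i. x i \<oplus> c \<otimes> y i) = \<phi> x \<oplus>\<^bsub>T\<^esub> ps_term R c {#} \<otimes>\<^bsub>T\<^esub> \<phi> y"
        using x by (intro ext) (auto simp: \<phi>_def supp_funs_def coeff_smult, auto simp: ps_term_def)
    qed
    moreover have "x = (\<lambda>_. \<zero>)"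
      if x: "x \<in> vecs R 1" and mem: "\<phi> x \<in> \<pp> t <+>\<^bsub>T\<^esub> ord_ideal 1" for x
    proof -
      obtain p q where "p \<in> \<pp> t" "q \<in> ord_ideal 1" "\<phi> x = p \<oplus>\<^bsub>T\<^esub> q"
        using mem by (rule set_add_memE)
      then have "\<phi> x {#} = \<zero>"
        using proper_ideal_const_coeff[OF id[of t], of p] by (simp add: mono_ideal_def)
      then have "x 0 = \<zero>" by (simp add: \<phi>_def ps_term_def)
      then have "x i = \<zero>" for i using x by (cases i) (auto simp: supp_funs_def)
      then show ?thesis by (simp add: fun_eq_iff)
    qed
    ultimately show ?case by (intro exI[of _ 0] allI exI[of _ \<phi>]) simp
  next
    case (Suc j)
    then obtain C where C: "\<forall>n. \<exists>\<phi>. lin_map (n ^ j) \<phi> \<and>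
     (\<forall>x\<in>vecs R (n ^ j). \<phi> x \<in> \<pp> (t - j) <+>\<^bsub>T\<^esub> ord_ideal (1 + n * C) \<longrightarrow> x = (\<lambda>_. \<zero>))"
      by (meson Suc_leD)
    have sub: "\<pp> (t - Suc j) \<subset> \<pp> (t - j)"
      using chain[of "t - Suc j"] Suc.prems by (simp add: Suc_diff_Suc)
    then obtain g where g: "g \<in> \<pp> (t - j)" "g \<notin> \<pp> (t - Suc j)" by blast
    interpret \<qq>: ideal "\<pp> (t - j)" T by (rule id) simp
    obtain c where c: "\<And>n a. a \<in> carrier T \<Longrightarrow> a \<otimes>\<^bsub>T\<^esub> g \<in> \<pp> (t - Suc j) <+>\<^bsub>T\<^esub> ord_ideal n
      \<Longrightarrow> a \<in> \<pp> (t - Suc j) <+>\<^bsub>T\<^esub> ord_ideal (n - c)"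
      by (rule colon_order_bound[OF fin prime \<qq>.Icarr[OF g(1)] g(2)]) (simp, rule that)
    show ?case
    proof (intro exI[of _ "C + c"] allI)
      fix n
      obtain \<phi> where \<phi>: "lin_map (n ^ j) \<phi> \<and>
        (\<forall>x\<in>vecs R (n ^ j). \<phi> x \<in> \<pp> (t - j) <+>\<^bsub>T\<^esub> ord_ideal (1 + n * C) \<longrightarrow> x = (\<lambda>_. \<zero>))"
        using C[rule_format, of n] by (rule exE)
      have "\<exists>\<psi>. lin_map (n * n ^ j) \<psi> \<and> (\<forall>x\<in>vecs R (n * n ^ j).
          \<psi> x \<in> \<pp> (t - Suc j) <+>\<^bsub>T\<^esub> ord_ideal (1 + n * C + n * c) \<longrightarrow> x = (\<lambda>_. \<zero>))"
        by (rule independent_powers[OF id(1) \<qq>.is_ideal _ g(1) c \<phi>[THEN conjunct1]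
              \<phi>[THEN conjunct2, rule_format]]) (use sub in auto)
      then show "\<exists>\<phi>. lin_map (n ^ Suc j) \<phi> \<and> (\<forall>x\<in>vecs R (n ^ Suc j).
          \<phi> x \<in> \<pp> (t - Suc j) <+>\<^bsub>T\<^esub> ord_ideal (1 + n * (C + c)) \<longrightarrow> x = (\<lambda>_. \<zero>))"
        by (simp add: distrib_left add.assoc)
    qed
  qed
  from this[of t] obtain C where C: "\<forall>n. \<exists>\<phi>. lin_map (n ^ t) \<phi> \<and>
     (\<forall>x\<in>vecs R (n ^ t). \<phi> x \<in> \<pp> 0 <+>\<^bsub>T\<^esub> ord_ideal (1 + n * C) \<longrightarrow> x = (\<lambda>_. \<zero>))" by auto
  assume "\<not> t \<le> card I"
  \<comment> \<open>At most \<open>(1 + n * C) ^ card I\<close> monomials have degree below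
    \<open>1 + n * C\<close>, and this is at most \<open>n ^ card I * (1 + C) ^ card I\<close>. As n
    exceeds the second factor, the count is below \<open>n ^ Suc (card I)\<close>, hence below the
    number \<open>n ^ t\<close> of independent series if t were larger than
    \<open>card I\<close>.\<close>
  define n where "n = Suc ((1 + C) ^ card I)"
  obtain \<phi> where "lin_map (n ^ t) \<phi> \<and>
     (\<forall>x\<in>vecs R (n ^ t). \<phi> x \<in> \<pp> 0 <+>\<^bsub>T\<^esub> ord_ideal (1 + n * C) \<longrightarrow> x = (\<lambda>_. \<zero>))"
    using C[rule_format, of n] by (rule exE)
  note \<phi> = this[THEN conjunct1] this[THEN conjunct2, rule_format]
  define E where "E = {m. set_mset m \<subseteq> I \<and> size m < 1 + n * C}"
  have "card E \<le> (1 + n * C) ^ card I" unfolding E_def by (rule card_monomials_le[OF fin])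
  also have "\<dots> \<le> (n * (1 + C)) ^ card I" by (intro power_mono) (auto simp: n_def)
  also have "\<dots> < n ^ card I * n" 
    unfolding power_mult_distrib by (intro mult_strict_left_mono) (auto simp: n_def)
  also have "\<dots> = n ^ Suc (card I)" by simp
  also have "\<dots> \<le> n ^ t" using \<open>\<not> t \<le> card I\<close> by (intro power_increasing) (auto simp: n_def)
  finally have less: "card E < n ^ t" .
  have "lin_form R (n ^ t) (\<lambda>x. \<phi> x m)" for m
    using \<phi>(1) unfolding lin_form_def lin_map_def by (auto simp: coeff_smult)
  then obtain x where x: "x \<in> vecs R (n ^ t)" "x \<noteq> (\<lambda>_. \<zero>)" "\<And>m. m \<in> E \<Longrightarrow> \<phi> x m = \<zero>"
    using common_zero_of_lin_forms[of E "n ^ t" "\<lambda>m x. \<phi> x m"] less card_monomials_le(1)[OF fin]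
    unfolding E_def by auto
  have xc: "\<phi> x \<in> carrier T" using \<phi>(1) x(1) by (simp add: lin_map_def)
  have "\<phi> x m = \<zero>" if "size m < 1 + n * C" for m
    using x(3)[of m] coeff_outside[OF xc, of m] that by (auto simp: E_def)
  then have "\<phi> x \<in> ord_ideal (1 + n * C)" using xc by (auto simp: mono_ideal_def)
  moreover have "\<zero>\<^bsub>T\<^esub> \<in> \<pp> 0"
    by (rule additive_subgroup.zero_closed[OF ideal.axioms(1)[OF id(1)]]) simp
  moreover have "\<phi> x = \<zero>\<^bsub>T\<^esub> \<oplus>\<^bsub>T\<^esub> \<phi> x" using xc by (rule T.l_zero[symmetric])
  ultimately have "\<phi> x \<in> \<pp> 0 <+>\<^bsub>T\<^esub> ord_ideal (1 + n * C)"
    using set_add_memI[of "\<zero>\<^bsub>T\<^esub>" "\<pp> 0" "\<phi> x" "ord_ideal (1 + n * C)" T] by (simp only:)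
  with \<phi>(2)[OF x(1)] x(2) show False by blast
qed

end

section \<open>Depth is bounded by dimension\<close>

text \<open>Krull's existence theorem rather than the prime avoidance lemma: an ideal that is
  maximal among those containing \<aa> and missing a multiplicative set is prime. If neither a nor b
  lies in it, both enlarged ideals meet \<open>W\<close>, and so does their product.\<close>

lemma (in cring) prime_avoiding:
  assumes \<aa>: "ideal \<aa> R" and W: "W \<subseteq> carrier R" "\<one> \<in> W" "\<And>x y. x \<in> W \<Longrightarrow> y \<in> W \<Longrightarrow> x \<otimes> y \<in> W"
    and disj: "\<aa> \<inter> W = {}"
  obtains P where "primeideal P R" "\<aa> \<subseteq> P" "P \<inter> W = {}"
proof -
  define F where "F = {I. ideal I R \<and> \<aa> \<subseteq> I \<and> I \<inter> W = {}}"
  have "\<exists>M\<in>F. \<forall>I\<in>F. M \<subseteq> I \<longrightarrow> I = M"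
  proof (rule subset_Zorn_nonempty)
    show "F \<noteq> {}" using \<aa> disj by (auto simp: F_def)
    fix C assume C: "C \<noteq> {}" "subset.chain F C"
    then have "subset.chain {I. ideal I R} C" by (auto simp: F_def pred_on.chain_def)
    from chain_Union_is_ideal[OF this] C(1) have "ideal (\<Union>C) R" by simp
    then show "\<Union>C \<in> F" using C by (auto simp: F_def pred_on.chain_def)
  qed
  then obtain M where M: "M \<in> F" "\<And>I. I \<in> F \<Longrightarrow> M \<subseteq> I \<Longrightarrow> I = M" by blast
  interpret M: ideal M R using M(1) by (simp add: F_def)
  have meets: "\<exists>m\<in>M. \<exists>r\<in>carrier R. m \<oplus> r \<otimes> a \<in> W" if a: "a \<in> carrier R" "a \<notin> M" for a
  proof -
    let ?J = "M <+>\<^bsub>R\<^esub> PIdl a"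
    have J: "ideal ?J R" by (intro add_ideals M.is_ideal cgenideal_ideal a)
    have z: "\<zero> \<in> PIdl a" using cgenideal_ideal[OF a(1)] by (simp add: additive_subgroup.zero_closed ideal.axioms(1))
    have sub: "M \<subseteq> ?J"
    proof
      fix x assume "x \<in> M"
      then show "x \<in> ?J" using set_add_memI[OF _ z, of x M R] M.Icarr by simp
    qed
    have "a \<in> ?J" using set_add_memI[of \<zero> M a "PIdl a" R] cgenideal_self[OF a(1)] a(1) by simp
    then have "?J \<notin> F" using M(2)[OF _ sub] a(2) by blast
    then have "?J \<inter> W \<noteq> {}" using J sub M(1) by (auto simp: F_def)
    then obtain w where w: "w \<in> ?J" "w \<in> W" by blast
    then obtain m b where "m \<in> M" "b \<in> PIdl a" "w = m \<oplus> b" by (blast elim: set_add_memE)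
    with w show ?thesis by (auto simp: cgenideal_def)
  qed
  have "primeideal M R"
  proof (rule primeidealI)
    show "carrier R \<noteq> M" using M(1) W by (auto simp: F_def)
    fix a b assume ab: "a \<in> carrier R" "b \<in> carrier R" "a \<otimes> b \<in> M"
    show "a \<in> M \<or> b \<in> M"
    proof (rule ccontr)
      assume "\<not> (a \<in> M \<or> b \<in> M)"
      then obtain m r n s where x: "m \<in> M" "r \<in> carrier R" "m \<oplus> r \<otimes> a \<in> W"
        "n \<in> M" "s \<in> carrier R" "n \<oplus> s \<otimes> b \<in> W" using meets ab by meson
      have c: "m \<in> carrier R" "n \<in> carrier R" using M.Icarr x(1,4) by blast+
      have "(m \<oplus> r \<otimes> a) \<otimes> (n \<oplus> s \<otimes> b) = (n \<oplus> s \<otimes> b) \<otimes> m \<oplus> ((r \<otimes> a) \<otimes> n \<oplus> (r \<otimes> s) \<otimes> (a \<otimes> b))"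
        using c x(2,5) ab(1,2) by algebra
      also have "\<dots> \<in> M" 
        using x ab c
        by (intro M.a_closed M.I_l_closed[OF x(1)] M.I_l_closed[OF x(4)] M.I_l_closed[OF ab(3)]) auto
      finally show False using W(3)[OF x(3,6)] M(1) by (auto simp: F_def)
    qed
  qed (use M.is_ideal is_cring in auto)
  then show thesis using that M(1) by (auto simp: F_def)
qed

context module
begin

lemma seq_submodule_submodule: "set xs \<subseteq> carrier R \<Longrightarrow> submodule (seq_submodule M xs) R M"
proof (induction xs)
  case Nil
  show ?case by (rule submoduleI) auto
next
  case (Cons x xs)
  then have x: "x \<in> carrier R" and S: "submodule (seq_submodule M xs) R M" by auto
  note S' = submoduleE[OF S]
  have S0: "\<zero>\<^bsub>M\<^esub> \<in> seq_submodule M xs"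
    using S by (metis M.add.one_closed monoid.simps(2) subgroup.one_closed submodule.axioms(1) )
  show ?case
  proof (rule submoduleI)
    show "seq_submodule M (x # xs) \<subseteq> carrier M" using x S'(1) by auto
    show "\<zero>\<^bsub>M\<^esub> \<in> seq_submodule M (x # xs)"
      using x S0 by (auto intro!: exI[of _ "\<zero>\<^bsub>M\<^esub>"])
  next
    fix a assume "a \<in> seq_submodule M (x # xs)"
    then obtain y z where a: "a = x \<odot>\<^bsub>M\<^esub> y \<oplus>\<^bsub>M\<^esub> z" "y \<in> carrier M" "z \<in> seq_submodule M xs" by auto
    then have "\<ominus>\<^bsub>M\<^esub> a = x \<odot>\<^bsub>M\<^esub> (\<ominus>\<^bsub>M\<^esub> y) \<oplus>\<^bsub>M\<^esub> \<ominus>\<^bsub>M\<^esub> z"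
      using x S'(1) by (auto simp: smult_r_minus M.minus_add)
    with a S'(3) show "\<ominus>\<^bsub>M\<^esub> a \<in> seq_submodule M (x # xs)" by auto
    fix b assume "b \<in> seq_submodule M (x # xs)"
    then obtain y' z' where b: "b = x \<odot>\<^bsub>M\<^esub> y' \<oplus>\<^bsub>M\<^esub> z'" "y' \<in> carrier M" "z' \<in> seq_submodule M xs" by auto
    have "a \<oplus>\<^bsub>M\<^esub> b = x \<odot>\<^bsub>M\<^esub> (y \<oplus>\<^bsub>M\<^esub> y') \<oplus>\<^bsub>M\<^esub> (z \<oplus>\<^bsub>M\<^esub> z')"
      using a(2) b(2) x subsetD[OF S'(1) a(3)] subsetD[OF S'(1) b(3)]
      unfolding a(1) b(1) by (simp add: smult_r_distr M.a_ac)
    then show "a \<oplus>\<^bsub>M\<^esub> b \<in> seq_submodule M (x # xs)" using a b S'(5) M.a_closed by auto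
  next
    fix r a assume r: "r \<in> carrier R" and "a \<in> seq_submodule M (x # xs)"
    then obtain y z where a: "a = x \<odot>\<^bsub>M\<^esub> y \<oplus>\<^bsub>M\<^esub> z" "y \<in> carrier M" "z \<in> seq_submodule M xs" by auto
    then have "r \<odot>\<^bsub>M\<^esub> a = x \<odot>\<^bsub>M\<^esub> (r \<odot>\<^bsub>M\<^esub> y) \<oplus>\<^bsub>M\<^esub> r \<odot>\<^bsub>M\<^esub> z"
      using x r S'(1) by (auto simp: smult_r_distr smult_assoc1[symmetric] R.m_comm)
    with a r S'(4) show "r \<odot>\<^bsub>M\<^esub> a \<in> seq_submodule M (x # xs)" by auto
  qed
qed

lemma seq_submodule_snoc:
  assumes "set xs \<subseteq> carrier R" "x \<in> carrier R"
  shows "seq_submodule M (xs @ [x]) = {z \<oplus>\<^bsub>M\<^esub> x \<odot>\<^bsub>M\<^esub> y | y z. y \<in> carrier M \<and> z \<in> seq_submodule M xs}"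
  using assms(1)
proof (induction xs)
  case Nil
  have "seq_submodule M ([] @ [x]) = {x \<odot>\<^bsub>M\<^esub> y \<oplus>\<^bsub>M\<^esub> \<zero>\<^bsub>M\<^esub> | y. y \<in> carrier M}" by simp
  also have "\<dots> = {\<zero>\<^bsub>M\<^esub> \<oplus>\<^bsub>M\<^esub> x \<odot>\<^bsub>M\<^esub> y | y. y \<in> carrier M}"
    by (rule Collect_cong) (metis M.a_comm M.zero_closed assms(2) smult_closed)
  finally show ?case by simp
next
  case (Cons a xs)
  have S: "seq_submodule M xs \<subseteq> carrier M"
    using submoduleE(1)[OF seq_submodule_submodule] Cons.prems by auto
  have a: "a \<in> carrier R" using Cons.prems by simp
  show ?case
  proof (intro equalityI subsetI)
    fix w assume "w \<in> seq_submodule M ((a # xs) @ [x])"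
    then obtain y z y' where w: "w = a \<odot>\<^bsub>M\<^esub> y \<oplus>\<^bsub>M\<^esub> (z \<oplus>\<^bsub>M\<^esub> x \<odot>\<^bsub>M\<^esub> y')" "y \<in> carrier M" "y' \<in> carrier M"
      "z \<in> seq_submodule M xs" using Cons by auto
    have "w = (a \<odot>\<^bsub>M\<^esub> y \<oplus>\<^bsub>M\<^esub> z) \<oplus>\<^bsub>M\<^esub> x \<odot>\<^bsub>M\<^esub> y'" using w a assms(2) S by (auto simp: M.a_assoc)
    then show "w \<in> {z \<oplus>\<^bsub>M\<^esub> x \<odot>\<^bsub>M\<^esub> y |y z. y \<in> carrier M \<and> z \<in> seq_submodule M (a # xs)}" using w by auto
  next
    fix w assume "w \<in> {z \<oplus>\<^bsub>M\<^esub> x \<odot>\<^bsub>M\<^esub> y |y z. y \<in> carrier M \<and> z \<in> seq_submodule M (a # xs)}"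
    then obtain y z y' where w: "w = (a \<odot>\<^bsub>M\<^esub> y \<oplus>\<^bsub>M\<^esub> z) \<oplus>\<^bsub>M\<^esub> x \<odot>\<^bsub>M\<^esub> y'" "y \<in> carrier M" "y' \<in> carrier M"
      "z \<in> seq_submodule M xs" by auto
    have "w = a \<odot>\<^bsub>M\<^esub> y \<oplus>\<^bsub>M\<^esub> (z \<oplus>\<^bsub>M\<^esub> x \<odot>\<^bsub>M\<^esub> y')" using w a assms(2) S by (auto simp: M.a_assoc)
    then show "w \<in> seq_submodule M ((a # xs) @ [x])" using w Cons by auto
  qed
qed

text \<open>Let \<open>\<aa> i\<close> be the annihilator of M modulo the first i elements. The
  chain is built downwards from a prime over the last annihilator. Given a prime Q over
  \<open>\<aa> (Suc k)\<close> and the element x at position k, the products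
  \<open>x [^] e \<otimes> s\<close> with s outside Q miss \<open>\<aa> k\<close>: regularity
  cancels the powers of x, and then s would lie in \<open>\<aa> k\<close>, hence in Q. A prime over
  \<open>\<aa> k\<close> missing these products lies in Q and omits x, which belongs to Q, so the
  inclusion is strict.\<close>

lemma regular_seq_prime_chain:
  assumes xs: "set xs \<subseteq> carrier R" and reg: "regular_seq M xs"
  shows "\<exists>P. (\<forall>i\<le>length xs. primeideal (P i) R) \<and> (\<forall>i<length xs. P i \<subset> P (Suc i))"
proof -
  define S where "S i = seq_submodule M (take i xs)" for i
  define \<aa> where "\<aa> i = {a \<in> carrier R. \<forall>y\<in>carrier M. a \<odot>\<^bsub>M\<^esub> y \<in> S i}" for i
  have sub: "submodule (S i) R M" for i
    unfolding S_def using xs by (intro seq_submodule_submodule) (auto dest: in_set_takeD)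
  have S0: "\<zero>\<^bsub>M\<^esub> \<in> S i" for i
    using subgroup.one_closed[OF submodule.axioms(1)[OF sub]] by simp
  have S_Suc: "S (Suc i) = {z \<oplus>\<^bsub>M\<^esub> (xs ! i) \<odot>\<^bsub>M\<^esub> y | y z. y \<in> carrier M \<and> z \<in> S i}" if "i < length xs" for i
    unfolding S_def take_Suc_conv_app_nth[OF that] using xs that
    by (intro seq_submodule_snoc) (auto dest: in_set_takeD)
  have xc: "xs ! i \<in> carrier R" if "i < length xs" for i using xs that by (auto simp: subset_iff)
  have mono: "\<aa> i \<subseteq> \<aa> (Suc i)" if "i < length xs" for i
  proof -
    have "S i \<subseteq> S (Suc i)"
    proof
      fix z assume z: "z \<in> S i"
      then have "z = z \<oplus>\<^bsub>M\<^esub> (xs ! i) \<odot>\<^bsub>M\<^esub> \<zero>\<^bsub>M\<^esub>" using subsetD[OF submoduleE(1)[OF sub] z] xc[OF that] by simp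
      with z show "z \<in> S (Suc i)" unfolding S_Suc[OF that] by blast
    qed
    then show ?thesis by (auto simp: \<aa>_def)
  qed
  have x_in: "xs ! i \<in> \<aa> (Suc i)" if "i < length xs" for i
  proof -
    have "(xs ! i) \<odot>\<^bsub>M\<^esub> y \<in> S (Suc i)" if y: "y \<in> carrier M" for y
    proof -
      have "(xs ! i) \<odot>\<^bsub>M\<^esub> y = \<zero>\<^bsub>M\<^esub> \<oplus>\<^bsub>M\<^esub> (xs ! i) \<odot>\<^bsub>M\<^esub> y" using xc[OF \<open>i < length xs\<close>] y by simp
      then show ?thesis unfolding S_Suc[OF \<open>i < length xs\<close>] using y S0 by blast
    qed
    then show ?thesis using xc[OF that] by (simp add: \<aa>_def)
  qed
  have ideal: "ideal (\<aa> i) R" for i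
  proof (rule idealI)
    show "subgroup (\<aa> i) (add_monoid R)"
    proof (rule R.add.subgroupI)
      show "\<aa> i \<noteq> {}" using S0 by (auto simp: \<aa>_def intro!: exI[of _ \<zero>])
      fix a assume "a \<in> \<aa> i"
      then show "\<ominus> a \<in> \<aa> i" using submoduleE(3)[OF sub] by (auto simp: \<aa>_def smult_l_minus)
      fix b assume "b \<in> \<aa> i"
      then show "a \<oplus> b \<in> \<aa> i" using \<open>a \<in> \<aa> i\<close> submoduleE(5)[OF sub] by (auto simp: \<aa>_def smult_l_distr)
    qed (auto simp: \<aa>_def)
    fix a x assume a: "a \<in> \<aa> i" and x: "x \<in> carrier R"
    show "x \<otimes> a \<in> \<aa> i" using a x submoduleE(4)[OF sub x] by (auto simp: \<aa>_def smult_assoc1)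
    then show "a \<otimes> x \<in> \<aa> i" using a x by (simp add: R.m_comm \<aa>_def)
  qed (rule R.ring_axioms)
  have reg1: "y \<in> S i" if "i < length xs" "y \<in> carrier M" "(xs ! i) \<odot>\<^bsub>M\<^esub> y \<in> S i" for i y
    using reg that by (auto simp: regular_seq_def S_def)
  have "\<exists>P. (\<forall>i. n - j \<le> i \<and> i \<le> n \<longrightarrow> primeideal (P i) R \<and> \<aa> i \<subseteq> P i)
      \<and> (\<forall>i. n - j \<le> i \<and> i < n \<longrightarrow> P i \<subset> P (Suc i))" if "n = length xs" "j \<le> n" for n j
    using that(2)
  proof (induction j)
    case 0
    have "\<aa> n \<inter> {\<one>} = {}"
    proof -
      have "S n \<noteq> carrier M" using reg that(1) by (simp add: regular_seq_def S_def)
      then show ?thesis using submoduleE(1)[OF sub, of n] by (auto simp: \<aa>_def)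
    qed
    then obtain Q where Q: "primeideal Q R" "\<aa> n \<subseteq> Q"
      by (rule R.prime_avoiding[OF ideal, of "{\<one>}", rotated 3]) auto
    then show ?case by (intro exI[of _ "\<lambda>_. Q"]) auto
  next
    case (Suc j)
    then have "\<exists>P. (\<forall>i. n - j \<le> i \<and> i \<le> n \<longrightarrow> primeideal (P i) R \<and> \<aa> i \<subseteq> P i)
      \<and> (\<forall>i. n - j \<le> i \<and> i < n \<longrightarrow> P i \<subset> P (Suc i))" by simp
    then obtain P where "(\<forall>i. n - j \<le> i \<and> i \<le> n \<longrightarrow> primeideal (P i) R \<and> \<aa> i \<subseteq> P i)
      \<and> (\<forall>i. n - j \<le> i \<and> i < n \<longrightarrow> P i \<subset> P (Suc i))" by (rule exE)
    note P = this[THEN conjunct1, rule_format, OF conjI] this[THEN conjunct2, rule_format, OF conjI]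
    define k where "k = n - Suc j"
    have k: "k < n" "Suc k = n - j" using Suc.prems by (auto simp: k_def)
    define Q where "Q = P (Suc k)"
    have Q: "primeideal Q R" "\<aa> (Suc k) \<subseteq> Q" using P(1)[of "Suc k"] k by (auto simp: Q_def)
    interpret Q: primeideal Q R by (rule Q)
    let ?x = "xs ! k"
    have kl: "k < length xs" using k that by simp
    have x: "?x \<in> carrier R" using xc k that by simp
    define W where "W = {?x [^] e \<otimes> s | (e::nat) s. s \<in> carrier R \<and> s \<notin> Q}"
    have disj: "\<aa> k \<inter> W = {}"
    proof (rule equals0I)
      fix a assume a: "a \<in> \<aa> k \<inter> W"
      then obtain e :: nat and s where s: "a = ?x [^] e \<otimes> s" "s \<in> carrier R" "s \<notin> Q" by (auto simp: W_def)
      have drop: "s \<odot>\<^bsub>M\<^esub> y \<in> S k" if "y \<in> carrier M" "(?x [^] e \<otimes> s) \<odot>\<^bsub>M\<^esub> y \<in> S k" for y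
        using that(2)
      proof (induction e)
        case 0
        then show ?case using s(2) by simp
      next
        case (Suc e)
        have c: "?x [^] e \<otimes> s \<in> carrier R" using x s(2) by (intro R.m_closed R.nat_pow_closed)
        have "?x [^] Suc e \<otimes> s = ?x \<otimes> (?x [^] e \<otimes> s)" using x s(2) by (simp add: R.m_ac)
        with Suc.prems have "?x \<odot>\<^bsub>M\<^esub> ((?x [^] e \<otimes> s) \<odot>\<^bsub>M\<^esub> y) \<in> S k"
          using smult_assoc1[OF x c that(1)] by (simp only:)
        with kl smult_closed[OF c that(1)] have "(?x [^] e \<otimes> s) \<odot>\<^bsub>M\<^esub> y \<in> S k" by (rule reg1)
        then show ?case by (rule Suc.IH)
      qed
      moreover have "(?x [^] e \<otimes> s) \<odot>\<^bsub>M\<^esub> y \<in> S k" if "y \<in> carrier M" for y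
        using a that unfolding s(1) \<aa>_def by blast
      ultimately have "s \<in> \<aa> k" using s(2) unfolding \<aa>_def by blast
      then show False using mono[of k] Q(2) s(3) k that by auto
    qed
    have Wc: "W \<subseteq> carrier R" using x by (auto simp: W_def)
    have "\<one> \<notin> Q" using Q.one_imp_carrier Q.I_notcarr by auto
    then have W1: "\<one> \<in> W" unfolding W_def by (intro CollectI exI[of _ "0::nat"] exI[of _ \<one>]) auto
    have Wm: "a \<otimes> b \<in> W" if ab: "a \<in> W" "b \<in> W" for a b
    proof -
      obtain e s e' s' where "a = ?x [^] (e::nat) \<otimes> s" "s \<in> carrier R" "s \<notin> Q"
        "b = ?x [^] (e'::nat) \<otimes> s'" "s' \<in> carrier R" "s' \<notin> Q" using ab by (auto simp: W_def)
      then show ?thesis using x Q.I_prime[of s s'] unfolding W_def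
        by (intro CollectI exI[of _ "e + e'"] exI[of _ "s \<otimes> s'"]) (auto simp: R.nat_pow_mult[symmetric] R.m_ac)
    qed
    obtain P' where P': "primeideal P' R" "\<aa> k \<subseteq> P'" "P' \<inter> W = {}"
      by (rule R.prime_avoiding[OF ideal Wc W1 Wm disj]) (simp_all add: that)
    interpret P': primeideal P' R by (rule P'(1))
    have sW: "s \<in> W" if "s \<in> carrier R" "s \<notin> Q" for s
      unfolding W_def using that by (intro CollectI exI[of _ "0::nat"] exI[of _ s]) auto
    have "P' \<subseteq> Q" using sW P'(3) P'.Icarr by blast
    moreover have "?x \<in> Q" using x_in[of k] Q(2) k that by auto
    moreover have "?x \<in> W" unfolding W_def
      using x \<open>\<one> \<notin> Q\<close> by (intro CollectI exI[of _ "1::nat"] exI[of _ \<one>]) auto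
    ultimately have strict: "P' \<subset> Q" using P'(3) by blast
    show ?case
    proof (intro exI[of _ "P(k := P')"] conjI allI impI)
      fix i assume i: "n - Suc j \<le> i \<and> i \<le> n"
      show "primeideal ((P(k := P')) i) R" "\<aa> i \<subseteq> (P(k := P')) i"
        using P(1)[of i] P'(1,2) i k by (cases "i = k"; simp add: k_def)+
    next
      fix i assume i: "n - Suc j \<le> i \<and> i < n"
      show "(P(k := P')) i \<subset> (P(k := P')) (Suc i)"
        using P(2)[of i] strict i k by (cases "i = k") (auto simp: Q_def k_def)
    qed
  qed
  from this[OF refl, of "length xs"] show ?thesis by auto
qed

lemma depth_le_krull_dim:
  assumes "carrier M \<noteq> {\<zero>\<^bsub>M\<^esub>}" and "max_ideal R \<subseteq> carrier R"
  shows "depth R M \<le> krull_dim R"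
proof -
  have "enat (length xs) \<le> krull_dim R" if "set xs \<subseteq> max_ideal R" "regular_seq M xs" for xs
    unfolding krull_dim_def using regular_seq_prime_chain[OF _ that(2)] that(1) assms(2)
    by (intro Sup_upper) blast
  then show ?thesis using assms(1) by (auto simp: depth_def intro!: Sup_least)
qed

end

section \<open>Direct summands\<close>

definition complementary :: "('a, 'm) ring_scheme \<Rightarrow> ('a, 'b, 'n) module_scheme \<Rightarrow> 'b set \<Rightarrow> 'b set \<Rightarrow> bool" where
  "complementary R M A B \<longleftrightarrow> submodule A R M \<and> submodule B R M \<and>
     A <+>\<^bsub>M\<^esub> B = carrier M \<and> A \<inter> B = {\<zero>\<^bsub>M\<^esub>}"

lemma set_add_carrier_update [simp]: "A <+>\<^bsub>M\<lparr>carrier := C\<rparr>\<^esub> B = A <+>\<^bsub>M\<^esub> B"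
  by (simp add: set_add_def')

context module
begin

lemma submodule_mem:
  assumes "submodule A R M"
  shows "A \<subseteq> carrier M" "\<zero>\<^bsub>M\<^esub> \<in> A" "\<And>x y. x \<in> A \<Longrightarrow> y \<in> A \<Longrightarrow> x \<oplus>\<^bsub>M\<^esub> y \<in> A"
    "\<And>x. x \<in> A \<Longrightarrow> \<ominus>\<^bsub>M\<^esub> x \<in> A" "\<And>r x. r \<in> carrier R \<Longrightarrow> x \<in> A \<Longrightarrow> r \<odot>\<^bsub>M\<^esub> x \<in> A"
  using submoduleE[OF assms] subgroup.one_closed[OF submodule.axioms(1)[OF assms]] by auto

lemma complementary_commute: "complementary R M A B \<longleftrightarrow> complementary R M B A"
proof -
  have "A <+>\<^bsub>M\<^esub> B = B <+>\<^bsub>M\<^esub> A" if "submodule A R M" "submodule B R M"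
    using submodule_mem(1)[OF that(1)] submodule_mem(1)[OF that(2)] M.a_comm
    by (fastforce simp: set_add_def' subset_iff)
  then show ?thesis by (auto simp: complementary_def Int_commute)
qed

lemma complementary_trivial: "complementary R M (carrier M) {\<zero>\<^bsub>M\<^esub>}"
proof -
  have "submodule {\<zero>\<^bsub>M\<^esub>} R M" by (rule submoduleI) auto
  moreover have "carrier M <+>\<^bsub>M\<^esub> {\<zero>\<^bsub>M\<^esub>} = carrier M" by (auto simp: set_add_def')
  ultimately show ?thesis by (auto simp: complementary_def carrier_is_submodule)
qed

lemma complementary_projection:
  assumes "complementary R M A B"
  obtains \<pi> where "\<And>x. x \<in> carrier M \<Longrightarrow> \<pi> x \<in> A"
    "\<And>x y. x \<in> carrier M \<Longrightarrow> y \<in> carrier M \<Longrightarrow> \<pi> (x \<oplus>\<^bsub>M\<^esub> y) = \<pi> x \<oplus>\<^bsub>M\<^esub> \<pi> y"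
    "\<And>r x. r \<in> carrier R \<Longrightarrow> x \<in> carrier M \<Longrightarrow> \<pi> (r \<odot>\<^bsub>M\<^esub> x) = r \<odot>\<^bsub>M\<^esub> \<pi> x"
    "\<And>x. x \<in> A \<Longrightarrow> \<pi> x = x" "\<And>x. x \<in> B \<Longrightarrow> \<pi> x = \<zero>\<^bsub>M\<^esub>"
    "\<And>x. x \<in> carrier M \<Longrightarrow> \<exists>b\<in>B. x = \<pi> x \<oplus>\<^bsub>M\<^esub> b"
proof -
  have AB: "submodule A R M" "submodule B R M" "A <+>\<^bsub>M\<^esub> B = carrier M" "A \<inter> B = {\<zero>\<^bsub>M\<^esub>}"
    using assms by (auto simp: complementary_def)
  note A = submodule_mem[OF AB(1)] and B = submodule_mem[OF AB(2)]
  have uniq: "a = a'" if "a \<in> A" "a' \<in> A" "b \<in> B" "b' \<in> B" "a \<oplus>\<^bsub>M\<^esub> b = a' \<oplus>\<^bsub>M\<^esub> b'" for a a' b b'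
  proof -
    have c: "a \<in> carrier M" "a' \<in> carrier M" "b \<in> carrier M" "b' \<in> carrier M" using that A(1) B(1) by auto
    have "a \<oplus>\<^bsub>M\<^esub> \<ominus>\<^bsub>M\<^esub> a' = (a \<oplus>\<^bsub>M\<^esub> b) \<oplus>\<^bsub>M\<^esub> (\<ominus>\<^bsub>M\<^esub> b \<oplus>\<^bsub>M\<^esub> \<ominus>\<^bsub>M\<^esub> a')"
      using c by (simp add: M.a_assoc) (simp add: M.a_assoc[symmetric] M.r_neg)
    also have "\<dots> = b' \<oplus>\<^bsub>M\<^esub> \<ominus>\<^bsub>M\<^esub> b"
    proof -
      have "(a \<oplus>\<^bsub>M\<^esub> b) \<oplus>\<^bsub>M\<^esub> (\<ominus>\<^bsub>M\<^esub> b \<oplus>\<^bsub>M\<^esub> \<ominus>\<^bsub>M\<^esub> a') = (a' \<oplus>\<^bsub>M\<^esub> \<ominus>\<^bsub>M\<^esub> a') \<oplus>\<^bsub>M\<^esub> (b' \<oplus>\<^bsub>M\<^esub> \<ominus>\<^bsub>M\<^esub> b)"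
        unfolding that(5) using c by (simp add: M.a_ac)
      then show ?thesis using c by (simp add: M.r_neg)
    qed
    finally have eq: "a \<oplus>\<^bsub>M\<^esub> \<ominus>\<^bsub>M\<^esub> a' = b' \<oplus>\<^bsub>M\<^esub> \<ominus>\<^bsub>M\<^esub> b" .
    have "a \<oplus>\<^bsub>M\<^esub> \<ominus>\<^bsub>M\<^esub> a' \<in> A \<inter> B"
    proof
      show "a \<oplus>\<^bsub>M\<^esub> \<ominus>\<^bsub>M\<^esub> a' \<in> A" by (intro A that)
      show "a \<oplus>\<^bsub>M\<^esub> \<ominus>\<^bsub>M\<^esub> a' \<in> B" unfolding eq by (intro B that)
    qed
    then have "a \<oplus>\<^bsub>M\<^esub> \<ominus>\<^bsub>M\<^esub> a' = \<zero>\<^bsub>M\<^esub>" using AB(4) by blast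
    moreover have "a = (a \<oplus>\<^bsub>M\<^esub> \<ominus>\<^bsub>M\<^esub> a') \<oplus>\<^bsub>M\<^esub> a'" using c by (simp add: M.a_assoc M.l_neg)
    ultimately show ?thesis using c by simp
  qed
  have "\<exists>a. a \<in> A \<and> (\<exists>b\<in>B. x = a \<oplus>\<^bsub>M\<^esub> b)" if "x \<in> carrier M" for x
    using that unfolding AB(3)[symmetric] set_add_def' by blast
  then obtain \<pi> where \<pi>: "\<And>x. x \<in> carrier M \<Longrightarrow> \<pi> x \<in> A \<and> (\<exists>b\<in>B. x = \<pi> x \<oplus>\<^bsub>M\<^esub> b)" by metis
  have I: "\<pi> x = a" if "a \<in> A" "b \<in> B" "x = a \<oplus>\<^bsub>M\<^esub> b" for x a b
  proof -
    have "x \<in> carrier M" using that A(1) B(1) by auto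
    then obtain b' where "b' \<in> B" "x = \<pi> x \<oplus>\<^bsub>M\<^esub> b'" "\<pi> x \<in> A" using \<pi> by blast
    with uniq[of "\<pi> x" a b' b] that show ?thesis by metis
  qed
  show thesis
  proof (rule that[of \<pi>])
    fix x assume x: "x \<in> carrier M"
    then show "\<pi> x \<in> A" "\<exists>b\<in>B. x = \<pi> x \<oplus>\<^bsub>M\<^esub> b" using \<pi> by blast+
    then obtain b where b: "\<pi> x \<in> A" "b \<in> B" "x = \<pi> x \<oplus>\<^bsub>M\<^esub> b" by blast
    have bc: "\<pi> x \<in> carrier M" "b \<in> carrier M" using b A(1) B(1) by auto
    { fix y assume y: "y \<in> carrier M"
      then obtain b' where b': "\<pi> y \<in> A" "b' \<in> B" "y = \<pi> y \<oplus>\<^bsub>M\<^esub> b'" using \<pi> by blast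
      have bc': "\<pi> y \<in> carrier M" "b' \<in> carrier M" using b' A(1) B(1) by auto
      have "x \<oplus>\<^bsub>M\<^esub> y = (\<pi> x \<oplus>\<^bsub>M\<^esub> b) \<oplus>\<^bsub>M\<^esub> (\<pi> y \<oplus>\<^bsub>M\<^esub> b')" using b(3) b'(3) by simp
      also have "\<dots> = (\<pi> x \<oplus>\<^bsub>M\<^esub> \<pi> y) \<oplus>\<^bsub>M\<^esub> (b \<oplus>\<^bsub>M\<^esub> b')" using bc bc' by (simp add: M.a_ac)
      finally show "\<pi> (x \<oplus>\<^bsub>M\<^esub> y) = \<pi> x \<oplus>\<^bsub>M\<^esub> \<pi> y"
        by (rule I[rotated 2]) (intro A B b b')+ }
    { fix r assume r: "r \<in> carrier R"
      have "r \<odot>\<^bsub>M\<^esub> x = r \<odot>\<^bsub>M\<^esub> (\<pi> x \<oplus>\<^bsub>M\<^esub> b)" using b(3) by simp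
      also have "\<dots> = r \<odot>\<^bsub>M\<^esub> \<pi> x \<oplus>\<^bsub>M\<^esub> r \<odot>\<^bsub>M\<^esub> b" by (rule smult_r_distr[OF r bc])
      finally show "\<pi> (r \<odot>\<^bsub>M\<^esub> x) = r \<odot>\<^bsub>M\<^esub> \<pi> x"
        by (rule I[rotated 2]) (intro A B b r)+ }
  next
    fix x assume x: "x \<in> A"
    then show "\<pi> x = x" using A(1) B(2) by (intro I[of x "\<zero>\<^bsub>M\<^esub>"]) auto
  next
    fix x assume x: "x \<in> B"
    then show "\<pi> x = \<zero>\<^bsub>M\<^esub>" using B(1) A(2) by (intro I[of "\<zero>\<^bsub>M\<^esub>" x]) auto
  qed
qed

lemma module_restrict: "submodule A R M \<Longrightarrow> module R (M\<lparr>carrier := A\<rparr>)"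
  by (rule submodule.submodule_is_module[OF _ module_axioms])

text \<open>The map \<theta> allows a change of rings along the way: it is the identity for direct
  summands and the projection onto the quotient ring for cokernels.\<close>

lemma fg_module_image:
  assumes fg: "fg_module R M" and N: "module S N" and surj: "\<pi> ` carrier M = carrier N"
    and add: "\<And>x y. x \<in> carrier M \<Longrightarrow> y \<in> carrier M \<Longrightarrow> \<pi> (x \<oplus>\<^bsub>M\<^esub> y) = \<pi> x \<oplus>\<^bsub>N\<^esub> \<pi> y"
    and smult: "\<And>r x. r \<in> carrier R \<Longrightarrow> x \<in> carrier M \<Longrightarrow> \<pi> (r \<odot>\<^bsub>M\<^esub> x) = \<theta> r \<odot>\<^bsub>N\<^esub> \<pi> x"
    and \<theta>: "\<And>r. r \<in> carrier R \<Longrightarrow> \<theta> r \<in> carrier S"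
  shows "fg_module S N"
proof -
  interpret N: module S N by (rule N)
  obtain G where G: "finite G" "G \<subseteq> carrier M"
    "\<And>y. y \<in> carrier M \<Longrightarrow> \<exists>c\<in>G \<rightarrow> carrier R. y = (\<Oplus>\<^bsub>M\<^esub>x\<in>G. c x \<odot>\<^bsub>M\<^esub> x)"
    using fg unfolding fg_module_def by blast
  have \<pi>N: "\<pi> x \<in> carrier N" if "x \<in> carrier M" for x using surj that by auto
  have \<pi>0: "\<pi> \<zero>\<^bsub>M\<^esub> = \<zero>\<^bsub>N\<^esub>"
    using add[of "\<zero>\<^bsub>M\<^esub>" "\<zero>\<^bsub>M\<^esub>"] \<pi>N[of "\<zero>\<^bsub>M\<^esub>"] N.M.add.l_cancel_one'[of "\<pi> \<zero>\<^bsub>M\<^esub>" "\<pi> \<zero>\<^bsub>M\<^esub>"] by simp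
  \<comment> \<open>The fibres of \<open>\<pi>\<close> on \<open>G\<close> are merged by adding up the coefficients over them.\<close>
  have "\<exists>c\<in>\<pi> ` G \<rightarrow> carrier S. y = (\<Oplus>\<^bsub>N\<^esub>x\<in>\<pi> ` G. c x \<odot>\<^bsub>N\<^esub> x)" if y: "y \<in> carrier N" for y
  proof -
    obtain y' where y': "y' \<in> carrier M" "y = \<pi> y'" using y surj by auto
    obtain c where c: "c \<in> G \<rightarrow> carrier R" "y' = (\<Oplus>\<^bsub>M\<^esub>x\<in>G. c x \<odot>\<^bsub>M\<^esub> x)" using G(3)[OF y'(1)] by blast
    have cG: "c x \<in> carrier R" "\<theta> (c x) \<in> carrier S" "x \<in> carrier M" "\<pi> x \<in> carrier N" if "x \<in> G" for x
      using that c(1) G(2) \<pi>N \<theta> by auto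
    define e where "e a = (\<Oplus>\<^bsub>S\<^esub>x\<in>{x \<in> G. \<pi> x = a}. \<theta> (c x))" for a
    have e: "e a \<in> carrier S" for a unfolding e_def by (intro N.R.finsum_closed) (auto simp: cG)
    have "\<pi> (\<Oplus>\<^bsub>M\<^esub>x\<in>H. c x \<odot>\<^bsub>M\<^esub> x) = (\<Oplus>\<^bsub>N\<^esub>x\<in>H. \<theta> (c x) \<odot>\<^bsub>N\<^esub> \<pi> x)" if "H \<subseteq> G" for H
      using finite_subset[OF that G(1)] that
    proof (induction H)
      case (insert x H)
      then have "(\<lambda>x. c x \<odot>\<^bsub>M\<^esub> x) \<in> H \<rightarrow> carrier M" "c x \<odot>\<^bsub>M\<^esub> x \<in> carrier M"
        "(\<lambda>x. \<theta> (c x) \<odot>\<^bsub>N\<^esub> \<pi> x) \<in> H \<rightarrow> carrier N" "\<theta> (c x) \<odot>\<^bsub>N\<^esub> \<pi> x \<in> carrier N"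
        by (auto simp: cG subset_iff)
      with insert show ?case by (simp add: add smult cG)
    qed (simp add: \<pi>0)
    then have "y = (\<Oplus>\<^bsub>N\<^esub>x\<in>G. \<theta> (c x) \<odot>\<^bsub>N\<^esub> \<pi> x)" using y'(2) c(2) by simp
    also have "\<dots> = (\<Oplus>\<^bsub>N\<^esub>x\<in>(\<Union>a\<in>\<pi> ` G. {x \<in> G. \<pi> x = a}). \<theta> (c x) \<odot>\<^bsub>N\<^esub> \<pi> x)"
      by (rule N.M.finsum_cong') (auto simp: cG)
    also have "\<dots> = (\<Oplus>\<^bsub>N\<^esub>a\<in>\<pi> ` G. \<Oplus>\<^bsub>N\<^esub>x\<in>{x \<in> G. \<pi> x = a}. \<theta> (c x) \<odot>\<^bsub>N\<^esub> \<pi> x)"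
      by (rule N.M.add.finprod_UN_disjoint) (use G(1) in \<open>auto simp: cG pairwise_def disjnt_def\<close>)
    also have "\<dots> = (\<Oplus>\<^bsub>N\<^esub>a\<in>\<pi> ` G. e a \<odot>\<^bsub>N\<^esub> a)"
    proof (rule N.M.finsum_cong'[OF refl])
      fix a assume a: "a \<in> \<pi> ` G"
      have aN: "a \<in> carrier N" using a cG by auto
      have "(\<Oplus>\<^bsub>S\<^esub>x\<in>H. \<theta> (c x)) \<odot>\<^bsub>N\<^esub> a = (\<Oplus>\<^bsub>N\<^esub>x\<in>H. \<theta> (c x) \<odot>\<^bsub>N\<^esub> \<pi> x)"
        if "finite H" "H \<subseteq> {x \<in> G. \<pi> x = a}" for H
        using that
      proof (induction H)
        case (insert x H)
        then have "(\<lambda>x. \<theta> (c x)) \<in> H \<rightarrow> carrier S" "\<theta> (c x) \<in> carrier S" "\<pi> x = a"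
          "(\<lambda>x. \<theta> (c x) \<odot>\<^bsub>N\<^esub> \<pi> x) \<in> H \<rightarrow> carrier N" by (auto simp: cG)
        with insert show ?case using aN by (simp add: N.smult_l_distr)
      qed (use aN in simp)
      then show "(\<Oplus>\<^bsub>N\<^esub>x\<in>{x \<in> G. \<pi> x = a}. \<theta> (c x) \<odot>\<^bsub>N\<^esub> \<pi> x) = e a \<odot>\<^bsub>N\<^esub> a"
        unfolding e_def using G(1) by simp
    qed (use e cG in auto)
    finally show ?thesis using e by blast
  qed
  moreover have "\<pi> ` G \<subseteq> carrier N" using \<pi>N G(2) by auto
  ultimately show ?thesis
    unfolding fg_module_def using G(1) N by (intro conjI exI[of _ "\<pi> ` G"]) auto
qed

lemma fg_module_summand:
  assumes "fg_module R M" and AB: "complementary R M A B"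
  shows "fg_module R (M\<lparr>carrier := A\<rparr>)"
proof -
  obtain \<pi> where \<pi>: "\<And>x. x \<in> carrier M \<Longrightarrow> \<pi> x \<in> A"
    "\<And>x y. x \<in> carrier M \<Longrightarrow> y \<in> carrier M \<Longrightarrow> \<pi> (x \<oplus>\<^bsub>M\<^esub> y) = \<pi> x \<oplus>\<^bsub>M\<^esub> \<pi> y"
    "\<And>r x. r \<in> carrier R \<Longrightarrow> x \<in> carrier M \<Longrightarrow> \<pi> (r \<odot>\<^bsub>M\<^esub> x) = r \<odot>\<^bsub>M\<^esub> \<pi> x"
    "\<And>x. x \<in> A \<Longrightarrow> \<pi> x = x" "\<And>x. x \<in> B \<Longrightarrow> \<pi> x = \<zero>\<^bsub>M\<^esub>"
    "\<And>x. x \<in> carrier M \<Longrightarrow> \<exists>b\<in>B. x = \<pi> x \<oplus>\<^bsub>M\<^esub> b" by (rule complementary_projection[OF AB]) (rule that)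
  have A: "submodule A R M" using AB by (simp add: complementary_def)
  have "\<pi> ` carrier M = A"
  proof (intro equalityI subsetI)
    fix a assume "a \<in> A"
    then show "a \<in> \<pi> ` carrier M"
      using \<pi>(4)[of a] submodule_mem(1)[OF A] by (metis imageI subsetD)
  qed (use \<pi>(1) in auto)
  then show ?thesis
    using fg_module_image[OF assms(1) module_restrict[OF A], of \<pi> "\<lambda>r. r"] \<pi>(2,3) by simp
qed

text \<open>Keeps every refinement a decomposition of the same module M, so that successive
  splittings can be measured against M.\<close>

lemma complementary_trans:
  assumes AB: "complementary R M A B" and A12: "complementary R (M\<lparr>carrier := A\<rparr>) A1 A2"
  shows "complementary R M A1 (A2 <+>\<^bsub>M\<^esub> B)"
proof -
  have A: "submodule A R M" and B: "submodule B R M" and sum: "A <+>\<^bsub>M\<^esub> B = carrier M" and int: "A \<inter> B = {\<zero>\<^bsub>M\<^esub>}"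
    using AB by (auto simp: complementary_def)
  interpret N: module R "M\<lparr>carrier := A\<rparr>" by (rule module_restrict[OF A])
  have sub: "submodule C R M" if "submodule C R (M\<lparr>carrier := A\<rparr>)" for C
  proof (rule module_incl_imp_submodule)
    show "C \<subseteq> carrier M" using N.submodule_mem(1)[OF that] submodule_mem(1)[OF A] by auto
    show "module R (M\<lparr>carrier := C\<rparr>)" using N.module_restrict[OF that] by simp
  qed
  have A1: "submodule A1 R M" and A2: "submodule A2 R M"
    using A12 unfolding complementary_def by (auto intro!: sub)
  have sum': "A1 <+>\<^bsub>M\<^esub> A2 = A" and int': "A1 \<inter> A2 = {\<zero>\<^bsub>M\<^esub>}" using A12 by (auto simp: complementary_def)
  note S = submodule_mem[OF A] and S1 = submodule_mem[OF A1] and S2 = submodule_mem[OF A2] and SB = submodule_mem[OF B]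
  have sub12: "A1 \<subseteq> A" "A2 \<subseteq> A"
    using A12 N.submodule_mem(1)[of A1] N.submodule_mem(1)[of A2] by (simp_all add: complementary_def)
  have C: "submodule (A2 <+>\<^bsub>M\<^esub> B) R M"
  proof (rule submoduleI)
    show "A2 <+>\<^bsub>M\<^esub> B \<subseteq> carrier M" using S2(1) SB(1) by (auto simp: set_add_def')
    show "\<zero>\<^bsub>M\<^esub> \<in> A2 <+>\<^bsub>M\<^esub> B" using set_add_memI[OF S2(2) SB(2), of M] by simp
  next
    fix a assume "a \<in> A2 <+>\<^bsub>M\<^esub> B"
    then obtain x y where a: "x \<in> A2" "y \<in> B" "a = x \<oplus>\<^bsub>M\<^esub> y" by (rule set_add_memE)
    have xy: "x \<in> carrier M" "y \<in> carrier M" using a S2(1) SB(1) by auto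
    have "\<ominus>\<^bsub>M\<^esub> a = \<ominus>\<^bsub>M\<^esub> x \<oplus>\<^bsub>M\<^esub> \<ominus>\<^bsub>M\<^esub> y" using xy a(3) by (simp add: M.minus_add)
    then show "\<ominus>\<^bsub>M\<^esub> a \<in> A2 <+>\<^bsub>M\<^esub> B" using set_add_memI[OF S2(4)[OF a(1)] SB(4)[OF a(2)], of M] by simp
    { fix r assume r: "r \<in> carrier R"
      have "r \<odot>\<^bsub>M\<^esub> a = r \<odot>\<^bsub>M\<^esub> x \<oplus>\<^bsub>M\<^esub> r \<odot>\<^bsub>M\<^esub> y" using xy r a(3) by (simp add: smult_r_distr)
      then show "r \<odot>\<^bsub>M\<^esub> a \<in> A2 <+>\<^bsub>M\<^esub> B" using set_add_memI[OF S2(5)[OF r a(1)] SB(5)[OF r a(2)], of M] by simp }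
    fix b assume "b \<in> A2 <+>\<^bsub>M\<^esub> B"
    then obtain x' y' where b: "x' \<in> A2" "y' \<in> B" "b = x' \<oplus>\<^bsub>M\<^esub> y'" by (rule set_add_memE)
    have xy': "x' \<in> carrier M" "y' \<in> carrier M" using b S2(1) SB(1) by auto
    have "a \<oplus>\<^bsub>M\<^esub> b = (x \<oplus>\<^bsub>M\<^esub> x') \<oplus>\<^bsub>M\<^esub> (y \<oplus>\<^bsub>M\<^esub> y')" unfolding a b using xy xy' by (simp add: M.a_ac)
    then show "a \<oplus>\<^bsub>M\<^esub> b \<in> A2 <+>\<^bsub>M\<^esub> B"
      using set_add_memI[OF S2(3)[OF a(1) b(1)] SB(3)[OF a(2) b(2)], of M] by simp
  qed
  have "A1 <+>\<^bsub>M\<^esub> (A2 <+>\<^bsub>M\<^esub> B) = (A1 <+>\<^bsub>M\<^esub> A2) <+>\<^bsub>M\<^esub> B"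
    by (rule M.add.set_mult_assoc[symmetric, folded set_add_def]) (use S1(1) S2(1) SB(1) in auto)
  moreover have "A1 \<inter> (A2 <+>\<^bsub>M\<^esub> B) = {\<zero>\<^bsub>M\<^esub>}"
  proof (rule equalityI)
    show "A1 \<inter> (A2 <+>\<^bsub>M\<^esub> B) \<subseteq> {\<zero>\<^bsub>M\<^esub>}"
    proof
      fix x assume "x \<in> A1 \<inter> (A2 <+>\<^bsub>M\<^esub> B)"
      then have x: "x \<in> A1" "x \<in> A2 <+>\<^bsub>M\<^esub> B" by (simp_all only: Int_iff)
      obtain y z where yz: "y \<in> A2" "z \<in> B" "x = y \<oplus>\<^bsub>M\<^esub> z" using x(2) by (rule set_add_memE)
      have c: "y \<in> carrier M" "z \<in> carrier M" using yz S2(1) SB(1) by auto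
      have "z = \<ominus>\<^bsub>M\<^esub> y \<oplus>\<^bsub>M\<^esub> x" unfolding yz(3) using c by (simp add: M.a_assoc[symmetric] M.l_neg)
      moreover have "\<ominus>\<^bsub>M\<^esub> y \<oplus>\<^bsub>M\<^esub> x \<in> A" using yz(1) x(1) sub12 by (intro S(3,4)) auto
      ultimately have "z = \<zero>\<^bsub>M\<^esub>" using int yz(2) by auto
      then have "x \<in> A1 \<inter> A2" using yz(1,3) x(1) c by simp
      then show "x \<in> {\<zero>\<^bsub>M\<^esub>}" using int' by simp
    qed
    show "{\<zero>\<^bsub>M\<^esub>} \<subseteq> A1 \<inter> (A2 <+>\<^bsub>M\<^esub> B)" using S1(2) submodule_mem(2)[OF C] by simp
  qed
  ultimately show ?thesis using A1 C sum sum' by (simp add: complementary_def)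
qed

lemma seq_submodule_linear_image:
  assumes xs: "set xs \<subseteq> carrier R" and \<pi>: "\<And>x. x \<in> carrier M \<Longrightarrow> \<pi> x \<in> carrier N"
    "\<And>x y. x \<in> carrier M \<Longrightarrow> y \<in> carrier M \<Longrightarrow> \<pi> (x \<oplus>\<^bsub>M\<^esub> y) = \<pi> x \<oplus>\<^bsub>N\<^esub> \<pi> y"
    "\<And>r x. r \<in> carrier R \<Longrightarrow> x \<in> carrier M \<Longrightarrow> \<pi> (r \<odot>\<^bsub>M\<^esub> x) = \<theta> r \<odot>\<^bsub>N\<^esub> \<pi> x" "\<pi> \<zero>\<^bsub>M\<^esub> = \<zero>\<^bsub>N\<^esub>"
  shows "\<pi> ` seq_submodule M xs \<subseteq> seq_submodule N (map \<theta> xs)"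
    "\<pi> ` carrier M = carrier N \<Longrightarrow> \<pi> ` seq_submodule M xs = seq_submodule N (map \<theta> xs)"
proof -
  have sub: "seq_submodule M ys \<subseteq> carrier M" if "set ys \<subseteq> carrier R" for ys
    using submodule_mem(1)[OF seq_submodule_submodule[OF that]] .
  show "\<pi> ` seq_submodule M xs \<subseteq> seq_submodule N (map \<theta> xs)"
    using xs
  proof (induction xs)
    case (Cons x xs)
    show ?case
    proof (rule image_subsetI)
      fix w assume "w \<in> seq_submodule M (x # xs)"
      then obtain y z where w: "w = x \<odot>\<^bsub>M\<^esub> y \<oplus>\<^bsub>M\<^esub> z" "y \<in> carrier M" "z \<in> seq_submodule M xs" by auto
      have "\<pi> w = \<theta> x \<odot>\<^bsub>N\<^esub> \<pi> y \<oplus>\<^bsub>N\<^esub> \<pi> z"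
        using w Cons.prems sub[of xs] \<pi>(2)[of "x \<odot>\<^bsub>M\<^esub> y" z] \<pi>(3)[of x y] by auto
      then show "\<pi> w \<in> seq_submodule N (map \<theta> (x # xs))" using Cons w \<pi>(1) by auto
    qed
  qed (simp add: \<pi>(4))
  moreover assume surj: "\<pi> ` carrier M = carrier N"
  have "seq_submodule N (map \<theta> xs) \<subseteq> \<pi> ` seq_submodule M xs"
    using xs
  proof (induction xs)
    case (Cons x xs)
    show ?case
    proof (rule subsetI)
      fix w assume "w \<in> seq_submodule N (map \<theta> (x # xs))"
      then obtain y z where w: "w = \<theta> x \<odot>\<^bsub>N\<^esub> y \<oplus>\<^bsub>N\<^esub> z" "y \<in> carrier N" "z \<in> seq_submodule N (map \<theta> xs)" by auto
      have "y \<in> \<pi> ` carrier M" using w(2) surj by simp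
      moreover have "z \<in> \<pi> ` seq_submodule M xs" using w(3) Cons by auto
      ultimately obtain y' z' where y': "y' \<in> carrier M" "y = \<pi> y'" "z' \<in> seq_submodule M xs" "z = \<pi> z'"
        by blast
      have "w = \<pi> (x \<odot>\<^bsub>M\<^esub> y' \<oplus>\<^bsub>M\<^esub> z')"
        using w y' Cons.prems sub[of xs] \<pi>(2)[of "x \<odot>\<^bsub>M\<^esub> y'" z'] \<pi>(3)[of x y'] by auto
      then show "w \<in> \<pi> ` seq_submodule M (x # xs)" using y' by auto
    qed
  qed (simp add: \<pi>(4))
  ultimately show "\<pi> ` seq_submodule M xs = seq_submodule N (map \<theta> xs)" by blast
qed

end

section \<open>Lifting maps to the residue field along a tangent vector\<close>

text \<open>
  A ring homomorphism \<open>R \<rightarrow> K[t]/(t\<^sup>2)\<close> is written as \<open>\<epsilon> + t \<tau>\<close>. The predicate \<open>lifts\<close> says that every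
  linear map from \<open>M\<close> to \<open>K\<close> lifts to \<open>K[t]/(t\<^sup>2)\<close>; for a minimal presentation of \<open>M\<close> over a local
  ring this means that \<open>\<tau>\<close> vanishes on the entries of the matrix.
\<close>

definition residue_hom ::
    "('k, 'l) ring_scheme \<Rightarrow> ('a, 'm) ring_scheme \<Rightarrow> ('a \<Rightarrow> 'k) \<Rightarrow> ('a, 'b, 'n) module_scheme \<Rightarrow> ('b \<Rightarrow> 'k) \<Rightarrow> bool" where
  "residue_hom K R \<epsilon> M g \<longleftrightarrow> g \<in> carrier M \<rightarrow> carrier K \<and>
     (\<forall>x\<in>carrier M. \<forall>y\<in>carrier M. g (x \<oplus>\<^bsub>M\<^esub> y) = g x \<oplus>\<^bsub>K\<^esub> g y) \<and>
     (\<forall>r\<in>carrier R. \<forall>x\<in>carrier M. g (r \<odot>\<^bsub>M\<^esub> x) = \<epsilon> r \<otimes>\<^bsub>K\<^esub> g x)"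

text \<open>With this twisted Leibniz rule \<open>g + t h\<close> is linear into
  \<open>K[t]/(t\<^sup>2)\<close>, where R acts through
  \<open>\<epsilon> + t \<tau>\<close>.\<close>

definition tangent_part ::
    "('k, 'l) ring_scheme \<Rightarrow> ('a, 'm) ring_scheme \<Rightarrow> ('a \<Rightarrow> 'k) \<Rightarrow> ('a \<Rightarrow> 'k) \<Rightarrow> ('a, 'b, 'n) module_scheme
      \<Rightarrow> ('b \<Rightarrow> 'k) \<Rightarrow> ('b \<Rightarrow> 'k) \<Rightarrow> bool" where
  "tangent_part K R \<epsilon> \<tau> M g h \<longleftrightarrow> h \<in> carrier M \<rightarrow> carrier K \<and>
     (\<forall>x\<in>carrier M. \<forall>y\<in>carrier M. h (x \<oplus>\<^bsub>M\<^esub> y) = h x \<oplus>\<^bsub>K\<^esub> h y) \<and>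
     (\<forall>r\<in>carrier R. \<forall>x\<in>carrier M. h (r \<odot>\<^bsub>M\<^esub> x) = \<epsilon> r \<otimes>\<^bsub>K\<^esub> h x \<oplus>\<^bsub>K\<^esub> \<tau> r \<otimes>\<^bsub>K\<^esub> g x)"

definition lifts ::
    "('k, 'l) ring_scheme \<Rightarrow> ('a, 'm) ring_scheme \<Rightarrow> ('a \<Rightarrow> 'k) \<Rightarrow> ('a \<Rightarrow> 'k) \<Rightarrow> ('a, 'b, 'n) module_scheme \<Rightarrow> bool" where
  "lifts K R \<epsilon> \<tau> M \<longleftrightarrow> (\<forall>g. residue_hom K R \<epsilon> M g \<longrightarrow> (\<exists>h. tangent_part K R \<epsilon> \<tau> M g h))"

lemma residue_homD:
  assumes "residue_hom K R \<epsilon> M g"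
  shows "x \<in> carrier M \<Longrightarrow> g x \<in> carrier K"
    "x \<in> carrier M \<Longrightarrow> y \<in> carrier M \<Longrightarrow> g (x \<oplus>\<^bsub>M\<^esub> y) = g x \<oplus>\<^bsub>K\<^esub> g y"
    "r \<in> carrier R \<Longrightarrow> x \<in> carrier M \<Longrightarrow> g (r \<odot>\<^bsub>M\<^esub> x) = \<epsilon> r \<otimes>\<^bsub>K\<^esub> g x"
  using assms by (auto simp: residue_hom_def)

lemma tangent_partD:
  assumes "tangent_part K R \<epsilon> \<tau> M g h"
  shows "x \<in> carrier M \<Longrightarrow> h x \<in> carrier K"
    "x \<in> carrier M \<Longrightarrow> y \<in> carrier M \<Longrightarrow> h (x \<oplus>\<^bsub>M\<^esub> y) = h x \<oplus>\<^bsub>K\<^esub> h y"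
    "r \<in> carrier R \<Longrightarrow> x \<in> carrier M \<Longrightarrow> h (r \<odot>\<^bsub>M\<^esub> x) = \<epsilon> r \<otimes>\<^bsub>K\<^esub> h x \<oplus>\<^bsub>K\<^esub> \<tau> r \<otimes>\<^bsub>K\<^esub> g x"
  using assms by (auto simp: tangent_part_def)

lemma lifts_iso:
  assumes "module R M" and iso: "module_iso R M N" and "lifts K R \<epsilon> \<tau> M"
  shows "lifts K R \<epsilon> \<tau> N"
  unfolding lifts_def
proof (intro allI impI)
  interpret M: module R M by fact
  obtain \<phi> where \<phi>: "bij_betw \<phi> (carrier M) (carrier N)"
    "\<And>x y. x \<in> carrier M \<Longrightarrow> y \<in> carrier M \<Longrightarrow> \<phi> (x \<oplus>\<^bsub>M\<^esub> y) = \<phi> x \<oplus>\<^bsub>N\<^esub> \<phi> y"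
    "\<And>a x. a \<in> carrier R \<Longrightarrow> x \<in> carrier M \<Longrightarrow> \<phi> (a \<odot>\<^bsub>M\<^esub> x) = a \<odot>\<^bsub>N\<^esub> \<phi> x"
    using iso unfolding module_iso_def by blast
  have \<phi>N: "\<phi> x \<in> carrier N" if "x \<in> carrier M" for x using \<phi>(1) that by (auto simp: bij_betw_def)
  define \<psi> where "\<psi> = inv_into (carrier M) \<phi>"
  have \<psi>: "\<psi> (\<phi> x) = x" if "x \<in> carrier M" for x
    using \<phi>(1) that by (simp add: \<psi>_def bij_betw_def)
  have ex: "\<exists>x\<in>carrier M. y = \<phi> x" if "y \<in> carrier N" for y using \<phi>(1) that by (auto simp: bij_betw_def)
  fix g assume g: "residue_hom K R \<epsilon> N g"
  have "residue_hom K R \<epsilon> M (\<lambda>x. g (\<phi> x))"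
    using residue_homD[OF g] by (auto simp: residue_hom_def \<phi> \<phi>N)
  then obtain h where h: "tangent_part K R \<epsilon> \<tau> M (\<lambda>x. g (\<phi> x)) h" using assms(3) by (auto simp: lifts_def)
  have "tangent_part K R \<epsilon> \<tau> N g (\<lambda>y. h (\<psi> y))"
    unfolding tangent_part_def
  proof (intro conjI ballI funcsetI)
    fix y assume "y \<in> carrier N"
    then obtain x where x: "x \<in> carrier M" "y = \<phi> x" using ex by blast
    then show "h (\<psi> y) \<in> carrier K" using tangent_partD(1)[OF h] by (simp add: \<psi>)
    { fix y' assume "y' \<in> carrier N"
      then obtain x' where x': "x' \<in> carrier M" "y' = \<phi> x'" using ex by blast
      show "h (\<psi> (y \<oplus>\<^bsub>N\<^esub> y')) = h (\<psi> y) \<oplus>\<^bsub>K\<^esub> h (\<psi> y')"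
        using x x' \<phi>(2)[of x x'] tangent_partD(2)[OF h, of x x'] \<psi>[of "x \<oplus>\<^bsub>M\<^esub> x'"] by (simp add: \<psi>) }
    { fix r assume r: "r \<in> carrier R"
      show "h (\<psi> (r \<odot>\<^bsub>N\<^esub> y)) = \<epsilon> r \<otimes>\<^bsub>K\<^esub> h (\<psi> y) \<oplus>\<^bsub>K\<^esub> \<tau> r \<otimes>\<^bsub>K\<^esub> g y"
        using x r \<phi>(3)[of r x] tangent_partD(3)[OF h, of r x] \<psi>[of "r \<odot>\<^bsub>M\<^esub> x"] by (simp add: \<psi>) }
  qed
  then show "\<exists>h. tangent_part K R \<epsilon> \<tau> N g h" by (intro exI[of _ "\<lambda>y. h (\<psi> y)"])
qed

text \<open>The two conditions on \<epsilon> say that R is local and that \<epsilon> is a map to a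
  field whose kernel consists of the nonunits.\<close>

locale residue_module = module R M + K: field K
  for R (structure) and M (structure) and K :: "('k, 'l) ring_scheme" (structure) +
  fixes \<epsilon> :: "'a \<Rightarrow> 'k"
  assumes \<epsilon>_hom: "\<epsilon> \<in> ring_hom R K" and \<epsilon>_unit: "\<And>r. r \<in> carrier R \<Longrightarrow> \<epsilon> r \<noteq> \<zero>\<^bsub>K\<^esub> \<Longrightarrow> r \<in> Units R"
begin

lemma \<epsilon>_simps [simp]:
  "r \<in> carrier R \<Longrightarrow> \<epsilon> r \<in> carrier K"
  "r \<in> carrier R \<Longrightarrow> s \<in> carrier R \<Longrightarrow> \<epsilon> (r \<otimes>\<^bsub>R\<^esub> s) = \<epsilon> r \<otimes>\<^bsub>K\<^esub> \<epsilon> s"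
  "r \<in> carrier R \<Longrightarrow> s \<in> carrier R \<Longrightarrow> \<epsilon> (r \<oplus>\<^bsub>R\<^esub> s) = \<epsilon> r \<oplus>\<^bsub>K\<^esub> \<epsilon> s"
  "\<epsilon> \<one>\<^bsub>R\<^esub> = \<one>\<^bsub>K\<^esub>"
  using \<epsilon>_hom by (auto simp: ring_hom_def)

lemma \<epsilon>_zero [simp]: "\<epsilon> \<zero>\<^bsub>R\<^esub> = \<zero>\<^bsub>K\<^esub>"
  using \<epsilon>_simps(3)[of "\<zero>\<^bsub>R\<^esub>" "\<zero>\<^bsub>R\<^esub>"] K.add.r_cancel_one' by fastforce

lemma residue_module_restrict:
  "submodule A R M \<Longrightarrow> residue_module R (M\<lparr>carrier := A\<rparr>) K \<epsilon>"
  by (intro residue_module.intro module_restrict K.field_axioms residue_module_axioms.intro \<epsilon>_hom \<epsilon>_unit)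

lemma residue_hom_zero: "residue_hom K R \<epsilon> M g \<Longrightarrow> g \<zero>\<^bsub>M\<^esub> = \<zero>\<^bsub>K\<^esub>"
  using residue_homD(2)[of K R \<epsilon> M g "\<zero>\<^bsub>M\<^esub>" "\<zero>\<^bsub>M\<^esub>"] residue_homD(1)[of K R \<epsilon> M g "\<zero>\<^bsub>M\<^esub>"]
    K.add.r_cancel_one' by fastforce

lemma nonzero_residue_hom_exists:
  assumes fg: "fg_module R M" and nz: "carrier M \<noteq> {\<zero>\<^bsub>M\<^esub>}"
  shows "\<exists>g. residue_hom K R \<epsilon> M g \<and> (\<exists>m\<in>carrier M. g m = \<one>\<^bsub>K\<^esub>)"
proof -
  define gens where "gens G \<longleftrightarrow> finite G \<and> G \<subseteq> carrier M \<and>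
      (\<forall>y\<in>carrier M. \<exists>c\<in>G \<rightarrow> carrier R. y = (\<Oplus>\<^bsub>M\<^esub>x\<in>G. c x \<odot>\<^bsub>M\<^esub> x))" for G
  have "\<exists>G. gens G" using fg by (simp add: fg_module_def gens_def)
  define n where "n = (LEAST n. \<exists>G. gens G \<and> card G = n)"
  have "\<exists>G. gens G \<and> card G = n" unfolding n_def
    by (rule LeastI_ex[where P = "\<lambda>n. \<exists>G. gens G \<and> card G = n"]) (use \<open>\<exists>G. gens G\<close> in blast)
  then obtain G where G: "gens G" "card G = n" by blast
  have min: "card G \<le> card H" if "gens H" for H
    unfolding G(2) n_def by (rule Least_le) (use that in blast)
  have fin: "finite G" and GM: "G \<subseteq> carrier M"
    and span: "\<And>y. y \<in> carrier M \<Longrightarrow> \<exists>c\<in>G \<rightarrow> carrier R. y = (\<Oplus>\<^bsub>M\<^esub>x\<in>G. c x \<odot>\<^bsub>M\<^esub> x)"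
    using G(1) by (auto simp: gens_def)
  have "G \<noteq> {}" using span nz M.zero_closed by fastforce
  then obtain y where y: "y \<in> G" by blast
  define S where "S c H = (\<Oplus>\<^bsub>M\<^esub>x\<in>H. c x \<odot>\<^bsub>M\<^esub> x)" for c H
  have Sc: "S c H \<in> carrier M" if "c \<in> H \<rightarrow> carrier R" "H \<subseteq> G" for c H
    unfolding S_def using that GM by (intro M.finsum_closed) auto
  have S_add: "S (\<lambda>x. c x \<oplus>\<^bsub>R\<^esub> e x) H = S c H \<oplus>\<^bsub>M\<^esub> S e H"
    if "c \<in> H \<rightarrow> carrier R" "e \<in> H \<rightarrow> carrier R" "H \<subseteq> G" for c e H
  proof -
    have "S (\<lambda>x. c x \<oplus>\<^bsub>R\<^esub> e x) H = (\<Oplus>\<^bsub>M\<^esub>x\<in>H. c x \<odot>\<^bsub>M\<^esub> x \<oplus>\<^bsub>M\<^esub> e x \<odot>\<^bsub>M\<^esub> x)"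
      unfolding S_def using that GM by (intro M.finsum_cong') (auto simp: smult_l_distr Pi_def subset_iff)
    also have "\<dots> = S c H \<oplus>\<^bsub>M\<^esub> S e H"
      unfolding S_def using that GM by (intro M.finsum_addf) (auto simp: Pi_def subset_iff)
    finally show ?thesis .
  qed
  have S_smult: "S (\<lambda>x. r \<otimes>\<^bsub>R\<^esub> c x) H = r \<odot>\<^bsub>M\<^esub> S c H"
    if "c \<in> H \<rightarrow> carrier R" "r \<in> carrier R" "H \<subseteq> G" for c r H
  proof -
    have "finite H" using that fin finite_subset by blast
    then have "r \<odot>\<^bsub>M\<^esub> S c H = (\<Oplus>\<^bsub>M\<^esub>x\<in>H. r \<odot>\<^bsub>M\<^esub> (c x \<odot>\<^bsub>M\<^esub> x))"
      unfolding S_def using that GM by (intro finsum_smult_ldistr) (auto simp: Pi_def subset_iff)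
    also have "\<dots> = S (\<lambda>x. r \<otimes>\<^bsub>R\<^esub> c x) H"
      unfolding S_def using that GM by (intro M.finsum_cong') (auto simp: smult_assoc1 Pi_def subset_iff)
    finally show ?thesis by simp
  qed
  have S_split: "S c G = c y \<odot>\<^bsub>M\<^esub> y \<oplus>\<^bsub>M\<^esub> S c (G - {y})" if "c \<in> G \<rightarrow> carrier R" for c
  proof -
    have "(\<Oplus>\<^bsub>M\<^esub>x\<in>insert y (G - {y}). c x \<odot>\<^bsub>M\<^esub> x) = c y \<odot>\<^bsub>M\<^esub> y \<oplus>\<^bsub>M\<^esub> (\<Oplus>\<^bsub>M\<^esub>x\<in>G - {y}. c x \<odot>\<^bsub>M\<^esub> x)"
      using that GM fin y by (intro M.finsum_insert) (auto simp: Pi_def subset_iff)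
    then show ?thesis using y by (simp add: S_def insert_absorb)
  qed
  have key0: "\<epsilon> (d y) = \<zero>\<^bsub>K\<^esub>" if d: "d \<in> G \<rightarrow> carrier R" "S d G = \<zero>\<^bsub>M\<^esub>" for d
  proof (rule ccontr)
    assume "\<epsilon> (d y) \<noteq> \<zero>\<^bsub>K\<^esub>"
    then have u: "d y \<in> Units R" using d(1) y by (intro \<epsilon>_unit) auto
    define i where "i = inv\<^bsub>R\<^esub> (d y)"
    have i: "i \<in> carrier R" "i \<otimes>\<^bsub>R\<^esub> d y = \<one>\<^bsub>R\<^esub>" using u by (auto simp: i_def)
    have yM: "y \<in> carrier M" using y GM by auto
    have dr: "d \<in> G - {y} \<rightarrow> carrier R" using d(1) by auto
    define e where "e x = \<ominus>\<^bsub>R\<^esub> i \<otimes>\<^bsub>R\<^esub> d x" for x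
    have e: "e \<in> G - {y} \<rightarrow> carrier R" using d(1) i(1) by (auto simp: e_def Pi_iff)
    have "y = S e (G - {y})"
    proof -
      have z: "i \<odot>\<^bsub>M\<^esub> (d y \<odot>\<^bsub>M\<^esub> y \<oplus>\<^bsub>M\<^esub> S d (G - {y})) = \<zero>\<^bsub>M\<^esub>"
        using d(2) S_split[OF d(1)] i by simp
      have c: "S d (G - {y}) \<in> carrier M" "d y \<in> carrier R" using Sc[OF dr] d(1) y by auto
      have "i \<odot>\<^bsub>M\<^esub> (d y \<odot>\<^bsub>M\<^esub> y \<oplus>\<^bsub>M\<^esub> S d (G - {y})) = y \<oplus>\<^bsub>M\<^esub> i \<odot>\<^bsub>M\<^esub> S d (G - {y})"
        using c i yM by (simp add: smult_r_distr smult_assoc1[symmetric])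
      with z have "y \<oplus>\<^bsub>M\<^esub> i \<odot>\<^bsub>M\<^esub> S d (G - {y}) = \<zero>\<^bsub>M\<^esub>" by simp
      then have "y = \<ominus>\<^bsub>M\<^esub> (i \<odot>\<^bsub>M\<^esub> S d (G - {y}))" using c i yM by (simp add: M.add.inv_solve_right M.minus_equality)
      also have "\<dots> = (\<ominus>\<^bsub>R\<^esub> i) \<odot>\<^bsub>M\<^esub> S d (G - {y})" using c i by (simp add: smult_l_minus)
      also have "\<dots> = S e (G - {y})" unfolding e_def using S_smult[OF dr, of "\<ominus>\<^bsub>R\<^esub> i"] i by simp
      finally show ?thesis .
    qed
    have "gens (G - {y})"
      unfolding gens_def
    proof (intro conjI ballI)
      fix m assume "m \<in> carrier M"
      then obtain b where b: "b \<in> G \<rightarrow> carrier R" "m = S b G" using span unfolding S_def by blast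
      have br: "b \<in> G - {y} \<rightarrow> carrier R" "b y \<in> carrier R" using b y by auto
      have ber: "(\<lambda>x. b y \<otimes>\<^bsub>R\<^esub> e x) \<in> G - {y} \<rightarrow> carrier R" using br e by auto
      have "m = b y \<odot>\<^bsub>M\<^esub> S e (G - {y}) \<oplus>\<^bsub>M\<^esub> S b (G - {y})"
        using b(2) S_split[OF b(1)] \<open>y = S e (G - {y})\<close> by simp
      also have "\<dots> = S (\<lambda>x. b y \<otimes>\<^bsub>R\<^esub> e x \<oplus>\<^bsub>R\<^esub> b x) (G - {y})"
        using S_smult[OF e br(2)] S_add[OF ber br(1)] by auto
      finally show "\<exists>c\<in>G - {y} \<rightarrow> carrier R. m = (\<Oplus>\<^bsub>M\<^esub>x\<in>G - {y}. c x \<odot>\<^bsub>M\<^esub> x)"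

        unfolding S_def using br ber by (intro bexI[of _ "\<lambda>x. b y \<otimes>\<^bsub>R\<^esub> e x \<oplus>\<^bsub>R\<^esub> b x"]) auto
    qed (use fin GM in auto)
    from min[OF this] show False using card_Diff1_less[OF fin y] by linarith
  qed
  have key: "\<epsilon> (c y) = \<epsilon> (e y)" if "c \<in> G \<rightarrow> carrier R" "e \<in> G \<rightarrow> carrier R" "S c G = S e G" for c e
  proof -
    define d where "d x = c x \<oplus>\<^bsub>R\<^esub> \<ominus>\<^bsub>R\<^esub> \<one>\<^bsub>R\<^esub> \<otimes>\<^bsub>R\<^esub> e x" for x
    have e': "(\<lambda>x. \<ominus>\<^bsub>R\<^esub> \<one>\<^bsub>R\<^esub> \<otimes>\<^bsub>R\<^esub> e x) \<in> G \<rightarrow> carrier R" using that(2) by auto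
    have "S d G = S c G \<oplus>\<^bsub>M\<^esub> (\<ominus>\<^bsub>R\<^esub> \<one>\<^bsub>R\<^esub>) \<odot>\<^bsub>M\<^esub> S e G"
      unfolding d_def using S_add[OF that(1) e'] S_smult[OF that(2), of "\<ominus>\<^bsub>R\<^esub> \<one>\<^bsub>R\<^esub>"] by simp
    also have "\<dots> = \<zero>\<^bsub>M\<^esub>" using that(3) Sc[OF that(2)] by (simp add: smult_l_minus M.r_neg)
    finally have "S d G = \<zero>\<^bsub>M\<^esub>" .
    moreover have "d \<in> G \<rightarrow> carrier R" using that(1,2) by (auto simp: d_def Pi_iff)
    ultimately have "\<epsilon> (d y) = \<zero>\<^bsub>K\<^esub>" by (intro key0)
    moreover have cy: "c y \<in> carrier R" "e y \<in> carrier R" using that y by auto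
    moreover have dy: "d y \<in> carrier R" unfolding d_def using cy by simp
    moreover have "c y = d y \<oplus>\<^bsub>R\<^esub> e y" unfolding d_def using cy by algebra
    ultimately have "\<epsilon> (c y) = \<zero>\<^bsub>K\<^esub> \<oplus>\<^bsub>K\<^esub> \<epsilon> (e y)" using \<epsilon>_simps(3)[OF dy cy(2)] by (simp only:)
    then show ?thesis using cy by simp
  qed
  define C where "C m = (SOME c. c \<in> G \<rightarrow> carrier R \<and> m = S c G)" for m
  have C: "C m \<in> G \<rightarrow> carrier R \<and> m = S (C m) G" if "m \<in> carrier M" for m
  proof -
    have "\<exists>c. c \<in> G \<rightarrow> carrier R \<and> m = S c G" using span[OF that] unfolding S_def by blast
    then show ?thesis unfolding C_def by (rule someI_ex)
  qed
  define g where "g m = \<epsilon> (C m y)" for m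
  have g: "g m = \<epsilon> (c y)" if "c \<in> G \<rightarrow> carrier R" "m = S c G" for m c
  proof -
    have "m \<in> carrier M" using that Sc[of c G] by simp
    then have "C m \<in> G \<rightarrow> carrier R" "S (C m) G = S c G" using C that(2) by auto
    then show ?thesis unfolding g_def by (intro key that(1))
  qed
  have "residue_hom K R \<epsilon> M g"
    unfolding residue_hom_def
  proof (intro conjI ballI funcsetI)
    fix m assume m: "m \<in> carrier M"
    have Cm: "C m \<in> G \<rightarrow> carrier R" "C m y \<in> carrier R" "S (C m) G = m" using C[OF m] y by auto
    show "g m \<in> carrier K" using Cm by (simp add: g_def)
    { fix m' assume m': "m' \<in> carrier M"
      have Cm': "C m' \<in> G \<rightarrow> carrier R" "C m' y \<in> carrier R" "S (C m') G = m'" using C[OF m'] y by auto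
      have "m \<oplus>\<^bsub>M\<^esub> m' = S (\<lambda>x. C m x \<oplus>\<^bsub>R\<^esub> C m' x) G" using S_add[OF Cm(1) Cm'(1)] Cm Cm' by simp
      then have "g (m \<oplus>\<^bsub>M\<^esub> m') = \<epsilon> (C m y \<oplus>\<^bsub>R\<^esub> C m' y)" using Cm(1) Cm'(1) by (intro g) auto
      then show "g (m \<oplus>\<^bsub>M\<^esub> m') = g m \<oplus>\<^bsub>K\<^esub> g m'" using Cm Cm' by (simp add: g_def) }
    { fix r assume r: "r \<in> carrier R"
      have "r \<odot>\<^bsub>M\<^esub> m = S (\<lambda>x. r \<otimes>\<^bsub>R\<^esub> C m x) G" using S_smult[OF Cm(1) r] Cm by simp
      then have "g (r \<odot>\<^bsub>M\<^esub> m) = \<epsilon> (r \<otimes>\<^bsub>R\<^esub> C m y)" using Cm(1) r by (intro g) auto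
      then show "g (r \<odot>\<^bsub>M\<^esub> m) = \<epsilon> r \<otimes>\<^bsub>K\<^esub> g m" using Cm r by (simp add: g_def) }
  qed
  moreover have "g y = \<one>\<^bsub>K\<^esub>"
  proof -
    let ?c = "\<lambda>x. if x = y then \<one>\<^bsub>R\<^esub> else \<zero>\<^bsub>R\<^esub>"
    have "S ?c G = ?c y \<odot>\<^bsub>M\<^esub> y" unfolding S_def
      using y GM fin by (intro M.finsum_single) auto
    then have "g y = \<epsilon> (?c y)" using y GM by (intro g) auto
    then show ?thesis by simp
  qed
  ultimately show ?thesis using y GM by blast
qed

end

context residue_module
begin

text \<open>The lift of a fixed functional depends linearly on the tangent vector, so the tangent
  vectors along which M lifts form a subspace.\<close>

lemma lifts_lincomb:
  assumes "lifts K R \<epsilon> \<tau> M" "lifts K R \<epsilon> \<tau>' M"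
    and \<tau>: "\<And>r. r \<in> carrier R \<Longrightarrow> \<tau> r \<in> carrier K" "\<And>r. r \<in> carrier R \<Longrightarrow> \<tau>' r \<in> carrier K"
    and ab: "a \<in> carrier K" "b \<in> carrier K"
    and \<tau>'': "\<And>r. r \<in> carrier R \<Longrightarrow> \<tau>'' r = a \<otimes>\<^bsub>K\<^esub> \<tau> r \<oplus>\<^bsub>K\<^esub> b \<otimes>\<^bsub>K\<^esub> \<tau>' r"
  shows "lifts K R \<epsilon> \<tau>'' M"
  unfolding lifts_def
proof (intro allI impI)
  fix g assume g: "residue_hom K R \<epsilon> M g"
  obtain h where h: "tangent_part K R \<epsilon> \<tau> M g h" using assms(1) g unfolding lifts_def by blast
  obtain h' where h': "tangent_part K R \<epsilon> \<tau>' M g h'" using assms(2) g unfolding lifts_def by blast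
  let ?h = "\<lambda>x. a \<otimes>\<^bsub>K\<^esub> h x \<oplus>\<^bsub>K\<^esub> b \<otimes>\<^bsub>K\<^esub> h' x"
  have "tangent_part K R \<epsilon> \<tau>'' M g ?h"
    unfolding tangent_part_def
  proof (intro conjI ballI funcsetI)
    fix x assume x: "x \<in> carrier M"
    have c: "h x \<in> carrier K" "h' x \<in> carrier K" "g x \<in> carrier K"
      using x tangent_partD(1)[OF h] tangent_partD(1)[OF h'] residue_homD(1)[OF g] by auto
    show "?h x \<in> carrier K" using c ab by simp
    { fix y assume y: "y \<in> carrier M"
      have c': "h y \<in> carrier K" "h' y \<in> carrier K"
        using y tangent_partD(1)[OF h] tangent_partD(1)[OF h'] by auto
      show "?h (x \<oplus>\<^bsub>M\<^esub> y) = ?h x \<oplus>\<^bsub>K\<^esub> ?h y"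
        unfolding tangent_partD(2)[OF h x y] tangent_partD(2)[OF h' x y] using c c' ab by algebra }
    { fix r assume r: "r \<in> carrier R"
      show "?h (r \<odot>\<^bsub>M\<^esub> x) = \<epsilon> r \<otimes>\<^bsub>K\<^esub> ?h x \<oplus>\<^bsub>K\<^esub> \<tau>'' r \<otimes>\<^bsub>K\<^esub> g x"
        unfolding tangent_partD(3)[OF h r x] tangent_partD(3)[OF h' r x] \<tau>''[OF r]
        using c ab \<tau>[OF r] \<epsilon>_simps(1)[OF r] by algebra }
  qed
  then show "\<exists>h. tangent_part K R \<epsilon> \<tau>'' M g h" by (intro exI[of _ ?h])
qed

text \<open>A functional on the summand extends to M along the projection, and a lift of the
  extension restricts to a lift of the functional.\<close>

lemma lifts_summand:
  assumes AB: "complementary R M A B" and "lifts K R \<epsilon> \<tau> M"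
  shows "lifts K R \<epsilon> \<tau> (M\<lparr>carrier := A\<rparr>)"
  unfolding lifts_def
proof (intro allI impI)
  have A: "submodule A R M" using AB by (simp add: complementary_def)
  note S = submodule_mem[OF A]
  obtain \<pi> where \<pi>: "\<And>x. x \<in> carrier M \<Longrightarrow> \<pi> x \<in> A"
    "\<And>x y. x \<in> carrier M \<Longrightarrow> y \<in> carrier M \<Longrightarrow> \<pi> (x \<oplus>\<^bsub>M\<^esub> y) = \<pi> x \<oplus>\<^bsub>M\<^esub> \<pi> y"
    "\<And>r x. r \<in> carrier R \<Longrightarrow> x \<in> carrier M \<Longrightarrow> \<pi> (r \<odot>\<^bsub>M\<^esub> x) = r \<odot>\<^bsub>M\<^esub> \<pi> x"
    "\<And>x. x \<in> A \<Longrightarrow> \<pi> x = x" "\<And>x. x \<in> B \<Longrightarrow> \<pi> x = \<zero>\<^bsub>M\<^esub>"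
    "\<And>x. x \<in> carrier M \<Longrightarrow> \<exists>b\<in>B. x = \<pi> x \<oplus>\<^bsub>M\<^esub> b" by (rule complementary_projection[OF AB]) (rule that)
  fix g assume g: "residue_hom K R \<epsilon> (M\<lparr>carrier := A\<rparr>) g"
  have "residue_hom K R \<epsilon> M (\<lambda>x. g (\<pi> x))"
    using residue_homD[OF g] \<pi>(1-3) by (simp add: residue_hom_def)
  then obtain h where h: "tangent_part K R \<epsilon> \<tau> M (\<lambda>x. g (\<pi> x)) h" using assms(2) unfolding lifts_def by blast
  have "tangent_part K R \<epsilon> \<tau> (M\<lparr>carrier := A\<rparr>) g h"
    using tangent_partD[OF h] S(1) \<pi>(4) by (auto simp: tangent_part_def subset_iff)
  then show "\<exists>h. tangent_part K R \<epsilon> \<tau> (M\<lparr>carrier := A\<rparr>) g h" by (intro exI[of _ h])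
qed

text \<open>Lifts on the two parts are added after projecting. Read backwards: if M does not lift,
  neither do all its summands, and this lets a failure be followed into ever smaller
  summands.\<close>

lemma lifts_sum:
  assumes AB: "complementary R M A B"
    and lA: "lifts K R \<epsilon> \<tau> (M\<lparr>carrier := A\<rparr>)" and lB: "lifts K R \<epsilon> \<tau> (M\<lparr>carrier := B\<rparr>)"
    and \<tau>: "\<And>r. r \<in> carrier R \<Longrightarrow> \<tau> r \<in> carrier K"
  shows "lifts K R \<epsilon> \<tau> M"
  unfolding lifts_def
proof (intro allI impI)
  have A: "submodule A R M" "submodule B R M" and int: "A \<inter> B = {\<zero>\<^bsub>M\<^esub>}" using AB by (simp_all add: complementary_def)
  note S = submodule_mem[OF A(1)] and SB = submodule_mem[OF A(2)]
  obtain \<pi> where \<pi>: "\<And>x. x \<in> carrier M \<Longrightarrow> \<pi> x \<in> A"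
    "\<And>x y. x \<in> carrier M \<Longrightarrow> y \<in> carrier M \<Longrightarrow> \<pi> (x \<oplus>\<^bsub>M\<^esub> y) = \<pi> x \<oplus>\<^bsub>M\<^esub> \<pi> y"
    "\<And>r x. r \<in> carrier R \<Longrightarrow> x \<in> carrier M \<Longrightarrow> \<pi> (r \<odot>\<^bsub>M\<^esub> x) = r \<odot>\<^bsub>M\<^esub> \<pi> x"
    "\<And>x. x \<in> A \<Longrightarrow> \<pi> x = x" "\<And>x. x \<in> B \<Longrightarrow> \<pi> x = \<zero>\<^bsub>M\<^esub>"
    "\<And>x. x \<in> carrier M \<Longrightarrow> \<exists>b\<in>B. x = \<pi> x \<oplus>\<^bsub>M\<^esub> b" by (rule complementary_projection[OF AB]) (rule that)
  obtain \<rho> where \<rho>: "\<And>x. x \<in> carrier M \<Longrightarrow> \<rho> x \<in> B"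
    "\<And>x y. x \<in> carrier M \<Longrightarrow> y \<in> carrier M \<Longrightarrow> \<rho> (x \<oplus>\<^bsub>M\<^esub> y) = \<rho> x \<oplus>\<^bsub>M\<^esub> \<rho> y"
    "\<And>r x. r \<in> carrier R \<Longrightarrow> x \<in> carrier M \<Longrightarrow> \<rho> (r \<odot>\<^bsub>M\<^esub> x) = r \<odot>\<^bsub>M\<^esub> \<rho> x"
    "\<And>x. x \<in> B \<Longrightarrow> \<rho> x = x" "\<And>x. x \<in> A \<Longrightarrow> \<rho> x = \<zero>\<^bsub>M\<^esub>"
    "\<And>x. x \<in> carrier M \<Longrightarrow> \<exists>b\<in>A. x = \<rho> x \<oplus>\<^bsub>M\<^esub> b"
    by (rule complementary_projection[OF AB[unfolded complementary_commute[of A B]]]) (rule that)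
  have dec: "x = \<pi> x \<oplus>\<^bsub>M\<^esub> \<rho> x" if x: "x \<in> carrier M" for x
  proof -
    obtain b where b: "b \<in> B" "x = \<pi> x \<oplus>\<^bsub>M\<^esub> b" using \<pi>(6)[OF x] by blast
    have c: "\<pi> x \<in> carrier M" "b \<in> carrier M" using \<pi>(1)[OF x] b S(1) SB(1) by auto
    have "\<rho> x = \<rho> (\<pi> x) \<oplus>\<^bsub>M\<^esub> \<rho> b" using \<rho>(2)[OF c] b(2) by simp
    then have "\<rho> x = b" using \<rho>(5)[OF \<pi>(1)[OF x]] \<rho>(4)[OF b(1)] c by simp
    with b show ?thesis by simp
  qed
  fix g assume g: "residue_hom K R \<epsilon> M g"
  have gA: "residue_hom K R \<epsilon> (M\<lparr>carrier := A\<rparr>) g" "residue_hom K R \<epsilon> (M\<lparr>carrier := B\<rparr>) g"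
    using residue_homD[OF g] S(1) SB(1) by (auto simp: residue_hom_def subset_iff)
  obtain h where h: "tangent_part K R \<epsilon> \<tau> (M\<lparr>carrier := A\<rparr>) g h" using lA gA(1) unfolding lifts_def by blast
  obtain h' where h': "tangent_part K R \<epsilon> \<tau> (M\<lparr>carrier := B\<rparr>) g h'" using lB gA(2) unfolding lifts_def by blast
  let ?h = "\<lambda>x. h (\<pi> x) \<oplus>\<^bsub>K\<^esub> h' (\<rho> x)"
  have "tangent_part K R \<epsilon> \<tau> M g ?h"
    unfolding tangent_part_def
  proof (intro conjI ballI funcsetI)
    fix x assume x: "x \<in> carrier M"
    have m: "\<pi> x \<in> carrier M" "\<rho> x \<in> carrier M" using \<pi>(1)[OF x] \<rho>(1)[OF x] S(1) SB(1) by auto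
    have c: "h (\<pi> x) \<in> carrier K" "h' (\<rho> x) \<in> carrier K" "g (\<pi> x) \<in> carrier K" "g (\<rho> x) \<in> carrier K"
      using x m \<pi>(1) \<rho>(1) tangent_partD(1)[OF h] tangent_partD(1)[OF h'] residue_homD(1)[OF g] by auto
    show "?h x \<in> carrier K" using c by simp
    { fix y assume y: "y \<in> carrier M"
      have c': "h (\<pi> y) \<in> carrier K" "h' (\<rho> y) \<in> carrier K"
        using y \<pi>(1) \<rho>(1) tangent_partD(1)[OF h] tangent_partD(1)[OF h'] by auto
      have e: "h (\<pi> x \<oplus>\<^bsub>M\<^esub> \<pi> y) = h (\<pi> x) \<oplus>\<^bsub>K\<^esub> h (\<pi> y)" "h' (\<rho> x \<oplus>\<^bsub>M\<^esub> \<rho> y) = h' (\<rho> x) \<oplus>\<^bsub>K\<^esub> h' (\<rho> y)"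
        using x y \<pi>(1) \<rho>(1) tangent_partD(2)[OF h] tangent_partD(2)[OF h'] by auto
      show "?h (x \<oplus>\<^bsub>M\<^esub> y) = ?h x \<oplus>\<^bsub>K\<^esub> ?h y"
        unfolding \<pi>(2)[OF x y] \<rho>(2)[OF x y] e using c c' by algebra }
    { fix r assume r: "r \<in> carrier R"
      have e: "h (r \<odot>\<^bsub>M\<^esub> \<pi> x) = \<epsilon> r \<otimes>\<^bsub>K\<^esub> h (\<pi> x) \<oplus>\<^bsub>K\<^esub> \<tau> r \<otimes>\<^bsub>K\<^esub> g (\<pi> x)"
        "h' (r \<odot>\<^bsub>M\<^esub> \<rho> x) = \<epsilon> r \<otimes>\<^bsub>K\<^esub> h' (\<rho> x) \<oplus>\<^bsub>K\<^esub> \<tau> r \<otimes>\<^bsub>K\<^esub> g (\<rho> x)"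
        using x r \<pi>(1) \<rho>(1) tangent_partD(3)[OF h] tangent_partD(3)[OF h'] by auto
      have gx: "g x = g (\<pi> x) \<oplus>\<^bsub>K\<^esub> g (\<rho> x)" using dec[OF x] residue_homD(2)[OF g m] by simp
      show "?h (r \<odot>\<^bsub>M\<^esub> x) = \<epsilon> r \<otimes>\<^bsub>K\<^esub> ?h x \<oplus>\<^bsub>K\<^esub> \<tau> r \<otimes>\<^bsub>K\<^esub> g x"
        unfolding \<pi>(3)[OF r x] \<rho>(3)[OF r x] e gx using c \<tau>[OF r] \<epsilon>_simps(1)[OF r] by algebra }
  qed
  then show "\<exists>h. tangent_part K R \<epsilon> \<tau> M g h" by (intro exI[of _ ?h])
qed

lemma lifts_zero_module:
  assumes "carrier M = {\<zero>\<^bsub>M\<^esub>}" and \<tau>: "\<And>r. r \<in> carrier R \<Longrightarrow> \<tau> r \<in> carrier K"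
  shows "lifts K R \<epsilon> \<tau> M"
  unfolding lifts_def
proof (intro allI impI)
  fix g assume g: "residue_hom K R \<epsilon> M g"
  have "tangent_part K R \<epsilon> \<tau> M g (\<lambda>_. \<zero>\<^bsub>K\<^esub>)"
    using residue_hom_zero[OF g] \<tau> assms(1) by (auto simp: tangent_part_def)
  then show "\<exists>h. tangent_part K R \<epsilon> \<tau> M g h" by (intro exI[of _ "\<lambda>_. \<zero>\<^bsub>K\<^esub>"])
qed

section \<open>Indecomposable summands on which lifting fails\<close>

text \<open>A measure of what has been split off from M: n residue functionals that kill the part A
  still under study, with dual vectors in the complement B. It replaces the dimension of the residue
  space of B.\<close>

definition dual_system :: "'c set \<Rightarrow> 'c set \<Rightarrow> nat \<Rightarrow> (nat \<Rightarrow> 'c \<Rightarrow> 'k) \<Rightarrow> (nat \<Rightarrow> 'c) \<Rightarrow> bool" where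
  "dual_system A B n b m \<longleftrightarrow> (\<forall>i<n. residue_hom K R \<epsilon> M (b i) \<and> (\<forall>a\<in>A. b i a = \<zero>\<^bsub>K\<^esub>) \<and> m i \<in> B \<and>
     (\<forall>j<n. b i (m j) = (if i = j then \<one>\<^bsub>K\<^esub> else \<zero>\<^bsub>K\<^esub>)))"

text \<open>With more functionals than generators, a nontrivial combination of them would vanish on
  all generators and therefore on M. Its value at \<open>m j\<close> is its j-th coefficient, a
  contradiction.\<close>

lemma dual_system_bound:
  assumes G: "finite G" "G \<subseteq> carrier M"
      "\<And>y. y \<in> carrier M \<Longrightarrow> \<exists>c\<in>G \<rightarrow> carrier R. y = (\<Oplus>\<^bsub>M\<^esub>x\<in>G. c x \<odot>\<^bsub>M\<^esub> x)"
    and D: "dual_system A B n b m" and B: "B \<subseteq> carrier M"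
  shows "n \<le> card G"
proof (rule ccontr)
  assume n: "\<not> n \<le> card G"
  have b: "residue_hom K R \<epsilon> M (b i)" "m i \<in> carrier M" "j < n \<Longrightarrow> b i (m j) = (if i = j then \<one>\<^bsub>K\<^esub> else \<zero>\<^bsub>K\<^esub>)"
    if "i < n" for i j using D that B by (auto simp: dual_system_def)
  have bc: "b i x \<in> carrier K" if "i < n" "x \<in> carrier M" for i x
    using residue_homD(1)[OF b(1)[OF that(1)] that(2)] .
  define \<beta> where "\<beta> x z = (\<Oplus>\<^bsub>K\<^esub>i\<in>{..<n}. x i \<otimes>\<^bsub>K\<^esub> b i z)" for x z
  have "lin_form K n (\<lambda>x. \<beta> x z)" if z: "z \<in> G" for z
    unfolding lin_form_def
  proof (intro ballI conjI)
    have zM: "z \<in> carrier M" using z G by auto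
    fix x assume x: "x \<in> vecs K n"
    have xc: "x i \<in> carrier K" for i using x by (simp add: supp_funs_def)
    show "\<beta> x z \<in> carrier K" unfolding \<beta>_def using xc bc[OF _ zM] by (intro K.finsum_closed) auto
    fix c y assume c: "c \<in> carrier K" and y: "y \<in> vecs K n"
    have yc: "y i \<in> carrier K" for i using y by (simp add: supp_funs_def)
    have "\<beta> (\<lambda>i. x i \<oplus>\<^bsub>K\<^esub> c \<otimes>\<^bsub>K\<^esub> y i) z = (\<Oplus>\<^bsub>K\<^esub>i\<in>{..<n}. x i \<otimes>\<^bsub>K\<^esub> b i z \<oplus>\<^bsub>K\<^esub> c \<otimes>\<^bsub>K\<^esub> (y i \<otimes>\<^bsub>K\<^esub> b i z))"
      unfolding \<beta>_def using xc yc c bc[OF _ zM]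
      by (intro K.finsum_cong') (auto simp: K.l_distr K.m_assoc)
    also have "\<dots> = \<beta> x z \<oplus>\<^bsub>K\<^esub> (\<Oplus>\<^bsub>K\<^esub>i\<in>{..<n}. c \<otimes>\<^bsub>K\<^esub> (y i \<otimes>\<^bsub>K\<^esub> b i z))"
      unfolding \<beta>_def using xc yc c bc[OF _ zM] by (intro K.finsum_addf) auto
    also have "(\<Oplus>\<^bsub>K\<^esub>i\<in>{..<n}. c \<otimes>\<^bsub>K\<^esub> (y i \<otimes>\<^bsub>K\<^esub> b i z)) = c \<otimes>\<^bsub>K\<^esub> \<beta> y z"
      unfolding \<beta>_def using yc c bc[OF _ zM] by (intro K.finsum_rdistr[symmetric]) auto
    finally show "\<beta> (\<lambda>i. x i \<oplus>\<^bsub>K\<^esub> c \<otimes>\<^bsub>K\<^esub> y i) z = \<beta> x z \<oplus>\<^bsub>K\<^esub> c \<otimes>\<^bsub>K\<^esub> \<beta> y z" .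
  qed
  then obtain x where x: "x \<in> vecs K n" "x \<noteq> (\<lambda>_. \<zero>\<^bsub>K\<^esub>)" "\<And>z. z \<in> G \<Longrightarrow> \<beta> x z = \<zero>\<^bsub>K\<^esub>"
    using K.common_zero_of_lin_forms[of G n "\<lambda>z x. \<beta> x z"] G(1) n by (auto simp: not_le)
  have xc: "x i \<in> carrier K" for i using x(1) by (simp add: supp_funs_def)
  have \<beta>c: "\<beta> x z \<in> carrier K" if "z \<in> carrier M" for z
    unfolding \<beta>_def using xc bc that by (intro K.finsum_closed) auto
  have \<beta>_add: "\<beta> x (y \<oplus>\<^bsub>M\<^esub> z) = \<beta> x y \<oplus>\<^bsub>K\<^esub> \<beta> x z" if "y \<in> carrier M" "z \<in> carrier M" for y z
  proof -
    have "\<beta> x (y \<oplus>\<^bsub>M\<^esub> z) = (\<Oplus>\<^bsub>K\<^esub>i\<in>{..<n}. x i \<otimes>\<^bsub>K\<^esub> b i y \<oplus>\<^bsub>K\<^esub> x i \<otimes>\<^bsub>K\<^esub> b i z)"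
      unfolding \<beta>_def using xc bc that residue_homD(2)[OF b(1) that]
      by (intro K.finsum_cong') (auto simp: K.r_distr)
    also have "\<dots> = \<beta> x y \<oplus>\<^bsub>K\<^esub> \<beta> x z" unfolding \<beta>_def using xc bc that by (intro K.finsum_addf) auto
    finally show ?thesis .
  qed
  have \<beta>_smult: "\<beta> x (r \<odot>\<^bsub>M\<^esub> z) = \<epsilon> r \<otimes>\<^bsub>K\<^esub> \<beta> x z" if "r \<in> carrier R" "z \<in> carrier M" for r z
  proof -
    have "\<beta> x (r \<odot>\<^bsub>M\<^esub> z) = (\<Oplus>\<^bsub>K\<^esub>i\<in>{..<n}. \<epsilon> r \<otimes>\<^bsub>K\<^esub> (x i \<otimes>\<^bsub>K\<^esub> b i z))"
      unfolding \<beta>_def using xc bc that residue_homD(3)[OF b(1) that]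
      by (intro K.finsum_cong') (auto simp: K.m_lcomm)
    also have "\<dots> = \<epsilon> r \<otimes>\<^bsub>K\<^esub> \<beta> x z" unfolding \<beta>_def using xc bc that by (intro K.finsum_rdistr[symmetric]) auto
    finally show ?thesis .
  qed
  have vanish: "\<beta> x z = \<zero>\<^bsub>K\<^esub>" if z: "z \<in> carrier M" for z
  proof -
    obtain c where c: "c \<in> G \<rightarrow> carrier R" "z = (\<Oplus>\<^bsub>M\<^esub>x\<in>G. c x \<odot>\<^bsub>M\<^esub> x)" using G(3)[OF z] by blast
    have "\<beta> x (\<Oplus>\<^bsub>M\<^esub>x\<in>H. c x \<odot>\<^bsub>M\<^esub> x) = \<zero>\<^bsub>K\<^esub>" if "H \<subseteq> G" for H
      using finite_subset[OF that G(1)] that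
    proof (induction H)
      case empty
      have "\<beta> x (\<zero>\<^bsub>R\<^esub> \<odot>\<^bsub>M\<^esub> \<zero>\<^bsub>M\<^esub>) = \<zero>\<^bsub>K\<^esub>" using \<beta>_smult[of "\<zero>\<^bsub>R\<^esub>" "\<zero>\<^bsub>M\<^esub>"] \<beta>c by simp
      then show ?case by simp
    next
      case (insert h H)
      have h: "h \<in> carrier M" "c h \<in> carrier R" "(\<lambda>x. c x \<odot>\<^bsub>M\<^esub> x) \<in> H \<rightarrow> carrier M"
        using insert.prems c(1) G(2) by (auto simp: Pi_iff subset_iff)
      have "\<beta> x (\<Oplus>\<^bsub>M\<^esub>x\<in>insert h H. c x \<odot>\<^bsub>M\<^esub> x) = \<beta> x (c h \<odot>\<^bsub>M\<^esub> h \<oplus>\<^bsub>M\<^esub> (\<Oplus>\<^bsub>M\<^esub>x\<in>H. c x \<odot>\<^bsub>M\<^esub> x))"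
        using insert h by simp
      also have "\<dots> = \<beta> x (c h \<odot>\<^bsub>M\<^esub> h) \<oplus>\<^bsub>K\<^esub> \<zero>\<^bsub>K\<^esub>"
        using insert h by (subst \<beta>_add) auto
      also have "\<dots> = \<zero>\<^bsub>K\<^esub>" using \<beta>_smult[OF h(2,1)] x(3)[of h] insert.prems h by simp
      finally show ?case .
    qed
    then show ?thesis using c(2) by simp
  qed
  obtain j where j: "x j \<noteq> \<zero>\<^bsub>K\<^esub>" using x(2) by (auto simp: fun_eq_iff)
  then have jn: "j < n" using x(1) by (auto simp: supp_funs_def)
  have "\<beta> x (m j) = x j \<otimes>\<^bsub>K\<^esub> b j (m j)"
    unfolding \<beta>_def using jn xc b by (intro K.finsum_single) auto
  then have "\<beta> x (m j) = x j" using b(3)[OF jn jn] xc by simp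
  then show False using vanish[OF b(2)[OF jn]] j by simp
qed

text \<open>A nonzero part \<open>A2\<close> split off from A is finitely generated, so it has a
  functional with value 1 somewhere. Pulled back along the projections of M to A and of A to
  \<open>A2\<close>, it vanishes on \<open>A1\<close> and on B; the old functionals vanish on A, so
  duality persists.\<close>

lemma dual_system_step:
  assumes fg: "fg_module R M" and AB: "complementary R M A B"
    and A12: "complementary R (M\<lparr>carrier := A\<rparr>) A1 A2" and nz: "A2 \<noteq> {\<zero>\<^bsub>M\<^esub>}"
    and D: "dual_system A B n b m"
  shows "\<exists>b m. dual_system A1 (A2 <+>\<^bsub>M\<^esub> B) (Suc n) b m"
proof -
  have A: "submodule A R M" and B: "submodule B R M" using AB by (auto simp: complementary_def)
  interpret N: residue_module R "M\<lparr>carrier := A\<rparr>" K \<epsilon> by (rule residue_module_restrict[OF A])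
  have A2: "submodule A2 R (M\<lparr>carrier := A\<rparr>)" and A1: "submodule A1 R (M\<lparr>carrier := A\<rparr>)"
    using A12 by (auto simp: complementary_def)
  interpret N2: residue_module R "M\<lparr>carrier := A2\<rparr>" K \<epsilon>
    using N.residue_module_restrict[OF A2] by simp
  have A21: "complementary R (M\<lparr>carrier := A\<rparr>) A2 A1"
    using A12 by (simp only: N.complementary_commute[of A2 A1])
  have "fg_module R (M\<lparr>carrier := A2\<rparr>)"
    using N.fg_module_summand[OF fg_module_summand[OF fg AB] A21] by simp
  then have "\<exists>g. residue_hom K R \<epsilon> (M\<lparr>carrier := A2\<rparr>) g \<and> (\<exists>m\<in>A2. g m = \<one>\<^bsub>K\<^esub>)"
    using N2.nonzero_residue_hom_exists nz by simp
  then obtain g m0 where g: "residue_hom K R \<epsilon> (M\<lparr>carrier := A2\<rparr>) g" and m0: "m0 \<in> A2" "g m0 = \<one>\<^bsub>K\<^esub>" by blast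
  have sub: "A1 \<subseteq> A" "A2 \<subseteq> A" "A \<subseteq> carrier M" "B \<subseteq> carrier M"
    using N.submodule_mem(1)[OF A1] N.submodule_mem(1)[OF A2] submodule_mem(1)[OF A] submodule_mem(1)[OF B] by auto
  obtain \<pi> where \<pi>: "\<And>x. x \<in> carrier M \<Longrightarrow> \<pi> x \<in> A"
    "\<And>x y. x \<in> carrier M \<Longrightarrow> y \<in> carrier M \<Longrightarrow> \<pi> (x \<oplus>\<^bsub>M\<^esub> y) = \<pi> x \<oplus>\<^bsub>M\<^esub> \<pi> y"
    "\<And>r x. r \<in> carrier R \<Longrightarrow> x \<in> carrier M \<Longrightarrow> \<pi> (r \<odot>\<^bsub>M\<^esub> x) = r \<odot>\<^bsub>M\<^esub> \<pi> x"
    "\<And>x. x \<in> A \<Longrightarrow> \<pi> x = x" "\<And>x. x \<in> B \<Longrightarrow> \<pi> x = \<zero>\<^bsub>M\<^esub>"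
    "\<And>x. x \<in> carrier M \<Longrightarrow> \<exists>b\<in>B. x = \<pi> x \<oplus>\<^bsub>M\<^esub> b" by (rule complementary_projection[OF AB]) (rule that)
  obtain \<rho> where \<rho>: "\<And>x. x \<in> A \<Longrightarrow> \<rho> x \<in> A2"
    "\<And>x y. x \<in> A \<Longrightarrow> y \<in> A \<Longrightarrow> \<rho> (x \<oplus>\<^bsub>M\<^esub> y) = \<rho> x \<oplus>\<^bsub>M\<^esub> \<rho> y"
    "\<And>r x. r \<in> carrier R \<Longrightarrow> x \<in> A \<Longrightarrow> \<rho> (r \<odot>\<^bsub>M\<^esub> x) = r \<odot>\<^bsub>M\<^esub> \<rho> x"
    "\<And>x. x \<in> A2 \<Longrightarrow> \<rho> x = x" "\<And>x. x \<in> A1 \<Longrightarrow> \<rho> x = \<zero>\<^bsub>M\<^esub>"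
    by (rule N.complementary_projection[OF A21]) (simp, rule that)
  have g0: "g \<zero>\<^bsub>M\<^esub> = \<zero>\<^bsub>K\<^esub>" using N2.residue_hom_zero[OF g] by simp
  let ?g = "\<lambda>x. g (\<rho> (\<pi> x))"
  have hom: "residue_hom K R \<epsilon> M ?g"
    using residue_homD[OF g] \<pi>(1-3) \<rho>(1-3) by (simp add: residue_hom_def)
  have g1: "?g x = \<zero>\<^bsub>K\<^esub>" if "x \<in> A1" for x using that sub(1) \<pi>(4) \<rho>(5) g0 by auto
  have "\<rho> \<zero>\<^bsub>M\<^esub> = \<zero>\<^bsub>M\<^esub>" using \<rho>(5) N.submodule_mem(2)[OF A1] by simp
  then have g2: "?g x = \<zero>\<^bsub>K\<^esub>" if "x \<in> B" for x using that \<pi>(5) g0 by auto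
  have g3: "?g m0 = \<one>\<^bsub>K\<^esub>" using m0 sub(2) \<pi>(4) \<rho>(4) by auto
  have inl: "x \<in> A2 <+>\<^bsub>M\<^esub> B" if "x \<in> A2" for x
    using set_add_memI[OF that submodule_mem(2)[OF B], of M] that sub by auto
  have inr: "x \<in> A2 <+>\<^bsub>M\<^esub> B" if "x \<in> B" for x
    using set_add_memI[OF N.submodule_mem(2)[OF A2] that, of M] that sub by auto
  have "dual_system A1 (A2 <+>\<^bsub>M\<^esub> B) (Suc n) (b(n := ?g)) (m(n := m0))"
    using D hom g1 g2 g3 inl inr m0 sub by (auto simp: dual_system_def less_Suc_eq subset_iff)
  then show ?thesis by blast
qed

text \<open>Among all decompositions whose part A does not lift, one with a dual system of maximal
  size n is taken; n is bounded by the number of generators of M. If A splits further, one of its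
  parts does not lift, and the other must be zero because it could be moved to the complement and
  would raise n.\<close>

theorem indecomposable_nonlifting_summand:
  assumes fg: "fg_module R M" and nl: "\<not> lifts K R \<epsilon> \<tau> M"
    and \<tau>: "\<And>r. r \<in> carrier R \<Longrightarrow> \<tau> r \<in> carrier K"
  obtains A B where "complementary R M A B" "indecomposable_module R (M\<lparr>carrier := A\<rparr>)"
    "\<not> lifts K R \<epsilon> \<tau> (M\<lparr>carrier := A\<rparr>)"
proof -
  obtain G where G: "finite G" "G \<subseteq> carrier M"
    "\<And>y. y \<in> carrier M \<Longrightarrow> \<exists>c\<in>G \<rightarrow> carrier R. y = (\<Oplus>\<^bsub>M\<^esub>x\<in>G. c x \<odot>\<^bsub>M\<^esub> x)"
    using fg unfolding fg_module_def by blast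
  define Q where "Q n \<longleftrightarrow> (\<exists>A B b m. complementary R M A B \<and> \<not> lifts K R \<epsilon> \<tau> (M\<lparr>carrier := A\<rparr>) \<and> dual_system A B n b m)" for n
  have bound: "n \<le> card G" if "Q n" for n
  proof -
    obtain A B b m where *: "complementary R M A B" "dual_system A B n b m" using \<open>Q n\<close> unfolding Q_def by blast
    then have "B \<subseteq> carrier M" using submodule_mem(1) by (auto simp: complementary_def)
    from dual_system_bound[OF G *(2) this] show ?thesis .
  qed
  have "Q 0"
    unfolding Q_def using complementary_trivial nl
    by (intro exI[of _ "carrier M"] exI[of _ "{\<zero>\<^bsub>M\<^esub>}"]) (simp add: dual_system_def)
  then obtain n where n: "Q n" "\<And>k. Q k \<Longrightarrow> k \<le> n"
    using GreatestI_nat[of Q 0 "card G"] Greatest_le_nat[of Q _ "card G"] bound by blast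
  obtain A B b m where AB: "complementary R M A B" and nlA: "\<not> lifts K R \<epsilon> \<tau> (M\<lparr>carrier := A\<rparr>)"
    and D: "dual_system A B n b m" using n(1) unfolding Q_def by blast
  have A: "submodule A R M" using AB by (simp add: complementary_def)
  interpret N: residue_module R "M\<lparr>carrier := A\<rparr>" K \<epsilon> by (rule residue_module_restrict[OF A])
  have A0: "A \<noteq> {\<zero>\<^bsub>M\<^esub>}" using N.lifts_zero_module[of \<tau>] \<tau> nlA by auto
  have max: "A2 = {\<zero>\<^bsub>M\<^esub>}" if A12: "complementary R (M\<lparr>carrier := A\<rparr>) A1 A2" and "\<not> lifts K R \<epsilon> \<tau> (M\<lparr>carrier := A1\<rparr>)" for A1 A2
  proof (rule ccontr)
    assume "A2 \<noteq> {\<zero>\<^bsub>M\<^esub>}"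
    then have "\<exists>b m. dual_system A1 (A2 <+>\<^bsub>M\<^esub> B) (Suc n) b m" by (rule dual_system_step[OF fg AB A12 _ D])
    then have "Q (Suc n)" unfolding Q_def using complementary_trans[OF AB A12] that(2) by blast
    then show False using n(2) by fastforce
  qed
  have "indecomposable_module R (M\<lparr>carrier := A\<rparr>)"
    unfolding indecomposable_module_def
  proof (intro conjI allI impI)
    show "module R (M\<lparr>carrier := A\<rparr>)" by (rule N.module_axioms)
    show "carrier (M\<lparr>carrier := A\<rparr>) \<noteq> {\<zero>\<^bsub>M\<lparr>carrier := A\<rparr>\<^esub>}" using A0 by simp
    fix A1 A2 assume *: "submodule A1 R (M\<lparr>carrier := A\<rparr>)" "submodule A2 R (M\<lparr>carrier := A\<rparr>)"
      "A1 <+>\<^bsub>M\<lparr>carrier := A\<rparr>\<^esub> A2 = carrier (M\<lparr>carrier := A\<rparr>)" "A1 \<inter> A2 = {\<zero>\<^bsub>M\<lparr>carrier := A\<rparr>\<^esub>}"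
    then have c: "complementary R (M\<lparr>carrier := A\<rparr>) A1 A2" by (simp add: complementary_def)
    have c': "complementary R (M\<lparr>carrier := A\<rparr>) A2 A1"
      using c by (simp only: N.complementary_commute[of A2 A1])
    have "\<not> lifts K R \<epsilon> \<tau> (M\<lparr>carrier := A1\<rparr>) \<or> \<not> lifts K R \<epsilon> \<tau> (M\<lparr>carrier := A2\<rparr>)"
    proof (rule ccontr)
      assume "\<not> (\<not> lifts K R \<epsilon> \<tau> (M\<lparr>carrier := A1\<rparr>) \<or> \<not> lifts K R \<epsilon> \<tau> (M\<lparr>carrier := A2\<rparr>))"
      then have "lifts K R \<epsilon> \<tau> (M\<lparr>carrier := A\<rparr>)" by (intro N.lifts_sum[OF c] \<tau>) simp_all
      with nlA show False by (rule notE)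
    qed
    then show "A1 = {\<zero>\<^bsub>M\<lparr>carrier := A\<rparr>\<^esub>} \<or> A2 = {\<zero>\<^bsub>M\<lparr>carrier := A\<rparr>\<^esub>}"
    proof
      assume "\<not> lifts K R \<epsilon> \<tau> (M\<lparr>carrier := A1\<rparr>)"
      from max[OF c this] show ?thesis by simp
    next
      assume "\<not> lifts K R \<epsilon> \<tau> (M\<lparr>carrier := A2\<rparr>)"
      from max[OF c' this] show ?thesis by simp
    qed
  qed
  with AB nlA show thesis by (intro that)
qed

text \<open>Applying the projection shows that membership of an element of A in
  \<open>(xs) M\<close> already gives membership in \<open>(xs) A\<close>, so regularity is
  inherited. A residue functional with value 1 on A kills \<open>(xs) A\<close>, so this is a proper
  submodule. This gives depth at least \<open>length xs\<close>, hence at least the dimension; the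
  reverse inequality is general. Failure of lifting enters by making A nonzero.\<close>

lemma MCM_summand:
  assumes noeth: "noetherian_ring R" and loc: "local_ring R" and fg: "fg_module R M"
    and AB: "complementary R M A B" and nl: "\<not> lifts K R \<epsilon> \<tau> (M\<lparr>carrier := A\<rparr>)"
    and \<tau>: "\<And>r. r \<in> carrier R \<Longrightarrow> \<tau> r \<in> carrier K"
    and mx: "max_ideal R = {r \<in> carrier R. \<epsilon> r = \<zero>\<^bsub>K\<^esub>}"
    and xs: "set xs \<subseteq> max_ideal R" "regular_seq M xs" "krull_dim R \<le> enat (length xs)"
  shows "MCM R (M\<lparr>carrier := A\<rparr>)"
proof -
  have A: "submodule A R M" using AB by (simp add: complementary_def)
  let ?N = "M\<lparr>carrier := A\<rparr>"
  interpret N: residue_module R ?N K \<epsilon> by (rule residue_module_restrict[OF A])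
  have AM: "A \<subseteq> carrier M" by (rule submodule_mem(1)[OF A])
  have A0: "A \<noteq> {\<zero>\<^bsub>M\<^esub>}" using N.lifts_zero_module[of \<tau>] \<tau> nl by auto
  obtain \<pi> where \<pi>: "\<And>x. x \<in> carrier M \<Longrightarrow> \<pi> x \<in> A"
    "\<And>x y. x \<in> carrier M \<Longrightarrow> y \<in> carrier M \<Longrightarrow> \<pi> (x \<oplus>\<^bsub>M\<^esub> y) = \<pi> x \<oplus>\<^bsub>M\<^esub> \<pi> y"
    "\<And>r x. r \<in> carrier R \<Longrightarrow> x \<in> carrier M \<Longrightarrow> \<pi> (r \<odot>\<^bsub>M\<^esub> x) = r \<odot>\<^bsub>M\<^esub> \<pi> x"
    "\<And>x. x \<in> A \<Longrightarrow> \<pi> x = x" "\<And>x. x \<in> B \<Longrightarrow> \<pi> x = \<zero>\<^bsub>M\<^esub>"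
    "\<And>x. x \<in> carrier M \<Longrightarrow> \<exists>b\<in>B. x = \<pi> x \<oplus>\<^bsub>M\<^esub> b" by (rule complementary_projection[OF AB]) (rule that)
  have xc: "set xs \<subseteq> carrier R" using xs(1) mx by auto
  have incl: "seq_submodule ?N ys \<subseteq> seq_submodule M ys" if "set ys \<subseteq> carrier R" for ys
    using N.seq_submodule_linear_image(1)[OF that, of "\<lambda>x. x" M "\<lambda>r. r"] AM by (auto simp: subset_iff)
  have proj: "\<pi> ` seq_submodule M ys \<subseteq> seq_submodule ?N ys" if "set ys \<subseteq> carrier R" for ys
    using seq_submodule_linear_image(1)[OF that, of \<pi> ?N "\<lambda>r. r"] \<pi>(1-4) submodule_mem(2)[OF A] by simp
  obtain g m where g: "residue_hom K R \<epsilon> ?N g" and m: "m \<in> A" "g m = \<one>\<^bsub>K\<^esub>"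
    using N.nonzero_residue_hom_exists[OF fg_module_summand[OF fg AB]] A0 by auto
  have reg: "regular_seq ?N xs"
    unfolding regular_seq_def
  proof (intro conjI allI impI ballI)
    fix i y assume i: "i < length xs" and y: "y \<in> carrier ?N"
      and mem: "xs ! i \<odot>\<^bsub>?N\<^esub> y \<in> seq_submodule ?N (take i xs)"
    have tc: "set (take i xs) \<subseteq> carrier R" using xc set_take_subset[of i xs] by blast
    have "xs ! i \<odot>\<^bsub>M\<^esub> y \<in> seq_submodule M (take i xs)" using mem incl[OF tc] by auto
    then have "y \<in> seq_submodule M (take i xs)" using xs(2) i y AM by (auto simp: regular_seq_def)
    then have "\<pi> y \<in> seq_submodule ?N (take i xs)" using proj[OF tc] by auto
    then show "y \<in> seq_submodule ?N (take i xs)" using \<pi>(4) y by simp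
  next
    have zero: "\<forall>z\<in>seq_submodule ?N ys. z \<in> A \<and> g z = \<zero>\<^bsub>K\<^esub>" if "set ys \<subseteq> max_ideal R" for ys
      using that
    proof (induction ys)
      case Nil
      then show ?case using N.residue_hom_zero[OF g] submodule_mem(2)[OF A] by simp
    next
      case (Cons y ys)
      then have y: "y \<in> carrier R" "\<epsilon> y = \<zero>\<^bsub>K\<^esub>" using mx by auto
      have "a \<oplus>\<^bsub>M\<^esub> z \<in> A \<and> g (y \<odot>\<^bsub>M\<^esub> w \<oplus>\<^bsub>M\<^esub> z) = \<zero>\<^bsub>K\<^esub>"
        if "a = y \<odot>\<^bsub>M\<^esub> w" "w \<in> A" "z \<in> A" "g z = \<zero>\<^bsub>K\<^esub>" for a w z
        using that y residue_homD[OF g] submodule_mem(3,5)[OF A] by auto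
      then show ?case using Cons by auto
    qed
    show "seq_submodule ?N xs \<noteq> carrier ?N"
      using zero[OF xs(1)] m by auto
  qed
  have "enat (length xs) \<le> depth R ?N"
    unfolding depth_def using A0 xs(1) reg by (auto intro!: Sup_upper)
  moreover have "depth R ?N \<le> krull_dim R"
    using N.depth_le_krull_dim A0 mx by auto
  ultimately have "depth R ?N = krull_dim R" using xs(3) by (meson order.antisym order.trans)
  then show ?thesis unfolding MCM_def using noeth loc fg_module_summand[OF fg AB] by blast
qed

end

section \<open>Quotients of rings and modules\<close>

text \<open>\<open>quot_module W H S \<theta>\<close> is \<open>W/H\<close> as a module over \<open>S\<close>, where \<open>\<theta>\<close> maps the ring acting
  on \<open>W\<close> onto \<open>S\<close> and its kernel maps \<open>W\<close> into \<open>H\<close>.\<close>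

definition quot_class :: "('t, 'w, 'n) module_scheme \<Rightarrow> 'w set \<Rightarrow> 'w \<Rightarrow> 'w set" where
  "quot_class W H x = {y \<in> carrier W. y \<ominus>\<^bsub>W\<^esub> x \<in> H}"

definition quot_module ::
    "('t, 'm) ring_scheme \<Rightarrow> ('t, 'w, 'n) module_scheme \<Rightarrow> 'w set \<Rightarrow> ('t \<Rightarrow> 's) \<Rightarrow> ('s, 'w set) module" where
  "quot_module T W H \<theta> =
    (let q = quot_class W H; rep = (\<lambda>Y. SOME x. x \<in> carrier W \<and> q x = Y) in
    \<lparr> carrier = q ` carrier W, monoid.mult = undefined, one = undefined,
      ring.zero = q \<zero>\<^bsub>W\<^esub>, add = (\<lambda>Y Z. q (rep Y \<oplus>\<^bsub>W\<^esub> rep Z)),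
      smult = (\<lambda>a Y. q (inv_into (carrier T) \<theta> a \<odot>\<^bsub>W\<^esub> rep Y)) \<rparr>)"

locale module_quotient = module T W for T and W (structure) +
  fixes H and S :: "('s, 'l) ring_scheme" and \<theta>
  assumes H: "submodule H T W" and S: "cring S" and \<theta>: "\<theta> \<in> ring_hom T S" and surj: "\<theta> ` carrier T = carrier S"
    and kernel: "\<And>P w. P \<in> carrier T \<Longrightarrow> \<theta> P = \<zero>\<^bsub>S\<^esub> \<Longrightarrow> w \<in> carrier W \<Longrightarrow> P \<odot>\<^bsub>W\<^esub> w \<in> H"
begin

abbreviation q where "q \<equiv> quot_class W H"
abbreviation Q where "Q \<equiv> quot_module T W H \<theta>"

lemma q_eq_iff:
  assumes "x \<in> carrier W" "y \<in> carrier W"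
  shows "q x = q y \<longleftrightarrow> x \<ominus>\<^bsub>W\<^esub> y \<in> H"
proof
  note S = submodule_mem[OF H]
  have xx: "x \<ominus>\<^bsub>W\<^esub> x \<in> H" using assms S(2) by (simp add: M.minus_eq M.r_neg)
  assume "q x = q y"
  then show "x \<ominus>\<^bsub>W\<^esub> y \<in> H" using xx assms by (auto simp: quot_class_def)
next
  note S = submodule_mem[OF H]
  assume xy: "x \<ominus>\<^bsub>W\<^esub> y \<in> H"
  have "z \<ominus>\<^bsub>W\<^esub> x \<in> H \<longleftrightarrow> z \<ominus>\<^bsub>W\<^esub> y \<in> H" if z: "z \<in> carrier W" for z
  proof
    assume a: "z \<ominus>\<^bsub>W\<^esub> x \<in> H"
    have "z \<ominus>\<^bsub>W\<^esub> y = (z \<ominus>\<^bsub>W\<^esub> x) \<oplus>\<^bsub>W\<^esub> (x \<ominus>\<^bsub>W\<^esub> y)"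
      using z assms by (simp add: M.minus_eq M.a_assoc) (simp add: M.a_assoc[symmetric] M.l_neg)
    then show "z \<ominus>\<^bsub>W\<^esub> y \<in> H" using S(3)[OF a xy] by simp
  next
    assume a: "z \<ominus>\<^bsub>W\<^esub> y \<in> H"
    have e: "\<ominus>\<^bsub>W\<^esub> (x \<ominus>\<^bsub>W\<^esub> y) = \<ominus>\<^bsub>W\<^esub> x \<oplus>\<^bsub>W\<^esub> y" using assms by (simp add: M.minus_eq M.minus_add)
    have "(z \<ominus>\<^bsub>W\<^esub> y) \<oplus>\<^bsub>W\<^esub> (\<ominus>\<^bsub>W\<^esub> x \<oplus>\<^bsub>W\<^esub> y) = (z \<ominus>\<^bsub>W\<^esub> x) \<oplus>\<^bsub>W\<^esub> (\<ominus>\<^bsub>W\<^esub> y \<oplus>\<^bsub>W\<^esub> y)"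
      using z assms by (simp add: M.minus_eq M.a_ac)
    then have "z \<ominus>\<^bsub>W\<^esub> x = (z \<ominus>\<^bsub>W\<^esub> y) \<oplus>\<^bsub>W\<^esub> \<ominus>\<^bsub>W\<^esub> (x \<ominus>\<^bsub>W\<^esub> y)"
      unfolding e using z assms by (simp add: M.l_neg)
    then show "z \<ominus>\<^bsub>W\<^esub> x \<in> H" using S(3)[OF a S(4)[OF xy]] by simp
  qed
  then show "q x = q y" by (auto simp: quot_class_def)
qed

lemma \<theta>_simps:
  "P \<in> carrier T \<Longrightarrow> \<theta> P \<in> carrier S"
  "P \<in> carrier T \<Longrightarrow> P' \<in> carrier T \<Longrightarrow> \<theta> (P \<otimes>\<^bsub>T\<^esub> P') = \<theta> P \<otimes>\<^bsub>S\<^esub> \<theta> P'"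
  "P \<in> carrier T \<Longrightarrow> P' \<in> carrier T \<Longrightarrow> \<theta> (P \<oplus>\<^bsub>T\<^esub> P') = \<theta> P \<oplus>\<^bsub>S\<^esub> \<theta> P'"
  "\<theta> \<one>\<^bsub>T\<^esub> = \<one>\<^bsub>S\<^esub>"
  using \<theta> by (auto simp: ring_hom_def)

lemma quot_rep:
  assumes "x \<in> carrier W"
  shows "(SOME y. y \<in> carrier W \<and> q y = q x) \<in> carrier W"
    "(SOME y. y \<in> carrier W \<and> q y = q x) \<ominus>\<^bsub>W\<^esub> x \<in> H"
proof -
  have *: "(SOME y. y \<in> carrier W \<and> q y = q x) \<in> carrier W \<and> q (SOME y. y \<in> carrier W \<and> q y = q x) = q x"
    by (rule someI[of "\<lambda>y. y \<in> carrier W \<and> q y = q x" x]) (use assms in simp)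
  then show "(SOME y. y \<in> carrier W \<and> q y = q x) \<in> carrier W" by (rule conjunct1)
  then show "(SOME y. y \<in> carrier W \<and> q y = q x) \<ominus>\<^bsub>W\<^esub> x \<in> H" using * q_eq_iff assms by blast
qed

lemma quot_carrier: "carrier Q = q ` carrier W"
  by (simp add: quot_module_def Let_def)

lemma quot_zero: "\<zero>\<^bsub>Q\<^esub> = q \<zero>\<^bsub>W\<^esub>"
  by (simp add: quot_module_def Let_def)

lemma quot_add:
  assumes "x \<in> carrier W" "y \<in> carrier W"
  shows "q x \<oplus>\<^bsub>Q\<^esub> q y = q (x \<oplus>\<^bsub>W\<^esub> y)"
proof -
  define r where "r x = (SOME y. y \<in> carrier W \<and> q y = q x)" for x
  have r: "r x \<in> carrier W" "r x \<ominus>\<^bsub>W\<^esub> x \<in> H" "r y \<in> carrier W" "r y \<ominus>\<^bsub>W\<^esub> y \<in> H"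
    unfolding r_def using quot_rep assms by blast+
  have "(r x \<oplus>\<^bsub>W\<^esub> r y) \<ominus>\<^bsub>W\<^esub> (x \<oplus>\<^bsub>W\<^esub> y) = (r x \<ominus>\<^bsub>W\<^esub> x) \<oplus>\<^bsub>W\<^esub> (r y \<ominus>\<^bsub>W\<^esub> y)"
    using r assms by (simp add: M.minus_eq M.minus_add M.a_ac)
  also have "\<dots> \<in> H" by (intro submodule_mem(3)[OF H] r)
  finally have "q (r x \<oplus>\<^bsub>W\<^esub> r y) = q (x \<oplus>\<^bsub>W\<^esub> y)" using r assms by (subst q_eq_iff) auto
  then show ?thesis by (simp add: quot_module_def Let_def r_def)
qed

lemma quot_smult:
  assumes P: "P \<in> carrier T" and x: "x \<in> carrier W"
  shows "\<theta> P \<odot>\<^bsub>Q\<^esub> q x = q (P \<odot>\<^bsub>W\<^esub> x)"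
proof -
  interpret S: cring S by (rule S)
  define r where "r = (SOME y. y \<in> carrier W \<and> q y = q x)"
  have r: "r \<in> carrier W" "r \<ominus>\<^bsub>W\<^esub> x \<in> H" unfolding r_def using quot_rep x by blast+
  define P' where "P' = inv_into (carrier T) \<theta> (\<theta> P)"
  have P': "P' \<in> carrier T" "\<theta> P' = \<theta> P"
    unfolding P'_def using P by (auto intro!: inv_into_into f_inv_into_f)
  have z: "\<theta> \<zero>\<^bsub>T\<^esub> = \<zero>\<^bsub>S\<^esub>"
    using \<theta>_simps(1)[of "\<zero>\<^bsub>T\<^esub>"] \<theta>_simps(3)[of "\<zero>\<^bsub>T\<^esub>" "\<zero>\<^bsub>T\<^esub>"] S.add.l_cancel_one'[of "\<theta> \<zero>\<^bsub>T\<^esub>" "\<theta> \<zero>\<^bsub>T\<^esub>"] by simp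
  have "\<theta> (P' \<ominus>\<^bsub>T\<^esub> P) \<oplus>\<^bsub>S\<^esub> \<theta> P = \<zero>\<^bsub>S\<^esub> \<oplus>\<^bsub>S\<^esub> \<theta> P"
    using P P' \<theta>_simps(1) by (simp add: \<theta>_simps(3)[symmetric] R.minus_eq R.a_assoc R.l_neg)
  then have "\<theta> (P' \<ominus>\<^bsub>T\<^esub> P) = \<zero>\<^bsub>S\<^esub>" using P P' \<theta>_simps(1) by (simp add: S.add.r_cancel)
  then have k: "(P' \<ominus>\<^bsub>T\<^esub> P) \<odot>\<^bsub>W\<^esub> x \<in> H" using P P' x by (intro kernel) auto
  have "P' \<odot>\<^bsub>W\<^esub> r \<ominus>\<^bsub>W\<^esub> P \<odot>\<^bsub>W\<^esub> x = P' \<odot>\<^bsub>W\<^esub> (r \<ominus>\<^bsub>W\<^esub> x) \<oplus>\<^bsub>W\<^esub> (P' \<ominus>\<^bsub>T\<^esub> P) \<odot>\<^bsub>W\<^esub> x"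
    using P P' x r
    by (simp add: M.minus_eq R.minus_eq smult_r_distr smult_l_distr smult_r_minus smult_l_minus M.a_assoc)
       (simp add: M.a_assoc[symmetric] M.l_neg)
  also have "\<dots> \<in> H" by (intro submodule_mem(3,5)[OF H] r k P')
  finally have "q (P' \<odot>\<^bsub>W\<^esub> r) = q (P \<odot>\<^bsub>W\<^esub> x)" using P P' r x by (subst q_eq_iff) auto
  then show ?thesis by (simp add: quot_module_def Let_def r_def P'_def)
qed

lemma module_quot: "module S Q"
proof (intro moduleI S)
  interpret S: cring S by (rule S)
  show "abelian_group Q"
  proof (rule abelian_groupI)
    fix Y assume "Y \<in> carrier Q"
    then obtain x where x: "x \<in> carrier W" "Y = q x" by (auto simp: quot_carrier)
    then show "\<exists>Z\<in>carrier Q. Z \<oplus>\<^bsub>Q\<^esub> Y = \<zero>\<^bsub>Q\<^esub>"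
      by (intro bexI[of _ "q (\<ominus>\<^bsub>W\<^esub> x)"]) (auto simp: quot_carrier quot_zero quot_add M.l_neg)
  qed (auto simp: quot_carrier quot_zero quot_add M.a_ac)
  fix a x assume "a \<in> carrier S" "x \<in> carrier Q"
  then obtain P w where Pw: "P \<in> carrier T" "a = \<theta> P" "w \<in> carrier W" "x = q w"
    unfolding surj[symmetric] quot_carrier by blast
  then show "a \<odot>\<^bsub>Q\<^esub> x \<in> carrier Q" by (auto simp: quot_smult quot_carrier)
  { fix b assume "b \<in> carrier S"
    then obtain P' where P': "P' \<in> carrier T" "b = \<theta> P'" unfolding surj[symmetric] by blast
    show "(a \<oplus>\<^bsub>S\<^esub> b) \<odot>\<^bsub>Q\<^esub> x = (a \<odot>\<^bsub>Q\<^esub> x) \<oplus>\<^bsub>Q\<^esub> (b \<odot>\<^bsub>Q\<^esub> x)"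
      using Pw P' by (simp add: \<theta>_simps(3)[symmetric] quot_smult quot_add smult_l_distr)
    show "(a \<otimes>\<^bsub>S\<^esub> b) \<odot>\<^bsub>Q\<^esub> x = a \<odot>\<^bsub>Q\<^esub> (b \<odot>\<^bsub>Q\<^esub> x)"
      using Pw P' by (simp add: \<theta>_simps(2)[symmetric] quot_smult smult_assoc1) }
  { fix y assume "y \<in> carrier Q"
    then obtain w' where "w' \<in> carrier W" "y = q w'" by (auto simp: quot_carrier)
    with Pw show "a \<odot>\<^bsub>Q\<^esub> (x \<oplus>\<^bsub>Q\<^esub> y) = (a \<odot>\<^bsub>Q\<^esub> x) \<oplus>\<^bsub>Q\<^esub> (a \<odot>\<^bsub>Q\<^esub> y)"
      by (simp add: quot_smult quot_add smult_r_distr) }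
next
  fix x assume "x \<in> carrier Q"
  then obtain w where w: "w \<in> carrier W" "x = q w" by (auto simp: quot_carrier)
  then show "\<one>\<^bsub>S\<^esub> \<odot>\<^bsub>Q\<^esub> x = x" by (simp add: \<theta>_simps(4)[symmetric] quot_smult)
qed

lemma fg_quot: "fg_module T W \<Longrightarrow> fg_module S Q"
  by (rule fg_module_image[OF _ module_quot, where \<pi> = q and \<theta> = \<theta>])
    (simp_all add: quot_carrier quot_add quot_smult \<theta>_simps)

text \<open>Translates questions of regularity on the quotient into equations between
  representatives in W, where components can be computed with.\<close>

lemma seq_submodule_quot:
  assumes "set xs \<subseteq> carrier T" "w \<in> carrier W"
  shows "q w \<in> seq_submodule Q (map \<theta> xs) \<longleftrightarrow> (\<exists>s\<in>seq_submodule W xs. w \<ominus>\<^bsub>W\<^esub> s \<in> H)"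
proof -
  have sub: "seq_submodule W xs \<subseteq> carrier W"
    by (rule submodule_mem(1)[OF seq_submodule_submodule[OF assms(1)]])
  have "q ` seq_submodule W xs = seq_submodule Q (map \<theta> xs)"
    using assms(1)
    by (rule seq_submodule_linear_image(2)) (auto simp: quot_carrier quot_zero quot_add quot_smult)
  then have "q w \<in> seq_submodule Q (map \<theta> xs) \<longleftrightarrow> (\<exists>s\<in>seq_submodule W xs. q w = q s)" by auto
  also have "\<dots> \<longleftrightarrow> (\<exists>s\<in>seq_submodule W xs. w \<ominus>\<^bsub>W\<^esub> s \<in> H)"
    using q_eq_iff assms(2) sub by blast
  finally show ?thesis .
qed

end

lemma noetherian_ring_image:
  assumes "noetherian_ring T" and h: "ring_hom_ring T S h" and surj: "h ` carrier T = carrier S"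
  shows "noetherian_ring S"
proof -
  interpret T: noetherian_ring T by fact
  interpret h: ring_hom_ring T S h by fact
  show ?thesis
  proof (rule h.S.noetherian_ringI)
    fix J assume J: "ideal J S"
    interpret J: ideal J S by (rule J)
    let ?J = "{r \<in> carrier T. h r \<in> J}"
    have "ideal ?J T" by (rule h.ideal_vimage[OF J])
    then obtain G where G: "G \<subseteq> carrier T" "finite G" "?J = Idl\<^bsub>T\<^esub> G" using T.finetely_gen by blast
    have GJ: "h ` G \<subseteq> J" using T.genideal_self[OF G(1)] G(3) by auto
    then have GS: "h ` G \<subseteq> carrier S" using J.Icarr by auto
    interpret I: ideal "Idl\<^bsub>S\<^esub> (h ` G)" S by (rule h.S.genideal_ideal[OF GS])
    have "ideal {r \<in> carrier T. h r \<in> Idl\<^bsub>S\<^esub> (h ` G)} T" by (rule h.ideal_vimage[OF I.is_ideal])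
    moreover have "G \<subseteq> {r \<in> carrier T. h r \<in> Idl\<^bsub>S\<^esub> (h ` G)}" using G(1) h.S.genideal_self[OF GS] by auto
    ultimately have sub: "?J \<subseteq> {r \<in> carrier T. h r \<in> Idl\<^bsub>S\<^esub> (h ` G)}"
      unfolding G(3) by (intro T.genideal_minimal)
    have "J \<subseteq> Idl\<^bsub>S\<^esub> (h ` G)"
    proof
      fix s assume s: "s \<in> J"
      then obtain r where r: "r \<in> carrier T" "s = h r" using J.Icarr surj by (metis imageE)
      with s sub show "s \<in> Idl\<^bsub>S\<^esub> (h ` G)" by blast
    qed
    moreover have "Idl\<^bsub>S\<^esub> (h ` G) \<subseteq> J" by (rule h.S.genideal_minimal[OF J GJ])
    ultimately show "\<exists>A\<subseteq>carrier S. finite A \<and> J = Idl\<^bsub>S\<^esub> A"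
      using GS G(2) by (intro exI[of _ "h ` G"]) auto
  qed
qed

lemma primeideal_vimage:
  assumes h: "ring_hom_ring T S h" and "cring T" and P: "primeideal P S"
  shows "primeideal {r \<in> carrier T. h r \<in> P} T"
proof -
  interpret h: ring_hom_ring T S h by fact
  interpret P: primeideal P S by fact
  show ?thesis
  proof (rule primeidealI)
    show "ideal {r \<in> carrier T. h r \<in> P} T" by (rule h.ideal_vimage[OF P.is_ideal])
    have "\<one>\<^bsub>S\<^esub> \<notin> P" using P.one_imp_carrier P.I_notcarr by auto
    then have "\<one>\<^bsub>T\<^esub> \<notin> {r \<in> carrier T. h r \<in> P}" by simp
    then show "carrier T \<noteq> {r \<in> carrier T. h r \<in> P}" using h.R.one_closed by blast
    fix a b assume "a \<in> carrier T" "b \<in> carrier T" "a \<otimes>\<^bsub>T\<^esub> b \<in> {r \<in> carrier T. h r \<in> P}"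
    then show "a \<in> {r \<in> carrier T. h r \<in> P} \<or> b \<in> {r \<in> carrier T. h r \<in> P}"
      using P.I_prime[of "h a" "h b"] by auto
  qed (rule assms(2))
qed

section \<open>The hypersurface of a monomial plus \<open>u v\<close>\<close>

lemma local_ring_residue:
  fixes K (structure)
  assumes "cring A" and "field K" and \<epsilon>: "\<epsilon> \<in> ring_hom A K"
    and unit: "\<And>r. r \<in> carrier A \<Longrightarrow> \<epsilon> r \<noteq> \<zero> \<Longrightarrow> r \<in> Units A"
  shows "local_ring A" and "max_ideal A = {r \<in> carrier A. \<epsilon> r = \<zero>}"
proof -
  interpret A: cring A by fact
  interpret K: field K by fact
  interpret \<epsilon>: ring_hom_ring A K \<epsilon>
    by (rule ring_hom_ringI2[OF A.ring_axioms K.ring_axioms \<epsilon>])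
  let ?m = "{r \<in> carrier A. \<epsilon> r = \<zero>}"
  have m_eq: "?m = {r \<in> carrier A. \<epsilon> r \<in> {\<zero>}}" by simp
  have "ideal ?m A" unfolding m_eq by (rule \<epsilon>.ideal_vimage[OF K.zeroideal])
  have one: "\<one>\<^bsub>A\<^esub> \<notin> ?m" by simp
  have sub: "J \<subseteq> ?m" if J: "ideal J A" "J \<noteq> carrier A" for J
  proof
    interpret J: ideal J A by (rule J)
    fix r assume r: "r \<in> J"
    then have rA: "r \<in> carrier A" by (rule J.Icarr)
    show "r \<in> ?m"
    proof (rule ccontr)
      assume "r \<notin> ?m"
      then have u: "r \<in> Units A" using unit rA by auto
      then have "inv\<^bsub>A\<^esub> r \<otimes>\<^bsub>A\<^esub> r \<in> J" using r by (intro J.I_l_closed) auto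
      then have "\<one>\<^bsub>A\<^esub> \<in> J" using u by simp
      then show False using J.one_imp_carrier J(2) by blast
    qed
  qed
  have max: "maximalideal ?m A"
  proof (rule maximalidealI)
    show "ideal ?m A" by fact
    show "carrier A \<noteq> ?m" using one A.one_closed by blast
    fix J assume J: "ideal J A" "?m \<subseteq> J" "J \<subseteq> carrier A"
    show "J = ?m \<or> J = carrier A" using sub[OF J(1)] J(2) by blast
  qed
  have uniq: "J = ?m" if "maximalideal J A" for J
  proof -
    interpret J: maximalideal J A by (rule that)
    have "J \<subseteq> ?m" using sub J.is_ideal J.I_notcarr by blast
    then have "?m = J \<or> ?m = carrier A" using \<open>ideal ?m A\<close> by (intro J.I_maximal) auto
    then show ?thesis using one A.one_closed by blast
  qed
  show "local_ring A" unfolding local_ring_def using max uniq assms(1) by blast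
  show "max_ideal A = ?m" unfolding max_ideal_def by (rule the_equality) (fact max, rule uniq)
qed

context power_series
begin

lemma ps_term_mult:
  assumes "c \<in> carrier R" "c' \<in> carrier R" "set_mset a \<subseteq> I" "set_mset b \<subseteq> I"
  shows "ps_term R c a \<otimes>\<^bsub>T\<^esub> ps_term R c' b = ps_term R (c \<otimes> c') (a + b)"
proof
  fix m
  have "b = m - a \<longleftrightarrow> m = a + b" if "a \<subseteq># m" using that by (auto simp: subset_mset.add_diff_inverse)
  moreover have "m \<noteq> a + b" if "\<not> a \<subseteq># m" using that by auto
  ultimately show "(ps_term R c a \<otimes>\<^bsub>T\<^esub> ps_term R c' b) m = ps_term R (c \<otimes> c') (a + b) m"
    using assms by (simp add: coeff_term_mult) (auto simp: ps_term_def)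
qed

end

context power_series_field
begin

abbreviation var :: "'v \<Rightarrow> 'v multiset \<Rightarrow> 'a" where
  "var x \<equiv> ps_term R \<one> {#x#}"

lemma var_in_var_ideal_iff: "x \<in> I \<Longrightarrow> var x \<in> var_ideal J \<longleftrightarrow> x \<in> J"
proof -
  assume x: "x \<in> I"
  then have "var x \<in> carrier T" by (intro ps_term_closed) auto
  moreover have "(\<forall>m. set_mset m \<inter> J = {} \<longrightarrow> var x m = \<zero>) \<longleftrightarrow> x \<in> J"
  proof
    assume "\<forall>m. set_mset m \<inter> J = {} \<longrightarrow> var x m = \<zero>"
    then have "set_mset {#x#} \<inter> J = {} \<longrightarrow> var x {#x#} = \<zero>" by (rule spec)
    then show "x \<in> J" by (auto simp: ps_term_def)
  qed (auto simp: ps_term_def)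
  ultimately show ?thesis by (simp add: var_ideal_iff)
qed

lemma ideal_var_ideal: "ideal (var_ideal J) T"
  using primeideal_var_ideal by (rule primeideal.axioms(1))

lemma var_ideal_mono: "J \<subseteq> J' \<Longrightarrow> var_ideal J \<subseteq> var_ideal J'"
  unfolding var_ideal_iff subset_iff by blast

lemma var_ideal_insertE:
  assumes "P \<in> var_ideal (insert x J)" and x: "x \<in> I"
  obtains a b where "a \<in> carrier T" "b \<in> var_ideal J" "P = var x \<otimes>\<^bsub>T\<^esub> a \<oplus>\<^bsub>T\<^esub> b"
proof -
  have P: "P \<in> carrier T" "\<And>m. set_mset m \<inter> insert x J = {} \<Longrightarrow> P m = \<zero>" using assms by (auto simp: var_ideal_iff)
  \<comment> \<open>A monomial of P that avoids J must contain x; these terms are divided by x, and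
    what remains is already in \<open>var_ideal J\<close>.\<close>
  define a where "a m = (if set_mset m \<inter> J = {} then P (add_mset x m) else \<zero>)" for m
  have a: "a \<in> carrier T"
  proof (rule T_memI)
    fix m :: "'v multiset" assume "\<not> set_mset m \<subseteq> I"
    then have "P (add_mset x m) = \<zero>" by (intro coeff_outside[OF P(1)]) auto
    then show "a m = \<zero>" by (simp add: a_def)
  qed (use P in \<open>auto simp: a_def\<close>)
  have xT: "var x \<in> carrier T" using x by auto
  define b where "b = P \<ominus>\<^bsub>T\<^esub> var x \<otimes>\<^bsub>T\<^esub> a"
  have bT: "b \<in> carrier T" unfolding b_def using P a xT by simp
  have "b m = \<zero>" if m: "set_mset m \<inter> J = {}" for m
  proof (cases "x \<in># m")
    case True
    have "set_mset (m - {#x#}) \<inter> J = {}" using m by (auto dest: in_diffD)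
    then have "(var x \<otimes>\<^bsub>T\<^esub> a) m = P m" using True a P(1) by (simp add: coeff_term_mult a_def)
    then show ?thesis unfolding b_def using P a xT by (simp add: r_right_minus_eq)
  next
    case False
    then have "(var x \<otimes>\<^bsub>T\<^esub> a) m = \<zero>" using a by (simp add: coeff_term_mult)
    moreover have "P m = \<zero>" using False m by (intro P(2)) auto
    ultimately show ?thesis unfolding b_def using P a xT by (simp add: minus_eq)
  qed
  then have "b \<in> var_ideal J" using bT by (auto simp: var_ideal_iff)
  moreover have "P = var x \<otimes>\<^bsub>T\<^esub> a \<oplus>\<^bsub>T\<^esub> b" unfolding b_def using P(1) a xT by algebra
  ultimately show thesis using that a by blast
qed

lemma var_mult_add_mem:
  assumes "a \<in> carrier T" "b \<in> var_ideal J" "x \<in> I"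
  shows "var x \<otimes>\<^bsub>T\<^esub> a \<oplus>\<^bsub>T\<^esub> b \<in> var_ideal (insert x J)"
proof -
  interpret J: ideal "var_ideal (insert x J)" T by (rule ideal_var_ideal)
  have "var x \<in> var_ideal (insert x J)" using assms(3) by (simp add: var_in_var_ideal_iff)
  moreover have "b \<in> var_ideal (insert x J)" using assms(2) var_ideal_mono[of J "insert x J"] by blast
  ultimately show ?thesis using assms(1) by (intro J.a_closed J.I_r_closed) auto
qed

end

text \<open>The ring A enters only through a surjection from a series ring in one set of variables
  whose kernel is generated by the binomial. The iterated series and the cosets of the actual ring
  become visible only when the locale is instantiated.\<close>

locale binomial_hypersurface = power_series_field K I for K (structure) and I :: "'v::wellorder set" +
  fixes A :: "('h, 'n) ring_scheme" and \<Theta> and d :: "'v multiset" and u v :: 'v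
  assumes fin: "finite I" and A: "cring A" and hom: "\<Theta> \<in> ring_hom T A" and surj: "\<Theta> ` carrier T = carrier A"
    and uv: "u \<in> I" "v \<in> I" "u \<noteq> v" and d: "set_mset d \<subseteq> I - {u, v}" "2 \<le> size d"
    and ker: "\<And>P. P \<in> carrier T \<Longrightarrow>
      \<Theta> P = \<zero>\<^bsub>A\<^esub> \<longleftrightarrow> (\<exists>H\<in>carrier T. P = H \<otimes>\<^bsub>T\<^esub> (ps_term K \<one> d \<ominus>\<^bsub>T\<^esub> ps_term K \<one> {#u, v#}))"
begin

abbreviation J where "J \<equiv> I - {u, v}"

definition F where "F = ps_term K \<one> d \<ominus>\<^bsub>T\<^esub> ps_term K \<one> {#u, v#}"

lemma F_closed [simp]: "F \<in> carrier T"
  unfolding F_def using uv d by (intro T.minus_closed ps_term_closed) auto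

lemma d_neq: "d \<noteq> {#u, v#}"
  using d(1) by auto

lemma F_coeff: "F m = (if m = d then \<one> else if m = {#u, v#} then \<ominus> \<one> else \<zero>)"
proof -
  have "F m = ps_term K \<one> d m \<ominus> ps_term K \<one> {#u, v#} m"
    unfolding F_def using uv d by (intro coeff_diff ps_term_closed) auto
  then show ?thesis using d_neq by (auto simp: ps_term_def minus_eq)
qed

interpretation A: cring A by (rule A)

sublocale \<Theta>: ring_hom_ring T A \<Theta>
  by (rule ring_hom_ringI2[OF T.ring_axioms A.ring_axioms hom])

text \<open>The equation has order at least 2, so constant and linear coefficients are well defined
  on A. They supply the residue map and the tangent vectors.\<close>

lemma \<Theta>_eqD:
  assumes "P \<in> carrier T" "P' \<in> carrier T" "\<Theta> P = \<Theta> P'" "size m \<le> 1"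
  shows "P m = P' m"
proof -
  have "\<Theta> (P \<ominus>\<^bsub>T\<^esub> P') = \<zero>\<^bsub>A\<^esub>" using assms by (simp add: T.minus_eq A.r_neg)
  then obtain H where H: "H \<in> carrier T" "P \<ominus>\<^bsub>T\<^esub> P' = H \<otimes>\<^bsub>T\<^esub> F" using ker[of "P \<ominus>\<^bsub>T\<^esub> P'"] assms by (auto simp: F_def)
  have "F \<in> ord_ideal 2" using d by (auto simp: mono_ideal_def F_coeff)
  then have "H \<otimes>\<^bsub>T\<^esub> F \<in> ord_ideal 2" using H(1) by (intro ideal.I_l_closed[OF ideal_ord_ideal])
  then have "(P \<ominus>\<^bsub>T\<^esub> P') m = \<zero>" using H(2) assms(4) by (simp add: mono_ideal_def)
  then show ?thesis using assms(1,2) by (simp add: r_right_minus_eq)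
qed

definition cf where "cf m a = inv_into (carrier T) \<Theta> a m"

lemma cf_\<Theta>:
  assumes "P \<in> carrier T" "size m \<le> 1"
  shows "cf m (\<Theta> P) = P m"
proof -
  have "\<Theta> P \<in> \<Theta> ` carrier T" using assms(1) by blast
  from inv_into_into[OF this] f_inv_into_f[OF this] show ?thesis
    unfolding cf_def by (intro \<Theta>_eqD assms)
qed

abbreviation \<epsilon> where "\<epsilon> \<equiv> cf {#}"

lemma \<Theta>_ex: "a \<in> carrier A \<Longrightarrow> \<exists>P\<in>carrier T. a = \<Theta> P"
  using surj by auto

lemma \<epsilon>_hom: "\<epsilon> \<in> ring_hom A K"
proof (rule ring_hom_memI)
  fix a assume "a \<in> carrier A"
  then obtain P where P: "P \<in> carrier T" "a = \<Theta> P" using \<Theta>_ex by blast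
  show "\<epsilon> a \<in> carrier K" using P by (simp add: cf_\<Theta>)
  fix b assume "b \<in> carrier A"
  then obtain P' where P': "P' \<in> carrier T" "b = \<Theta> P'" using \<Theta>_ex by blast
  show "\<epsilon> (a \<otimes>\<^bsub>A\<^esub> b) = \<epsilon> a \<otimes> \<epsilon> b"
    using P P' cf_\<Theta>[of "P \<otimes>\<^bsub>T\<^esub> P'" "{#}"] by (simp add: cf_\<Theta> coeff_mult_empty)
  show "\<epsilon> (a \<oplus>\<^bsub>A\<^esub> b) = \<epsilon> a \<oplus> \<epsilon> b"
    using P P' cf_\<Theta>[of "P \<oplus>\<^bsub>T\<^esub> P'" "{#}"] \<Theta>.hom_add[OF P(1) P'(1)] T.a_closed[OF P(1) P'(1)]
    by (simp add: cf_\<Theta>)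
next
  show "\<epsilon> \<one>\<^bsub>A\<^esub> = \<one>" using cf_\<Theta>[of "\<one>\<^bsub>T\<^esub>" "{#}"] by (simp add: coeff_one)
qed

lemma \<epsilon>_unit:
  assumes "a \<in> carrier A" "\<epsilon> a \<noteq> \<zero>" shows "a \<in> Units A"
proof -
  obtain P where P: "P \<in> carrier T" "a = \<Theta> P" using \<Theta>_ex assms(1) by blast
  then have "P \<in> Units T" using assms(2) by (intro T_Units) (auto simp: cf_\<Theta>)
  then obtain Q where Q: "Q \<in> carrier T" "Q \<otimes>\<^bsub>T\<^esub> P = \<one>\<^bsub>T\<^esub>" "P \<otimes>\<^bsub>T\<^esub> Q = \<one>\<^bsub>T\<^esub>" unfolding Units_def by blast
  have "\<Theta> Q \<otimes>\<^bsub>A\<^esub> a = \<one>\<^bsub>A\<^esub>" "a \<otimes>\<^bsub>A\<^esub> \<Theta> Q = \<one>\<^bsub>A\<^esub>"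
    using P Q by (simp_all add: \<Theta>.hom_mult[symmetric] del: \<Theta>.hom_mult)
  then show ?thesis unfolding Units_def using assms(1) Q(1) by auto
qed

lemma local_A: "local_ring A" and max_ideal_A: "max_ideal A = {a \<in> carrier A. \<epsilon> a = \<zero>}"
  using local_ring_residue[OF A field_axioms \<epsilon>_hom \<epsilon>_unit] by auto

lemma noetherian_A: "noetherian_ring A"
  by (rule noetherian_ring_image[OF noetherian_T[OF fin] \<Theta>.ring_hom_ring_axioms surj])

text \<open>A chain of primes of A is pulled back to T. All its members contain the nonzero element
  F, so the zero ideal, which is prime, can be added below; this accounts for the 1 that is
  subtracted.\<close>

lemma krull_dim_A: "krull_dim A \<le> enat (card I - 1)"
  unfolding krull_dim_def
proof (rule Sup_least)
  fix N assume "N \<in> {enat n |n. \<exists>P. (\<forall>i\<le>n. primeideal (P i) A) \<and> (\<forall>i<n. P i \<subset> P (Suc i))}"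
  then obtain n P where N: "N = enat n" and P: "\<And>i. i \<le> n \<Longrightarrow> primeideal (P i) A" "\<And>i. i < n \<Longrightarrow> P i \<subset> P (Suc i)"
    by blast
  let ?V = "\<lambda>J. {r \<in> carrier T. \<Theta> r \<in> J}"
  define Q where "Q i = (case i of 0 \<Rightarrow> {\<zero>\<^bsub>T\<^esub>} | Suc j \<Rightarrow> ?V (P j))" for i
  have "Suc n \<le> card I"
  proof (rule prime_chain_length_le[OF fin])
    fix i assume "i \<le> Suc n"
    then show "primeideal (Q i) T"
      using P(1) primeideal_zero primeideal_vimage[OF \<Theta>.ring_hom_ring_axioms T.is_cring]
      by (cases i) (auto simp: Q_def)
  next
    fix i assume i: "i < Suc n"
    show "Q i \<subset> Q (Suc i)"
    proof (cases i)
      case 0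
      interpret P0: primeideal "P 0" A by (rule P(1)) simp
      have "\<Theta> F = \<zero>\<^bsub>A\<^esub>" using ker[of F] by (auto simp: F_def[symmetric] intro!: bexI[of _ "\<one>\<^bsub>T\<^esub>"])
      then have F1: "F \<in> Q 1" by (simp add: Q_def)
      have "F d \<noteq> \<zero>" by (simp add: F_coeff)
      then have F0: "F \<notin> {\<zero>\<^bsub>T\<^esub>}" by auto
      have "{\<zero>\<^bsub>T\<^esub>} \<subset> Q 1"
      proof (rule psubsetI)
        show "{\<zero>\<^bsub>T\<^esub>} \<subseteq> Q 1" by (simp add: Q_def)
        show "{\<zero>\<^bsub>T\<^esub>} \<noteq> Q 1" 
        proof
          assume "{\<zero>\<^bsub>T\<^esub>} = Q 1"
          with F1 have "F \<in> {\<zero>\<^bsub>T\<^esub>}" by (simp only:)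
          with F0 show False by (rule notE)
        qed
      qed
      then show ?thesis using 0 by (simp add: Q_def)
    next
      case (Suc j)
      then have s: "P j \<subset> P (Suc j)" using P(2) i by simp
      then obtain a where a: "a \<in> P (Suc j)" "a \<notin> P j" by blast
      have "ideal (P (Suc j)) A" using P(1)[of "Suc j"] i Suc by (simp add: primeideal.axioms(1))
      then have "a \<in> carrier A" using a(1) by (rule ideal.Icarr)
      then obtain r where "r \<in> carrier T" "a = \<Theta> r" using \<Theta>_ex by blast
      then have "r \<in> ?V (P (Suc j))" "r \<notin> ?V (P j)" using a by auto
      moreover have "?V (P j) \<subseteq> ?V (P (Suc j))" using s by blast
      ultimately have "?V (P j) \<subset> ?V (P (Suc j))" by blast
      then show ?thesis using Suc by (simp add: Q_def)
    qed
  qed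
  then show "N \<le> enat (card I - 1)" using N by simp
qed

end

section \<open>A matrix factorization\<close>

definition free4 :: "('t, 'm) ring_scheme \<Rightarrow> ('t, 't \<times> 't \<times> 't \<times> 't) module" where
  "free4 T = \<lparr> carrier = carrier T \<times> carrier T \<times> carrier T \<times> carrier T,
    monoid.mult = undefined, one = undefined, ring.zero = (\<zero>\<^bsub>T\<^esub>, \<zero>\<^bsub>T\<^esub>, \<zero>\<^bsub>T\<^esub>, \<zero>\<^bsub>T\<^esub>),
    add = (\<lambda>(a, b, c, e) (a', b', c', e'). (a \<oplus>\<^bsub>T\<^esub> a', b \<oplus>\<^bsub>T\<^esub> b', c \<oplus>\<^bsub>T\<^esub> c', e \<oplus>\<^bsub>T\<^esub> e')),
    smult = (\<lambda>r (a, b, c, e). (r \<otimes>\<^bsub>T\<^esub> a, r \<otimes>\<^bsub>T\<^esub> b, r \<otimes>\<^bsub>T\<^esub> c, r \<otimes>\<^bsub>T\<^esub> e)) \<rparr>"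

lemma free4_simps:
  "carrier (free4 T) = carrier T \<times> carrier T \<times> carrier T \<times> carrier T"
  "\<zero>\<^bsub>free4 T\<^esub> = (\<zero>\<^bsub>T\<^esub>, \<zero>\<^bsub>T\<^esub>, \<zero>\<^bsub>T\<^esub>, \<zero>\<^bsub>T\<^esub>)"
  "(a, b, c, e) \<oplus>\<^bsub>free4 T\<^esub> (a', b', c', e') = (a \<oplus>\<^bsub>T\<^esub> a', b \<oplus>\<^bsub>T\<^esub> b', c \<oplus>\<^bsub>T\<^esub> c', e \<oplus>\<^bsub>T\<^esub> e')"
  "r \<odot>\<^bsub>free4 T\<^esub> (a, b, c, e) = (r \<otimes>\<^bsub>T\<^esub> a, r \<otimes>\<^bsub>T\<^esub> b, r \<otimes>\<^bsub>T\<^esub> c, r \<otimes>\<^bsub>T\<^esub> e)"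
  by (simp_all add: free4_def)

context cring
begin

lemma module_free4: "module R (free4 R)"
proof (intro moduleI is_cring)
  show "abelian_group (free4 R)"
  proof (rule abelian_groupI)
    fix w assume "w \<in> carrier (free4 R)"
    then obtain a b c e where w: "w = (a, b, c, e)" "a \<in> carrier R" "b \<in> carrier R" "c \<in> carrier R" "e \<in> carrier R"
      by (auto simp: free4_simps)
    then show "\<exists>w'\<in>carrier (free4 R). w' \<oplus>\<^bsub>free4 R\<^esub> w = \<zero>\<^bsub>free4 R\<^esub>"
      by (intro bexI[of _ "(\<ominus> a, \<ominus> b, \<ominus> c, \<ominus> e)"]) (auto simp: free4_simps l_neg)
  qed (auto simp: free4_simps a_ac)
qed (auto simp: free4_simps l_distr r_distr m_assoc)

lemma free4_uminus:
  assumes "a \<in> carrier R" "b \<in> carrier R" "c \<in> carrier R" "e \<in> carrier R"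
  shows "\<ominus>\<^bsub>free4 R\<^esub> (a, b, c, e) = (\<ominus> a, \<ominus> b, \<ominus> c, \<ominus> e)"
proof -
  interpret W: module R "free4 R" by (rule module_free4)
  show ?thesis by (rule W.M.minus_equality) (use assms in \<open>auto simp: free4_simps l_neg\<close>)
qed

lemma free4_minus:
  assumes "a \<in> carrier R" "b \<in> carrier R" "c \<in> carrier R" "e \<in> carrier R"
    "a' \<in> carrier R" "b' \<in> carrier R" "c' \<in> carrier R" "e' \<in> carrier R"
  shows "(a, b, c, e) \<ominus>\<^bsub>free4 R\<^esub> (a', b', c', e') = (a \<ominus> a', b \<ominus> b', c \<ominus> c', e \<ominus> e')"
  using assms by (simp add: a_minus_def[of "free4 R"] free4_uminus free4_simps minus_eq)

text \<open>Generation is expressed by a sum over a set, so the four unit vectors have to be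
  distinct; \<open>\<one> \<noteq> \<zero>\<close> guarantees this.\<close>

lemma fg_free4:
  assumes "\<one> \<noteq> \<zero>" shows "fg_module R (free4 R)"
proof -
  interpret W: module R "free4 R" by (rule module_free4)
  let ?e1 = "(\<one>, \<zero>, \<zero>, \<zero>)" and ?e2 = "(\<zero>, \<one>, \<zero>, \<zero>)" and ?e3 = "(\<zero>, \<zero>, \<one>, \<zero>)" and ?e4 = "(\<zero>, \<zero>, \<zero>, \<one>)"
  let ?G = "{?e1, ?e2, ?e3, ?e4}"
  have "\<exists>c\<in>?G \<rightarrow> carrier R. w = (\<Oplus>\<^bsub>free4 R\<^esub>x\<in>?G. c x \<odot>\<^bsub>free4 R\<^esub> x)" if w: "w \<in> carrier (free4 R)" for w
  proof -
    obtain a b c e where w: "w = (a, b, c, e)" "a \<in> carrier R" "b \<in> carrier R" "c \<in> carrier R" "e \<in> carrier R"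
      using w by (auto simp: free4_simps)
    define k where "k x = (if x = ?e1 then a else if x = ?e2 then b else if x = ?e3 then c else e)" for x
    have k: "k ?e1 = a" "k ?e2 = b" "k ?e3 = c" "k ?e4 = e" using assms by (auto simp: k_def)
    have kc: "k x \<in> carrier R" for x using w by (simp add: k_def)
    have eW: "?e1 \<in> carrier (free4 R)" "?e2 \<in> carrier (free4 R)" "?e3 \<in> carrier (free4 R)" "?e4 \<in> carrier (free4 R)"
      by (simp_all add: free4_simps)
    have ne: "?e1 \<notin> {?e2, ?e3, ?e4}" "?e2 \<notin> {?e3, ?e4}" "?e3 \<notin> {?e4}" using assms by auto
    have f: "(\<lambda>x. k x \<odot>\<^bsub>free4 R\<^esub> x) \<in> S \<rightarrow> carrier (free4 R)" if "S \<subseteq> carrier (free4 R)" for S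
      using kc that by auto
    have ins: "(\<Oplus>\<^bsub>free4 R\<^esub>x\<in>insert g S. k x \<odot>\<^bsub>free4 R\<^esub> x)
        = k g \<odot>\<^bsub>free4 R\<^esub> g \<oplus>\<^bsub>free4 R\<^esub> (\<Oplus>\<^bsub>free4 R\<^esub>x\<in>S. k x \<odot>\<^bsub>free4 R\<^esub> x)"
      if "finite S" "g \<notin> S" "S \<subseteq> carrier (free4 R)" "g \<in> carrier (free4 R)" for g S
      using that f[OF that(3)] kc by (intro W.M.finsum_insert) auto
    have "(\<Oplus>\<^bsub>free4 R\<^esub>x\<in>?G. k x \<odot>\<^bsub>free4 R\<^esub> x) = k ?e1 \<odot>\<^bsub>free4 R\<^esub> ?e1 \<oplus>\<^bsub>free4 R\<^esub> (k ?e2 \<odot>\<^bsub>free4 R\<^esub> ?e2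
        \<oplus>\<^bsub>free4 R\<^esub> (k ?e3 \<odot>\<^bsub>free4 R\<^esub> ?e3 \<oplus>\<^bsub>free4 R\<^esub> (k ?e4 \<odot>\<^bsub>free4 R\<^esub> ?e4 \<oplus>\<^bsub>free4 R\<^esub> \<zero>\<^bsub>free4 R\<^esub>)))"
      using ne eW by (simp only: ins finite.intros insert_subset empty_subsetI W.M.finsum_empty empty_iff not_False_eq_True simp_thms)
    also have "\<dots> = w" unfolding k using w by (simp add: free4_simps)
    finally show ?thesis using kc by (intro bexI[of _ k]) auto
  qed
  then show ?thesis unfolding fg_module_def
    by (intro conjI module_free4 exI[of _ ?G]) (auto simp: free4_simps)
qed

end

locale factorization_module = binomial_hypersurface K I A \<Theta> d u v
  for K (structure) and I :: "'v::wellorder set" and A :: "('h, 'n) ring_scheme" and \<Theta> d u v +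
  fixes y z l :: "'v multiset \<Rightarrow> 'a"
  assumes yzl: "y \<in> var_ideal (I - {u, v})" "z \<in> var_ideal (I - {u, v})" "l \<in> var_ideal (I - {u, v})"
    and yz: "y \<otimes>\<^bsub>T\<^esub> z = ps_term K \<one> d"
begin

lemma yzl_closed [simp]: "y \<in> carrier T" "z \<in> carrier T" "l \<in> carrier T"
  using yzl by (auto simp: var_ideal_iff)

lemma var_closed [simp]: "x \<in> I \<Longrightarrow> var x \<in> carrier T"
  by (intro ps_term_closed) auto

lemma uv_closed [simp]: "var u \<in> carrier T" "var v \<in> carrier T"
  using uv by auto

lemma F_eq: "F = y \<otimes>\<^bsub>T\<^esub> z \<ominus>\<^bsub>T\<^esub> var u \<otimes>\<^bsub>T\<^esub> var v"
  unfolding F_def yz using uv by (simp add: ps_term_mult add_mset_commute[of v u])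

abbreviation W where "W \<equiv> free4 T"

text \<open>In 2 by 2 blocks the matrix is (u M; N v) with M = (y l; 0 z) and N = (z -l; 0 y), so
  that M N = N M = y z. Its partner \<Psi> is (-v M; N -u). The off-diagonal entry l ties the two
  factors y and z together in M and is the parameter to be varied; it drops out of both
  products.\<close>

fun \<Phi> where
  "\<Phi> (a, b, c, e) =
    (var u \<otimes>\<^bsub>T\<^esub> a \<oplus>\<^bsub>T\<^esub> y \<otimes>\<^bsub>T\<^esub> c \<oplus>\<^bsub>T\<^esub> l \<otimes>\<^bsub>T\<^esub> e, var u \<otimes>\<^bsub>T\<^esub> b \<oplus>\<^bsub>T\<^esub> z \<otimes>\<^bsub>T\<^esub> e,
     z \<otimes>\<^bsub>T\<^esub> a \<ominus>\<^bsub>T\<^esub> l \<otimes>\<^bsub>T\<^esub> b \<oplus>\<^bsub>T\<^esub> var v \<otimes>\<^bsub>T\<^esub> c, y \<otimes>\<^bsub>T\<^esub> b \<oplus>\<^bsub>T\<^esub> var v \<otimes>\<^bsub>T\<^esub> e)"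

fun \<Psi> where
  "\<Psi> (a, b, c, e) =
    (y \<otimes>\<^bsub>T\<^esub> c \<oplus>\<^bsub>T\<^esub> l \<otimes>\<^bsub>T\<^esub> e \<ominus>\<^bsub>T\<^esub> var v \<otimes>\<^bsub>T\<^esub> a, z \<otimes>\<^bsub>T\<^esub> e \<ominus>\<^bsub>T\<^esub> var v \<otimes>\<^bsub>T\<^esub> b,
     z \<otimes>\<^bsub>T\<^esub> a \<ominus>\<^bsub>T\<^esub> l \<otimes>\<^bsub>T\<^esub> b \<ominus>\<^bsub>T\<^esub> var u \<otimes>\<^bsub>T\<^esub> c, y \<otimes>\<^bsub>T\<^esub> b \<ominus>\<^bsub>T\<^esub> var u \<otimes>\<^bsub>T\<^esub> e)"

definition H where "H = \<Phi> ` carrier W"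

sublocale W: module T W by (rule T.module_free4)

lemma \<Phi>_closed: "n \<in> carrier W \<Longrightarrow> \<Phi> n \<in> carrier W"
  by (auto simp: free4_simps simp del: coeff_add)

lemma \<Psi>_closed: "n \<in> carrier W \<Longrightarrow> \<Psi> n \<in> carrier W"
  by (auto simp: free4_simps simp del: coeff_add)

lemma \<Phi>_add: "m \<in> carrier W \<Longrightarrow> n \<in> carrier W \<Longrightarrow> \<Phi> (m \<oplus>\<^bsub>W\<^esub> n) = \<Phi> m \<oplus>\<^bsub>W\<^esub> \<Phi> n"
  using yzl_closed uv_closed
  by (cases m; cases n) (simp only: free4_simps \<Phi>.simps mem_Times_iff fst_conv snd_conv prod.inject, elim conjE, intro conjI; algebra)

lemma \<Phi>_smult: "r \<in> carrier T \<Longrightarrow> n \<in> carrier W \<Longrightarrow> \<Phi> (r \<odot>\<^bsub>W\<^esub> n) = r \<odot>\<^bsub>W\<^esub> \<Phi> n"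
  using yzl_closed uv_closed
  by (cases n) (simp only: free4_simps \<Phi>.simps mem_Times_iff fst_conv snd_conv prod.inject, elim conjE, intro conjI; algebra)

lemma H_submodule: "submodule H T W"
proof (rule W.submoduleI)
  show "H \<subseteq> carrier W" using \<Phi>_closed by (auto simp: H_def)
  have "\<Phi> (\<zero>\<^bsub>T\<^esub> \<odot>\<^bsub>W\<^esub> \<zero>\<^bsub>W\<^esub>) = \<zero>\<^bsub>T\<^esub> \<odot>\<^bsub>W\<^esub> \<Phi> \<zero>\<^bsub>W\<^esub>" by (intro \<Phi>_smult) auto
  then have "\<Phi> \<zero>\<^bsub>W\<^esub> = \<zero>\<^bsub>W\<^esub>" using \<Phi>_closed by (simp only: W.smult_l_null W.M.zero_closed)
  then show "\<zero>\<^bsub>W\<^esub> \<in> H" unfolding H_def by (metis W.M.zero_closed imageI)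
next
  fix h assume "h \<in> H"
  then obtain n where n: "n \<in> carrier W" "h = \<Phi> n" by (auto simp: H_def)
  have "\<Phi> ((\<ominus>\<^bsub>T\<^esub> \<one>\<^bsub>T\<^esub>) \<odot>\<^bsub>W\<^esub> n) = \<ominus>\<^bsub>W\<^esub> h"
    using \<Phi>_smult[of "\<ominus>\<^bsub>T\<^esub> \<one>\<^bsub>T\<^esub>" n] n \<Phi>_closed[OF n(1)] by (simp add: W.smult_l_minus)
  then show "\<ominus>\<^bsub>W\<^esub> h \<in> H" unfolding H_def using n(1) by (metis W.smult_closed T.a_inv_closed T.one_closed imageI)
  { fix h' assume "h' \<in> H"
    then obtain n' where "n' \<in> carrier W" "h' = \<Phi> n'" by (auto simp: H_def)
    then show "h \<oplus>\<^bsub>W\<^esub> h' \<in> H" unfolding H_def using n by (metis \<Phi>_add W.M.a_closed imageI) }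
  { fix r assume "r \<in> carrier T"
    then show "r \<odot>\<^bsub>W\<^esub> h \<in> H" unfolding H_def using n by (metis \<Phi>_smult W.smult_closed imageI) }
qed

text \<open>The two products of the factorization do different work. That \<Phi> after \<Psi> is
  multiplication by F shows that F kills the cokernel; that \<Psi> after \<Phi> is multiplication by
  F allows conclusions from \<open>\<Phi> w\<close> back to \<open>w\<close>.\<close>

lemma F_smult_in_H:
  assumes "w \<in> carrier W" shows "F \<odot>\<^bsub>W\<^esub> w \<in> H"
proof -
  obtain a b c e where w: "w = (a, b, c, e)" "a \<in> carrier T" "b \<in> carrier T" "c \<in> carrier T" "e \<in> carrier T"
    using assms by (auto simp: free4_simps)
  have "\<Phi> (\<Psi> w) = F \<odot>\<^bsub>W\<^esub> w"
    unfolding w(1) free4_simps \<Phi>.simps \<Psi>.simps F_eq prod.inject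
    using w(2-) yzl_closed uv_closed by (intro conjI; algebra)
  then show ?thesis unfolding H_def using \<Psi>_closed[OF assms] by (metis imageI)
qed

lemma \<Psi>_\<Phi>:
  assumes "w \<in> carrier W" shows "\<Psi> (\<Phi> w) = F \<odot>\<^bsub>W\<^esub> w"
proof -
  obtain a b c e where w: "w = (a, b, c, e)" "a \<in> carrier T" "b \<in> carrier T" "c \<in> carrier T" "e \<in> carrier T"
    using assms by (auto simp: free4_simps)
  then show ?thesis
    unfolding w(1) free4_simps \<Phi>.simps \<Psi>.simps F_eq prod.inject
    using w(2-) yzl_closed uv_closed by (intro conjI; algebra)
qed

sublocale Q: module_quotient T W H A \<Theta>
proof (intro module_quotient.intro W.module_axioms module_quotient_axioms.intro H_submodule A hom surj)
  fix P w assume P: "P \<in> carrier T" "\<Theta> P = \<zero>\<^bsub>A\<^esub>" and w: "w \<in> carrier W"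
  then obtain G where G: "G \<in> carrier T" "P = G \<otimes>\<^bsub>T\<^esub> F" using ker[of P] by (auto simp: F_def)
  have "P \<odot>\<^bsub>W\<^esub> w = G \<odot>\<^bsub>W\<^esub> (F \<odot>\<^bsub>W\<^esub> w)" using G w by (simp add: W.smult_assoc1)
  then show "P \<odot>\<^bsub>W\<^esub> w \<in> H" using G w W.submodule_mem(5)[OF H_submodule] F_smult_in_H by simp
qed

abbreviation Q where "Q \<equiv> quot_module T W H \<Theta>"

sublocale R: residue_module A Q K \<epsilon>
  by (intro residue_module.intro residue_module_axioms.intro Q.module_quot field_axioms \<epsilon>_hom \<epsilon>_unit)

lemma T_one_not_zero: "\<one>\<^bsub>T\<^esub> \<noteq> \<zero>\<^bsub>T\<^esub>"
proof
  assume "\<one>\<^bsub>T\<^esub> = \<zero>\<^bsub>T\<^esub>"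
  then have "\<one>\<^bsub>T\<^esub> {#} = \<zero>\<^bsub>T\<^esub> {#}" by (simp only:)
  then show False by (simp add: coeff_one)
qed

lemma fg_Q: "fg_module A Q"
  by (rule Q.fg_quot[OF T.fg_free4[OF T_one_not_zero]])

section \<open>A regular sequence on the cokernel\<close>

lemma seq_submodule_vars:
  assumes "set xs \<subseteq> I"
  shows "seq_submodule W (map var xs) =
    var_ideal (set xs) \<times> var_ideal (set xs) \<times> var_ideal (set xs) \<times> var_ideal (set xs)"
  using assms
proof (induction xs)
  case Nil
  then show ?case by (auto simp: free4_simps var_ideal_empty)
next
  case (Cons x xs)
  let ?p = "var_ideal (set xs)" and ?q = "var_ideal (insert x (set xs))"
  have x: "x \<in> I" using Cons.prems by simp
  have IH: "seq_submodule W (map var xs) = ?p \<times> ?p \<times> ?p \<times> ?p" using Cons by simp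
  show ?case
  proof (intro equalityI subsetI)
    fix w assume "w \<in> seq_submodule W (map var (x # xs))"
    then obtain n p where w: "n \<in> carrier W" "p \<in> ?p \<times> ?p \<times> ?p \<times> ?p" "w = var x \<odot>\<^bsub>W\<^esub> n \<oplus>\<^bsub>W\<^esub> p" using IH by auto
    obtain n1 n2 n3 n4 p1 p2 p3 p4 where np: "n = (n1, n2, n3, n4)" "p = (p1, p2, p3, p4)" by (cases n, cases p)
    show "w \<in> var_ideal (set (x # xs)) \<times> var_ideal (set (x # xs)) \<times> var_ideal (set (x # xs)) \<times> var_ideal (set (x # xs))"
      using w x unfolding np free4_simps by (simp del: coeff_add add: var_mult_add_mem)
  next
    fix w assume "w \<in> var_ideal (set (x # xs)) \<times> var_ideal (set (x # xs)) \<times> var_ideal (set (x # xs)) \<times> var_ideal (set (x # xs))"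
    then obtain w1 w2 w3 w4 where w: "w = (w1, w2, w3, w4)" "w1 \<in> ?q" "w2 \<in> ?q" "w3 \<in> ?q" "w4 \<in> ?q" by auto
    obtain a1 b1 where 1: "a1 \<in> carrier T" "b1 \<in> ?p" "w1 = var x \<otimes>\<^bsub>T\<^esub> a1 \<oplus>\<^bsub>T\<^esub> b1" using w(2) x by (rule var_ideal_insertE)
    obtain a2 b2 where 2: "a2 \<in> carrier T" "b2 \<in> ?p" "w2 = var x \<otimes>\<^bsub>T\<^esub> a2 \<oplus>\<^bsub>T\<^esub> b2" using w(3) x by (rule var_ideal_insertE)
    obtain a3 b3 where 3: "a3 \<in> carrier T" "b3 \<in> ?p" "w3 = var x \<otimes>\<^bsub>T\<^esub> a3 \<oplus>\<^bsub>T\<^esub> b3" using w(4) x by (rule var_ideal_insertE)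
    obtain a4 b4 where 4: "a4 \<in> carrier T" "b4 \<in> ?p" "w4 = var x \<otimes>\<^bsub>T\<^esub> a4 \<oplus>\<^bsub>T\<^esub> b4" using w(5) x by (rule var_ideal_insertE)
    have "w = var x \<odot>\<^bsub>W\<^esub> (a1, a2, a3, a4) \<oplus>\<^bsub>W\<^esub> (b1, b2, b3, b4)"
      unfolding w 1(3) 2(3) 3(3) 4(3) free4_simps by (rule refl)
    moreover have "(a1, a2, a3, a4) \<in> carrier W" using 1 2 3 4 by (simp add: free4_simps)
    moreover have "(b1, b2, b3, b4) \<in> seq_submodule W (map var xs)" unfolding IH using 1 2 3 4 by simp
    ultimately show "w \<in> seq_submodule W (map var (x # xs))"
      unfolding list.map seq_submodule.simps by blast
  qed
qed

abbreviation P4 where "P4 \<pp> \<equiv> \<pp> \<times> \<pp> \<times> \<pp> \<times> \<pp>"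

lemma P4_closed:
  assumes "ideal \<pp> T"
  shows "submodule (P4 \<pp>) T W" "w \<in> P4 \<pp> \<Longrightarrow> \<Phi> w \<in> P4 \<pp>" "w \<in> P4 \<pp> \<Longrightarrow> \<Psi> w \<in> P4 \<pp>"
proof -
  interpret \<pp>: ideal \<pp> T by (rule assms)
  show "submodule (P4 \<pp>) T W"
    by (rule W.submoduleI)
      (auto simp: free4_simps T.free4_uminus \<pp>.Icarr \<pp>.I_l_closed simp del: coeff_add)
  show "w \<in> P4 \<pp> \<Longrightarrow> \<Phi> w \<in> P4 \<pp>" "w \<in> P4 \<pp> \<Longrightarrow> \<Psi> w \<in> P4 \<pp>"
    by (auto simp: a_minus_def intro!: \<pp>.a_closed \<pp>.a_inv_closed \<pp>.I_l_closed simp del: coeff_add)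
qed

text \<open>The term \<open>x\<^sub>u x\<^sub>v\<close> of F survives when variables of J are set to
  zero.\<close>

lemma F_notin: "J' \<subseteq> J \<Longrightarrow> F \<notin> var_ideal J'"
  unfolding var_ideal_iff by (auto intro!: exI[of _ "{#u, v#}"] simp: F_coeff d_neq)

text \<open>Let \<open>?p\<close> be generated by the variables in J' and \<open>?q\<close> by these
  and x. From \<open>x w - s = \<Phi> n\<close> and the factorization, \<open>F n\<close> has
  components in the prime \<open>?q\<close>, which does not contain F; so \<open>n = x a + b\<close>
  with b in \<open>?p\<close>. Then \<open>x (w - \<Phi> a)\<close> equals
  \<open>\<Phi> b + s\<close>, which lies in \<open>?p\<close>, and \<open>?p\<close> is a prime
  without x. Hence \<open>w - \<Phi> a\<close> can serve as \<open>s'\<close>.\<close>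

lemma colon_var:
  assumes J': "J' \<subseteq> J" and x: "x \<in> J" "x \<notin> J'" and w: "w \<in> carrier W" and s: "s \<in> P4 (var_ideal J')"
    and mem: "var x \<odot>\<^bsub>W\<^esub> w \<ominus>\<^bsub>W\<^esub> s \<in> H"
  shows "\<exists>s'\<in>P4 (var_ideal J'). w \<ominus>\<^bsub>W\<^esub> s' \<in> H"
proof -
  let ?p = "var_ideal J'" and ?q = "var_ideal (insert x J')"
  have xI: "x \<in> I" using x by simp
  interpret p: primeideal ?p T by (rule primeideal_var_ideal)
  interpret q: primeideal ?q T by (rule primeideal_var_ideal)
  note Sp = W.submodule_mem[OF P4_closed(1)[OF p.is_ideal]] and Sq = W.submodule_mem[OF P4_closed(1)[OF q.is_ideal]]
  have pq: "P4 ?p \<subseteq> P4 ?q" using var_ideal_mono[of J' "insert x J'"] by blast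
  have sW: "s \<in> carrier W" using s Sp(1) by blast
  obtain n where n: "n \<in> carrier W" "var x \<odot>\<^bsub>W\<^esub> w \<ominus>\<^bsub>W\<^esub> s = \<Phi> n" using mem by (auto simp: H_def)
  have xq: "var x \<in> ?q" using xI by (simp add: var_in_var_ideal_iff)
  have "var x \<odot>\<^bsub>W\<^esub> w \<in> P4 ?q" using w xq by (auto simp: free4_simps q.I_r_closed)
  then have "\<Phi> n \<in> P4 ?q" unfolding n(2)[symmetric] W.M.minus_eq using s pq by (intro Sq(3,4)) auto
  then have Fn: "F \<odot>\<^bsub>W\<^esub> n \<in> P4 ?q" using P4_closed(3)[OF q.is_ideal] \<Psi>_\<Phi>[OF n(1)] by metis
  have Fq: "F \<notin> ?q" using J' x by (intro F_notin) auto
  obtain n1 n2 n3 n4 where n4: "n = (n1, n2, n3, n4)" "n1 \<in> carrier T" "n2 \<in> carrier T" "n3 \<in> carrier T" "n4 \<in> carrier T"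
    using n(1) by (auto simp: free4_simps)
  have nq: "n1 \<in> ?q" "n2 \<in> ?q" "n3 \<in> ?q" "n4 \<in> ?q"
  proof -
    have "F \<otimes>\<^bsub>T\<^esub> n1 \<in> ?q" "F \<otimes>\<^bsub>T\<^esub> n2 \<in> ?q" "F \<otimes>\<^bsub>T\<^esub> n3 \<in> ?q" "F \<otimes>\<^bsub>T\<^esub> n4 \<in> ?q"
      using Fn unfolding n4(1) free4_simps by (simp_all only: mem_Times_iff fst_conv snd_conv)
    then show "n1 \<in> ?q" "n2 \<in> ?q" "n3 \<in> ?q" "n4 \<in> ?q"
      using q.I_prime[OF F_closed] n4(2-) Fq by blast+
  qed
  obtain a1 b1 where 1: "a1 \<in> carrier T" "b1 \<in> ?p" "n1 = var x \<otimes>\<^bsub>T\<^esub> a1 \<oplus>\<^bsub>T\<^esub> b1" using nq(1) xI by (rule var_ideal_insertE)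
  obtain a2 b2 where 2: "a2 \<in> carrier T" "b2 \<in> ?p" "n2 = var x \<otimes>\<^bsub>T\<^esub> a2 \<oplus>\<^bsub>T\<^esub> b2" using nq(2) xI by (rule var_ideal_insertE)
  obtain a3 b3 where 3: "a3 \<in> carrier T" "b3 \<in> ?p" "n3 = var x \<otimes>\<^bsub>T\<^esub> a3 \<oplus>\<^bsub>T\<^esub> b3" using nq(3) xI by (rule var_ideal_insertE)
  obtain a4 b4 where 4: "a4 \<in> carrier T" "b4 \<in> ?p" "n4 = var x \<otimes>\<^bsub>T\<^esub> a4 \<oplus>\<^bsub>T\<^esub> b4" using nq(4) xI by (rule var_ideal_insertE)
  define a where "a = (a1, a2, a3, a4)"
  define b where "b = (b1, b2, b3, b4)"
  have ab: "a \<in> carrier W" "b \<in> P4 ?p" "n = var x \<odot>\<^bsub>W\<^esub> a \<oplus>\<^bsub>W\<^esub> b"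
    unfolding n4(1) a_def b_def free4_simps 1(3) 2(3) 3(3) 4(3) using 1(1,2) 2(1,2) 3(1,2) 4(1,2)
    by (blast intro: SigmaI refl)+
  have bW: "b \<in> carrier W" using ab(2) Sp(1) by blast
  note c = ab(1) bW w sW \<Phi>_closed[OF ab(1)] \<Phi>_closed[OF bW] var_closed[OF xI]
  define s' where "s' = w \<ominus>\<^bsub>W\<^esub> \<Phi> a"
  have s'W: "s' \<in> carrier W" using c by (simp add: s'_def)
  have "\<Phi> n = var x \<odot>\<^bsub>W\<^esub> \<Phi> a \<oplus>\<^bsub>W\<^esub> \<Phi> b" unfolding ab(3) using c by (simp add: \<Phi>_add \<Phi>_smult)
  then have e: "var x \<odot>\<^bsub>W\<^esub> w \<ominus>\<^bsub>W\<^esub> s = var x \<odot>\<^bsub>W\<^esub> \<Phi> a \<oplus>\<^bsub>W\<^esub> \<Phi> b" using n(2) by simp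
  have "var x \<odot>\<^bsub>W\<^esub> w = (var x \<odot>\<^bsub>W\<^esub> w \<ominus>\<^bsub>W\<^esub> s) \<oplus>\<^bsub>W\<^esub> s" using c by (simp add: W.M.minus_eq W.M.a_assoc W.M.l_neg)
  then have e': "var x \<odot>\<^bsub>W\<^esub> w = var x \<odot>\<^bsub>W\<^esub> \<Phi> a \<oplus>\<^bsub>W\<^esub> (\<Phi> b \<oplus>\<^bsub>W\<^esub> s)" unfolding e using c by (simp add: W.M.a_assoc)
  have "var x \<odot>\<^bsub>W\<^esub> s' = var x \<odot>\<^bsub>W\<^esub> w \<ominus>\<^bsub>W\<^esub> var x \<odot>\<^bsub>W\<^esub> \<Phi> a"
    unfolding s'_def using c by (simp add: W.M.minus_eq W.smult_r_distr W.smult_r_minus)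
  also have "\<dots> = \<Phi> b \<oplus>\<^bsub>W\<^esub> s" unfolding e' using c
    by (simp add: W.M.minus_eq W.M.a_ac[of "var x \<odot>\<^bsub>W\<^esub> \<Phi> a"] W.M.a_assoc W.M.r_neg)
  also have "\<dots> \<in> P4 ?p" by (intro Sp(3) P4_closed(2)[OF p.is_ideal] ab s)
  finally have xs': "var x \<odot>\<^bsub>W\<^esub> s' \<in> P4 ?p" .
  have "var x \<notin> ?p" using xI x by (simp add: var_in_var_ideal_iff)
  then have "s' \<in> P4 ?p" using xs' s'W p.I_prime[OF var_closed[OF xI]] by (cases s') (auto simp: free4_simps)
  moreover have "w \<ominus>\<^bsub>W\<^esub> s' = \<Phi> a"
    unfolding s'_def using c by (simp add: W.M.minus_eq W.M.minus_add W.M.a_assoc[symmetric] W.M.r_neg)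
  then have "w \<ominus>\<^bsub>W\<^esub> s' \<in> H" using ab(1) by (simp add: H_def)
  ultimately show ?thesis by blast
qed

text \<open>Modulo the variables in J the entries y, z and l vanish, and \<Phi> becomes diagonal
  with entries u, u, v, v. In the first two components the equation says that
  \<open>(u + v) w\<close> is a multiple of u, so \<open>v w\<close> is one, and so is w because u
  generates a prime without v. In the last two components u and v are exchanged.\<close>

lemma colon_uv:
  assumes w: "w \<in> carrier W" and s: "s \<in> P4 (var_ideal J)"
    and mem: "(var u \<oplus>\<^bsub>T\<^esub> var v) \<odot>\<^bsub>W\<^esub> w \<ominus>\<^bsub>W\<^esub> s \<in> H"
  shows "\<exists>s'\<in>P4 (var_ideal J). w \<ominus>\<^bsub>W\<^esub> s' \<in> H"
proof -
  let ?p = "var_ideal J" and ?qu = "var_ideal (insert u J)" and ?qv = "var_ideal (insert v J)"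
  interpret p: primeideal ?p T by (rule primeideal_var_ideal)
  interpret qu: primeideal ?qu T by (rule primeideal_var_ideal)
  interpret qv: primeideal ?qv T by (rule primeideal_var_ideal)
  obtain n where n: "n \<in> carrier W" "(var u \<oplus>\<^bsub>T\<^esub> var v) \<odot>\<^bsub>W\<^esub> w \<ominus>\<^bsub>W\<^esub> s = \<Phi> n" using mem by (auto simp: H_def)
  obtain n1 n2 n3 n4 where n4: "n = (n1, n2, n3, n4)" "n1 \<in> carrier T" "n2 \<in> carrier T" "n3 \<in> carrier T" "n4 \<in> carrier T"
    using n(1) by (auto simp: free4_simps)
  obtain w1 w2 w3 w4 where w4: "w = (w1, w2, w3, w4)" "w1 \<in> carrier T" "w2 \<in> carrier T" "w3 \<in> carrier T" "w4 \<in> carrier T"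
    using w by (auto simp: free4_simps)
  obtain s1 s2 s3 s4 where s4: "s = (s1, s2, s3, s4)" "s1 \<in> ?p" "s2 \<in> ?p" "s3 \<in> ?p" "s4 \<in> ?p"
    using s by auto
  have sc: "s1 \<in> carrier T" "s2 \<in> carrier T" "s3 \<in> carrier T" "s4 \<in> carrier T" using s4 p.Icarr by auto
  note cl = w4(2-) n4(2-) sc yzl_closed uv_closed
  let ?t = "var u \<oplus>\<^bsub>T\<^esub> var v"
  have E: "?t \<otimes>\<^bsub>T\<^esub> w1 \<ominus>\<^bsub>T\<^esub> s1 = var u \<otimes>\<^bsub>T\<^esub> n1 \<oplus>\<^bsub>T\<^esub> y \<otimes>\<^bsub>T\<^esub> n3 \<oplus>\<^bsub>T\<^esub> l \<otimes>\<^bsub>T\<^esub> n4"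
    "?t \<otimes>\<^bsub>T\<^esub> w2 \<ominus>\<^bsub>T\<^esub> s2 = var u \<otimes>\<^bsub>T\<^esub> n2 \<oplus>\<^bsub>T\<^esub> z \<otimes>\<^bsub>T\<^esub> n4"
    "?t \<otimes>\<^bsub>T\<^esub> w3 \<ominus>\<^bsub>T\<^esub> s3 = z \<otimes>\<^bsub>T\<^esub> n1 \<ominus>\<^bsub>T\<^esub> l \<otimes>\<^bsub>T\<^esub> n2 \<oplus>\<^bsub>T\<^esub> var v \<otimes>\<^bsub>T\<^esub> n3"
    "?t \<otimes>\<^bsub>T\<^esub> w4 \<ominus>\<^bsub>T\<^esub> s4 = y \<otimes>\<^bsub>T\<^esub> n2 \<oplus>\<^bsub>T\<^esub> var v \<otimes>\<^bsub>T\<^esub> n4"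
    using n(2) cl unfolding w4(1) s4(1) n4(1) by (simp_all add: free4_simps T.free4_minus del: coeff_add)
  \<comment> \<open>Moves the part of the left side that is a multiple of the diagonal entry U to
    the right; used with (U, V) = (u, v) and (v, u).\<close>
  have solve: "V \<otimes>\<^bsub>T\<^esub> w = U \<otimes>\<^bsub>T\<^esub> (n \<ominus>\<^bsub>T\<^esub> w) \<oplus>\<^bsub>T\<^esub> (r \<oplus>\<^bsub>T\<^esub> s)"
    if "(U \<oplus>\<^bsub>T\<^esub> V) \<otimes>\<^bsub>T\<^esub> w \<ominus>\<^bsub>T\<^esub> s = U \<otimes>\<^bsub>T\<^esub> n \<oplus>\<^bsub>T\<^esub> r" "U \<in> carrier T" "V \<in> carrier T" "w \<in> carrier T"
      "s \<in> carrier T" "n \<in> carrier T" "r \<in> carrier T" for U V w s n r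
  proof -
    have "V \<otimes>\<^bsub>T\<^esub> w = ((U \<oplus>\<^bsub>T\<^esub> V) \<otimes>\<^bsub>T\<^esub> w \<ominus>\<^bsub>T\<^esub> s) \<oplus>\<^bsub>T\<^esub> s \<ominus>\<^bsub>T\<^esub> U \<otimes>\<^bsub>T\<^esub> w" using that(2-) by algebra
    also have "\<dots> = U \<otimes>\<^bsub>T\<^esub> (n \<ominus>\<^bsub>T\<^esub> w) \<oplus>\<^bsub>T\<^esub> (r \<oplus>\<^bsub>T\<^esub> s)" unfolding that(1) using that(2-) by algebra
    finally show ?thesis .
  qed
  have nv: "var v \<notin> ?qu" "var u \<notin> ?qv" using uv by (auto simp: var_in_var_ideal_iff)
  have pm: "a \<ominus>\<^bsub>T\<^esub> b \<in> ?p" if "a \<in> ?p" "b \<in> ?p" for a b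
    unfolding a_minus_def using that by (intro p.a_closed p.a_inv_closed)
  have "var v \<otimes>\<^bsub>T\<^esub> w1 = var u \<otimes>\<^bsub>T\<^esub> (n1 \<ominus>\<^bsub>T\<^esub> w1) \<oplus>\<^bsub>T\<^esub> ((y \<otimes>\<^bsub>T\<^esub> n3 \<oplus>\<^bsub>T\<^esub> l \<otimes>\<^bsub>T\<^esub> n4) \<oplus>\<^bsub>T\<^esub> s1)"
    by (rule solve) (use E(1) cl in \<open>simp_all add: T.a_assoc del: coeff_add\<close>)
  also have "\<dots> \<in> ?qu"
    by (rule var_mult_add_mem[OF _ _ uv(1)]) (intro T.minus_closed cl pm p.a_closed p.I_r_closed yzl s4(2-))+
  finally have "w1 \<in> ?qu" using qu.I_prime[OF uv_closed(2) w4(2)] nv by blast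
  then obtain a1 b1 where 1: "a1 \<in> carrier T" "b1 \<in> ?p" "w1 = var u \<otimes>\<^bsub>T\<^esub> a1 \<oplus>\<^bsub>T\<^esub> b1" using uv(1) by (rule var_ideal_insertE)
  have "var v \<otimes>\<^bsub>T\<^esub> w2 = var u \<otimes>\<^bsub>T\<^esub> (n2 \<ominus>\<^bsub>T\<^esub> w2) \<oplus>\<^bsub>T\<^esub> (z \<otimes>\<^bsub>T\<^esub> n4 \<oplus>\<^bsub>T\<^esub> s2)"
    by (rule solve) (use E(2) cl in \<open>simp_all del: coeff_add\<close>)
  also have "\<dots> \<in> ?qu"
    by (rule var_mult_add_mem[OF _ _ uv(1)]) (intro T.minus_closed cl pm p.a_closed p.I_r_closed yzl s4(2-))+
  finally have "w2 \<in> ?qu" using qu.I_prime[OF uv_closed(2) w4(3)] nv by blast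
  then obtain a2 b2 where 2: "a2 \<in> carrier T" "b2 \<in> ?p" "w2 = var u \<otimes>\<^bsub>T\<^esub> a2 \<oplus>\<^bsub>T\<^esub> b2" using uv(1) by (rule var_ideal_insertE)
  have "var u \<otimes>\<^bsub>T\<^esub> w3 = var v \<otimes>\<^bsub>T\<^esub> (n3 \<ominus>\<^bsub>T\<^esub> w3) \<oplus>\<^bsub>T\<^esub> ((z \<otimes>\<^bsub>T\<^esub> n1 \<ominus>\<^bsub>T\<^esub> l \<otimes>\<^bsub>T\<^esub> n2) \<oplus>\<^bsub>T\<^esub> s3)"
    by (rule solve) (use E(3) cl in \<open>simp_all add: T.a_comm del: coeff_add\<close>)
  also have "\<dots> \<in> ?qv"
    by (rule var_mult_add_mem[OF _ _ uv(2)]) (intro T.minus_closed cl pm p.a_closed p.I_r_closed yzl s4(2-))+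
  finally have "w3 \<in> ?qv" using qv.I_prime[OF uv_closed(1) w4(4)] nv by blast
  then obtain a3 b3 where 3: "a3 \<in> carrier T" "b3 \<in> ?p" "w3 = var v \<otimes>\<^bsub>T\<^esub> a3 \<oplus>\<^bsub>T\<^esub> b3" using uv(2) by (rule var_ideal_insertE)
  have "var u \<otimes>\<^bsub>T\<^esub> w4 = var v \<otimes>\<^bsub>T\<^esub> (n4 \<ominus>\<^bsub>T\<^esub> w4) \<oplus>\<^bsub>T\<^esub> (y \<otimes>\<^bsub>T\<^esub> n2 \<oplus>\<^bsub>T\<^esub> s4)"
    by (rule solve) (use E(4) cl in \<open>simp_all add: T.a_comm del: coeff_add\<close>)
  also have "\<dots> \<in> ?qv"
    by (rule var_mult_add_mem[OF _ _ uv(2)]) (intro T.minus_closed cl pm p.a_closed p.I_r_closed yzl s4(2-))+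
  finally have "w4 \<in> ?qv" using qv.I_prime[OF uv_closed(1) w4(5)] nv by blast
  then obtain a4 b4 where 4: "a4 \<in> carrier T" "b4 \<in> ?p" "w4 = var v \<otimes>\<^bsub>T\<^esub> a4 \<oplus>\<^bsub>T\<^esub> b4" using uv(2) by (rule var_ideal_insertE)
  have bc: "b1 \<in> carrier T" "b2 \<in> carrier T" "b3 \<in> carrier T" "b4 \<in> carrier T" using 1 2 3 4 p.Icarr by auto
  define a where "a = (a1, a2, a3, a4)"
  \<comment> \<open>The coefficients \<open>a1\<close> to \<open>a4\<close> of u and v in the
    components of w form a preimage under the diagonal part of \<Phi>. Subtracting
    \<open>\<Phi> a\<close> leaves \<open>b1\<close> to \<open>b4\<close> corrected by multiples of
    y, z and l, which lie in the ideal of the variables in J.\<close>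
  define s' where "s' = (b1 \<ominus>\<^bsub>T\<^esub> (y \<otimes>\<^bsub>T\<^esub> a3 \<oplus>\<^bsub>T\<^esub> l \<otimes>\<^bsub>T\<^esub> a4), b2 \<ominus>\<^bsub>T\<^esub> z \<otimes>\<^bsub>T\<^esub> a4,
    b3 \<ominus>\<^bsub>T\<^esub> (z \<otimes>\<^bsub>T\<^esub> a1 \<ominus>\<^bsub>T\<^esub> l \<otimes>\<^bsub>T\<^esub> a2), b4 \<ominus>\<^bsub>T\<^esub> y \<otimes>\<^bsub>T\<^esub> a2)"
  have aW: "a \<in> carrier W" using 1 2 3 4 by (simp add: a_def free4_simps)
  have "s' \<in> P4 ?p" unfolding s'_def
    by (intro SigmaI pm p.a_closed p.I_r_closed yzl 1(1,2) 2(1,2) 3(1,2) 4(1,2))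
  moreover have "w \<ominus>\<^bsub>W\<^esub> s' = \<Phi> a"
  proof -
    note c = bc 1(1) 2(1) 3(1) 4(1) yzl_closed uv_closed
    have "w \<ominus>\<^bsub>W\<^esub> s' = ((var u \<otimes>\<^bsub>T\<^esub> a1 \<oplus>\<^bsub>T\<^esub> b1) \<ominus>\<^bsub>T\<^esub> (b1 \<ominus>\<^bsub>T\<^esub> (y \<otimes>\<^bsub>T\<^esub> a3 \<oplus>\<^bsub>T\<^esub> l \<otimes>\<^bsub>T\<^esub> a4)),
        (var u \<otimes>\<^bsub>T\<^esub> a2 \<oplus>\<^bsub>T\<^esub> b2) \<ominus>\<^bsub>T\<^esub> (b2 \<ominus>\<^bsub>T\<^esub> z \<otimes>\<^bsub>T\<^esub> a4),
        (var v \<otimes>\<^bsub>T\<^esub> a3 \<oplus>\<^bsub>T\<^esub> b3) \<ominus>\<^bsub>T\<^esub> (b3 \<ominus>\<^bsub>T\<^esub> (z \<otimes>\<^bsub>T\<^esub> a1 \<ominus>\<^bsub>T\<^esub> l \<otimes>\<^bsub>T\<^esub> a2)),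
        (var v \<otimes>\<^bsub>T\<^esub> a4 \<oplus>\<^bsub>T\<^esub> b4) \<ominus>\<^bsub>T\<^esub> (b4 \<ominus>\<^bsub>T\<^esub> y \<otimes>\<^bsub>T\<^esub> a2))"
      unfolding w4(1) s'_def 1(3) 2(3) 3(3) 4(3) using c by (intro T.free4_minus) simp_all
    also have "\<dots> = \<Phi> a" unfolding a_def \<Phi>.simps prod.inject using c by (intro conjI; algebra)
    finally show ?thesis .
  qed
  then have "w \<ominus>\<^bsub>W\<^esub> s' \<in> H" using aW by (simp add: H_def)
  ultimately show ?thesis by blast
qed

text \<open>Setting the variables in J to zero turns the ring into \<open>K[[u, v]]/(u v)\<close>,
  where u and v are zero divisors but their sum is not; therefore the last element is
  \<open>u + v\<close>.\<close>

definition seq where "seq = map var (sorted_list_of_set J) @ [var u \<oplus>\<^bsub>T\<^esub> var v]"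

lemma set_J: "set (sorted_list_of_set J) = J" and length_J: "length (sorted_list_of_set J) = card I - 2"
proof -
  show "set (sorted_list_of_set J) = J" using fin by simp
  have "card J = card I - card {u, v}" using uv fin by (intro card_Diff_subset) auto
  then show "length (sorted_list_of_set J) = card I - 2" using uv(3) by simp
qed

lemma length_seq: "length seq = card I - 1"
proof -
  have "card {u, v} \<le> card I" using uv fin by (intro card_mono) auto
  then show ?thesis using uv(3) unfolding seq_def length_append length_map length_J by simp
qed

lemma seq_closed: "set seq \<subseteq> {P \<in> carrier T. P {#} = \<zero>}"
proof
  fix P assume "P \<in> set seq"
  then consider x where "x \<in> J" "P = var x" | "P = var u \<oplus>\<^bsub>T\<^esub> var v"
    unfolding seq_def set_append set_map set_J by auto
  then show "P \<in> {P \<in> carrier T. P {#} = \<zero>}"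
  proof cases
    case 1
    then have "P \<in> carrier T" by simp
    with 1 show ?thesis by (simp add: ps_term_def)
  next
    case 2
    then have "P \<in> carrier T" by (simp del: coeff_add)
    moreover have "P {#} = \<zero>" unfolding 2 coeff_add by (simp add: ps_term_def)
    ultimately show ?thesis by simp
  qed
qed

lemma H_const: "h \<in> H \<Longrightarrow> fst h {#} = \<zero>"
  using yzl unfolding H_def
  by (auto simp: free4_simps coeff_mult_empty var_ideal_iff) (auto simp: ps_term_def)

lemma seq_submodule_const:
  assumes "set ss \<subseteq> {P \<in> carrier T. P {#} = \<zero>}" "s \<in> seq_submodule W ss"
  shows "s \<in> carrier W \<and> fst s {#} = \<zero>"
  using assms
proof (induction ss arbitrary: s)
  case (Cons r ss)
  then obtain n s' where s: "n \<in> carrier W" "s' \<in> seq_submodule W ss" "s = r \<odot>\<^bsub>W\<^esub> n \<oplus>\<^bsub>W\<^esub> s'" by auto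
  have r: "r \<in> carrier T" "r {#} = \<zero>" using Cons.prems(1) by auto
  have s': "s' \<in> carrier W" "fst s' {#} = \<zero>" using Cons.IH[OF _ s(2)] Cons.prems(1) by auto
  then have "s \<in> carrier W" using s r by simp
  moreover have "fst s {#} = \<zero>"
    using s s' r by (cases n; cases s') (auto simp: free4_simps coeff_mult_empty)
  ultimately show ?case by blast
qed (auto simp: free4_simps)

theorem regular_seq_Q: "regular_seq Q (map \<Theta> seq)"
  unfolding regular_seq_def
proof (intro conjI allI impI ballI)
  let ?vs = "sorted_list_of_set J"
  fix i m assume i: "i < length (map \<Theta> seq)" and m: "m \<in> carrier Q"
    and mem: "map \<Theta> seq ! i \<odot>\<^bsub>Q\<^esub> m \<in> seq_submodule Q (take i (map \<Theta> seq))"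
  obtain w where w: "w \<in> carrier W" "m = Q.q w" using m by (auto simp: Q.quot_carrier)
  have i': "i < length seq" using i by simp
  have tc: "set (take i seq) \<subseteq> carrier T" using seq_closed set_take_subset[of i seq] by auto
  have rc: "seq ! i \<in> carrier T" using seq_closed nth_mem[OF i'] by auto
  have "Q.q (seq ! i \<odot>\<^bsub>W\<^esub> w) \<in> seq_submodule Q (map \<Theta> (take i seq))"
    using mem rc w i' by (simp add: take_map Q.quot_smult)
  then obtain s where s: "s \<in> seq_submodule W (take i seq)" "seq ! i \<odot>\<^bsub>W\<^esub> w \<ominus>\<^bsub>W\<^esub> s \<in> H"
    using Q.seq_submodule_quot[OF tc, of "seq ! i \<odot>\<^bsub>W\<^esub> w"] rc w(1) by blast
  have ilen: "i \<le> length ?vs" using i' by (simp add: seq_def)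
  have ti: "take i seq = map var (take i ?vs)" using ilen by (simp add: seq_def take_map)
  have sub: "set (take i ?vs) \<subseteq> J" using set_take_subset[of i ?vs] set_J by simp
  have S: "seq_submodule W (take i seq) = P4 (var_ideal (set (take i ?vs)))"
    unfolding ti by (rule seq_submodule_vars) (use sub in auto)
  have "\<exists>s'\<in>P4 (var_ideal (set (take i ?vs))). w \<ominus>\<^bsub>W\<^esub> s' \<in> H"
  proof (cases "i < length ?vs")
    case True
    then have nth: "seq ! i = var (?vs ! i)" by (simp add: seq_def nth_append)
    have "?vs ! i \<in> J" using nth_mem[OF True] set_J by simp
    moreover have "?vs ! i \<notin> set (take i ?vs)"
      using True distinct_sorted_list_of_set[of J] by (auto simp: in_set_conv_nth nth_eq_iff_index_eq)
    ultimately show ?thesis using s w(1) unfolding S nth by (intro colon_var[OF sub])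
  next
    case False
    then have "i = length ?vs" using ilen by simp
    then have nth: "seq ! i = var u \<oplus>\<^bsub>T\<^esub> var v" and set: "set (take i ?vs) = J"
      by (simp_all add: seq_def nth_append set_J del: coeff_add)
    show ?thesis using s w(1) unfolding S nth set by (intro colon_uv)
  qed
  then show "m \<in> seq_submodule Q (take i (map \<Theta> seq))"
    using Q.seq_submodule_quot[OF tc w(1)] w(2) unfolding S by (simp add: take_map)
next
  show "seq_submodule Q (map \<Theta> seq) \<noteq> carrier Q"
  proof
    assume eq: "seq_submodule Q (map \<Theta> seq) = carrier Q"
    \<comment> \<open>The first unit vector stays outside: elements of H and of the submodule
      generated by the sequence have zero constant coefficient in the first component.\<close>
    let ?e = "(\<one>\<^bsub>T\<^esub>, \<zero>\<^bsub>T\<^esub>, \<zero>\<^bsub>T\<^esub>, \<zero>\<^bsub>T\<^esub>)"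
    have e: "?e \<in> carrier W" by (simp add: free4_simps)
    have sc: "set seq \<subseteq> carrier T" using seq_closed by auto
    have "Q.q ?e \<in> carrier Q" using e by (simp add: Q.quot_carrier)
    then obtain s where s: "s \<in> seq_submodule W seq" "?e \<ominus>\<^bsub>W\<^esub> s \<in> H"
      using Q.seq_submodule_quot[OF sc e] eq by blast
    have sW: "s \<in> carrier W" "fst s {#} = \<zero>" using seq_submodule_const[OF seq_closed s(1)] by auto
    obtain s1 s2 s3 s4 where s4: "s = (s1, s2, s3, s4)" "s1 \<in> carrier T" "s2 \<in> carrier T" "s3 \<in> carrier T" "s4 \<in> carrier T"
      using sW(1) by (auto simp: free4_simps)
    have "fst (?e \<ominus>\<^bsub>W\<^esub> s) = \<one>\<^bsub>T\<^esub> \<ominus>\<^bsub>T\<^esub> s1" unfolding s4(1) using s4(2-) by (simp add: T.free4_minus)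
    then have "(\<one>\<^bsub>T\<^esub> \<ominus>\<^bsub>T\<^esub> s1) {#} = \<zero>" using H_const[OF s(2)] by simp
    then show False using s4 sW(2) by (simp add: coeff_one minus_eq)
  qed
qed

lemma seq_in_max_ideal: "set (map \<Theta> seq) \<subseteq> max_ideal A"
  unfolding max_ideal_A using seq_closed by (auto simp: cf_\<Theta>)

section \<open>Tangent vectors and the cokernel\<close>

text \<open>The tangent vector of the \<open>x\<^sub>1 x\<^sub>2\<close>-plane with coordinates \<open>(c, -1)\<close>.\<close>

definition tang where "tang x1 x2 c P = c \<otimes> P {#x1#} \<ominus> P {#x2#}"

definition tangA where "tangA x1 x2 c a = c \<otimes> cf {#x1#} a \<ominus> cf {#x2#} a"

lemma tangA_\<Theta>: "P \<in> carrier T \<Longrightarrow> tangA x1 x2 c (\<Theta> P) = tang x1 x2 c P"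
  by (simp add: tangA_def tang_def cf_\<Theta>)

lemma tang_closed: "c \<in> carrier K \<Longrightarrow> P \<in> carrier T \<Longrightarrow> tang x1 x2 c P \<in> carrier K"
  by (simp add: tang_def)

lemma tang_add:
  "c \<in> carrier K \<Longrightarrow> P \<in> carrier T \<Longrightarrow> P' \<in> carrier T \<Longrightarrow>
    tang x1 x2 c (P \<oplus>\<^bsub>T\<^esub> P') = tang x1 x2 c P \<oplus> tang x1 x2 c P'"
  using coeff_closed[of P "{#x1#}"] coeff_closed[of P "{#x2#}"] coeff_closed[of P' "{#x1#}"] coeff_closed[of P' "{#x2#}"]
  unfolding tang_def coeff_add by algebra

lemma tang_mult:
  assumes "c \<in> carrier K" "P \<in> carrier T" "P' \<in> carrier T"
  shows "tang x1 x2 c (P \<otimes>\<^bsub>T\<^esub> P') = P {#} \<otimes> tang x1 x2 c P' \<oplus> tang x1 x2 c P \<otimes> P' {#}"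
proof -
  have "P {#} \<in> carrier K" "P {#x1#} \<in> carrier K" "P {#x2#} \<in> carrier K"
    "P' {#} \<in> carrier K" "P' {#x1#} \<in> carrier K" "P' {#x2#} \<in> carrier K" using assms by auto
  then show ?thesis
    unfolding tang_def coeff_mult_single[OF assms(2,3)] using assms(1) by algebra
qed

lemma tangA_closed: "c \<in> carrier K \<Longrightarrow> a \<in> carrier A \<Longrightarrow> tangA x1 x2 c a \<in> carrier K"
  using \<Theta>_ex[of a] by (auto simp: tangA_\<Theta> tang_closed)

context
  fixes x1 x2 c
  assumes x12: "x1 \<in> J" "x2 \<in> J" and c: "c \<in> carrier K"
    and tz: "tang x1 x2 c y = \<zero>" "tang x1 x2 c z = \<zero>"
begin

abbreviation \<tau> where "\<tau> \<equiv> tang x1 x2 c"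

lemma tang_uv: "\<tau> (var u) = \<zero>" "\<tau> (var v) = \<zero>"
  using x12 c by (auto simp: tang_def ps_term_def minus_eq)

lemma const_zero: "y {#} = \<zero>" "z {#} = \<zero>" "l {#} = \<zero>" "var u {#} = \<zero>" "var v {#} = \<zero>"
  using yzl by (auto simp: var_ideal_iff) (auto simp: ps_term_def)

text \<open>On the free module W every residue map \<alpha> has a tangent part k, obtained by
  applying \<tau> to the coordinates. It descends to the cokernel once it vanishes on H, and it does
  because all matrix entries have zero constant coefficient and are killed by \<tau>.\<close>

lemma lifts_Q:
  assumes tl: "\<tau> l = \<zero>"
  shows "lifts K A \<epsilon> (tangA x1 x2 c) Q"
  unfolding lifts_def
proof (intro allI impI)
  fix g assume g: "residue_hom K A \<epsilon> Q g"
  let ?e1 = "(\<one>\<^bsub>T\<^esub>, \<zero>\<^bsub>T\<^esub>, \<zero>\<^bsub>T\<^esub>, \<zero>\<^bsub>T\<^esub>)" and ?e2 = "(\<zero>\<^bsub>T\<^esub>, \<one>\<^bsub>T\<^esub>, \<zero>\<^bsub>T\<^esub>, \<zero>\<^bsub>T\<^esub>)"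
    and ?e3 = "(\<zero>\<^bsub>T\<^esub>, \<zero>\<^bsub>T\<^esub>, \<one>\<^bsub>T\<^esub>, \<zero>\<^bsub>T\<^esub>)" and ?e4 = "(\<zero>\<^bsub>T\<^esub>, \<zero>\<^bsub>T\<^esub>, \<zero>\<^bsub>T\<^esub>, \<one>\<^bsub>T\<^esub>)"
  have eW: "?e1 \<in> carrier W" "?e2 \<in> carrier W" "?e3 \<in> carrier W" "?e4 \<in> carrier W" by (simp_all add: free4_simps)
  define \<alpha> where "\<alpha> w = g (Q.q w)" for w
  have \<alpha>c: "\<alpha> w \<in> carrier K" if "w \<in> carrier W" for w
    unfolding \<alpha>_def using that by (intro residue_homD(1)[OF g]) (auto simp: Q.quot_carrier)
  have \<alpha>_add: "\<alpha> (w \<oplus>\<^bsub>W\<^esub> w') = \<alpha> w \<oplus> \<alpha> w'" if "w \<in> carrier W" "w' \<in> carrier W" for w w'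
    unfolding \<alpha>_def Q.quot_add[OF that, symmetric] using that by (intro residue_homD(2)[OF g]) (auto simp: Q.quot_carrier)
  have \<alpha>_smult: "\<alpha> (P \<odot>\<^bsub>W\<^esub> w) = P {#} \<otimes> \<alpha> w" if "P \<in> carrier T" "w \<in> carrier W" for P w
    unfolding \<alpha>_def Q.quot_smult[OF that, symmetric]
    using that residue_homD(3)[OF g, of "\<Theta> P" "Q.q w"] by (auto simp: Q.quot_carrier cf_\<Theta>)
  have \<alpha>_eq: "\<alpha> (a, b, e, f) = a {#} \<otimes> \<alpha> ?e1 \<oplus> (b {#} \<otimes> \<alpha> ?e2 \<oplus> (e {#} \<otimes> \<alpha> ?e3 \<oplus> f {#} \<otimes> \<alpha> ?e4))"
    if "a \<in> carrier T" "b \<in> carrier T" "e \<in> carrier T" "f \<in> carrier T" for a b e f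
  proof -
    have "(a, b, e, f) = a \<odot>\<^bsub>W\<^esub> ?e1 \<oplus>\<^bsub>W\<^esub> (b \<odot>\<^bsub>W\<^esub> ?e2 \<oplus>\<^bsub>W\<^esub> (e \<odot>\<^bsub>W\<^esub> ?e3 \<oplus>\<^bsub>W\<^esub> f \<odot>\<^bsub>W\<^esub> ?e4))"
      using that by (simp add: free4_simps)
    then show ?thesis using that eW by (simp only: \<alpha>_add \<alpha>_smult W.smult_closed W.M.a_closed)
  qed
  define k where "k w = (case w of (a, b, e, f) \<Rightarrow>
    \<tau> a \<otimes> \<alpha> ?e1 \<oplus> (\<tau> b \<otimes> \<alpha> ?e2 \<oplus> (\<tau> e \<otimes> \<alpha> ?e3 \<oplus> \<tau> f \<otimes> \<alpha> ?e4)))" for w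
  have kc: "k w \<in> carrier K" if "w \<in> carrier W" for w
    using that \<alpha>c[OF eW(1)] \<alpha>c[OF eW(2)] \<alpha>c[OF eW(3)] \<alpha>c[OF eW(4)]
    by (auto simp: k_def free4_simps tang_closed[OF c])
  have k_add: "k (w \<oplus>\<^bsub>W\<^esub> w') = k w \<oplus> k w'" if "w \<in> carrier W" "w' \<in> carrier W" for w w'
  proof -
    obtain a b e f a' b' e' f' where w: "w = (a, b, e, f)" "w' = (a', b', e', f')" by (cases w, cases w')
    have m: "a \<in> carrier T" "b \<in> carrier T" "e \<in> carrier T" "f \<in> carrier T" "a' \<in> carrier T" "b' \<in> carrier T" "e' \<in> carrier T" "f' \<in> carrier T"
      using that w by (auto simp: free4_simps)
    note cl = m[THEN tang_closed[OF c, of _ x1 x2]] eW[THEN \<alpha>c]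
    show ?thesis
      unfolding w free4_simps k_def prod.case using m cl by (simp add: tang_add[OF c] l_distr a_ac del: coeff_add)
  qed
  have k_smult: "k (P \<odot>\<^bsub>W\<^esub> w) = P {#} \<otimes> k w \<oplus> \<tau> P \<otimes> \<alpha> w" if "P \<in> carrier T" "w \<in> carrier W" for P w
  proof -
    obtain a b e f where w: "w = (a, b, e, f)" by (cases w)
    have m: "a \<in> carrier T" "b \<in> carrier T" "e \<in> carrier T" "f \<in> carrier T"
      using that w by (auto simp: free4_simps)
    note cl = m[THEN tang_closed[OF c, of _ x1 x2]] eW[THEN \<alpha>c] m[THEN coeff_closed, of "{#}"]
      tang_closed[OF c that(1), of x1 x2] coeff_closed[OF that(1), of "{#}"]
    show ?thesis
      unfolding w free4_simps k_def prod.case \<alpha>_eq[OF m] tang_mult[OF c that(1) m(1)] tang_mult[OF c that(1) m(2)]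
        tang_mult[OF c that(1) m(3)] tang_mult[OF c that(1) m(4)]
      using cl by (simp add: l_distr r_distr m_assoc a_ac del: coeff_add)
  qed
  have k_H: "k h = \<zero>" if "h \<in> H" for h
  proof -
    obtain n where n: "n \<in> carrier W" "h = \<Phi> n" using \<open>h \<in> H\<close> unfolding H_def by blast
    obtain a b e f where "n = (a, b, e, f)" by (cases n)
    with n have h: "h = \<Phi> (a, b, e, f)" "a \<in> carrier T" "b \<in> carrier T" "e \<in> carrier T" "f \<in> carrier T"
      by (simp_all add: free4_simps)
    have z: "\<tau> (P \<otimes>\<^bsub>T\<^esub> P') = \<zero>" if "P \<in> carrier T" "P' \<in> carrier T" "P {#} = \<zero>" "\<tau> P = \<zero>" for P P'
      using that tang_closed[OF c] by (simp add: tang_mult[OF c])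
    have neg: "\<tau> (\<ominus>\<^bsub>T\<^esub> P) = \<zero>" if "P \<in> carrier T" "\<tau> P = \<zero>" for P
      using that tang_add[OF c that(1), of "\<ominus>\<^bsub>T\<^esub> P" x1 x2] tang_closed[OF c, of "\<ominus>\<^bsub>T\<^esub> P" x1 x2]
        c by (simp add: T.r_neg tang_def minus_eq del: coeff_add)
    show ?thesis
      unfolding h(1) \<Phi>.simps k_def prod.case T.minus_eq
      using h(2-) eW[THEN \<alpha>c] by (simp add: tang_add[OF c] z neg const_zero tz tl tang_uv del: coeff_add coeff_minus)
  qed
  define h where "h m = k (SOME w. w \<in> carrier W \<and> Q.q w = m)" for m
  have h: "h (Q.q w) = k w" if w: "w \<in> carrier W" for w
  proof -
    let ?r = "SOME w'. w' \<in> carrier W \<and> Q.q w' = Q.q w"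
    note r = Q.quot_rep[OF w]
    have "k ?r = k ((?r \<ominus>\<^bsub>W\<^esub> w) \<oplus>\<^bsub>W\<^esub> w)" using r(1) w by (simp add: W.M.minus_eq W.M.a_assoc W.M.l_neg)
    also have "\<dots> = k (?r \<ominus>\<^bsub>W\<^esub> w) \<oplus> k w" using r(1) w by (intro k_add) auto
    finally show ?thesis unfolding h_def k_H[OF r(2)] using kc[OF w] by simp
  qed
  have "tangent_part K A \<epsilon> (tangA x1 x2 c) Q g h"
    unfolding tangent_part_def
  proof (intro conjI ballI funcsetI)
    fix m assume "m \<in> carrier Q"
    then obtain w where w: "w \<in> carrier W" "m = Q.q w" by (auto simp: Q.quot_carrier)
    show "h m \<in> carrier K" using w by (simp add: h kc)
    { fix m' assume "m' \<in> carrier Q"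
      then obtain w' where w': "w' \<in> carrier W" "m' = Q.q w'" by (auto simp: Q.quot_carrier)
      show "h (m \<oplus>\<^bsub>Q\<^esub> m') = h m \<oplus> h m'" using w w' by (simp add: Q.quot_add h k_add) }
    { fix r assume "r \<in> carrier A"
      then obtain P where P: "P \<in> carrier T" "r = \<Theta> P" using \<Theta>_ex by blast
      show "h (r \<odot>\<^bsub>Q\<^esub> m) = \<epsilon> r \<otimes> h m \<oplus> tangA x1 x2 c r \<otimes> g m"
        using w P by (simp add: Q.quot_smult h k_smult cf_\<Theta> tangA_\<Theta> \<alpha>_def) }
  qed
  then show "\<exists>h. tangent_part K A \<epsilon> (tangA x1 x2 c) Q g h" by (intro exI[of _ h])
qed

text \<open>The test functional is the constant coefficient of the first coordinate. The last column
  of the matrix gives the relation that l times the first unit vector, z times the second and v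
  times the fourth add up to zero in the cokernel. Applied to this relation, a tangent part of the
  test functional would yield that \<tau> kills l.\<close>

lemma not_lifts_Q:
  assumes tl: "\<tau> l \<noteq> \<zero>"
  shows "\<not> lifts K A \<epsilon> (tangA x1 x2 c) Q"
proof
  assume lifts: "lifts K A \<epsilon> (tangA x1 x2 c) Q"
  define g where "g m = fst (SOME w. w \<in> carrier W \<and> Q.q w = m) {#}" for m
  have g: "g (Q.q w) = fst w {#}" if w: "w \<in> carrier W" for w
  proof -
    let ?r = "SOME w'. w' \<in> carrier W \<and> Q.q w' = Q.q w"
    note r = Q.quot_rep[OF w]
    obtain a b e f where w': "w = (a, b, e, f)" "a \<in> carrier T" "b \<in> carrier T" "e \<in> carrier T" "f \<in> carrier T"
      using w by (auto simp: free4_simps)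
    obtain a' b' e' f' where r': "?r = (a', b', e', f')" "a' \<in> carrier T" "b' \<in> carrier T" "e' \<in> carrier T" "f' \<in> carrier T"
      using r(1) by (auto simp: free4_simps)
    have "?r \<ominus>\<^bsub>W\<^esub> w = (a' \<ominus>\<^bsub>T\<^esub> a, b' \<ominus>\<^bsub>T\<^esub> b, e' \<ominus>\<^bsub>T\<^esub> e, f' \<ominus>\<^bsub>T\<^esub> f)"
      unfolding r'(1) by (subst w'(1), rule T.free4_minus) (rule w'(2-) r'(2-))+
    from r(2)[unfolded this, THEN H_const] have "(a' \<ominus>\<^bsub>T\<^esub> a) {#} = \<zero>" by (simp only: fst_conv)
    then have "a' {#} = a {#}" using w'(2) r'(2) by (simp add: r_right_minus_eq)
    then show ?thesis unfolding g_def r'(1) by (simp add: w'(1))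
  qed
  have "residue_hom K A \<epsilon> Q g"
    unfolding residue_hom_def
  proof (intro conjI ballI funcsetI)
    fix m assume "m \<in> carrier Q"
    then obtain w where w: "w \<in> carrier W" "m = Q.q w" by (auto simp: Q.quot_carrier)
    show "g m \<in> carrier K" using w by (auto simp: g free4_simps)
    { fix m' assume "m' \<in> carrier Q"
      then obtain w' where w': "w' \<in> carrier W" "m' = Q.q w'" by (auto simp: Q.quot_carrier)
      then have "g (m \<oplus>\<^bsub>Q\<^esub> m') = fst (w \<oplus>\<^bsub>W\<^esub> w') {#}" using w by (simp add: Q.quot_add g)
      then show "g (m \<oplus>\<^bsub>Q\<^esub> m') = g m \<oplus> g m'" using w w' by (simp add: g) (auto simp: free4_simps) }
    { fix r assume "r \<in> carrier A"
      then obtain P where P: "P \<in> carrier T" "r = \<Theta> P" using \<Theta>_ex by blast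
      then have "g (r \<odot>\<^bsub>Q\<^esub> m) = fst (P \<odot>\<^bsub>W\<^esub> w) {#}" using w by (simp add: Q.quot_smult g)
      then show "g (r \<odot>\<^bsub>Q\<^esub> m) = \<epsilon> r \<otimes> g m" using w P by (simp add: g cf_\<Theta>) (auto simp: free4_simps coeff_mult_empty) }
  qed
  then obtain h where h: "tangent_part K A \<epsilon> (tangA x1 x2 c) Q g h" using lifts unfolding lifts_def by blast
  define k where "k w = h (Q.q w)" for w
  have kc: "k w \<in> carrier K" if "w \<in> carrier W" for w
    unfolding k_def using that by (intro tangent_partD(1)[OF h]) (auto simp: Q.quot_carrier)
  have k_add: "k (w \<oplus>\<^bsub>W\<^esub> w') = k w \<oplus> k w'" if "w \<in> carrier W" "w' \<in> carrier W" for w w'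
    unfolding k_def Q.quot_add[OF that, symmetric] using that by (intro tangent_partD(2)[OF h]) (auto simp: Q.quot_carrier)
  have k_smult: "k (P \<odot>\<^bsub>W\<^esub> w) = P {#} \<otimes> k w \<oplus> \<tau> P \<otimes> fst w {#}" if "P \<in> carrier T" "w \<in> carrier W" for P w
    unfolding k_def Q.quot_smult[OF that, symmetric]
    using that tangent_partD(3)[OF h, of "\<Theta> P" "Q.q w"] by (auto simp: Q.quot_carrier cf_\<Theta> tangA_\<Theta> g)
  let ?e1 = "(\<one>\<^bsub>T\<^esub>, \<zero>\<^bsub>T\<^esub>, \<zero>\<^bsub>T\<^esub>, \<zero>\<^bsub>T\<^esub>)" and ?e2 = "(\<zero>\<^bsub>T\<^esub>, \<one>\<^bsub>T\<^esub>, \<zero>\<^bsub>T\<^esub>, \<zero>\<^bsub>T\<^esub>)"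
    and ?e4 = "(\<zero>\<^bsub>T\<^esub>, \<zero>\<^bsub>T\<^esub>, \<zero>\<^bsub>T\<^esub>, \<one>\<^bsub>T\<^esub>)"
  have eW: "?e1 \<in> carrier W" "?e2 \<in> carrier W" "?e4 \<in> carrier W" by (simp_all add: free4_simps)
  have H0: "\<Phi> ?e4 \<in> H" unfolding H_def using eW(3) by blast
  have "\<Phi> ?e4 = l \<odot>\<^bsub>W\<^esub> ?e1 \<oplus>\<^bsub>W\<^esub> (z \<odot>\<^bsub>W\<^esub> ?e2 \<oplus>\<^bsub>W\<^esub> var v \<odot>\<^bsub>W\<^esub> ?e4)"
    unfolding \<Phi>.simps free4_simps prod.inject using yzl_closed uv_closed by (intro conjI; algebra)
  then have k4: "k (\<Phi> ?e4) = k (l \<odot>\<^bsub>W\<^esub> ?e1) \<oplus> (k (z \<odot>\<^bsub>W\<^esub> ?e2) \<oplus> k (var v \<odot>\<^bsub>W\<^esub> ?e4))"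
    using eW by (simp only: k_add W.smult_closed W.M.a_closed yzl_closed uv_closed)
  have "Q.q (\<Phi> ?e4) = Q.q \<zero>\<^bsub>W\<^esub>"
    using W.submodule_mem(2-4)[OF H_submodule] H0 \<Phi>_closed[OF eW(3)] unfolding W.M.minus_eq[symmetric]
    by (subst Q.q_eq_iff) (simp_all only: W.M.minus_eq W.M.zero_closed)
  then have "k (\<Phi> ?e4) = k \<zero>\<^bsub>W\<^esub>" by (simp add: k_def)
  moreover have "k (\<zero>\<^bsub>W\<^esub> \<oplus>\<^bsub>W\<^esub> \<zero>\<^bsub>W\<^esub>) = k \<zero>\<^bsub>W\<^esub> \<oplus> k \<zero>\<^bsub>W\<^esub>" by (rule k_add) auto
  then have "k \<zero>\<^bsub>W\<^esub> = \<zero>" using kc[of "\<zero>\<^bsub>W\<^esub>"] add.l_cancel_one'[of "k \<zero>\<^bsub>W\<^esub>" "k \<zero>\<^bsub>W\<^esub>"] by simp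
  ultimately have "k (l \<odot>\<^bsub>W\<^esub> ?e1) \<oplus> (k (z \<odot>\<^bsub>W\<^esub> ?e2) \<oplus> k (var v \<odot>\<^bsub>W\<^esub> ?e4)) = \<zero>" using k4 by simp
  then have "\<tau> l = \<zero>"
    using eW kc[OF eW(1)] kc[OF eW(2)] kc[OF eW(3)] tang_closed[OF c yzl_closed(3)]
    by (simp add: k_smult const_zero tz tang_uv coeff_one)
  with tl show False by blast
qed

end

end

section \<open>Infinitely many indecomposable maximal Cohen-Macaulay modules\<close>

lemma module_iso_sym:
  assumes "module R M" and "module_iso R M N"
  shows "module_iso R N M"
proof -
  interpret M: module R M by fact
  obtain \<phi> where \<phi>: "bij_betw \<phi> (carrier M) (carrier N)"
    "\<And>x y. x \<in> carrier M \<Longrightarrow> y \<in> carrier M \<Longrightarrow> \<phi> (x \<oplus>\<^bsub>M\<^esub> y) = \<phi> x \<oplus>\<^bsub>N\<^esub> \<phi> y"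
    "\<And>a x. a \<in> carrier R \<Longrightarrow> x \<in> carrier M \<Longrightarrow> \<phi> (a \<odot>\<^bsub>M\<^esub> x) = a \<odot>\<^bsub>N\<^esub> \<phi> x"
    using assms(2) unfolding module_iso_def by blast
  define \<psi> where "\<psi> = inv_into (carrier M) \<phi>"
  have \<psi>: "\<psi> (\<phi> x) = x" if "x \<in> carrier M" for x
    using \<phi>(1) that by (simp add: \<psi>_def bij_betw_def)
  have ex: "\<exists>x\<in>carrier M. y = \<phi> x" if "y \<in> carrier N" for y using \<phi>(1) that by (auto simp: bij_betw_def)
  have "\<psi> (y \<oplus>\<^bsub>N\<^esub> y') = \<psi> y \<oplus>\<^bsub>M\<^esub> \<psi> y'" if y: "y \<in> carrier N" "y' \<in> carrier N" for y y'
  proof -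
    obtain x x' where x: "x \<in> carrier M" "y = \<phi> x" "x' \<in> carrier M" "y' = \<phi> x'" using ex[OF y(1)] ex[OF y(2)] by blast
    have "\<psi> (\<phi> (x \<oplus>\<^bsub>M\<^esub> x')) = x \<oplus>\<^bsub>M\<^esub> x'" using x by (intro \<psi>) auto
    then show ?thesis using x by (simp add: \<phi>(2) \<psi>)
  qed
  moreover have "\<psi> (a \<odot>\<^bsub>N\<^esub> y) = a \<odot>\<^bsub>M\<^esub> \<psi> y" if a: "a \<in> carrier R" and y: "y \<in> carrier N" for a y
  proof -
    obtain x where x: "x \<in> carrier M" "y = \<phi> x" using ex[OF y] by blast
    have "\<psi> (\<phi> (a \<odot>\<^bsub>M\<^esub> x)) = a \<odot>\<^bsub>M\<^esub> x" using x a by (intro \<psi>) auto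
    then show ?thesis using x a by (simp add: \<phi>(3) \<psi>)
  qed
  moreover have "bij_betw \<psi> (carrier N) (carrier M)" unfolding \<psi>_def by (rule bij_betw_inv_into[OF \<phi>(1)])
  ultimately show ?thesis unfolding module_iso_def by (intro exI[of _ \<psi>]) blast
qed

lemma module_iso_trans:
  assumes "module_iso R M N" and "module_iso R N P"
  shows "module_iso R M P"
proof -
  obtain \<phi> where \<phi>: "bij_betw \<phi> (carrier M) (carrier N)"
    "\<And>x y. x \<in> carrier M \<Longrightarrow> y \<in> carrier M \<Longrightarrow> \<phi> (x \<oplus>\<^bsub>M\<^esub> y) = \<phi> x \<oplus>\<^bsub>N\<^esub> \<phi> y"
    "\<And>a x. a \<in> carrier R \<Longrightarrow> x \<in> carrier M \<Longrightarrow> \<phi> (a \<odot>\<^bsub>M\<^esub> x) = a \<odot>\<^bsub>N\<^esub> \<phi> x"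
    using assms(1) unfolding module_iso_def by blast
  obtain \<psi> where \<psi>: "bij_betw \<psi> (carrier N) (carrier P)"
    "\<And>x y. x \<in> carrier N \<Longrightarrow> y \<in> carrier N \<Longrightarrow> \<psi> (x \<oplus>\<^bsub>N\<^esub> y) = \<psi> x \<oplus>\<^bsub>P\<^esub> \<psi> y"
    "\<And>a x. a \<in> carrier R \<Longrightarrow> x \<in> carrier N \<Longrightarrow> \<psi> (a \<odot>\<^bsub>N\<^esub> x) = a \<odot>\<^bsub>P\<^esub> \<psi> x"
    using assms(2) unfolding module_iso_def by blast
  have \<phi>N: "\<phi> x \<in> carrier N" if "x \<in> carrier M" for x using \<phi>(1) that by (auto simp: bij_betw_def)
  have "bij_betw (\<lambda>x. \<psi> (\<phi> x)) (carrier M) (carrier P)"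
    using bij_betw_trans[OF \<phi>(1) \<psi>(1)] by (simp add: comp_def)
  then show ?thesis unfolding module_iso_def
    by (intro exI[of _ "\<lambda>x. \<psi> (\<phi> x)"]) (simp add: \<phi> \<psi> \<phi>N)
qed

lemma regular_seq_iso:
  assumes "module R M" "module R N" and iso: "module_iso R M N" and xs: "set xs \<subseteq> carrier R" and "regular_seq M xs"
  shows "regular_seq N xs"
proof -
  interpret M: module R M by fact
  interpret N: module R N by fact
  obtain \<phi> where \<phi>: "bij_betw \<phi> (carrier M) (carrier N)"
    "\<And>x y. x \<in> carrier M \<Longrightarrow> y \<in> carrier M \<Longrightarrow> \<phi> (x \<oplus>\<^bsub>M\<^esub> y) = \<phi> x \<oplus>\<^bsub>N\<^esub> \<phi> y"
    "\<And>a x. a \<in> carrier R \<Longrightarrow> x \<in> carrier M \<Longrightarrow> \<phi> (a \<odot>\<^bsub>M\<^esub> x) = a \<odot>\<^bsub>N\<^esub> \<phi> x"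
    using iso unfolding module_iso_def by blast
  have im: "\<phi> ` carrier M = carrier N" and inj: "inj_on \<phi> (carrier M)" using \<phi>(1) by (auto simp: bij_betw_def)
  then have \<phi>N: "\<phi> x \<in> carrier N" if "x \<in> carrier M" for x using that by blast
  have \<phi>0: "\<phi> \<zero>\<^bsub>M\<^esub> = \<zero>\<^bsub>N\<^esub>"
    using \<phi>(3)[of "\<zero>\<^bsub>R\<^esub>" "\<zero>\<^bsub>M\<^esub>"] \<phi>N by simp
  have seq: "\<phi> ` seq_submodule M ys = seq_submodule N ys" if "set ys \<subseteq> carrier R" for ys
    using M.seq_submodule_linear_image(2)[OF that, of \<phi> N "\<lambda>r. r"] \<phi>(2,3) \<phi>N \<phi>0 im by simp
  have sub: "seq_submodule M ys \<subseteq> carrier M" if "set ys \<subseteq> carrier R" for ys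
    by (rule M.submodule_mem(1)[OF M.seq_submodule_submodule[OF that]])
  show ?thesis
    unfolding regular_seq_def
  proof (intro conjI allI impI ballI)
    fix i y assume i: "i < length xs" and y: "y \<in> carrier N" and mem: "xs ! i \<odot>\<^bsub>N\<^esub> y \<in> seq_submodule N (take i xs)"
    have tc: "set (take i xs) \<subseteq> carrier R" using xs set_take_subset[of i xs] by blast
    have xc: "xs ! i \<in> carrier R" using xs nth_mem[OF i] by blast
    obtain x where x: "x \<in> carrier M" "y = \<phi> x" using y im by blast
    have "\<phi> (xs ! i \<odot>\<^bsub>M\<^esub> x) \<in> \<phi> ` seq_submodule M (take i xs)" using mem x xc \<phi>(3) seq[OF tc] by simp
    then have "xs ! i \<odot>\<^bsub>M\<^esub> x \<in> seq_submodule M (take i xs)"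
      using inj sub[OF tc] x xc by (simp add: inj_on_image_mem_iff)
    then have "x \<in> seq_submodule M (take i xs)" using assms(5) i x by (auto simp: regular_seq_def)
    then show "y \<in> seq_submodule N (take i xs)" using x seq[OF tc] by blast
  next
    have "seq_submodule M xs \<noteq> carrier M" using assms(5) by (simp add: regular_seq_def)
    then show "seq_submodule N xs \<noteq> carrier N"
      using seq[OF xs] im inj_on_image_eq_iff[OF inj sub[OF xs] subset_refl] by simp
  qed
qed

lemma size_ge_4_split:
  assumes "4 \<le> size (d :: 'v multiset)"
  obtains d1 d2 where "d = d1 + d2" "2 \<le> size d1" "2 \<le> size d2"
proof -
  obtain a e where e: "d = add_mset a e" using assms by (cases d) auto
  then obtain b f where f: "e = add_mset b f" using assms by (cases e) auto
  show thesis by (rule that[of "{#a, b#}" f]) (use assms e f in auto)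
qed

context binomial_hypersurface
begin

theorem not_finite_CM_type:
  assumes size: "4 \<le> size d" and inf: "infinite (carrier K)"
    and x12: "x1 \<in> I - {u, v}" "x2 \<in> I - {u, v}" "x1 \<noteq> x2"
  shows "\<not> finite_CM_type A"
proof
  assume "finite_CM_type A"
  then obtain \<N> :: "'h fg_mod set" where
    "finite \<N> \<and> (\<forall>M :: 'h fg_mod. MCM A M \<and> indecomposable_module A M \<longrightarrow> (\<exists>N\<in>\<N>. module_iso A M N))"
    unfolding finite_CM_type_def by (rule exE)
  note \<N> = this[THEN conjunct1] this[THEN conjunct2, rule_format, OF conjI]
  obtain d1 d2 where d12: "d = d1 + d2" "2 \<le> size d1" "2 \<le> size d2" using size_ge_4_split[OF size] .
  have dJ: "set_mset d1 \<subseteq> I - {u, v}" "set_mset d2 \<subseteq> I - {u, v}" using d(1) d12(1) by auto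
  define y where "y = ps_term K \<one> d1"
  define z where "z = ps_term K \<one> d2"
  define l where "l c = var x1 \<oplus>\<^bsub>T\<^esub> ps_term K c {#x2#}" for c
  have mem: "ps_term K c m \<in> var_ideal (I - {u, v})"
    if "c \<in> carrier K" "set_mset m \<subseteq> I - {u, v}" "m \<noteq> {#}" for c m
  proof -
    have ne: "set_mset m \<inter> (I - {u, v}) \<noteq> {}" using that(2,3) by (simp add: Int_absorb2)
    have "ps_term K c m \<in> carrier T" using that by (intro ps_term_closed) auto
    moreover have "\<forall>m'. set_mset m' \<inter> (I - {u, v}) = {} \<longrightarrow> ps_term K c m m' = \<zero>"
    proof (intro allI impI)
      fix m' :: "'v multiset" assume "set_mset m' \<inter> (I - {u, v}) = {}"
      then have "m' \<noteq> m" using ne by metis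
      then show "ps_term K c m m' = \<zero>" by (simp add: ps_term_def)
    qed
    ultimately show ?thesis by (simp add: var_ideal_iff)
  qed
  have fm: "factorization_module K I A \<Theta> d u v y z (l c)" if "c \<in> carrier K" for c
  proof (intro factorization_module.intro binomial_hypersurface_axioms factorization_module_axioms.intro)
    show "y \<in> var_ideal (I - {u, v})" "z \<in> var_ideal (I - {u, v})"
      unfolding y_def z_def using dJ d12 by (auto intro!: mem)
    interpret V: ideal "var_ideal (I - {u, v})" T by (rule ideal_var_ideal)
    show "l c \<in> var_ideal (I - {u, v})"
      unfolding l_def using x12 that by (intro V.a_closed mem) auto
    show "y \<otimes>\<^bsub>T\<^esub> z = ps_term K \<one> d"
      unfolding y_def z_def d12(1) using dJ by (subst ps_term_mult) auto
  qed
  define \<tau> where "\<tau> c a = c \<otimes> cf {#x1#} a \<ominus> cf {#x2#} a" for c a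
  have "\<exists>N :: 'h fg_mod. module A N \<and> MCM A N \<and> indecomposable_module A N \<and>
      lifts K A \<epsilon> (\<tau> c) N \<and> \<not> lifts K A \<epsilon> (\<tau> \<zero>) N" if c: "c \<in> carrier K" "c \<noteq> \<zero>" for c
  proof -
    interpret fm: factorization_module K I A \<Theta> d u v y z "l c" by (rule fm[OF c(1)])
    have \<tau>_eq: "\<tau> e = fm.tangA x1 x2 e" for e by (simp add: \<tau>_def fm.tangA_def fun_eq_iff)
    have \<tau>c: "\<tau> e r \<in> carrier K" if "e \<in> carrier K" "r \<in> carrier A" for e r
      unfolding \<tau>_eq by (rule fm.tangA_closed[OF that])
    \<comment> \<open>Both factors of \<open>x\<^sup>d\<close> have degree at least 2, so they have
      no linear terms and every tangent vector of the plane kills them.\<close>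
    have coeffs: "y {#x1#} = \<zero>" "y {#x2#} = \<zero>" "z {#x1#} = \<zero>" "z {#x2#} = \<zero>"
      using d12 by (auto simp: y_def z_def ps_term_def)
    have yz0: "fm.tang x1 x2 e y = \<zero>" "fm.tang x1 x2 e z = \<zero>" if "e \<in> carrier K" for e
      using that coeffs by (simp_all add: fm.tang_def minus_eq)
    \<comment> \<open>The value \<open>e - c\<close> vanishes exactly for e = c. It is therefore
      zero along the vector of c and equal to -c, which is nonzero, along the vector of 0.\<close>
    have l: "fm.tang x1 x2 e (l c) = e \<ominus> c" if "e \<in> carrier K" for e
      using that x12 c by (simp add: fm.tang_def l_def) (simp add: ps_term_def)
    have "lifts K A \<epsilon> (\<tau> c) fm.Q"
      unfolding \<tau>_eq using x12 c yz0[OF c(1)] l[OF c(1)] by (intro fm.lifts_Q) (simp_all add: minus_eq r_neg)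
    moreover have "\<not> lifts K A \<epsilon> (\<tau> \<zero>) fm.Q"
      unfolding \<tau>_eq using x12 c yz0[OF zero_closed] l[OF zero_closed] by (intro fm.not_lifts_Q) (simp_all add: minus_eq)
    \<comment> \<open>Isomorphism classes are counted over the type \<open>fg_mod\<close>, so the
      cokernel is replaced by a copy there before summands are taken.\<close>
    moreover obtain N :: "'h fg_mod" where N: "fg_module A N" "module_iso A fm.Q N"
      using fg_module_copy[OF fm.fg_Q] by blast
    have modN: "module A N" using N(1) by (simp add: fg_module_def)
    have isoN: "module_iso A N fm.Q" by (rule module_iso_sym[OF fm.Q.module_quot N(2)])
    interpret N: residue_module A N K \<epsilon>
      by (intro residue_module.intro residue_module_axioms.intro modN field_axioms \<epsilon>_hom \<epsilon>_unit)
    have lN: "lifts K A \<epsilon> (\<tau> c) N" by (rule lifts_iso[OF fm.Q.module_quot N(2)]) fact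
    have nlN: "\<not> lifts K A \<epsilon> (\<tau> \<zero>) N" using lifts_iso[OF modN isoN] \<open>\<not> lifts K A \<epsilon> (\<tau> \<zero>) fm.Q\<close> by blast
    obtain B C where BC: "complementary A N B C" "indecomposable_module A (N\<lparr>carrier := B\<rparr>)"
      "\<not> lifts K A \<epsilon> (\<tau> \<zero>) (N\<lparr>carrier := B\<rparr>)"
      using \<tau>c by (rule N.indecomposable_nonlifting_summand[OF N(1) nlN]) auto
    have sc: "set (map \<Theta> fm.seq) \<subseteq> carrier A" using fm.seq_in_max_ideal unfolding max_ideal_A by blast
    have reg: "regular_seq N (map \<Theta> fm.seq)"
      by (rule regular_seq_iso[OF fm.Q.module_quot modN N(2) sc fm.regular_seq_Q])
    have kd: "krull_dim A \<le> enat (length (map \<Theta> fm.seq))" using krull_dim_A by (simp add: fm.length_seq)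
    have "MCM A (N\<lparr>carrier := B\<rparr>)"
      using \<tau>c by (intro N.MCM_summand[OF noetherian_A local_A N(1) BC(1) BC(3) _ max_ideal_A fm.seq_in_max_ideal reg kd]) auto
    moreover have "lifts K A \<epsilon> (\<tau> c) (N\<lparr>carrier := B\<rparr>)" by (rule N.lifts_summand[OF BC(1) lN])
    moreover have "module A (N\<lparr>carrier := B\<rparr>)" using BC(2) by (simp add: indecomposable_module_def)
    ultimately show ?thesis using BC by blast
  qed
  then have "\<forall>c\<in>carrier K - {\<zero>}. \<exists>N :: 'h fg_mod. module A N \<and> MCM A N \<and> indecomposable_module A N \<and>
      lifts K A \<epsilon> (\<tau> c) N \<and> \<not> lifts K A \<epsilon> (\<tau> \<zero>) N" by blast
  then obtain N :: "'a \<Rightarrow> 'h fg_mod" where N: "\<forall>c\<in>carrier K - {\<zero>}. module A (N c) \<and> MCM A (N c) \<and> indecomposable_module A (N c) \<and>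
      lifts K A \<epsilon> (\<tau> c) (N c) \<and> \<not> lifts K A \<epsilon> (\<tau> \<zero>) (N c)" by (rule bchoice[THEN exE])
  have "\<forall>c\<in>carrier K - {\<zero>}. \<exists>n\<in>\<N>. module_iso A (N c) n" using N \<N>(2) by blast
  then have "\<forall>c\<in>carrier K - {\<zero>}. \<exists>n. n \<in> \<N> \<and> module_iso A (N c) n" by blast
  then obtain n where n: "\<forall>c\<in>carrier K - {\<zero>}. n c \<in> \<N> \<and> module_iso A (N c) (n c)" by (rule bchoice[THEN exE])
  have "infinite (carrier K - {\<zero>})" using inf by simp
  moreover have "finite (n ` (carrier K - {\<zero>}))" using n \<N>(1) by (meson finite_subset image_subsetI)
  ultimately have "\<not> inj_on n (carrier K - {\<zero>})" using finite_imageD by blast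
  then obtain c e where ce: "c \<in> carrier K" "c \<noteq> \<zero>" "e \<in> carrier K" "e \<noteq> \<zero>" "c \<noteq> e" "n c = n e" by (auto simp: inj_on_def)
  have Nc: "module A (N c)" "lifts K A \<epsilon> (\<tau> c) (N c)" "\<not> lifts K A \<epsilon> (\<tau> \<zero>) (N c)" using N ce by auto
  have Ne: "module A (N e)" "lifts K A \<epsilon> (\<tau> e) (N e)" using N ce by auto
  have iso: "module_iso A (N c) (n c)" "module_iso A (N e) (n c)"
    using n[rule_format, of c] n[rule_format, of e] ce by simp_all
  have "module_iso A (N e) (N c)" by (rule module_iso_trans[OF iso(2) module_iso_sym[OF Nc(1) iso(1)]])
  then have le: "lifts K A \<epsilon> (\<tau> e) (N c)" by (rule lifts_iso[OF Ne(1) _ Ne(2)])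
  interpret Nc: residue_module A "N c" K \<epsilon>
    by (intro residue_module.intro residue_module_axioms.intro Nc(1) field_axioms \<epsilon>_hom \<epsilon>_unit)
  have "e \<ominus> c \<noteq> \<zero>" using ce r_right_minus_eq by auto
  then have u: "e \<ominus> c \<in> Units K" using ce by (simp add: field_Units)
  define i where "i = inv (e \<ominus> c)"
  have i: "i \<in> carrier K" "(e \<ominus> c) \<otimes> i = \<one>" using u by (auto simp: i_def)
  have cfc: "cf {#x#} r \<in> carrier K" if "r \<in> carrier A" for x r
    using \<Theta>_ex[OF that] by (auto simp: cf_\<Theta>)
  \<comment> \<open>The vector of 0 is \<open>(e \<tau> c - c \<tau> e) / (e - c)\<close>: the
    coefficients sum to 1, as the second coordinate demands, and the first coordinate
    cancels.\<close>
  have "lifts K A \<epsilon> (\<tau> \<zero>) (N c)"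
  proof (rule Nc.lifts_lincomb[OF Nc(2) le])
    show "e \<otimes> i \<in> carrier K" "\<ominus> (c \<otimes> i) \<in> carrier K" using ce i by auto
    fix r assume r: "r \<in> carrier A"
    show "\<tau> c r \<in> carrier K" "\<tau> e r \<in> carrier K" using cfc[OF r] ce by (auto simp: \<tau>_def)
    have "e \<otimes> i \<otimes> \<tau> c r \<oplus> \<ominus> (c \<otimes> i) \<otimes> \<tau> e r = \<ominus> (((e \<ominus> c) \<otimes> i) \<otimes> cf {#x2#} r)"
      unfolding \<tau>_def using ce(1,3) i(1) cfc[OF r, of x1] cfc[OF r, of x2] by algebra
    also have "\<dots> = \<tau> \<zero> r" unfolding i(2) \<tau>_def using cfc[OF r] by (simp add: minus_eq)
    finally show "\<tau> \<zero> r = e \<otimes> i \<otimes> \<tau> c r \<oplus> \<ominus> (c \<otimes> i) \<otimes> \<tau> e r" by simp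
  qed
  with Nc(3) show False by blast
qed

end

section \<open>Frobenius\<close>

context cring
begin

lemma binomial_expansion:
  assumes a: "a \<in> carrier R" and b: "b \<in> carrier R"
  shows "(a \<oplus> b) [^] n = (\<Oplus>i\<in>{..n}. [(n choose i)] \<cdot> (a [^] i \<otimes> b [^] (n - i)))"
proof (induction n)
  case 0
  show ?case by simp
next
  case (Suc n)
  let ?t = "\<lambda>i. a [^] i \<otimes> b [^] (n - i)"
  have tc: "?t i \<in> carrier R" for i using a b by simp
  have "(a \<oplus> b) [^] Suc n = (\<Oplus>i\<in>{..n}. [(n choose i)] \<cdot> ?t i) \<otimes> a \<oplus> (\<Oplus>i\<in>{..n}. [(n choose i)] \<cdot> ?t i) \<otimes> b"
    using a b tc by (simp add: Suc r_distr)
  also have "(\<Oplus>i\<in>{..n}. [(n choose i)] \<cdot> ?t i) \<otimes> a = (\<Oplus>i\<in>{..n}. [(n choose i)] \<cdot> (a [^] Suc i \<otimes> b [^] (n - i)))"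
    using a b tc
    by (subst finsum_ldistr) (auto intro!: finsum_cong' simp: add_pow_ldistr add_pow_rdistr m_ac)
  also have "(\<Oplus>i\<in>{..n}. [(n choose i)] \<cdot> ?t i) \<otimes> b = (\<Oplus>i\<in>{..n}. [(n choose i)] \<cdot> (a [^] i \<otimes> b [^] (Suc n - i)))"
    using a b tc
    by (subst finsum_ldistr) (auto intro!: finsum_cong' simp: add_pow_ldistr add_pow_rdistr m_ac Suc_diff_le)
  also have "\<dots> = (\<Oplus>i\<in>{..Suc n}. [(n choose i)] \<cdot> (a [^] i \<otimes> b [^] (Suc n - i)))"
    using a b by (subst finsum_Suc) (auto simp: Pi_def binomial_eq_0)
  also have "\<dots> = (\<Oplus>i\<in>{..n}. [(n choose Suc i)] \<cdot> (a [^] Suc i \<otimes> b [^] (n - i))) \<oplus> b [^] Suc n"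
    using a b by (subst finsum_Suc2) (auto simp: Pi_def)
  finally have "(a \<oplus> b) [^] Suc n = (\<Oplus>i\<in>{..n}. [(n choose i)] \<cdot> (a [^] Suc i \<otimes> b [^] (n - i)))
      \<oplus> ((\<Oplus>i\<in>{..n}. [(n choose Suc i)] \<cdot> (a [^] Suc i \<otimes> b [^] (n - i))) \<oplus> b [^] Suc n)" .
  also have "\<dots> = ((\<Oplus>i\<in>{..n}. [(n choose i)] \<cdot> (a [^] Suc i \<otimes> b [^] (n - i)))
      \<oplus> (\<Oplus>i\<in>{..n}. [(n choose Suc i)] \<cdot> (a [^] Suc i \<otimes> b [^] (n - i)))) \<oplus> b [^] Suc n"
    using a b by (intro a_assoc[symmetric] finsum_closed) auto
  also have "(\<Oplus>i\<in>{..n}. [(n choose i)] \<cdot> (a [^] Suc i \<otimes> b [^] (n - i)))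
      \<oplus> (\<Oplus>i\<in>{..n}. [(n choose Suc i)] \<cdot> (a [^] Suc i \<otimes> b [^] (n - i)))
      = (\<Oplus>i\<in>{..n}. [(Suc n choose Suc i)] \<cdot> (a [^] Suc i \<otimes> b [^] (n - i)))"
    using a b by (subst finsum_addf[symmetric]) (auto intro!: finsum_cong' simp: add.nat_pow_mult[symmetric])
  also have "\<dots> \<oplus> b [^] Suc n = (\<Oplus>i\<in>{..Suc n}. [(Suc n choose i)] \<cdot> (a [^] i \<otimes> b [^] (Suc n - i)))"
    using a b by (subst finsum_Suc2) (auto simp: Pi_def)
  finally show ?case .
qed

lemma char_p_add_pow:
  assumes "has_char R p" "p dvd n" "a \<in> carrier R"
  shows "[n] \<cdot> a = \<zero>"
proof -
  have "[n] \<cdot> \<one> = \<zero>" using assms(1,2) by (simp add: has_char_def)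
  then have "([n] \<cdot> \<one>) \<otimes> a = \<zero>" using assms(3) by simp
  then show ?thesis using assms(3) by (simp add: add_pow_ldistr)
qed

lemma frobenius_add:
  assumes p: "Factorial_Ring.prime p" "has_char R p" and a: "a \<in> carrier R" and b: "b \<in> carrier R"
  shows "(a \<oplus> b) [^] (p ^ e) = a [^] (p ^ e) \<oplus> b [^] (p ^ e)"
proof (induction e)
  case 0
  show ?case using a b by simp
next
  case (Suc e)
  have p0: "p > 0" using p(1) by (simp add: prime_gt_0_nat)
  have F: "(x \<oplus> y) [^] p = x [^] p \<oplus> y [^] p" if x: "x \<in> carrier R" "y \<in> carrier R" for x y
  proof -
    let ?t = "\<lambda>i. [(p choose i)] \<cdot> (x [^] i \<otimes> y [^] (p - i))"
    have "(x \<oplus> y) [^] p = (\<Oplus>i\<in>{..p}. ?t i)" by (rule binomial_expansion[OF x])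
    also have "\<dots> = (\<Oplus>i\<in>{0, p}. ?t i)"
    proof (rule add.finprod_mono_neutral_cong_right)
      fix i assume "i \<in> {..p} - {0, p}"
      then have "p dvd (p choose i)" using p(1) by (intro dvd_choose_prime) (auto simp: prime_gt_0_nat)
      then show "?t i = \<zero>" using x by (intro char_p_add_pow[OF p(2)]) auto
    qed (use x in auto)
    also have "\<dots> = x [^] p \<oplus> y [^] p" using x p0 by (simp add: a_comm)
    finally show ?thesis .
  qed
  have pw: "x [^] (p ^ Suc e) = (x [^] (p ^ e)) [^] p" if "x \<in> carrier R" for x
    using that by (simp add: nat_pow_pow mult.commute)
  show ?case using a b by (simp add: pw Suc F del: power_Suc)
qed

lemma frobenius_finsum:
  assumes p: "Factorial_Ring.prime p" "has_char R p" and "finite S" and "\<And>s. s \<in> S \<Longrightarrow> f s \<in> carrier R"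
  shows "(\<Oplus>s\<in>S. f s) [^] (p ^ e) = (\<Oplus>s\<in>S. f s [^] (p ^ e))"
  using assms(3,4)
proof (induction S)
  case empty
  have "p ^ e > 0" using p(1) by (simp add: prime_gt_0_nat)
  then show ?case by (simp add: nat_pow_zero)
next
  case (insert s S)
  then have "f \<in> S \<rightarrow> carrier R" "(\<lambda>s. f s [^] (p ^ e)) \<in> S \<rightarrow> carrier R" by auto
  with insert show ?case by (simp add: frobenius_add[OF p])
qed

end

lemma (in domain) frobenius_inj:
  assumes p: "Factorial_Ring.prime p" "has_char R p"
  shows "inj_on (\<lambda>a. a [^] (p ^ e :: nat)) (carrier R)"
proof (rule inj_onI)
  fix a b assume ab: "a \<in> carrier R" "b \<in> carrier R" "a [^] (p ^ e) = b [^] (p ^ e)"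
  have "(a \<ominus> b) [^] (p ^ e) \<oplus> b [^] (p ^ e) = a [^] (p ^ e)"
    using ab by (subst frobenius_add[OF p, symmetric]) (auto simp: minus_eq a_assoc l_neg)
  then have "(a \<ominus> b) [^] (p ^ e) = \<zero>" using ab by (simp add: add.r_cancel_one)
  moreover have "x [^] n \<noteq> \<zero>" if "x \<in> carrier R" "x \<noteq> \<zero>" for x and n :: nat
    using that by (induction n) (auto simp: integral_iff)
  ultimately have "a \<ominus> b = \<zero>" using ab by blast
  then show "a = b" using ab by simp
qed

context power_series_field
begin

lemma const_pow: "([(n :: nat)] \<cdot>\<^bsub>T\<^esub> \<one>\<^bsub>T\<^esub>) m = (if m = {#} then [n] \<cdot> \<one> else \<zero>)"
  by (induction n) (simp_all add: add_pow_def coeff_one ps_simps(2))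

lemma has_char_T: "has_char R p \<Longrightarrow> has_char T p"
proof -
  assume p: "has_char R p"
  have "[n] \<cdot>\<^bsub>T\<^esub> \<one>\<^bsub>T\<^esub> = \<zero>\<^bsub>T\<^esub> \<longleftrightarrow> [n] \<cdot> \<one> = \<zero>" for n :: nat
    using const_pow[of n] by (auto simp: ps_simps(2) fun_eq_iff)
  then show ?thesis using p by (simp add: has_char_def)
qed

lemma ps_term_pow:
  assumes "c \<in> carrier R" "set_mset a \<subseteq> I"
  shows "ps_term R c a [^]\<^bsub>T\<^esub> (n::nat) = ps_term R (c [^] n) (repeat_mset n a)"
proof (induction n)
  case 0
  show ?case by (auto simp: ps_term_def ps_simps(3))
next
  case (Suc n)
  have "set_mset (repeat_mset n a) \<subseteq> I" using assms(2) by (auto simp: count_greater_zero_iff[symmetric] simp del: count_greater_zero_iff)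
  with Suc show ?case using assms by (simp add: ps_term_mult add.commute)
qed

text \<open>The q-th power is additive, but P is an infinite sum. For the coefficient at m, P is cut
  into the finite sum \<open>P1\<close> of its terms dividing m and a rest \<open>P2\<close> without
  divisors of m. The rest lies in an ideal of such series, so its q-th power does not reach
  m.\<close>

lemma frobenius_coeff:
  assumes p: "Factorial_Ring.prime p" "has_char R p" and P: "P \<in> carrier T" and q: "q = p ^ e"
  shows "(P [^]\<^bsub>T\<^esub> q) (repeat_mset q a) = P a [^] q"
    and "(\<And>a. m \<noteq> repeat_mset q a) \<Longrightarrow> (P [^]\<^bsub>T\<^esub> q) m = \<zero>"
proof -
  have q0: "q > 0" using p(1) by (simp add: q prime_gt_0_nat)
  have inj: "a = b" if "repeat_mset q a = repeat_mset q b" for a b :: "'v multiset"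
  proof (rule multiset_eqI)
    fix x show "count a x = count b x" using arg_cong[OF that, of "\<lambda>m. count m x"] q0 by simp
  qed
  have eq: "(P [^]\<^bsub>T\<^esub> q) m = (\<Oplus>a\<in>{a. a \<subseteq># m \<and> set_mset a \<subseteq> I}. ps_term R (P a [^] q) (repeat_mset q a) m)" for m
  proof -
    define S where "S = {a. a \<subseteq># m \<and> set_mset a \<subseteq> I}"
    have fS: "finite S" unfolding S_def by (rule finite_subset[OF _ finite_submultisets[of m]]) auto
    define P1 where "P1 = (\<Oplus>\<^bsub>T\<^esub>a\<in>S. ps_term R (P a) a)"
    have tT: "ps_term R (P a) a \<in> carrier T" if "a \<in> S" for a using that P by (auto simp: S_def)
    have P1: "P1 \<in> carrier T" unfolding P1_def using tT by (intro T.finsum_closed) auto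
    define P2 where "P2 = P \<ominus>\<^bsub>T\<^esub> P1"
    have P2: "P2 \<in> carrier T" using P P1 by (simp add: P2_def)
    have "P1 a = P a" if "a \<subseteq># m" for a
    proof (cases "set_mset a \<subseteq> I")
      case True
      then have "a \<in> S" using that by (simp add: S_def)
      then have "(\<Oplus>b\<in>S. ps_term R (P b) b a) = ps_term R (P a) a a"
        by (intro finsum_single fS) (use P in \<open>auto simp: ps_term_def\<close>)
      then show ?thesis unfolding P1_def using tT by (subst coeff_finsum) (auto simp: ps_term_def)
    next
      case False
      then show ?thesis using coeff_outside[OF P False] coeff_outside[OF P1 False] by simp
    qed
    then have "P2 \<in> mono_ideal {a. \<not> a \<subseteq># m}" using P P1 P2 by (auto simp: mono_ideal_def P2_def r_right_minus_eq)
    moreover have id: "ideal (mono_ideal {a. \<not> a \<subseteq># m}) T"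
      by (rule ideal_mono_ideal) (auto dest: mset_subset_eq_add_left[THEN subset_mset.order_trans])
    ultimately have "P2 [^]\<^bsub>T\<^esub> Suc n \<in> mono_ideal {a. \<not> a \<subseteq># m}" for n
      using P2 by (auto intro!: ideal.I_l_closed[OF id])
    from this[of "q - 1"] have "P2 [^]\<^bsub>T\<^esub> q \<in> mono_ideal {a. \<not> a \<subseteq># m}" using q0 by simp
    then have z: "(P2 [^]\<^bsub>T\<^esub> q) m = \<zero>" by (simp add: mono_ideal_def)
    have "P = P1 \<oplus>\<^bsub>T\<^esub> P2" unfolding P2_def using P P1 by algebra
    then have "P [^]\<^bsub>T\<^esub> q = P1 [^]\<^bsub>T\<^esub> q \<oplus>\<^bsub>T\<^esub> P2 [^]\<^bsub>T\<^esub> q"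
      unfolding q using T.frobenius_add[OF p(1) has_char_T[OF p(2)] P1 P2] by (simp only:)
    also have "P1 [^]\<^bsub>T\<^esub> q = (\<Oplus>\<^bsub>T\<^esub>a\<in>S. ps_term R (P a) a [^]\<^bsub>T\<^esub> q)"
      unfolding P1_def q using tT by (intro T.frobenius_finsum[OF p(1) has_char_T[OF p(2)] fS])
    finally have "(P [^]\<^bsub>T\<^esub> q) m = (\<Oplus>\<^bsub>T\<^esub>a\<in>S. ps_term R (P a) a [^]\<^bsub>T\<^esub> q) m \<oplus> (P2 [^]\<^bsub>T\<^esub> q) m" by simp
    also have "(\<Oplus>\<^bsub>T\<^esub>a\<in>S. ps_term R (P a) a [^]\<^bsub>T\<^esub> q) m = (\<Oplus>a\<in>S. (ps_term R (P a) a [^]\<^bsub>T\<^esub> q) m)"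
      using tT by (intro coeff_finsum) auto
    also have "\<dots> = (\<Oplus>a\<in>S. ps_term R (P a [^] q) (repeat_mset q a) m)"
      using P by (intro finsum_cong') (auto simp: S_def ps_term_pow, auto simp: ps_term_def)
    finally show ?thesis using z P by (simp add: S_def[symmetric] ps_term_def finsum_closed)
  qed
  show "(P [^]\<^bsub>T\<^esub> q) m = \<zero>" if "\<And>a. m \<noteq> repeat_mset q a"
    unfolding eq using that by (intro add.finprod_one_eqI) (simp add: ps_term_def)
  show "(P [^]\<^bsub>T\<^esub> q) (repeat_mset q a) = P a [^] q"
  proof (cases "set_mset a \<subseteq> I")
    case True
    let ?S = "{b. b \<subseteq># repeat_mset q a \<and> set_mset b \<subseteq> I}"
    have "a \<subseteq># repeat_mset q a" using q0 by (simp add: subseteq_mset_def)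
    then have "a \<in> ?S" using True by simp
    moreover have "finite ?S" by (rule finite_subset[OF _ finite_submultisets[of "repeat_mset q a"]]) auto
    ultimately have "(\<Oplus>b\<in>?S. ps_term R (P b [^] q) (repeat_mset q b) (repeat_mset q a))
        = ps_term R (P a [^] q) (repeat_mset q a) (repeat_mset q a)"
      using P inj by (intro finsum_single) (auto simp: ps_term_def)
    then show ?thesis unfolding eq by (simp add: ps_term_def)
  next
    case False
    have "P [^]\<^bsub>T\<^esub> q \<in> carrier T" using P by simp
    moreover have "\<not> set_mset (repeat_mset q a) \<subseteq> I" using False q0 by (auto simp: subset_iff count_greater_zero_iff[symmetric] simp del: count_greater_zero_iff)
    ultimately have "(P [^]\<^bsub>T\<^esub> q) (repeat_mset q a) = \<zero>" by (rule coeff_outside)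
    moreover have "P a = \<zero>" by (rule coeff_outside[OF P False])
    ultimately show ?thesis using q0 by (simp add: nat_pow_zero)
  qed
qed

end

section \<open>Modules of power series over a cone of exponents\<close>

text \<open>The monomial with exponent \<theta>, as an element of a series module.\<close>

definition delta :: "('a, 'm) ring_scheme \<Rightarrow> 'g \<Rightarrow> 'g \<Rightarrow> 'a" where
  "delta R \<theta> = (\<lambda>\<eta>. if \<eta> = \<theta> then \<one>\<^bsub>R\<^esub> else \<zero>\<^bsub>R\<^esub>)"

lemma (in cring) delta_mem: "\<theta> \<in> Y \<Longrightarrow> delta R \<theta> \<in> supp_funs R Y"
  by (auto simp: delta_def supp_funs_def)

lemma (in ps_action) act_delta:
  assumes P: "P \<in> carrier (power_series_ring R I)" and \<theta>: "\<theta> \<in> Y"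
  shows "ps_act R I \<pi> Y P (delta R \<theta>) \<xi> = (\<Oplus>a\<in>{a. set_mset a \<subseteq> I \<and> \<pi> a + \<theta> = \<xi>}. P a)"
proof -
  have c: "P a \<in> carrier R" for a using P by (auto simp: supp_funs_def ps_simps)
  have "ps_act R I \<pi> Y P (delta R \<theta>) \<xi> = finsum R (\<lambda>(a, \<eta>). P a) {(a, \<eta>) \<in> D \<xi>. \<eta> = \<theta>}"
    unfolding ps_act_def
  proof (rule add.finprod_mono_neutral_cong_right[OF fin])
    have "P a \<otimes> delta R \<theta> \<eta> = \<zero>" if "\<eta> \<noteq> \<theta>" for a \<eta> using that c by (simp add: delta_def)
    then show "(case x of (a, \<eta>) \<Rightarrow> P a \<otimes> delta R \<theta> \<eta>) = \<zero>" if "x \<in> D \<xi> - {(a, \<eta>) \<in> D \<xi>. \<eta> = \<theta>}" for x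
      using that by auto
  qed (auto simp: delta_def c)
  also have "\<dots> = (\<Oplus>a\<in>{a. set_mset a \<subseteq> I \<and> \<pi> a + \<theta> = \<xi>}. P a)"
    by (rule finsum_bij[where h = fst]) (use \<theta> c in \<open>auto simp: bij_betw_def inj_on_def image_def\<close>)
  finally show ?thesis .
qed

lemma act_term:
  fixes \<pi> :: "'v multiset \<Rightarrow> 'g::ab_group_add"
  assumes "ps_action R I \<pi> Y" and c: "c \<in> carrier R" "set_mset b \<subseteq> I" and r: "r \<in> supp_funs R Y"
  shows "ps_act R I \<pi> Y (ps_term R c b) r \<xi> = c \<otimes>\<^bsub>R\<^esub> r (\<xi> - \<pi> b)"
proof -
  interpret ps_action R I \<pi> Y by fact
  have rc: "r \<eta> \<in> carrier R" for \<eta> using r by (auto simp: supp_funs_def)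
  show ?thesis
  proof (cases "\<xi> - \<pi> b \<in> Y")
    case True
    have "ps_act R I \<pi> Y (ps_term R c b) r \<xi> = (case (b, \<xi> - \<pi> b) of (a, \<eta>) \<Rightarrow> ps_term R c b a \<otimes>\<^bsub>R\<^esub> r \<eta>)"
      unfolding ps_act_def
      by (rule finsum_single[OF fin])
        (use True c rc in \<open>auto simp: ps_term_def algebra_simps split: if_splits\<close>)
    then show ?thesis by (simp add: ps_term_def)
  next
    case False
    then have "(\<lambda>(a, \<eta>). ps_term R c b a \<otimes>\<^bsub>R\<^esub> r \<eta>) x = \<zero>\<^bsub>R\<^esub>" if "x \<in> D \<xi>" for x
      using that rc by (auto simp: ps_term_def)
    then have "ps_act R I \<pi> Y (ps_term R c b) r \<xi> = \<zero>\<^bsub>R\<^esub>"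
      unfolding ps_act_def by (intro add.finprod_one_eqI)
    moreover have "r (\<xi> - \<pi> b) = \<zero>\<^bsub>R\<^esub>" using False r by (simp add: supp_funs_def)
    ultimately show ?thesis using c by simp
  qed
qed

lemma finite_multisets_count:
  assumes "finite A" shows "finite {m. set_mset m \<subseteq> A \<and> (\<forall>i. count m i \<le> M)}"
proof (rule finite_subset[OF _ card_monomials_le(1)[OF assms, of "Suc (card A * M)"]], safe)
  fix m :: "'a multiset" assume m: "set_mset m \<subseteq> A" "\<forall>i. count m i \<le> M"
  have "size m = (\<Sum>i\<in>set_mset m. count m i)" by (rule size_multiset_overloaded_eq)
  also have "\<dots> \<le> (\<Sum>i\<in>set_mset m. M)" by (intro sum_mono) (use m in auto)
  also have "\<dots> \<le> card A * M" using card_mono[OF assms m(1)] by simp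
  finally show "size m < Suc (card A * M)" by simp
qed

context binomial_hypersurface
begin

text \<open>With \<open>x\<^sub>v\<close> eliminated as \<open>x\<^sub>v = x\<^sup>d / x\<^sub>u\<close>, \<open>wt a\<close> is the exponent vector of \<open>x\<^sup>a\<close>; the
  exponents that occur in \<open>A\<close> form \<open>cone {#}\<close>, and the summands of its Frobenius pushforwards
  will be the modules of series over \<open>cone g\<close> for the divisors \<open>x\<^sup>g\<close> of \<open>x\<^sup>d\<close>.\<close>

definition wt :: "'v multiset \<Rightarrow> 'v \<Rightarrow> int" where
  "wt a = (\<lambda>i. if i = u then int (count a u) - int (count a v)
    else if i \<in> J then int (count a i) + int (count a v) * int (count d i) else 0)"

definition cone :: "'v multiset \<Rightarrow> ('v \<Rightarrow> int) set" where
  "cone g = {\<xi>. (\<forall>i\<in>J. 0 \<le> \<xi> i \<and> 0 \<le> \<xi> i + \<xi> u * int (count d i) + int (count g i)) \<and>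
    (\<forall>i. i \<notin> insert u J \<longrightarrow> \<xi> i = 0)}"

abbreviation cone_module where "cone_module g \<equiv> ps_module K I wt (cone g)"

lemma count_d_uv [simp]: "count d u = 0" "count d v = 0"
  using d(1) by (auto simp: count_eq_zero_iff)

lemma wt_add: "wt (a + b) = wt a + wt b"
  by (auto simp: wt_def fun_eq_iff algebra_simps)

lemma wt_zero: "wt {#} = 0"
  by (auto simp: wt_def fun_eq_iff)

text \<open>The inequalities of the cone are stable because the weight of a monomial satisfies them
  with \<open>g = {#}\<close>. Fibres are finite because some variable \<open>i0\<close> occurs in
  d: the exponent of \<open>i0\<close> in \<xi> bounds the multiplicity of v, and the second
  inequality at \<open>i0\<close> bounds that of u. The other multiplicities are bounded directly by
  \<xi>.\<close>

lemma ps_action_cone: "ps_action K I wt (cone g)"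
proof (intro ps_action.intro ps_action_axioms.intro is_cring wt_add wt_zero)
  fix a \<eta> assume a: "set_mset a \<subseteq> I" and \<eta>: "\<eta> \<in> cone g"
  have "0 \<le> (wt a + \<eta>) i" "0 \<le> (wt a + \<eta>) i + (wt a + \<eta>) u * int (count d i) + int (count g i)" if i: "i \<in> J" for i
  proof -
    have "0 \<le> \<eta> i" "0 \<le> \<eta> i + \<eta> u * int (count d i) + int (count g i)" using \<eta> i by (auto simp: cone_def)
    moreover have "(wt a + \<eta>) i = int (count a i) + int (count a v) * int (count d i) + \<eta> i" using i by (simp add: wt_def)
    moreover have "(wt a + \<eta>) i + (wt a + \<eta>) u * int (count d i) + int (count g i)
        = int (count a i) + int (count a u) * int (count d i) + (\<eta> i + \<eta> u * int (count d i) + int (count g i))"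
      using i by (simp add: wt_def algebra_simps)
    moreover have "0 \<le> int (count a v) * int (count d i)" "0 \<le> int (count a u) * int (count d i)" by simp_all
    ultimately show "0 \<le> (wt a + \<eta>) i" "0 \<le> (wt a + \<eta>) i + (wt a + \<eta>) u * int (count d i) + int (count g i)"
      by linarith+
  qed
  moreover have "(wt a + \<eta>) i = 0" if "i \<notin> insert u J" for i using that \<eta> by (auto simp: wt_def cone_def)
  ultimately show "wt a + \<eta> \<in> cone g" unfolding cone_def by blast
next
  fix \<xi> :: "'v \<Rightarrow> int"
  have "d \<noteq> {#}" using d(2) by auto
  then obtain i0 where i0: "i0 \<in># d" by blast
  then have i0J: "i0 \<in> J" "count d i0 \<ge> 1" using d(1) by (auto simp: Suc_le_eq)
  define M where "M = (\<Sum>i\<in>I. nat (\<xi> i)) + nat (\<xi> i0 + \<xi> u * int (count d i0) + int (count g i0))"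
  have "{(a, \<eta>). set_mset a \<subseteq> I \<and> \<eta> \<in> cone g \<and> wt a + \<eta> = \<xi>}
      \<subseteq> (\<lambda>a. (a, \<xi> - wt a)) ` {a. set_mset a \<subseteq> I \<and> (\<forall>i. count a i \<le> M)}"
  proof clarify
    fix a \<eta> assume a: "set_mset a \<subseteq> I" and \<eta>: "\<eta> \<in> cone g" and \<xi>: "\<xi> = wt a + \<eta>"
    have e: "\<xi> i = int (count a i) + int (count a v) * int (count d i) + \<eta> i" "0 \<le> \<eta> i" if "i \<in> J" for i
      using that \<eta> by (auto simp: \<xi> wt_def cone_def)
    have mul: "int n \<le> int n * int (count d i0)" for n using i0J(2) by (simp flip: of_nat_mult)
    have le: "nat (\<xi> i) \<le> M" if "i \<in> I" for i
      unfolding M_def using member_le_sum[of i I "\<lambda>i. nat (\<xi> i)"] that fin by simp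
    have "count a i \<le> M" for i
    proof (cases "i \<in> J")
      case True
      have "0 \<le> int (count a v) * int (count d i)" by simp
      then have "int (count a i) \<le> \<xi> i" using e[OF True] by linarith
      then show ?thesis using le[of i] True by simp
    next
      case False
      have v: "count a v \<le> M"
      proof -
        have "int (count a v) \<le> \<xi> i0" using e[OF i0J(1)] mul[of "count a v"] by linarith
        then show ?thesis using le[of i0] i0J by simp
      qed
      have u: "count a u \<le> M"
      proof -
        have "\<xi> i0 + \<xi> u * int (count d i0) + int (count g i0) = int (count a i0) + int (count a u) * int (count d i0)
            + (\<eta> i0 + \<eta> u * int (count d i0) + int (count g i0))"
          using i0J(1) by (simp add: \<xi> wt_def algebra_simps)
        moreover have "0 \<le> \<eta> i0 + \<eta> u * int (count d i0) + int (count g i0)" using \<eta> i0J(1) by (auto simp: cone_def)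
        ultimately have "int (count a u) \<le> \<xi> i0 + \<xi> u * int (count d i0) + int (count g i0)"
          using mul[of "count a u"] by linarith
        then show ?thesis unfolding M_def by linarith
      qed
      consider "i = u" | "i = v" | "i \<notin> I" using False by blast
      then show ?thesis
      proof cases
        case 3
        then have "i \<notin># a" using a by blast
        then show ?thesis by (simp add: not_in_iff)
      qed (use u v in auto)
    qed
    then show "(a, \<eta>) \<in> (\<lambda>b. (b, (wt a + \<eta>) - wt b)) ` {b. set_mset b \<subseteq> I \<and> (\<forall>i. count b i \<le> M)}"
      using a by (intro image_eqI[of _ _ a]) (auto simp: algebra_simps)
  qed
  moreover have "finite ((\<lambda>a. (a, \<xi> - wt a)) ` {a. set_mset a \<subseteq> I \<and> (\<forall>i. count a i \<le> M)})"
    by (intro finite_imageI finite_multisets_count fin)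
  ultimately show "finite {(a, \<eta>). set_mset a \<subseteq> I \<and> \<eta> \<in> cone g \<and> wt a + \<eta> = \<xi>}" by (rule finite_subset)
qed

lemma module_cone: "module T (cone_module g)"
  by (rule ps_action.module_ps_module[OF ps_action_cone])

text \<open>The monomials \<open>x\<^sup>d\<close> and \<open>x\<^sub>u x\<^sub>v\<close> have the
  same weight and so act in the same way.\<close>

lemma F_smult:
  assumes r: "r \<in> carrier (cone_module g)" shows "F \<odot>\<^bsub>cone_module g\<^esub> r = \<zero>\<^bsub>cone_module g\<^esub>"
proof -
  interpret N: module T "cone_module g" by (rule module_cone)
  have uvI: "set_mset {#u, v#} \<subseteq> I" and dI: "set_mset d \<subseteq> I" using uv d by auto
  have "wt {#u, v#} = wt d" using uv(3) by (auto simp: wt_def fun_eq_iff)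
  moreover have r': "r \<in> supp_funs K (cone g)" using r by (simp add: ps_module_simps)
  ultimately have e: "ps_term K \<one> d \<odot>\<^bsub>cone_module g\<^esub> r = ps_term K \<one> {#u, v#} \<odot>\<^bsub>cone_module g\<^esub> r"
    unfolding ps_module_simps
    by (intro ext) (simp only: act_term[OF ps_action_cone one_closed dI r'] act_term[OF ps_action_cone one_closed uvI r'])
  have tT: "ps_term K \<one> d \<in> carrier T" "ps_term K \<one> {#u, v#} \<in> carrier T"
    by (rule ps_term_closed[OF one_closed dI], rule ps_term_closed[OF one_closed uvI])
  have "F \<odot>\<^bsub>cone_module g\<^esub> r = ps_term K \<one> d \<odot>\<^bsub>cone_module g\<^esub> r
      \<oplus>\<^bsub>cone_module g\<^esub> \<ominus>\<^bsub>cone_module g\<^esub> (ps_term K \<one> {#u, v#} \<odot>\<^bsub>cone_module g\<^esub> r)"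
    unfolding F_def T.minus_eq using tT r by (simp only: N.smult_l_distr N.smult_l_minus T.a_inv_closed)
  then show ?thesis unfolding e using r tT by (simp add: N.M.r_neg)
qed

lemma kernel_smult:
  assumes P: "P \<in> carrier T" "\<Theta> P = \<zero>\<^bsub>A\<^esub>" and r: "r \<in> carrier (cone_module g)"
  shows "P \<odot>\<^bsub>cone_module g\<^esub> r = \<zero>\<^bsub>cone_module g\<^esub>"
proof -
  interpret N: module T "cone_module g" by (rule module_cone)
  obtain H where "H \<in> carrier T" "P = H \<otimes>\<^bsub>T\<^esub> F" using P ker unfolding F_def by blast
  then show ?thesis using r by (simp add: N.smult_assoc1 F_smult)
qed

text \<open>Monomials not divisible by \<open>x\<^sub>u x\<^sub>v\<close> are the normal forms
  modulo the equation. The sign of the u-exponent of the weight tells which of u and v occurs, and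
  its size tells how often.\<close>

lemma wt_inj:
  assumes eq: "wt a = wt b" and I: "set_mset a \<subseteq> I" "set_mset b \<subseteq> I"
    and a: "count a u = 0 \<or> count a v = 0" and b: "count b u = 0 \<or> count b v = 0"
  shows "a = b"
proof (rule multiset_eqI)
  fix i
  have z: "count c j = 0" if "set_mset c \<subseteq> I" "j \<notin> I" for c j using that by (metis not_in_iff subsetD)
  have "int (count a u) - int (count a v) = int (count b u) - int (count b v)"
    using fun_cong[OF eq, of u] by (simp add: wt_def)
  then have uv': "count a u = count b u" "count a v = count b v" using a b by auto
  consider "i = u" | "i = v" | "i \<in> J" | "i \<notin> I" by blast
  then show "count a i = count b i"
  proof cases
    case 3
    then show ?thesis using fun_cong[OF eq, of i] uv' by (simp add: wt_def)
  next
    case 4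
    then show ?thesis using z I by simp
  qed (use uv' in auto)
qed

text \<open>The least exponent of the cone with u-exponent -1: there the second inequality reads
  \<open>d i - g i \<le> \<xi> i\<close>. For \<open>g = {#}\<close> it is the weight of v.\<close>

definition apex :: "'v multiset \<Rightarrow> 'v \<Rightarrow> int" where
  "apex g = (\<lambda>i. if i = u then -1 else if i \<in> J then int (count d i) - int (count g i) else 0)"

lemma apex_mem: "g \<subseteq># d \<Longrightarrow> apex g \<in> cone g"
  by (auto simp: apex_def cone_def mset_subset_eq_count)

lemma zero_mem_cone: "0 \<in> cone g"
  by (auto simp: cone_def)

definition exps :: "nat \<Rightarrow> nat \<Rightarrow> ('v \<Rightarrow> nat) \<Rightarrow> 'v multiset" where
  "exps m n h = replicate_mset m u + replicate_mset n v + (\<Sum>i\<in>J. replicate_mset (h i) i)"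

lemma count_exps: "count (exps m n h) i = (if i = u then m else if i = v then n else if i \<in> J then h i else 0)"
proof -
  have "count (\<Sum>i\<in>J. replicate_mset (h i) i) i = (if i \<in> J then h i else 0)"
    using fin by (simp add: count_sum sum.delta')
  then show ?thesis using uv(3) by (auto simp: exps_def)
qed

lemma set_exps: "set_mset (exps m n h) \<subseteq> I"
proof
  fix i assume "i \<in># exps m n h"
  then have "count (exps m n h) i \<noteq> 0" by simp
  then show "i \<in> I" using uv by (auto simp: count_exps split: if_splits)
qed

text \<open>The module has the two generators with exponents 0 and \<open>apex g\<close>. Exponents
  with nonnegative u-part are uniquely 0 plus the weight of a monomial without v, those with
  negative u-part uniquely the apex plus the weight of a monomial without u. So the two coefficient
  series can be read off, and infinitely many terms are treated at once.\<close>

lemma cone_generators: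
  assumes g: "g \<subseteq># d" and r: "r \<in> supp_funs K (cone g)"
  obtains P Q where "P \<in> carrier T" "Q \<in> carrier T"
    "r = (\<lambda>\<xi>. ps_act K I wt (cone g) P (delta K 0) \<xi> \<oplus> ps_act K I wt (cone g) Q (delta K (apex g)) \<xi>)"
proof -
  interpret ps_action K I wt "cone g" by (rule ps_action_cone)
  have rc: "r \<xi> \<in> carrier K" for \<xi> using r by (auto simp: supp_funs_def)
  have r0: "r \<xi> = \<zero>" if "\<xi> \<notin> cone g" for \<xi> using r that by (auto simp: supp_funs_def)
  define P where "P a = (if set_mset a \<subseteq> I - {v} then r (wt a) else \<zero>)" for a
  define Q where "Q a = (if set_mset a \<subseteq> I - {u} then r (wt a + apex g) else \<zero>)" for a
  have PT: "P \<in> carrier T" by (rule T_memI) (auto simp: P_def rc split: if_splits)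
  have QT: "Q \<in> carrier T" by (rule T_memI) (auto simp: Q_def rc split: if_splits)
  have gd: "count g i \<le> count d i" for i using g by (rule mset_subset_eq_count)
  have mem: "0 \<le> \<xi> i" "0 \<le> \<xi> i + \<xi> u * int (count d i) + int (count g i)" if "\<xi> \<in> cone g" "i \<in> J" for \<xi> i
    using that unfolding cone_def by blast+
  have out: "\<xi> i = 0" if "\<xi> \<in> cone g" "i \<notin> insert u J" for \<xi> i
    using that unfolding cone_def by blast
  have inj: "a = b" if "wt a = wt b" "set_mset a \<subseteq> I - {w}" "set_mset b \<subseteq> I - {w}" "w = u \<or> w = v" for a b w
    by (rule wt_inj) (use that in \<open>auto simp: count_eq_zero_iff\<close>)
  have fib: "finite {a. set_mset a \<subseteq> I \<and> wt a + \<theta> = \<xi>}" if "\<theta> \<in> cone g" for \<theta> \<xi>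
  proof (rule finite_subset)
    show "{a. set_mset a \<subseteq> I \<and> wt a + \<theta> = \<xi>} \<subseteq> fst ` D \<xi>" using that by force
    show "finite (fst ` D \<xi>)" by (intro finite_imageI fin)
  qed
  have pr: "ps_act K I wt (cone g) P (delta K 0) \<xi> = (if 0 \<le> \<xi> u then r \<xi> else \<zero>)" for \<xi>
  proof (cases "0 \<le> \<xi> u \<and> \<xi> \<in> cone g")
    case True
    let ?a = "exps (nat (\<xi> u)) 0 (\<lambda>i. nat (\<xi> i))"
    have wa: "wt ?a = \<xi>" using True mem out uv(3) by (auto simp: wt_def count_exps fun_eq_iff)
    have "v \<notin># ?a" using uv(3) by (simp add: not_in_iff count_exps)
    then have sa: "set_mset ?a \<subseteq> I - {v}" using set_exps[of "nat (\<xi> u)" 0 "\<lambda>i. nat (\<xi> i)"] by blast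
    have "(\<Oplus>a\<in>{a. set_mset a \<subseteq> I \<and> wt a + 0 = \<xi>}. P a) = P ?a"
    proof (rule finsum_single[OF fib[OF zero_mem_cone]])
      fix b assume b: "b \<in> {a. set_mset a \<subseteq> I \<and> wt a + 0 = \<xi>}" "b \<noteq> ?a"
      then have "\<not> set_mset b \<subseteq> I - {v}" using inj[OF _ _ sa, of b] wa by auto
      then show "P b = \<zero>" by (simp add: P_def)
    qed (use sa wa PT in auto)
    then show ?thesis using act_delta[OF PT zero_mem_cone] True sa wa by (simp add: P_def)
  next
    case False
    have "P b = \<zero>" if b: "set_mset b \<subseteq> I" "wt b + 0 = \<xi>" for b
    proof (cases "set_mset b \<subseteq> I - {v}")
      case True
      then have "count b v = 0" by (auto simp: count_eq_zero_iff)
      then have "0 \<le> \<xi> u" using b(2) by (auto simp: wt_def)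
      then show ?thesis using False r0[of \<xi>] b(2) by (simp add: P_def)
    qed (simp add: P_def)
    then have "(\<Oplus>a\<in>{a. set_mset a \<subseteq> I \<and> wt a + 0 = \<xi>}. P a) = \<zero>" by (intro add.finprod_one_eqI) blast
    then show ?thesis using act_delta[OF PT zero_mem_cone] False r0[of \<xi>] by auto
  qed
  have qr: "ps_act K I wt (cone g) Q (delta K (apex g)) \<xi> = (if 0 \<le> \<xi> u then \<zero> else r \<xi>)" for \<xi>
  proof (cases "\<not> 0 \<le> \<xi> u \<and> \<xi> \<in> cone g")
    case True
    let ?h = "\<lambda>i. nat (\<xi> i + \<xi> u * int (count d i) + int (count g i))"
    \<comment> \<open>One of the negative powers of u is supplied by the apex, so v occurs one time
      fewer than the absolute value of the u-exponent.\<close>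
    let ?a = "exps 0 (nat (- \<xi> u - 1)) ?h"
    have wa: "wt ?a + apex g = \<xi>"
    proof
      fix i
      show "(wt ?a + apex g) i = \<xi> i"
        using True mem[of \<xi> i] out[of \<xi> i] uv(3) by (auto simp: wt_def apex_def count_exps algebra_simps)
    qed
    have "u \<notin># ?a" by (simp add: not_in_iff count_exps)
    then have sa: "set_mset ?a \<subseteq> I - {u}" using set_exps[of 0 "nat (- \<xi> u - 1)" ?h] by blast
    have "(\<Oplus>a\<in>{a. set_mset a \<subseteq> I \<and> wt a + apex g = \<xi>}. Q a) = Q ?a"
    proof (rule finsum_single[OF fib[OF apex_mem[OF g]]])
      fix b assume b: "b \<in> {a. set_mset a \<subseteq> I \<and> wt a + apex g = \<xi>}" "b \<noteq> ?a"
      then have "wt b + apex g = wt ?a + apex g" using wa by simp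
      then have "wt b = wt ?a" by (simp only: add_right_cancel)
      then have "\<not> set_mset b \<subseteq> I - {u}" using inj[OF _ _ sa, of b] b(2) by auto
      then show "Q b = \<zero>" by (simp add: Q_def)
    qed (use sa wa QT in auto)
    then show ?thesis using act_delta[OF QT apex_mem[OF g]] True sa wa by (simp add: Q_def)
  next
    case False
    have "Q b = \<zero>" if b: "set_mset b \<subseteq> I" "wt b + apex g = \<xi>" for b
    proof (cases "set_mset b \<subseteq> I - {u}")
      case True
      then have "count b u = 0" by (auto simp: count_eq_zero_iff)
      then have "\<not> 0 \<le> \<xi> u" using b(2) by (auto simp: wt_def apex_def)
      then show ?thesis using False r0[of \<xi>] b(2) by (simp add: Q_def)
    qed (simp add: Q_def)
    then have "(\<Oplus>a\<in>{a. set_mset a \<subseteq> I \<and> wt a + apex g = \<xi>}. Q a) = \<zero>" by (intro add.finprod_one_eqI) blast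
    then show ?thesis using act_delta[OF QT apex_mem[OF g]] False r0[of \<xi>] by auto
  qed
  show thesis by (rule that[OF PT QT]) (auto simp: pr qr rc fun_eq_iff)
qed

lemma fg_cone:
  assumes g: "g \<subseteq># d" shows "fg_module T (cone_module g)"
proof -
  interpret N: module T "cone_module g" by (rule module_cone)
  have del: "delta K 0 \<in> carrier (cone_module g)" "delta K (apex g) \<in> carrier (cone_module g)"
    unfolding ps_module_simps by (rule delta_mem[OF zero_mem_cone], rule delta_mem[OF apex_mem[OF g]])
  have "apex g u \<noteq> (0 :: 'v \<Rightarrow> int) u" by (simp add: apex_def)
  then have ne: "delta K (apex g) \<noteq> delta K 0" by (metis delta_def one_not_zero)
  show ?thesis
    unfolding fg_module_def
  proof (intro conjI module_cone exI[of _ "{delta K 0, delta K (apex g)}"] ballI)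
    fix r assume "r \<in> carrier (cone_module g)"
    then have "r \<in> supp_funs K (cone g)" by (simp add: ps_module_simps)
    then obtain P Q where PQ: "P \<in> carrier T" "Q \<in> carrier T"
      "r = (\<lambda>\<xi>. ps_act K I wt (cone g) P (delta K 0) \<xi> \<oplus> ps_act K I wt (cone g) Q (delta K (apex g)) \<xi>)"
      by (rule cone_generators[OF g])
    let ?c = "\<lambda>x. if x = delta K 0 then P else Q"
    have r_eq: "r = P \<odot>\<^bsub>cone_module g\<^esub> delta K 0 \<oplus>\<^bsub>cone_module g\<^esub> Q \<odot>\<^bsub>cone_module g\<^esub> delta K (apex g)"
      unfolding PQ(3) by (simp add: ps_module_simps)
    have "(\<Oplus>\<^bsub>cone_module g\<^esub>x\<in>{delta K 0, delta K (apex g)}. ?c x \<odot>\<^bsub>cone_module g\<^esub> x) = r"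
      unfolding r_eq using del ne PQ(1,2) by (subst N.M.finsum_insert) (auto intro!: N.smult_closed)
    then show "\<exists>c\<in>{delta K 0, delta K (apex g)} \<rightarrow> carrier T.
        r = (\<Oplus>\<^bsub>cone_module g\<^esub>x\<in>{delta K 0, delta K (apex g)}. c x \<odot>\<^bsub>cone_module g\<^esub> x)"
      using PQ by (intro bexI[of _ ?c]) auto
  qed (use del in auto)
qed

end

section \<open>The hypersurface ring as series over a cone\<close>

context binomial_hypersurface
begin

text \<open>The substitution of monomial weights, written as the action on the unit element of the
  module over \<open>cone {#}\<close>. In this form multiplicativity is associativity of the
  action.\<close>

definition expand :: "('v multiset \<Rightarrow> 'a) \<Rightarrow> ('v \<Rightarrow> int) \<Rightarrow> 'a" where
  "expand P = ps_act K I wt (cone {#}) P (delta K 0)"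

lemma expand_simps:
  assumes "P \<in> carrier T"
  shows "expand P \<in> supp_funs K (cone {#})"
    and "Q \<in> carrier T \<Longrightarrow> expand (P \<otimes>\<^bsub>T\<^esub> Q) = ps_act K I wt (cone {#}) P (expand Q)"
    and "Q \<in> carrier T \<Longrightarrow> expand (P \<oplus>\<^bsub>T\<^esub> Q) = (\<lambda>\<xi>. expand P \<xi> \<oplus> expand Q \<xi>)"
proof -
  interpret ps_action K I wt "cone {#}" by (rule ps_action_cone)
  note del = delta_mem[OF zero_mem_cone[of "{#}"]]
  show "expand P \<in> supp_funs K (cone {#})" unfolding expand_def by (rule act_closed[OF assms del])
  show "Q \<in> carrier T \<Longrightarrow> expand (P \<otimes>\<^bsub>T\<^esub> Q) = ps_act K I wt (cone {#}) P (expand Q)"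
    unfolding expand_def by (rule act_assoc[OF assms _ del])
  show "Q \<in> carrier T \<Longrightarrow> expand (P \<oplus>\<^bsub>T\<^esub> Q) = (\<lambda>\<xi>. expand P \<xi> \<oplus> expand Q \<xi>)"
    unfolding expand_def by (rule act_add_left[OF assms _ del])
qed

text \<open>The second generator of the module over \<open>cone {#}\<close> is the expansion of v,
  so everything is generated by expansions.\<close>

lemma expand_surj:
  assumes r: "r \<in> supp_funs K (cone {#})"
  shows "\<exists>P\<in>carrier T. expand P = r"
proof -
  interpret ps_action K I wt "cone {#}" by (rule ps_action_cone)
  obtain P Q where PQ: "P \<in> carrier T" "Q \<in> carrier T"
    "r = (\<lambda>\<xi>. ps_act K I wt (cone {#}) P (delta K 0) \<xi> \<oplus> ps_act K I wt (cone {#}) Q (delta K (apex {#})) \<xi>)"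
    by (rule cone_generators[OF _ r]) simp
  have vT: "var v \<in> carrier T" and vI: "set_mset {#v#} \<subseteq> I" using uv by auto
  have "wt {#v#} = apex {#}" using uv(3) by (auto simp: wt_def apex_def fun_eq_iff)
  then have "expand (var v) \<xi> = delta K (apex {#}) \<xi>" for \<xi>
    unfolding expand_def act_term[OF ps_action_cone one_closed vI delta_mem[OF zero_mem_cone]]
    by (simp add: delta_def)
  then have "expand (var v) = delta K (apex {#})" by (rule ext)
  then have "r = expand (P \<oplus>\<^bsub>T\<^esub> Q \<otimes>\<^bsub>T\<^esub> var v)"
    using PQ vT by (simp add: expand_simps del: coeff_add) (simp add: expand_def)
  then show ?thesis using PQ(1,2) vT by (intro bexI[of _ "P \<oplus>\<^bsub>T\<^esub> Q \<otimes>\<^bsub>T\<^esub> var v"]) (auto simp del: coeff_add)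
qed

lemma expand_zeroI:
  assumes "P \<in> carrier T" "\<Theta> P = \<zero>\<^bsub>A\<^esub>" shows "expand P = (\<lambda>\<xi>. \<zero>)"
  using kernel_smult[OF assms, of "delta K 0" "{#}"] delta_mem[OF zero_mem_cone[of "{#}"]]
  by (simp add: expand_def ps_module_simps)

text \<open>Division by -F. As d has degree at least 3, the lowest monomial of F is
  \<open>x\<^sub>u x\<^sub>v\<close>, so the remainder R involves only monomials not divisible by
  it. On these the weight is injective; each coefficient of R is therefore a coefficient of its
  expansion and vanishes.\<close>

lemma expand_zeroD:
  assumes size: "3 \<le> size d" and P: "P \<in> carrier T" and P0: "expand P = (\<lambda>\<xi>. \<zero>)"
  shows "\<Theta> P = \<zero>\<^bsub>A\<^esub>"
proof -
  interpret ps_action K I wt "cone {#}" by (rule ps_action_cone)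
  have "mkey {#u, v#} \<le> mkey d" using size by (simp add: mkey_def less_eq_prod_def)
  then have lead: "lead_at K (\<ominus>\<^bsub>T\<^esub> F) {#u, v#}" using d_neq by (auto simp: lead_at_def F_coeff)
  have monic: "(\<ominus>\<^bsub>T\<^esub> F) {#u, v#} = \<one>" using d_neq by (simp add: F_coeff)
  obtain h where h: "h () \<in> carrier T"
    "\<And>m. {#u, v#} \<subseteq># m \<Longrightarrow> P m = (\<Oplus>\<^bsub>T\<^esub>i\<in>{()}. h i \<otimes>\<^bsub>T\<^esub> \<ominus>\<^bsub>T\<^esub> F) m"
    by (rule division[of "{()}" "\<lambda>_. \<ominus>\<^bsub>T\<^esub> F" "\<lambda>_. {#u, v#}" P]) (use P lead monic in \<open>(simp; fail | blast)+\<close>)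
  define E where "E = h () \<otimes>\<^bsub>T\<^esub> \<ominus>\<^bsub>T\<^esub> F"
  have ET: "E \<in> carrier T" using h(1) by (simp add: E_def)
  have PE: "P m = E m" if "{#u, v#} \<subseteq># m" for m using h(2)[OF that] h(1) by (simp add: E_def)
  have "\<Theta> F = \<zero>\<^bsub>A\<^esub>" using ker[of F] by (auto simp: F_def[symmetric] intro!: bexI[of _ "\<one>\<^bsub>T\<^esub>"])
  then have E0: "\<Theta> E = \<zero>\<^bsub>A\<^esub>" using h(1) by (simp add: E_def)
  define R where "R = P \<ominus>\<^bsub>T\<^esub> E"
  have RT: "R \<in> carrier T" unfolding R_def using P ET by simp
  have PR: "P = R \<oplus>\<^bsub>T\<^esub> E" unfolding R_def using P ET by algebra
  have "expand P = (\<lambda>\<xi>. expand R \<xi> \<oplus> \<zero>)" unfolding PR using expand_simps(3)[OF RT ET] expand_zeroI[OF ET E0] by simp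
  moreover have "expand R \<xi> \<in> carrier K" for \<xi> using expand_simps(1)[OF RT] by (simp add: supp_funs_def)
  ultimately have R0: "expand R \<xi> = \<zero>" for \<xi> using P0 by (metis r_zero)
  have Ruv: "R m = \<zero>" if "{#u, v#} \<subseteq># m" for m
    unfolding R_def using PE[OF that] P ET by (simp add: r_right_minus_eq)
  have uv_le: "{#u, v#} \<subseteq># m" if "count m u \<noteq> 0" "count m v \<noteq> 0" for m
    using that uv(3) by (auto simp: subseteq_mset_def)
  have "R a = \<zero>" for a
  proof (cases "set_mset a \<subseteq> I \<and> (count a u = 0 \<or> count a v = 0)")
    case True
    have "expand R (wt a) = (\<Oplus>b\<in>{b. set_mset b \<subseteq> I \<and> wt b + 0 = wt a}. R b)"
      unfolding expand_def by (rule act_delta[OF RT zero_mem_cone])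
    also have "\<dots> = R a"
    proof (rule finsum_single)
      show "finite {b. set_mset b \<subseteq> I \<and> wt b + 0 = wt a}"
        by (rule finite_subset[OF _ finite_imageI[OF fin, of fst "wt a"]]) (use zero_mem_cone in force)
      fix b assume b: "b \<in> {b. set_mset b \<subseteq> I \<and> wt b + 0 = wt a}" "b \<noteq> a"
      have "b = a" if "count b u = 0 \<or> count b v = 0"
        by (rule wt_inj[OF _ _ _ that]) (use True b in auto)
      then have "\<not> (count b u = 0 \<or> count b v = 0)" using b(2) by blast
      then show "R b = \<zero>" using Ruv uv_le by blast
    qed (use True RT in auto)
    finally show ?thesis using R0 by simp
  next
    case False
    then show ?thesis using Ruv uv_le coeff_outside[OF RT] by blast
  qed
  then have "R = \<zero>\<^bsub>T\<^esub>" by (simp add: ps_simps(2) fun_eq_iff)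
  then have "P = E" using PR ET by simp
  then show ?thesis using E0 by simp
qed

definition expandA :: "'h \<Rightarrow> ('v \<Rightarrow> int) \<Rightarrow> 'a" where
  "expandA a = expand (inv_into (carrier T) \<Theta> a)"

lemma expandA_\<Theta>:
  assumes "P \<in> carrier T" shows "expandA (\<Theta> P) = expand P"
proof -
  interpret A: cring A by (rule A)
  define Q where "Q = inv_into (carrier T) \<Theta> (\<Theta> P)"
  have Q: "Q \<in> carrier T" "\<Theta> Q = \<Theta> P"
    unfolding Q_def using inv_into_into[of "\<Theta> P" \<Theta> "carrier T"] f_inv_into_f[of "\<Theta> P" \<Theta> "carrier T"] assms by blast+
  have D: "Q \<ominus>\<^bsub>T\<^esub> P \<in> carrier T" using Q assms by simp
  have "\<Theta> (Q \<ominus>\<^bsub>T\<^esub> P) = \<zero>\<^bsub>A\<^esub>" using Q assms by (simp add: T.minus_eq \<Theta>.S.r_neg)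
  then have "expand (Q \<ominus>\<^bsub>T\<^esub> P) = (\<lambda>\<xi>. \<zero>)" by (rule expand_zeroI[OF D])
  moreover have "Q = (Q \<ominus>\<^bsub>T\<^esub> P) \<oplus>\<^bsub>T\<^esub> P" using Q assms by algebra
  then have "expand Q = (\<lambda>\<xi>. expand (Q \<ominus>\<^bsub>T\<^esub> P) \<xi> \<oplus> expand P \<xi>)" using expand_simps(3)[OF D assms] by simp
  moreover have "expand P \<xi> \<in> carrier K" for \<xi> using expand_simps(1)[OF assms] by (simp add: supp_funs_def)
  ultimately show ?thesis unfolding expandA_def Q_def[symmetric] by simp
qed

lemma expandA_bij:
  assumes "3 \<le> size d" shows "bij_betw expandA (carrier A) (supp_funs K (cone {#}))"
  unfolding bij_betw_def
proof
  interpret A: cring A by (rule A)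
  show "inj_on expandA (carrier A)"
  proof (rule inj_onI)
    fix a b assume a: "a \<in> carrier A" "b \<in> carrier A" "expandA a = expandA b"
    obtain P where P: "P \<in> carrier T" "a = \<Theta> P" using \<Theta>_ex a by blast
    obtain Q where Q: "Q \<in> carrier T" "b = \<Theta> Q" using \<Theta>_ex a by blast
    have D: "P \<ominus>\<^bsub>T\<^esub> Q \<in> carrier T" using P Q by simp
    have "P = (P \<ominus>\<^bsub>T\<^esub> Q) \<oplus>\<^bsub>T\<^esub> Q" using P(1) Q(1) by algebra
    then have "expand P = (\<lambda>\<xi>. expand (P \<ominus>\<^bsub>T\<^esub> Q) \<xi> \<oplus> expand Q \<xi>)" using expand_simps(3)[OF D Q(1)] by simp
    moreover have "expand P = expand Q" using a P Q by (simp add: expandA_\<Theta>)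
    ultimately have eq: "expand Q \<xi> = expand (P \<ominus>\<^bsub>T\<^esub> Q) \<xi> \<oplus> expand Q \<xi>" for \<xi> by metis
    have cl: "expand Q \<xi> \<in> carrier K" "expand (P \<ominus>\<^bsub>T\<^esub> Q) \<xi> \<in> carrier K" for \<xi>
      using expand_simps(1)[OF Q(1)] expand_simps(1)[OF D] by (simp_all add: supp_funs_def)
    have "expand (P \<ominus>\<^bsub>T\<^esub> Q) \<xi> = \<zero>" for \<xi>
      using add.r_cancel_one[OF cl, of \<xi> \<xi>] eq[of \<xi>] by simp
    then have "\<Theta> (P \<ominus>\<^bsub>T\<^esub> Q) = \<zero>\<^bsub>A\<^esub>" by (intro expand_zeroD[OF assms D]) (rule ext)
    then show "a = b" using P Q by (simp add: T.minus_eq \<Theta>.S.minus_eq[symmetric])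
  qed
  show "expandA ` carrier A = supp_funs K (cone {#})"
  proof (intro equalityI subsetI)
    fix r assume "r \<in> expandA ` carrier A"
    then obtain a where a: "a \<in> carrier A" "r = expandA a" by blast
    obtain P where P: "P \<in> carrier T" "a = \<Theta> P" using \<Theta>_ex a by blast
    then show "r \<in> supp_funs K (cone {#})" using a(2) expand_simps(1) by (simp add: expandA_\<Theta>)
  next
    fix r assume "r \<in> supp_funs K (cone {#})"
    then obtain P where P: "P \<in> carrier T" "expand P = r" using expand_surj by blast
    then show "r \<in> expandA ` carrier A" by (intro image_eqI[of _ _ "\<Theta> P"]) (simp_all add: expandA_\<Theta>)
  qed
qed

lemma expandA_add:
  assumes "a \<in> carrier A" "b \<in> carrier A"
  shows "expandA (a \<oplus>\<^bsub>A\<^esub> b) = (\<lambda>\<xi>. expandA a \<xi> \<oplus> expandA b \<xi>)"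
proof -
  obtain P where P: "P \<in> carrier T" "a = \<Theta> P" using \<Theta>_ex assms by blast
  obtain Q where Q: "Q \<in> carrier T" "b = \<Theta> Q" using \<Theta>_ex assms by blast
  have "expandA (\<Theta> (P \<oplus>\<^bsub>T\<^esub> Q)) = (\<lambda>\<xi>. expand P \<xi> \<oplus> expand Q \<xi>)"
    using P(1) Q(1) T.a_closed[OF P(1) Q(1)] by (simp only: expandA_\<Theta> expand_simps(3))
  then show ?thesis using P Q by (simp only: \<Theta>.hom_add expandA_\<Theta>)
qed

lemma expandA_mult:
  assumes "P \<in> carrier T" "a \<in> carrier A"
  shows "expandA (\<Theta> P \<otimes>\<^bsub>A\<^esub> a) = ps_act K I wt (cone {#}) P (expandA a)"
proof -
  obtain Q where Q: "Q \<in> carrier T" "a = \<Theta> Q" using \<Theta>_ex assms by blast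
  have "expandA (\<Theta> (P \<otimes>\<^bsub>T\<^esub> Q)) = ps_act K I wt (cone {#}) P (expand Q)"
    using assms(1) Q(1) T.m_closed[OF assms(1) Q(1)] by (simp only: expandA_\<Theta> expand_simps(2))
  then show ?thesis using assms Q by (simp only: \<Theta>.hom_mult expandA_\<Theta>)
qed

text \<open>The quotient construction is applied to the zero submodule: only the acting ring changes
  from T to A. Passing to a copy then brings the module into the type over which finite
  F-representation type quantifies.\<close>

lemma descend:
  fixes W :: "('v multiset \<Rightarrow> 'a, 'w) module"
  assumes W: "fg_module T W"
    and kill: "\<And>P w. P \<in> carrier T \<Longrightarrow> \<Theta> P = \<zero>\<^bsub>A\<^esub> \<Longrightarrow> w \<in> carrier W \<Longrightarrow> P \<odot>\<^bsub>W\<^esub> w = \<zero>\<^bsub>W\<^esub>"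
  shows "\<exists>(N :: 'h fg_mod) \<psi>. fg_module A N \<and> bij_betw \<psi> (carrier W) (carrier N) \<and>
    (\<forall>x\<in>carrier W. \<forall>y\<in>carrier W. \<psi> (x \<oplus>\<^bsub>W\<^esub> y) = \<psi> x \<oplus>\<^bsub>N\<^esub> \<psi> y) \<and>
    (\<forall>P\<in>carrier T. \<forall>x\<in>carrier W. \<psi> (P \<odot>\<^bsub>W\<^esub> x) = \<Theta> P \<odot>\<^bsub>N\<^esub> \<psi> x)"
proof -
  have "module T W" using W by (simp add: fg_module_def)
  interpret W: module T W by fact
  interpret Q: module_quotient T W "{\<zero>\<^bsub>W\<^esub>}" A \<Theta>
  proof (intro module_quotient.intro \<open>module T W\<close> module_quotient_axioms.intro A hom surj)
    show "submodule {\<zero>\<^bsub>W\<^esub>} T W" using W.seq_submodule_submodule[of "[]"] by simp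
  qed (simp add: kill)
  have "fg_module A Q.Q" by (rule Q.fg_quot[OF W])
  then obtain N :: "'h fg_mod" where N: "fg_module A N \<and> module_iso A Q.Q N"
    by (rule exE[OF fg_module_copy])
  obtain \<phi> where \<phi>: "bij_betw \<phi> (carrier Q.Q) (carrier N) \<and>
      (\<forall>x\<in>carrier Q.Q. \<forall>y\<in>carrier Q.Q. \<phi> (x \<oplus>\<^bsub>Q.Q\<^esub> y) = \<phi> x \<oplus>\<^bsub>N\<^esub> \<phi> y) \<and>
      (\<forall>a\<in>carrier A. \<forall>x\<in>carrier Q.Q. \<phi> (a \<odot>\<^bsub>Q.Q\<^esub> x) = a \<odot>\<^bsub>N\<^esub> \<phi> x)"
    using conjunct2[OF N] unfolding module_iso_def by (rule exE)
  have qc: "Q.q x \<in> carrier Q.Q" if "x \<in> carrier W" for x using that by (simp add: Q.quot_carrier)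
  have eqI: "x = y" if "x \<ominus>\<^bsub>W\<^esub> y = \<zero>\<^bsub>W\<^esub>" "x \<in> carrier W" "y \<in> carrier W" for x y
  proof -
    have "x = (x \<ominus>\<^bsub>W\<^esub> y) \<oplus>\<^bsub>W\<^esub> y" using that(2,3) by (simp add: W.M.minus_eq W.M.a_assoc W.M.l_neg)
    then show ?thesis using that by simp
  qed
  have "bij_betw Q.q (carrier W) (carrier Q.Q)"
    unfolding bij_betw_def Q.quot_carrier
  proof (intro conjI inj_onI refl)
    fix x y assume "x \<in> carrier W" "y \<in> carrier W" "Q.q x = Q.q y"
    then show "x = y" using eqI[of x y] Q.q_eq_iff[of x y] by blast
  qed
  then have "bij_betw (\<phi> \<circ> Q.q) (carrier W) (carrier N)" using \<phi> by (intro bij_betw_trans) auto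
  moreover have "\<phi> (Q.q (x \<oplus>\<^bsub>W\<^esub> y)) = \<phi> (Q.q x) \<oplus>\<^bsub>N\<^esub> \<phi> (Q.q y)" if "x \<in> carrier W" "y \<in> carrier W" for x y
    using \<phi> qc that by (simp add: Q.quot_add[symmetric])
  moreover have "\<phi> (Q.q (P \<odot>\<^bsub>W\<^esub> x)) = \<Theta> P \<odot>\<^bsub>N\<^esub> \<phi> (Q.q x)" if "P \<in> carrier T" "x \<in> carrier W" for P x
    using \<phi> qc that by (simp add: Q.quot_smult[symmetric])
  ultimately show ?thesis using N by (intro exI[of _ N] exI[of _ "\<phi> \<circ> Q.q"]) simp
qed

section \<open>Finite F-representation type\<close>

definition residues :: "nat \<Rightarrow> ('v \<Rightarrow> int) set" where
  "residues q = {\<rho>. \<forall>i. (i \<in> insert u J \<longrightarrow> \<rho> i \<in> {0..<int q}) \<and> (i \<notin> insert u J \<longrightarrow> \<rho> i = 0)}"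

definition carry :: "nat \<Rightarrow> ('v \<Rightarrow> int) \<Rightarrow> 'v multiset" where
  "carry q \<rho> = exps 0 0 (\<lambda>i. nat ((\<rho> i + \<rho> u * int (count d i)) div int q))"

definition shift :: "nat \<Rightarrow> ('v \<Rightarrow> int) \<Rightarrow> ('v \<Rightarrow> int) \<Rightarrow> 'v \<Rightarrow> int" where
  "shift q \<rho> \<xi> = (\<lambda>i. \<rho> i + int q * \<xi> i)"

lemma finite_residues: "finite (residues q)"
  unfolding residues_def by (rule finite_set_of_finite_funs) (use fin in auto)

text \<open>Residues are below q, hence \<open>\<rho> i + \<rho> u * d i\<close> is below
  \<open>q * (d i + 1)\<close>.\<close>

lemma carry_le:
  assumes "0 < q" "\<rho> \<in> residues q" shows "carry q \<rho> \<subseteq># d"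
proof (rule mset_subset_eqI)
  fix i
  show "count (carry q \<rho>) i \<le> count d i"
  proof (cases "i \<in> J")
    case True
    have r: "0 \<le> \<rho> i" "\<rho> i < int q" "0 \<le> \<rho> u" "\<rho> u < int q" using assms(2) True by (auto simp: residues_def)
    then have "\<rho> u * int (count d i) \<le> int q * int (count d i)" by (intro mult_right_mono) auto
    then have "\<rho> i + \<rho> u * int (count d i) < int q * (int (count d i) + 1)" using r by (simp add: algebra_simps)
    moreover have "int q * ((\<rho> i + \<rho> u * int (count d i)) div int q) \<le> \<rho> i + \<rho> u * int (count d i)"
      using assms(1) by (simp add: mult_div_mod_eq[symmetric] minus_mod_eq_mult_div[symmetric])
    ultimately have "int q * ((\<rho> i + \<rho> u * int (count d i)) div int q) < int q * (int (count d i) + 1)" by linarith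
    then have "(\<rho> i + \<rho> u * int (count d i)) div int q < int (count d i) + 1"
      by (rule mult_left_less_imp_less) simp
    then show ?thesis using True by (auto simp: carry_def count_exps)
  qed (auto simp: carry_def count_exps)
qed

text \<open>For integers, \<open>w + q z\<close> is nonnegative if and only if z plus the integral
  part of w / q is. For the first inequality w is \<open>\<rho> i\<close>, with integral part 0; for
  the second the integral part is the carry, which becomes the translation of the new cone.\<close>

lemma shift_mem_cone_iff:
  assumes q: "0 < q" and \<rho>: "\<rho> \<in> residues q"
  shows "shift q \<rho> \<xi> \<in> cone {#} \<longleftrightarrow> \<xi> \<in> cone (carry q \<rho>)"
proof -
  have *: "0 \<le> w + int q * z \<longleftrightarrow> 0 \<le> z + w div int q" for w z
  proof -
    have "(w + int q * z) div int q = z + w div int q" using q by simp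
    then show ?thesis using pos_imp_zdiv_nonneg_iff[of "int q" "w + int q * z"] q by simp
  qed
  have "0 \<le> shift q \<rho> \<xi> i \<longleftrightarrow> 0 \<le> \<xi> i"
    "0 \<le> shift q \<rho> \<xi> i + shift q \<rho> \<xi> u * int (count d i) \<longleftrightarrow> 0 \<le> \<xi> i + \<xi> u * int (count d i) + int (count (carry q \<rho>) i)"
    if i: "i \<in> J" for i
  proof -
    have r: "0 \<le> \<rho> i" "\<rho> i < int q" "0 \<le> \<rho> u" using \<rho> i by (auto simp: residues_def)
    show "0 \<le> shift q \<rho> \<xi> i \<longleftrightarrow> 0 \<le> \<xi> i" using *[of "\<rho> i" "\<xi> i"] r by (simp add: shift_def)
    have "0 \<le> \<rho> i + \<rho> u * int (count d i)" using r by simp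
    then have c: "int (count (carry q \<rho>) i) = (\<rho> i + \<rho> u * int (count d i)) div int q"
      using i q by (auto simp: carry_def count_exps pos_imp_zdiv_nonneg_iff)
    have s: "shift q \<rho> \<xi> i + shift q \<rho> \<xi> u * int (count d i)
        = (\<rho> i + \<rho> u * int (count d i)) + int q * (\<xi> i + \<xi> u * int (count d i))"
      by (simp add: shift_def algebra_simps)
    show "0 \<le> shift q \<rho> \<xi> i + shift q \<rho> \<xi> u * int (count d i) \<longleftrightarrow>
        0 \<le> \<xi> i + \<xi> u * int (count d i) + int (count (carry q \<rho>) i)" unfolding s c by (rule *)
  qed
  moreover have "shift q \<rho> \<xi> i = 0 \<longleftrightarrow> \<xi> i = 0" if "i \<notin> insert u J" for i
    using that \<rho> q by (auto simp: shift_def residues_def)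
  ultimately show ?thesis unfolding cone_def by auto
qed

lemma shift_decomp:
  assumes q: "0 < q"
  shows "shift q (\<lambda>i. \<xi> i mod int q) (\<lambda>i. \<xi> i div int q) = \<xi>"
    and "\<xi> \<in> cone g \<Longrightarrow> (\<lambda>i. \<xi> i mod int q) \<in> residues q"
    and "\<rho> \<in> residues q \<Longrightarrow> (\<lambda>i. shift q \<rho> \<xi> i mod int q) = \<rho>"
    and "\<rho> \<in> residues q \<Longrightarrow> (\<lambda>i. shift q \<rho> \<xi> i div int q) = \<xi>"
proof -
  show "shift q (\<lambda>i. \<xi> i mod int q) (\<lambda>i. \<xi> i div int q) = \<xi>" by (simp add: shift_def)
  show "(\<lambda>i. \<xi> i mod int q) \<in> residues q" if "\<xi> \<in> cone g" using that q by (auto simp: cone_def residues_def)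
  assume \<rho>: "\<rho> \<in> residues q"
  have "0 \<le> \<rho> i" "\<rho> i < int q" for i using \<rho> q by (cases "i \<in> insert u J"; auto simp: residues_def)+
  then show "(\<lambda>i. shift q \<rho> \<xi> i mod int q) = \<rho>" "(\<lambda>i. shift q \<rho> \<xi> i div int q) = \<xi>"
    using q by (simp_all add: shift_def)
qed

end

section \<open>Sorting a Frobenius pushforward by residues\<close>

locale frobenius_hypersurface = binomial_hypersurface K I A \<Theta> d u v
  for K (structure) and I :: "'v::wellorder set" and A :: "('h, 'n) ring_scheme" and \<Theta> d u v +
  fixes p e q :: nat
  assumes p: "Factorial_Ring.prime p" "has_char K p" and q: "q = p ^ e"
    and roots: "\<And>c. c \<in> carrier K \<Longrightarrow> \<exists>b\<in>carrier K. b [^] q = c"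
begin

lemma q0: "0 < q"
  using p(1) by (simp add: q prime_gt_0_nat)

text \<open>The inverse of the q-th power on K. Being additive, it turns the semilinear extraction
  of coefficients into a linear map.\<close>

definition rt where "rt c = inv_into (carrier K) (\<lambda>b. b [^] q) c"

lemma frob_inj: "inj_on (\<lambda>b. b [^] q) (carrier K)"
  unfolding q by (rule frobenius_inj[OF p])

lemma rt_pow: "b \<in> carrier K \<Longrightarrow> rt (b [^] q) = b"
  unfolding rt_def by (rule inv_into_f_f[OF frob_inj])

lemma rt: "c \<in> carrier K \<Longrightarrow> rt c \<in> carrier K \<and> rt c [^] q = c"
  using roots[of c] rt_pow by auto

lemma rt_zero: "rt \<zero> = \<zero>"
  using rt_pow[of \<zero>] q0 by (simp add: nat_pow_zero)

lemma rt_add: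
  assumes "a \<in> carrier K" "b \<in> carrier K" shows "rt (a \<oplus> b) = rt a \<oplus> rt b"
proof -
  have "(rt a \<oplus> rt b) [^] q = a \<oplus> b" using rt[of a] rt[of b] assms unfolding q by (simp add: frobenius_add[OF p])
  then show ?thesis using rt_pow[of "rt a \<oplus> rt b"] rt assms by auto
qed

text \<open>Formally, a term \<open>c x\<close> with exponent \<open>\<rho> + q \<xi>\<close> in the
  pushforward is the q-th root of c times \<open>x\<close> to the \<xi>, acting on the basis element
  with exponent \<rho>; this collects the coordinates at \<rho>.\<close>

definition part :: "('v \<Rightarrow> int) \<Rightarrow> (('v \<Rightarrow> int) \<Rightarrow> 'a) \<Rightarrow> ('v \<Rightarrow> int) \<Rightarrow> 'a" where
  "part \<rho> r = (\<lambda>\<xi>. rt (r (shift q \<rho> \<xi>)))"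

lemma part_closed:
  assumes "\<rho> \<in> residues q" "r \<in> supp_funs K (cone {#})"
  shows "part \<rho> r \<in> supp_funs K (cone (carry q \<rho>))"
  using assms rt shift_mem_cone_iff[OF q0 assms(1)] by (auto simp: supp_funs_def part_def rt_zero)

lemma part_inj:
  assumes r: "r \<in> supp_funs K (cone {#})" "r' \<in> supp_funs K (cone {#})"
    and eq: "\<And>\<rho>. \<rho> \<in> residues q \<Longrightarrow> part \<rho> r = part \<rho> r'"
  shows "r = r'"
proof
  fix \<xi>
  show "r \<xi> = r' \<xi>"
  proof (cases "\<xi> \<in> cone {#}")
    case True
    have "part (\<lambda>i. \<xi> i mod int q) r (\<lambda>i. \<xi> i div int q) = part (\<lambda>i. \<xi> i mod int q) r' (\<lambda>i. \<xi> i div int q)"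
      by (simp only: eq[OF shift_decomp(2)[OF q0 True]])
    then have "rt (r \<xi>) = rt (r' \<xi>)" unfolding part_def shift_decomp(1)[OF q0] .
    then have "rt (r \<xi>) [^] q = rt (r' \<xi>) [^] q" by (simp only:)
    moreover have "r \<xi> \<in> carrier K" "r' \<xi> \<in> carrier K" using r by (simp_all add: supp_funs_def)
    ultimately show ?thesis by (simp only: rt)
  qed (use r in \<open>simp add: supp_funs_def\<close>)
qed

lemma part_surj:
  assumes s: "\<And>\<rho>. \<rho> \<in> residues q \<Longrightarrow> s \<rho> \<in> supp_funs K (cone (carry q \<rho>))"
  shows "\<exists>r\<in>supp_funs K (cone {#}). \<forall>\<rho>\<in>residues q. part \<rho> r = s \<rho>"
proof (intro bexI ballI)
  let ?r = "\<lambda>\<xi>. if \<xi> \<in> cone {#} then s (\<lambda>i. \<xi> i mod int q) (\<lambda>i. \<xi> i div int q) [^] q else \<zero>"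
  have sc: "s \<rho> \<xi> \<in> carrier K" if "\<rho> \<in> residues q" for \<rho> \<xi> using s[OF that] by (simp add: supp_funs_def)
  have "s (\<lambda>i. \<xi> i mod int q) (\<lambda>i. \<xi> i div int q) \<in> carrier K" if "\<xi> \<in> cone {#}" for \<xi>
    by (rule sc[OF shift_decomp(2)[OF q0 that]])
  then show "?r \<in> supp_funs K (cone {#})" by (simp add: supp_funs_def)
  fix \<rho> assume \<rho>: "\<rho> \<in> residues q"
  show "part \<rho> ?r = s \<rho>"
  proof
    fix \<xi>
    have "s \<rho> \<xi> = \<zero>" if "\<xi> \<notin> cone (carry q \<rho>)" using that s[OF \<rho>] by (simp add: supp_funs_def)
    then show "part \<rho> ?r \<xi> = s \<rho> \<xi>"
      unfolding part_def shift_decomp(3,4)[OF q0 \<rho>] shift_mem_cone_iff[OF q0 \<rho>]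
      using sc[OF \<rho>] by (simp add: rt_pow rt_zero)
  qed
qed

lemma part_add:
  assumes "r \<in> supp_funs K (cone {#})" "r' \<in> supp_funs K (cone {#})"
  shows "part \<rho> (\<lambda>\<xi>. r \<xi> \<oplus> r' \<xi>) = (\<lambda>\<xi>. part \<rho> r \<xi> \<oplus> part \<rho> r' \<xi>)"
  using assms by (auto simp: part_def rt_add supp_funs_def)

lemma wt_repeat: "wt (repeat_mset q a) = (\<lambda>i. int q * wt a i)"
  by (auto simp: wt_def algebra_simps)

text \<open>In the q-th power of P only exponents divisible by q occur, with coefficients
  \<open>P a [^] q\<close>. It therefore preserves residues, and the coefficient at
  \<open>\<rho> + q \<xi>\<close> is a sum of q-th powers, that is, the q-th power of the
  corresponding coefficient for P.\<close>

lemma part_smult: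
  assumes P: "P \<in> carrier T" and r: "r \<in> supp_funs K (cone {#})" and \<rho>: "\<rho> \<in> residues q"
  shows "part \<rho> (ps_act K I wt (cone {#}) (P [^]\<^bsub>T\<^esub> q) r) = ps_act K I wt (cone (carry q \<rho>)) P (part \<rho> r)"
proof
  interpret N: ps_action K I wt "cone (carry q \<rho>)" by (rule ps_action_cone)
  interpret N0: ps_action K I wt "cone {#}" by (rule ps_action_cone)
  fix \<xi>
  have rc: "r \<eta> \<in> carrier K" for \<eta> using r by (simp add: supp_funs_def)
  have Pq: "P [^]\<^bsub>T\<^esub> q \<in> carrier T" using P by simp
  have pc: "part \<rho> r \<eta> \<in> carrier K" for \<eta> using part_closed[OF \<rho> r] by (simp add: supp_funs_def)
  have pq: "part \<rho> r \<eta> [^] q = r (shift q \<rho> \<eta>)" for \<eta> using rt rc by (simp add: part_def)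
  let ?S = "{(b, \<zeta>) \<in> N0.D (shift q \<rho> \<xi>). \<exists>a. b = repeat_mset q a}"
  let ?h = "\<lambda>(a, \<eta>). (repeat_mset q a, shift q \<rho> \<eta>)"
  have rep_set: "set_mset (repeat_mset q a) = set_mset a" for a :: "'v multiset"
    using q0 by (auto simp: count_greater_zero_iff[symmetric] simp del: count_greater_zero_iff)
  have rep_inj: "a = b" if "repeat_mset q a = repeat_mset q b" for a b :: "'v multiset"
  proof (rule multiset_eqI)
    fix x show "count a x = count b x" using arg_cong[OF that, of "\<lambda>m. count m x"] q0 by simp
  qed
  have sh: "wt (repeat_mset q a) + shift q \<rho> \<eta> = shift q \<rho> \<xi> \<longleftrightarrow> wt a + \<eta> = \<xi>" for a \<eta>
  proof -
    have "wt (repeat_mset q a) + shift q \<rho> \<eta> = shift q \<rho> \<xi> \<longleftrightarrow> (\<forall>i. int q * (wt a i + \<eta> i) = int q * \<xi> i)"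
      by (auto simp: wt_repeat shift_def fun_eq_iff algebra_simps)
    then show ?thesis using q0 by (auto simp: fun_eq_iff)
  qed
  have bij: "bij_betw ?h (N.D \<xi>) ?S"
  proof (rule bij_betwI[where g = "\<lambda>(b, \<zeta>). ((THE a. b = repeat_mset q a), (\<lambda>i. \<zeta> i div int q))"])
    have the: "(THE a. repeat_mset q b = repeat_mset q a) = b" for b :: "'v multiset"
      by (rule the_equality) (auto dest: rep_inj)
    show "?h \<in> N.D \<xi> \<rightarrow> ?S"
    proof (rule Pi_I)
      fix x assume "x \<in> N.D \<xi>"
      then obtain a \<eta> where "x = (a, \<eta>)" "set_mset a \<subseteq> I" "\<eta> \<in> cone (carry q \<rho>)" "wt a + \<eta> = \<xi>" by blast
      moreover from this(4) have "wt (repeat_mset q a) + shift q \<rho> \<eta> = shift q \<rho> \<xi>" by (simp only: sh)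
      ultimately show "?h x \<in> ?S" by (auto simp only: case_prod_conv mem_Collect_eq rep_set shift_mem_cone_iff[OF q0 \<rho>])
    qed
    have unshift: "\<exists>\<eta>. \<zeta> = shift q \<rho> \<eta>" if "wt (repeat_mset q a) + \<zeta> = shift q \<rho> \<xi>" for a \<zeta>
    proof
      show "\<zeta> = shift q \<rho> (\<xi> - wt a)"
      proof
        fix i show "\<zeta> i = shift q \<rho> (\<xi> - wt a) i"
          using fun_cong[OF that, of i] by (simp add: wt_repeat shift_def algebra_simps)
      qed
    qed
    show "(\<lambda>(b, \<zeta>). ((THE a. b = repeat_mset q a), (\<lambda>i. \<zeta> i div int q))) \<in> ?S \<rightarrow> N.D \<xi>"
    proof (rule Pi_I)
      fix y assume "y \<in> ?S"
      then obtain a \<zeta> where y: "y = (repeat_mset q a, \<zeta>)"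
        and *: "set_mset (repeat_mset q a) \<subseteq> I" "\<zeta> \<in> cone {#}" "wt (repeat_mset q a) + \<zeta> = shift q \<rho> \<xi>" by blast
      obtain \<eta> where \<eta>: "\<zeta> = shift q \<rho> \<eta>" using unshift[OF *(3)] by blast
      show "(case y of (b, \<zeta>) \<Rightarrow> ((THE a. b = repeat_mset q a), (\<lambda>i. \<zeta> i div int q))) \<in> N.D \<xi>"
        using * unfolding y case_prod_conv the \<eta> shift_decomp(4)[OF q0 \<rho>] shift_mem_cone_iff[OF q0 \<rho>] sh rep_set by simp
    qed
    show "(\<lambda>(b, \<zeta>). ((THE a. b = repeat_mset q a), (\<lambda>i. \<zeta> i div int q))) (?h x) = x" if "x \<in> N.D \<xi>" for x
      by (simp add: case_prod_unfold the shift_decomp(4)[OF q0 \<rho>])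
    show "?h ((\<lambda>(b, \<zeta>). ((THE a. b = repeat_mset q a), (\<lambda>i. \<zeta> i div int q))) y) = y" if y: "y \<in> ?S" for y
    proof -
      obtain a \<zeta> where a: "y = (repeat_mset q a, \<zeta>)" "wt (repeat_mset q a) + \<zeta> = shift q \<rho> \<xi>" using y by auto
      obtain \<eta> where \<eta>: "\<zeta> = shift q \<rho> \<eta>" using unshift[OF a(2)] by blast
      show ?thesis unfolding a(1) \<eta> by (simp add: the shift_decomp(4)[OF q0 \<rho>])
    qed
  qed
  have "ps_act K I wt (cone {#}) (P [^]\<^bsub>T\<^esub> q) r (shift q \<rho> \<xi>) = finsum K (\<lambda>(b, \<zeta>). (P [^]\<^bsub>T\<^esub> q) b \<otimes> r \<zeta>) ?S"
    unfolding ps_act_def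
  proof (rule add.finprod_mono_neutral_cong_right[OF N0.fin])
    fix x assume x: "x \<in> N0.D (shift q \<rho> \<xi>) - ?S"
    then have "(P [^]\<^bsub>T\<^esub> q) (fst x) = \<zero>" by (intro frobenius_coeff(2)[OF p P q]) auto
    then show "(case x of (b, \<zeta>) \<Rightarrow> (P [^]\<^bsub>T\<^esub> q) b \<otimes> r \<zeta>) = \<zero>" using rc by (simp add: case_prod_unfold)
  qed (use Pq rc in \<open>auto simp: Pi_iff\<close>)
  also have "\<dots> = finsum K (\<lambda>(a, \<eta>). (P a \<otimes> part \<rho> r \<eta>) [^] q) (N.D \<xi>)"
    by (rule finsum_bij[OF bij, symmetric])
      (use Pq P rc pc in \<open>auto simp: frobenius_coeff(1)[OF p P q] nat_pow_distrib pq\<close>)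
  also have "\<dots> = ps_act K I wt (cone (carry q \<rho>)) P (part \<rho> r) \<xi> [^] q"
    using frobenius_finsum[OF p N.fin[of \<xi>], where f = "\<lambda>(a, \<eta>). P a \<otimes> part \<rho> r \<eta>" and e = e] P pc
    unfolding ps_act_def q[symmetric] by (simp add: case_prod_unfold)
  finally show "part \<rho> (ps_act K I wt (cone {#}) (P [^]\<^bsub>T\<^esub> q) r) \<xi> = ps_act K I wt (cone (carry q \<rho>)) P (part \<rho> r) \<xi>"
    using N.act_closed[OF P part_closed[OF \<rho> r]] by (simp add: part_def supp_funs_def rt_pow)
qed

end

text \<open>Bookkeeping for multiplicities: \<open>t j\<close> counts the elements on which \<gamma>
  takes the j-th value. Applied to the carries, it counts the residues that give the same
  summand.\<close>

lemma regroup: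
  assumes "finite R" and \<gamma>: "\<gamma> ` R \<subseteq> gs ` {..<s}" and gs: "inj_on gs {..<s :: nat}"
  shows "\<exists>t h. bij_betw h (SIGMA j:{..<s}. {..<t j :: nat}) R \<and> (\<forall>j<s. \<forall>l<t j. \<gamma> (h (j, l)) = gs j)"
proof -
  define Rj where "Rj j = {\<rho> \<in> R. \<gamma> \<rho> = gs j}" for j
  have "finite (Rj j)" for j using \<open>finite R\<close> by (simp add: Rj_def)
  then have "\<forall>j. \<exists>h. bij_betw h {0..<card (Rj j)} (Rj j)" using ex_bij_betw_nat_finite by blast
  then obtain h where h0: "\<forall>j. bij_betw (h j) {0..<card (Rj j)} (Rj j)" by (rule exE[OF choice])
  have h: "bij_betw (h j) {..<card (Rj j)} (Rj j)" for j using spec[OF h0, of j] by (simp only: atLeast0LessThan)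
  have hR: "h j l \<in> R" "\<gamma> (h j l) = gs j" if "l < card (Rj j)" for j l
    using h[of j] that by (auto simp: bij_betw_def Rj_def)
  have "bij_betw (\<lambda>(j, l). h j l) (SIGMA j:{..<s}. {..<card (Rj j)}) R"
    unfolding bij_betw_def
  proof (intro conjI inj_onI equalityI subsetI)
    fix x y assume x: "x \<in> (SIGMA j:{..<s}. {..<card (Rj j)})" and y: "y \<in> (SIGMA j:{..<s}. {..<card (Rj j)})"
      and eq: "(\<lambda>(j, l). h j l) x = (\<lambda>(j, l). h j l) y"
    obtain j l j' l' where xy: "x = (j, l)" "y = (j', l')" by fastforce
    have "gs j = gs j'" using hR(2)[of l j] hR(2)[of l' j'] x y eq xy by simp
    then have "j = j'" using gs x y xy by (auto dest: inj_onD)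
    moreover have "l = l'" using h[of j] x y eq xy \<open>j = j'\<close> by (auto simp: bij_betw_def dest: inj_onD)
    ultimately show "x = y" using xy by simp
  next
    fix \<rho> assume "\<rho> \<in> (\<lambda>(j, l). h j l) ` (SIGMA j:{..<s}. {..<card (Rj j)})"
    then show "\<rho> \<in> R" using hR(1) by auto
  next
    fix \<rho> assume \<rho>: "\<rho> \<in> R"
    then obtain j where j: "j < s" "\<gamma> \<rho> = gs j" using \<gamma> by blast
    then have "\<rho> \<in> Rj j" using \<rho> by (simp add: Rj_def)
    then obtain l where "l < card (Rj j)" "\<rho> = h j l" using h[of j] by (auto simp: bij_betw_def)
    then show "\<rho> \<in> (\<lambda>(j, l). h j l) ` (SIGMA j:{..<s}. {..<card (Rj j)})" using j by force
  qed
  then show ?thesis using hR(2) by (intro exI[of _ "\<lambda>j. card (Rj j)"] exI[of _ "\<lambda>(j, l). h j l"]) auto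
qed

context frobenius_hypersurface
begin

text \<open>The isomorphism sends an element of A to the family of all parts of its expansion,
  indexed by residues and carried into the chosen A-modules by \<psi>. It is bijective because an
  expansion can be cut into its residue classes and reassembled from arbitrary parts.\<close>

lemma pushforward_iso:
  fixes N :: "'v multiset \<Rightarrow> 'h fg_mod" and \<psi> and gs :: "nat \<Rightarrow> 'v multiset"
  assumes size: "3 \<le> size d"
    and \<psi>: "\<And>g. g \<subseteq># d \<Longrightarrow> bij_betw (\<psi> g) (supp_funs K (cone g)) (carrier (N g))"
      "\<And>g x y. g \<subseteq># d \<Longrightarrow> x \<in> supp_funs K (cone g) \<Longrightarrow> y \<in> supp_funs K (cone g) \<Longrightarrow>
        \<psi> g (\<lambda>\<xi>. x \<xi> \<oplus> y \<xi>) = \<psi> g x \<oplus>\<^bsub>N g\<^esub> \<psi> g y"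
      "\<And>g P x. g \<subseteq># d \<Longrightarrow> P \<in> carrier T \<Longrightarrow> x \<in> supp_funs K (cone g) \<Longrightarrow>
        \<psi> g (ps_act K I wt (cone g) P x) = \<Theta> P \<odot>\<^bsub>N g\<^esub> \<psi> g x"
    and gs: "inj_on gs {..<s}" "gs ` {..<s} = {g. g \<subseteq># d}"
  shows "\<exists>t :: nat \<Rightarrow> nat. module_iso A (frobenius_pushforward p e A (self_module A))
    (direct_sum (SIGMA j:{..<s}. {..<t j}) (\<lambda>(j, l). N (gs j)))"
proof -
  have "carry q ` residues q \<subseteq> gs ` {..<s}" unfolding gs(2) using carry_le[OF q0] by blast
  from regroup[OF finite_residues this gs(1)] obtain t :: "nat \<Rightarrow> nat" where
    "\<exists>h. bij_betw h (SIGMA j:{..<s}. {..<t j}) (residues q) \<and> (\<forall>j<s. \<forall>l<t j. carry q (h (j, l)) = gs j)" by (rule exE)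
  then obtain h where
    "bij_betw h (SIGMA j:{..<s}. {..<t j}) (residues q) \<and> (\<forall>j<s. \<forall>l<t j. carry q (h (j, l)) = gs j)" by (rule exE)
  note h = conjunct1[OF this] conjunct2[OF this]
  let ?E = "SIGMA j:{..<s}. {..<t j}"
  let ?D = "direct_sum ?E (\<lambda>(j, l). N (gs j))"
  have h_res: "h x \<in> residues q" if "x \<in> ?E" for x using h(1) that by (auto simp: bij_betw_def)
  have h_gs: "carry q (h x) = gs (fst x)" if "x \<in> ?E" for x using h(2) that by auto
  have gd: "gs (fst x) \<subseteq># d" if "x \<in> ?E" for x using gs(2) that by auto
  have h_part: "part (h x) r \<in> supp_funs K (cone (gs (fst x)))" if "x \<in> ?E" "r \<in> supp_funs K (cone {#})" for x r
    using part_closed[OF h_res[OF that(1)] that(2)] by (simp only: h_gs[OF that(1)])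
  define \<phi> where "\<phi> a = (\<lambda>x\<in>?E. \<psi> (gs (fst x)) (part (h x) (expandA a)))" for a
  have ex: "expandA a \<in> supp_funs K (cone {#})" if "a \<in> carrier A" for a
    using expandA_bij[OF size] that by (auto simp: bij_betw_def)
  have bij: "bij_betw \<phi> (carrier A) (carrier ?D)"
    unfolding bij_betw_def
  proof (intro conjI equalityI subsetI inj_onI)
    fix a b assume a: "a \<in> carrier A" and b: "b \<in> carrier A" and eq: "\<phi> a = \<phi> b"
    have "part \<rho> (expandA a) = part \<rho> (expandA b)" if "\<rho> \<in> residues q" for \<rho>
    proof -
      have "\<rho> \<in> h ` ?E" using that by (simp only: bij_betw_imp_surj_on[OF h(1)])
      then obtain x where x: "\<rho> = h x" "x \<in> ?E" by (rule imageE)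
      have "\<psi> (gs (fst x)) (part (h x) (expandA a)) = \<psi> (gs (fst x)) (part (h x) (expandA b))"
        using fun_cong[OF eq, of x] x(2) by (simp add: \<phi>_def)
      then show ?thesis
        unfolding x(1) using \<psi>(1)[OF gd[OF x(2)]] h_part[OF x(2) ex[OF a]] h_part[OF x(2) ex[OF b]]
        by (auto simp: bij_betw_def dest: inj_onD)
    qed
    then have "expandA a = expandA b" by (rule part_inj[OF ex[OF a] ex[OF b]])
    then show "a = b" using expandA_bij[OF size] a b by (auto simp: bij_betw_def dest: inj_onD)
  next
    fix f assume "f \<in> \<phi> ` carrier A"
    then obtain a where a: "a \<in> carrier A" "f = \<phi> a" by blast
    have "\<psi> (gs (fst x)) (part (h x) (expandA a)) \<in> carrier (N (gs (fst x)))" if "x \<in> ?E" for x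
      using bij_betw_apply[OF \<psi>(1)[OF gd[OF that]] h_part[OF that ex[OF a(1)]]] .
    then show "f \<in> carrier ?D" unfolding a(2) by (auto simp: direct_sum_def \<phi>_def)
  next
    fix f assume "f \<in> carrier ?D"
    then have f: "f \<in> extensional ?E" "\<And>x. x \<in> ?E \<Longrightarrow> f x \<in> carrier (N (gs (fst x)))"
      by (auto simp: direct_sum_def PiE_def Pi_iff case_prod_unfold)
    define s' where "s' \<rho> = inv_into (supp_funs K (cone (carry q \<rho>))) (\<psi> (carry q \<rho>)) (f (inv_into ?E h \<rho>))" for \<rho>
    have s': "s' (h x) \<in> supp_funs K (cone (gs (fst x)))" "\<psi> (gs (fst x)) (s' (h x)) = f x" if x: "x \<in> ?E" for x
    proof -
      have "inv_into ?E h (h x) = x" using h(1) x by (auto simp: bij_betw_def)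
      then have e: "s' (h x) = inv_into (supp_funs K (cone (gs (fst x)))) (\<psi> (gs (fst x))) (f x)"
        by (simp only: s'_def h_gs[OF x])
      have "f x \<in> \<psi> (gs (fst x)) ` supp_funs K (cone (gs (fst x)))"
        using f(2)[OF x] \<psi>(1)[OF gd[OF x]] by (auto simp: bij_betw_def)
      then show "s' (h x) \<in> supp_funs K (cone (gs (fst x)))" "\<psi> (gs (fst x)) (s' (h x)) = f x"
        unfolding e by (rule inv_into_into, rule f_inv_into_f)
    qed
    have "s' \<rho> \<in> supp_funs K (cone (carry q \<rho>))" if "\<rho> \<in> residues q" for \<rho>
    proof -
      have "\<rho> \<in> h ` ?E" using that by (simp only: bij_betw_imp_surj_on[OF h(1)])
      then obtain x where x: "\<rho> = h x" "x \<in> ?E" by (rule imageE)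
      then show ?thesis using s'(1)[OF x(2)] by (simp only: h_gs[OF x(2)])
    qed
    from part_surj[of s', OF this] obtain r where r: "r \<in> supp_funs K (cone {#})" "\<forall>\<rho>\<in>residues q. part \<rho> r = s' \<rho>"
      by blast
    obtain a where a: "a \<in> carrier A" "r = expandA a" using r(1) expandA_bij[OF size] by (auto simp: bij_betw_def)
    have "f = \<phi> a"
    proof
      fix x show "f x = \<phi> a x"
      proof (cases "x \<in> ?E")
        case True
        then show ?thesis using s'(2)[of x] r(2) h_res[of x] a(2) by (simp add: \<phi>_def)
      next
        case False
        then show ?thesis unfolding extensional_arb[OF f(1) False] by (simp add: \<phi>_def)
      qed
    qed
    then show "f \<in> \<phi> ` carrier A" using a(1) by blast
  qed
  have add: "\<phi> (a \<oplus>\<^bsub>A\<^esub> b) = \<phi> a \<oplus>\<^bsub>?D\<^esub> \<phi> b" if "a \<in> carrier A" "b \<in> carrier A" for a b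
  proof
    fix x
    show "\<phi> (a \<oplus>\<^bsub>A\<^esub> b) x = (\<phi> a \<oplus>\<^bsub>?D\<^esub> \<phi> b) x"
    proof (cases "x \<in> ?E")
      case True
      have "\<phi> (a \<oplus>\<^bsub>A\<^esub> b) x = \<psi> (gs (fst x)) (\<lambda>\<xi>. part (h x) (expandA a) \<xi> \<oplus> part (h x) (expandA b) \<xi>)"
        using True that by (simp add: \<phi>_def expandA_add part_add ex)
      also have "\<dots> = \<psi> (gs (fst x)) (part (h x) (expandA a)) \<oplus>\<^bsub>N (gs (fst x))\<^esub> \<psi> (gs (fst x)) (part (h x) (expandA b))"
        by (rule \<psi>(2)[OF gd[OF True] h_part[OF True ex[OF that(1)]] h_part[OF True ex[OF that(2)]]])
      also have "\<dots> = (\<phi> a \<oplus>\<^bsub>?D\<^esub> \<phi> b) x"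
        using True by (simp add: direct_sum_def \<phi>_def case_prod_unfold)
      finally show ?thesis .
    qed (simp add: direct_sum_def \<phi>_def)
  qed
  have smult: "\<phi> (c [^]\<^bsub>A\<^esub> (p ^ e) \<otimes>\<^bsub>A\<^esub> a) = c \<odot>\<^bsub>?D\<^esub> \<phi> a" if c: "c \<in> carrier A" and a: "a \<in> carrier A" for c a
  proof
    fix x
    obtain P where P: "P \<in> carrier T" "c = \<Theta> P" using \<Theta>_ex c by blast
    show "\<phi> (c [^]\<^bsub>A\<^esub> (p ^ e) \<otimes>\<^bsub>A\<^esub> a) x = (c \<odot>\<^bsub>?D\<^esub> \<phi> a) x"
    proof (cases "x \<in> ?E")
      case True
      have Pq: "P [^]\<^bsub>T\<^esub> q \<in> carrier T" using P(1) by simp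
      \<comment> \<open>A scalar acts on the pushforward through its q-th power, which lifts to the
        q-th power of a series.\<close>
      have "c [^]\<^bsub>A\<^esub> (p ^ e) = \<Theta> (P [^]\<^bsub>T\<^esub> q)" using P by (simp add: q \<Theta>.hom_nat_pow)
      then have "expandA (c [^]\<^bsub>A\<^esub> (p ^ e) \<otimes>\<^bsub>A\<^esub> a) = ps_act K I wt (cone {#}) (P [^]\<^bsub>T\<^esub> q) (expandA a)"
        by (simp only: expandA_mult[OF Pq a])
      then have "part (h x) (expandA (c [^]\<^bsub>A\<^esub> (p ^ e) \<otimes>\<^bsub>A\<^esub> a))
          = ps_act K I wt (cone (gs (fst x))) P (part (h x) (expandA a))"
        by (simp only: part_smult[OF P(1) ex[OF a] h_res[OF True]] h_gs[OF True])
      then have "\<phi> (c [^]\<^bsub>A\<^esub> (p ^ e) \<otimes>\<^bsub>A\<^esub> a) x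
          = \<psi> (gs (fst x)) (ps_act K I wt (cone (gs (fst x))) P (part (h x) (expandA a)))"
        using True by (simp add: \<phi>_def)
      also have "\<dots> = \<Theta> P \<odot>\<^bsub>N (gs (fst x))\<^esub> \<psi> (gs (fst x)) (part (h x) (expandA a))"
        by (rule \<psi>(3)[OF gd[OF True] P(1) h_part[OF True ex[OF a]]])
      also have "\<dots> = (c \<odot>\<^bsub>?D\<^esub> \<phi> a) x"
        unfolding P(2) using True by (simp add: direct_sum_def \<phi>_def case_prod_unfold)
      finally show ?thesis .
    qed (simp add: direct_sum_def \<phi>_def)
  qed
  have "module_iso A (frobenius_pushforward p e A (self_module A)) ?D"
    unfolding module_iso_def
    by (intro exI[of _ \<phi>]) (simp add: frobenius_pushforward_def self_module_def bij add smult)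
  then show ?thesis by blast
qed

end

context binomial_hypersurface
begin

text \<open>A multiple of 1 that is zero in A has zero constant coefficient, because constant
  coefficients are well defined on A.\<close>

lemma has_char_A:
  assumes "has_char K p" shows "has_char A p"
proof -
  have h: "\<Theta> ([n] \<cdot>\<^bsub>T\<^esub> \<one>\<^bsub>T\<^esub>) = [n] \<cdot>\<^bsub>A\<^esub> \<one>\<^bsub>A\<^esub>" for n :: nat
    by (induction n) (simp_all add: T.add.nat_pow_Suc \<Theta>.S.add.nat_pow_Suc del: coeff_add coeff_zero)
  have "[n] \<cdot>\<^bsub>A\<^esub> \<one>\<^bsub>A\<^esub> = \<zero>\<^bsub>A\<^esub> \<longleftrightarrow> p dvd n" for n :: nat
  proof
    assume z: "[n] \<cdot>\<^bsub>A\<^esub> \<one>\<^bsub>A\<^esub> = \<zero>\<^bsub>A\<^esub>"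
    have "[n] \<cdot> \<one> = ([n] \<cdot>\<^bsub>T\<^esub> \<one>\<^bsub>T\<^esub>) {#}" by (simp add: const_pow)
    also have "\<dots> = cf {#} (\<Theta> ([n] \<cdot>\<^bsub>T\<^esub> \<one>\<^bsub>T\<^esub>))" by (simp add: cf_\<Theta>)
    also have "\<dots> = cf {#} (\<Theta> \<zero>\<^bsub>T\<^esub>)" by (simp add: h z)
    also have "\<dots> = \<zero>" using cf_\<Theta>[of "\<zero>\<^bsub>T\<^esub>" "{#}"] by simp
    finally show "p dvd n" using assms by (simp add: has_char_def)
  next
    assume "p dvd n"
    then have "[n] \<cdot>\<^bsub>T\<^esub> \<one>\<^bsub>T\<^esub> = \<zero>\<^bsub>T\<^esub>" using has_char_T[OF assms] by (simp add: has_char_def)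
    then show "[n] \<cdot>\<^bsub>A\<^esub> \<one>\<^bsub>A\<^esub> = \<zero>\<^bsub>A\<^esub>" using h[of n] by simp
  qed
  then show ?thesis by (simp add: has_char_def)
qed

theorem FFRT_A:
  assumes size: "3 \<le> size d" and p: "Factorial_Ring.prime p" "has_char K p"
    and roots: "\<And>c n. c \<in> carrier K \<Longrightarrow> 0 < n \<Longrightarrow> \<exists>b\<in>carrier K. b [^] (n :: nat) = c"
  shows "FFRT p A"
proof -
  \<comment> \<open>The modules and the identifications with series over the cones are chosen before
    the exponent e, since one finite list has to serve all e.\<close>
  have "\<forall>g. \<exists>N :: 'h fg_mod. g \<subseteq># d \<longrightarrow> (\<exists>\<psi>. fg_module A N \<and> bij_betw \<psi> (supp_funs K (cone g)) (carrier N) \<and>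
    (\<forall>x\<in>supp_funs K (cone g). \<forall>y\<in>supp_funs K (cone g). \<psi> (\<lambda>\<xi>. x \<xi> \<oplus> y \<xi>) = \<psi> x \<oplus>\<^bsub>N\<^esub> \<psi> y) \<and>
    (\<forall>P\<in>carrier T. \<forall>x\<in>supp_funs K (cone g). \<psi> (ps_act K I wt (cone g) P x) = \<Theta> P \<odot>\<^bsub>N\<^esub> \<psi> x))"
  proof
    fix g
    show "\<exists>N :: 'h fg_mod. g \<subseteq># d \<longrightarrow> (\<exists>\<psi>. fg_module A N \<and> bij_betw \<psi> (supp_funs K (cone g)) (carrier N) \<and>
      (\<forall>x\<in>supp_funs K (cone g). \<forall>y\<in>supp_funs K (cone g). \<psi> (\<lambda>\<xi>. x \<xi> \<oplus> y \<xi>) = \<psi> x \<oplus>\<^bsub>N\<^esub> \<psi> y) \<and>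
      (\<forall>P\<in>carrier T. \<forall>x\<in>supp_funs K (cone g). \<psi> (ps_act K I wt (cone g) P x) = \<Theta> P \<odot>\<^bsub>N\<^esub> \<psi> x))"
    proof (cases "g \<subseteq># d")
      case True
      show ?thesis
        by (rule ex_forward[OF descend[OF fg_cone[OF True], unfolded ps_module_simps]])
          (use kernel_smult in \<open>simp_all add: ps_module_simps\<close>)
    qed simp
  qed
  then obtain N :: "'v multiset \<Rightarrow> 'h fg_mod" where
    "\<forall>g. g \<subseteq># d \<longrightarrow> (\<exists>\<psi>. fg_module A (N g) \<and> bij_betw \<psi> (supp_funs K (cone g)) (carrier (N g)) \<and>
    (\<forall>x\<in>supp_funs K (cone g). \<forall>y\<in>supp_funs K (cone g). \<psi> (\<lambda>\<xi>. x \<xi> \<oplus> y \<xi>) = \<psi> x \<oplus>\<^bsub>N g\<^esub> \<psi> y) \<and>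
    (\<forall>P\<in>carrier T. \<forall>x\<in>supp_funs K (cone g). \<psi> (ps_act K I wt (cone g) P x) = \<Theta> P \<odot>\<^bsub>N g\<^esub> \<psi> x))"
    by (rule exE[OF choice])
  then have "\<forall>g. \<exists>\<psi>. g \<subseteq># d \<longrightarrow> fg_module A (N g) \<and> bij_betw \<psi> (supp_funs K (cone g)) (carrier (N g)) \<and>
    (\<forall>x\<in>supp_funs K (cone g). \<forall>y\<in>supp_funs K (cone g). \<psi> (\<lambda>\<xi>. x \<xi> \<oplus> y \<xi>) = \<psi> x \<oplus>\<^bsub>N g\<^esub> \<psi> y) \<and>
    (\<forall>P\<in>carrier T. \<forall>x\<in>supp_funs K (cone g). \<psi> (ps_act K I wt (cone g) P x) = \<Theta> P \<odot>\<^bsub>N g\<^esub> \<psi> x)"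
    by (simp only: ex_simps(6))
  then obtain \<psi> where N\<psi>: "\<forall>g. g \<subseteq># d \<longrightarrow> fg_module A (N g) \<and> bij_betw (\<psi> g) (supp_funs K (cone g)) (carrier (N g)) \<and>
    (\<forall>x\<in>supp_funs K (cone g). \<forall>y\<in>supp_funs K (cone g). \<psi> g (\<lambda>\<xi>. x \<xi> \<oplus> y \<xi>) = \<psi> g x \<oplus>\<^bsub>N g\<^esub> \<psi> g y) \<and>
    (\<forall>P\<in>carrier T. \<forall>x\<in>supp_funs K (cone g). \<psi> g (ps_act K I wt (cone g) P x) = \<Theta> P \<odot>\<^bsub>N g\<^esub> \<psi> g x)"
    by (rule exE[OF choice])
  define s where "s = card {g. g \<subseteq># d}"
  obtain gs where "bij_betw gs {0..<s} {g. g \<subseteq># d}"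
    unfolding s_def by (rule exE[OF ex_bij_betw_nat_finite[OF finite_submultisets[of d]]])
  then have gs: "inj_on gs {..<s}" "gs ` {..<s} = {g. g \<subseteq># d}" by (simp_all add: bij_betw_def atLeast0LessThan)
  have iso: "\<exists>t :: nat \<Rightarrow> nat. module_iso A (frobenius_pushforward p e A (self_module A))
    (direct_sum (SIGMA j:{..<s}. {..<t j}) (\<lambda>(j, l). N (gs j)))" for e
  proof -
    have "0 < p ^ e" using p(1) by (simp add: prime_gt_0_nat)
    interpret FH: frobenius_hypersurface K I A \<Theta> d u v p e "p ^ e"
      by (intro frobenius_hypersurface.intro binomial_hypersurface_axioms frobenius_hypersurface_axioms.intro p refl
          roots \<open>0 < p ^ e\<close>)
    show ?thesis
      by (rule FH.pushforward_iso[OF size _ _ _ gs, of \<psi>]) (simp_all add: N\<psi>)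
  qed
  have "\<forall>j<s. fg_module A (N (gs j))" using N\<psi> gs(2) by blast
  then show ?thesis
    unfolding FFRT_def using A p(1) has_char_A[OF p(2)] iso
    by (intro conjI exI[of _ s] exI[of _ "\<lambda>j. N (gs j)"]) auto
qed

end

section \<open>Merging the variables\<close>

text \<open>Numbers u as k + 1 and v as k + 2. Every monomial in k + 2 variables is uniquely a sum
  of its \<open>low\<close> part and the encoding of its \<open>dec\<close> part, which identifies
  iterated series with series in one set of variables.\<close>

definition enc :: "nat \<Rightarrow> uv multiset \<Rightarrow> nat multiset" where
  "enc k m = replicate_mset (count m U) (k + 1) + replicate_mset (count m V) (k + 2)"

definition dec :: "nat \<Rightarrow> nat multiset \<Rightarrow> uv multiset" where
  "dec k a = replicate_mset (count a (k + 1)) U + replicate_mset (count a (k + 2)) V"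

definition low :: "nat \<Rightarrow> nat multiset \<Rightarrow> nat multiset" where
  "low k a = filter_mset (\<lambda>i. i \<le> k) a"

lemma uv_count_eqI: "count a U = count b U \<Longrightarrow> count a V = count b V \<Longrightarrow> a = b"
  by (rule multiset_eqI) (metis uv.exhaust)

lemma enc_add: "enc k (a + b) = enc k a + enc k b"
  by (rule multiset_eqI) (auto simp: enc_def)

lemma set_enc: "set_mset (enc k m) \<subseteq> {k + 1, k + 2}"
  by (auto simp: enc_def)

lemma dec_enc: "set_mset n \<subseteq> {1..k} \<Longrightarrow> dec k (n + enc k m) = m"
  by (rule uv_count_eqI) (auto simp: enc_def dec_def count_eq_zero_iff)

lemma low_enc: "set_mset n \<subseteq> {1..k} \<Longrightarrow> low k (n + enc k m) = n"
proof -
  assume n: "set_mset n \<subseteq> {1..k}"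
  have "filter_mset (\<lambda>i. i \<le> k) n = n" by (rule filter_mset_eq_conv[THEN iffD2]) (use n in auto)
  moreover have "filter_mset (\<lambda>i. i \<le> k) (enc k m) = {#}" by (auto simp: enc_def filter_mset_eq_conv)
  ultimately show ?thesis by (simp add: low_def)
qed

lemma low_dec:
  assumes "set_mset a \<subseteq> {1..k + 2}" shows "low k a + enc k (dec k a) = a"
proof (rule multiset_eqI)
  fix i
  have "count a i = 0" if "i > k" "i \<noteq> k + 1" "i \<noteq> k + 2" using assms that by (force simp: count_eq_zero_iff)
  then show "count (low k a + enc k (dec k a)) i = count a i"
    by (auto simp: low_def enc_def dec_def)
qed

lemma set_low: "set_mset a \<subseteq> {1..k + 2} \<Longrightarrow> set_mset (low k a) \<subseteq> {1..k}"
  by (auto simp: low_def)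

context cring
begin

abbreviation sgn_uv :: "uv multiset \<Rightarrow> 'a" where "sgn_uv m \<equiv> (\<ominus> \<one>) [^] count m U"

text \<open>The substitution \<open>x\<^bsub>k+1\<^esub> \<mapsto> -u\<close>, \<open>x\<^bsub>k+2\<^esub> \<mapsto> v\<close>.\<close>

definition split_uv :: "nat \<Rightarrow> (nat multiset \<Rightarrow> 'a) \<Rightarrow> uv multiset \<Rightarrow> nat multiset \<Rightarrow> 'a" where
  "split_uv k P = (\<lambda>m n. if set_mset n \<subseteq> {1..k} then sgn_uv m \<otimes> P (n + enc k m) else \<zero>)"

lemma sgn_uv: "sgn_uv m \<in> carrier R" "sgn_uv (a + b) = sgn_uv a \<otimes> sgn_uv b" "sgn_uv m \<otimes> sgn_uv m = \<one>"
proof -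
  show "sgn_uv (a + b) = sgn_uv a \<otimes> sgn_uv b" by (simp add: nat_pow_mult)
  have "sgn_uv m \<otimes> sgn_uv m = ((\<ominus> \<one>) \<otimes> (\<ominus> \<one>)) [^] count m U" by (rule nat_pow_distrib[symmetric]) auto
  then show "sgn_uv m \<otimes> sgn_uv m = \<one>" by (simp add: l_minus)
qed simp

abbreviation "S k \<equiv> power_series_ring R {1..k}"
abbreviation "T1 k \<equiv> power_series_ring R {1..k + 2}"
abbreviation "T2 k \<equiv> power_series_ring (S k) {U, V}"

lemma split_uv_closed:
  assumes "P \<in> carrier (T1 k)" shows "split_uv k P \<in> carrier (T2 k)"
proof -
  have "P a \<in> carrier R" for a using assms unfolding ps_simps(1) supp_funs_def by blast
  moreover have "set_mset m \<subseteq> {U, V}" for m using uv.exhaust by blast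
  ultimately show ?thesis by (simp add: ps_simps supp_funs_def split_uv_def)
qed

text \<open>A coefficient of the iterated product is a sum over splittings of m and of n separately;
  together these are the splittings of the merged monomial \<open>n + enc k m\<close>. The signs
  agree because they are multiplicative in m.\<close>

lemma split_uv_mult:
  assumes P: "P \<in> carrier (T1 k)" and Q: "Q \<in> carrier (T1 k)"
  shows "split_uv k (P \<otimes>\<^bsub>T1 k\<^esub> Q) = split_uv k P \<otimes>\<^bsub>T2 k\<^esub> split_uv k Q"
proof (intro ext)
  interpret S: power_series R "{1..k}" by (intro power_series.intro is_cring)
  interpret T2: power_series "S k" "{U, V}" by (intro power_series.intro S.T.is_cring)
  fix m n
  have Pc: "P a \<in> carrier R" "Q a \<in> carrier R" for a using P Q unfolding ps_simps(1) supp_funs_def by blast+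
  have PS: "split_uv k P a \<in> carrier (S k)" "split_uv k Q a \<in> carrier (S k)" for a
    using T2.coeff_closed[OF split_uv_closed[OF P]] T2.coeff_closed[OF split_uv_closed[OF Q]] by auto
  let ?P = "split_uv k P" and ?Q = "split_uv k Q"
  have "(?P \<otimes>\<^bsub>T2 k\<^esub> ?Q) m n = (\<Oplus>\<^bsub>S k\<^esub>z\<in>{(a, b). a + b = m}. ?P (fst z) \<otimes>\<^bsub>S k\<^esub> ?Q (snd z)) n"
    unfolding T2.coeff_mult case_prod_unfold by (rule refl)
  also have "\<dots> = (\<Oplus>z\<in>{(a, b). a + b = m}. (?P (fst z) \<otimes>\<^bsub>S k\<^esub> ?Q (snd z)) n)"
    using PS by (intro S.coeff_finsum S.T.m_closed)
  also have "\<dots> = (\<Oplus>z\<in>{(a, b). a + b = m}. \<Oplus>w\<in>{(a, b). a + b = n}. ?P (fst z) (fst w) \<otimes> ?Q (snd z) (snd w))"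
    unfolding S.coeff_mult case_prod_unfold by (rule refl)
  also have "\<dots> = finsum R (\<lambda>(z, w). ?P (fst z) (fst w) \<otimes> ?Q (snd z) (snd w))
      ({(a, b). a + b = m} \<times> {(a, b). a + b = n})"
    using PS by (intro finsum_Sigma finite_splits m_closed S.coeff_closed)
  also have "\<dots> = split_uv k (P \<otimes>\<^bsub>T1 k\<^esub> Q) m n"
  proof (cases "set_mset n \<subseteq> {1..k}")
    case False
    have z: "?P (fst z) (fst w) \<otimes> ?Q (snd z) (snd w) = \<zero>" if "fst w + snd w = n" for z w
    proof -
      have "\<not> set_mset (fst w) \<subseteq> {1..k} \<or> \<not> set_mset (snd w) \<subseteq> {1..k}"
        using False unfolding that[symmetric] set_mset_union Un_subset_iff by blast
      then consider "?P (fst z) (fst w) = \<zero>" | "?Q (snd z) (snd w) = \<zero>" unfolding split_uv_def by metis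
      then show ?thesis
        by cases (simp_all only: l_null r_null S.coeff_closed[OF PS(1)] S.coeff_closed[OF PS(2)])
    qed
    have "finsum R (\<lambda>(z, w). ?P (fst z) (fst w) \<otimes> ?Q (snd z) (snd w)) ({(a, b). a + b = m} \<times> {(a, b). a + b = n}) = \<zero>"
      using z by (intro add.finprod_one_eqI) auto
    then show ?thesis using False by (simp add: split_uv_def)
  next
    case True
    let ?h = "\<lambda>((m1, m2), (n1, n2)). (n1 + enc k m1, n2 + enc k m2)"
    have sub: "set_mset a \<subseteq> {1..k + 2}" "set_mset b \<subseteq> {1..k + 2}" if "a + b = n + enc k m" for a b
    proof -
      have "set_mset (a + b) \<subseteq> {1..k + 2}" unfolding that using True set_enc[of k m] by auto
      then show "set_mset a \<subseteq> {1..k + 2}" "set_mset b \<subseteq> {1..k + 2}" by auto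
    qed
    have bij: "bij_betw ?h ({(a, b). a + b = m} \<times> {(a, b). a + b = n}) {(a, b). a + b = n + enc k m}"
    proof (rule bij_betwI[where g = "\<lambda>(a, b). ((dec k a, dec k b), (low k a, low k b))"])
      show "?h \<in> {(a, b). a + b = m} \<times> {(a, b). a + b = n} \<rightarrow> {(a, b). a + b = n + enc k m}"
        by (auto simp: enc_add ac_simps)
      show "(\<lambda>(a, b). ((dec k a, dec k b), (low k a, low k b))) \<in> {(a, b). a + b = n + enc k m} \<rightarrow>
          {(a, b). a + b = m} \<times> {(a, b). a + b = n}"
      proof (rule Pi_I)
        fix z assume "z \<in> {(a, b). a + b = n + enc k m}"
        then obtain a b where z: "z = (a, b)" "a + b = n + enc k m" by blast
        have "dec k a + dec k b = dec k (a + b)" by (rule uv_count_eqI) (simp_all add: dec_def)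
        moreover have "low k a + low k b = low k (a + b)" by (simp add: low_def)
        ultimately show "(\<lambda>(a, b). ((dec k a, dec k b), (low k a, low k b))) z \<in> {(a, b). a + b = m} \<times> {(a, b). a + b = n}"
          unfolding z(1) using dec_enc[OF True, of m] low_enc[OF True, of m] by (simp add: z(2))
      qed
      show "(\<lambda>(a, b). ((dec k a, dec k b), (low k a, low k b))) (?h x) = x"
        if x: "x \<in> {(a, b). a + b = m} \<times> {(a, b). a + b = n}" for x
      proof -
        obtain m1 m2 n1 n2 where e: "x = ((m1, m2), (n1, n2))" "n1 + n2 = n" using x by auto
        have "set_mset n1 \<subseteq> {1..k}" "set_mset n2 \<subseteq> {1..k}" using True e(2) by auto
        then show ?thesis unfolding e(1) by (simp only: case_prod_conv dec_enc low_enc)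
      qed
      show "?h ((\<lambda>(a, b). ((dec k a, dec k b), (low k a, low k b))) y) = y"
        if y: "y \<in> {(a, b). a + b = n + enc k m}" for y
      proof -
        obtain a b where e: "y = (a, b)" "a + b = n + enc k m" using y by auto
        show ?thesis unfolding e(1) case_prod_conv by (simp only: low_dec[OF sub(1)[OF e(2)]] low_dec[OF sub(2)[OF e(2)]])
      qed
    qed
    have "finsum R (\<lambda>(z, w). ?P (fst z) (fst w) \<otimes> ?Q (snd z) (snd w)) ({(a, b). a + b = m} \<times> {(a, b). a + b = n})
        = finsum R (\<lambda>z. sgn_uv m \<otimes> (P (fst z) \<otimes> Q (snd z))) {(a, b). a + b = n + enc k m}"
    proof (rule finsum_bij[OF bij])
      fix x assume x: "x \<in> {(a, b). a + b = m} \<times> {(a, b). a + b = n}"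
      obtain m1 m2 n1 n2 where e: "x = ((m1, m2), (n1, n2))" "n1 + n2 = n" "m1 + m2 = m" using x by auto
      have n: "set_mset n1 \<subseteq> {1..k}" "set_mset n2 \<subseteq> {1..k}" using True e(2) by auto
      have "sgn_uv m1 \<otimes> P (n1 + enc k m1) \<otimes> (sgn_uv m2 \<otimes> Q (n2 + enc k m2))
          = sgn_uv m1 \<otimes> sgn_uv m2 \<otimes> (P (n1 + enc k m1) \<otimes> Q (n2 + enc k m2))"
        using Pc sgn_uv(1) by (simp only: m_ac m_closed)
      then show "(case x of (z, w) \<Rightarrow> ?P (fst z) (fst w) \<otimes> ?Q (snd z) (snd w))
          = sgn_uv m \<otimes> (P (fst (?h x)) \<otimes> Q (snd (?h x)))"
        unfolding e(1) e(3)[symmetric] sgn_uv(2) using n by (simp add: split_uv_def)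
    qed (use Pc in auto)
    also have "\<dots> = sgn_uv m \<otimes> finsum R (\<lambda>z. P (fst z) \<otimes> Q (snd z)) {(a, b). a + b = n + enc k m}"
      using Pc by (intro finsum_rdistr[symmetric] finite_splits) auto
    finally show ?thesis using True by (simp add: split_uv_def ps_simps case_prod_unfold)
  qed
  finally show "split_uv k (P \<otimes>\<^bsub>T1 k\<^esub> Q) m n = (?P \<otimes>\<^bsub>T2 k\<^esub> ?Q) m n" by simp
qed

lemma split_uv_term:
  assumes c: "c \<in> carrier R" and n: "set_mset n \<subseteq> {1..k}"
  shows "split_uv k (ps_term R c (n + enc k m)) = ps_term (S k) (ps_term R (sgn_uv m \<otimes> c) n) m"
proof (intro ext)
  fix m' n'
  show "split_uv k (ps_term R c (n + enc k m)) m' n' = ps_term (S k) (ps_term R (sgn_uv m \<otimes> c) n) m m' n'"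
  proof (cases "set_mset n' \<subseteq> {1..k}")
    case True
    have "n' + enc k m' = n + enc k m \<longleftrightarrow> n' = n \<and> m' = m"
      using dec_enc[OF True, of m'] dec_enc[OF n, of m] low_enc[OF True, of m'] low_enc[OF n, of m] by metis
    then show ?thesis using True by (auto simp: split_uv_def ps_term_def ps_simps)
  next
    case False
    then have "n' \<noteq> n" using n by blast
    then show ?thesis using False by (simp add: split_uv_def ps_term_def ps_simps)
  qed
qed

lemma split_uv_hom: "split_uv k \<in> ring_hom (T1 k) (T2 k)"
proof (rule ring_hom_memI)
  fix P Q assume P: "P \<in> carrier (T1 k)" and Q: "Q \<in> carrier (T1 k)"
  show "split_uv k P \<in> carrier (T2 k)" by (rule split_uv_closed[OF P])
  show "split_uv k (P \<otimes>\<^bsub>T1 k\<^esub> Q) = split_uv k P \<otimes>\<^bsub>T2 k\<^esub> split_uv k Q" by (rule split_uv_mult[OF P Q])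
  have "P a \<in> carrier R" "Q a \<in> carrier R" for a using P Q unfolding ps_simps(1) supp_funs_def by blast+
  then show "split_uv k (P \<oplus>\<^bsub>T1 k\<^esub> Q) = split_uv k P \<oplus>\<^bsub>T2 k\<^esub> split_uv k Q"
    by (intro ext) (simp add: split_uv_def ps_simps r_distr)
next
  have "\<one>\<^bsub>T1 k\<^esub> = ps_term R \<one> ({#} + enc k {#})" by (auto simp: ps_simps ps_term_def enc_def)
  moreover have "\<one>\<^bsub>T2 k\<^esub> = ps_term (S k) (ps_term R (sgn_uv {#} \<otimes> \<one>) {#}) {#}"
    by (auto simp: ps_simps ps_term_def fun_eq_iff)
  ultimately show "split_uv k \<one>\<^bsub>T1 k\<^esub> = \<one>\<^bsub>T2 k\<^esub>" by (simp only: split_uv_term[OF one_closed] set_mset_empty empty_subsetI)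
qed

lemma split_uv_bij: "bij_betw (split_uv k) (carrier (T1 k)) (carrier (T2 k))"
proof (rule bij_betwI)
  let ?g = "\<lambda>W a. if set_mset a \<subseteq> {1..k + 2} then sgn_uv (dec k a) \<otimes> W (dec k a) (low k a) else \<zero>"
  show "split_uv k \<in> carrier (T1 k) \<rightarrow> carrier (T2 k)" using split_uv_closed by blast
  have W: "W m n \<in> carrier R" "\<not> set_mset n \<subseteq> {1..k} \<Longrightarrow> W m n = \<zero>" if "W \<in> carrier (T2 k)" for W m n
    using that unfolding ps_simps(1) supp_funs_def by blast+
  show "?g \<in> carrier (T2 k) \<rightarrow> carrier (T1 k)"
    unfolding ps_simps(1)[of R "{1..k + 2}"] supp_funs_def using W(1) sgn_uv(1) by simp
  show "?g (split_uv k P) = P" if P: "P \<in> carrier (T1 k)" for P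
  proof
    fix a
    have Pc: "P a \<in> carrier R" "\<not> set_mset a \<subseteq> {1..k + 2} \<Longrightarrow> P a = \<zero>" for a
      using P unfolding ps_simps(1) supp_funs_def by blast+
    show "?g (split_uv k P) a = P a"
      using Pc sgn_uv(1,3) set_low[of a k] low_dec[of a k]
      by (simp add: split_uv_def m_assoc[symmetric])
  qed
  show "split_uv k (?g W) = W" if "W \<in> carrier (T2 k)" for W
  proof (intro ext)
    fix m n
    show "split_uv k (?g W) m n = W m n"
    proof (cases "set_mset n \<subseteq> {1..k}")
      case True
      have "set_mset (n + enc k m) \<subseteq> {1..k + 2}" using True set_enc[of k m] by auto
      then show ?thesis
        using True W(1)[OF that] sgn_uv(1,3) by (simp add: split_uv_def dec_enc low_enc m_assoc[symmetric] del: set_mset_union)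
    qed (simp add: split_uv_def W(2)[OF that])
  qed
qed

end

section \<open>Algebraically closed fields\<close>

lemma (in algebraically_closed) root_exists:
  assumes c: "c \<in> carrier L" and n: "0 < n"
  shows "\<exists>b\<in>carrier L. b [^]\<^bsub>L\<^esub> (n :: nat) = c"
proof -
  \<comment> \<open>The polynomial \<open>X^n - c\<close>, highest coefficient first.\<close>
  define P where "P = \<one> # replicate (n - 1) \<zero> @ [\<ominus> c]"
  have P: "P \<in> carrier (poly_ring L)"
    unfolding univ_poly_carrier[symmetric] polynomial_def P_def using c by auto
  have "size (roots P) = n" using roots_over_carrier[OF P] n by (simp add: splitted_def P_def)
  then obtain b where "b \<in># roots P" using n by fastforce
  then have "is_root P b" using roots_mem_iff_is_root[OF P] by blast
  then have b: "b \<in> carrier L" "eval P b = \<zero>" by (auto simp: is_root_def)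
  have "eval (replicate i \<zero> @ [\<ominus> c]) b = \<ominus> c" for i
    using b(1) c by (induction i) auto
  then have "b [^] n \<oplus> \<ominus> c = \<zero>" using b n by (simp add: P_def)
  then have "b [^] n = c" using b(1) c by (metis a_minus_def nat_pow_closed r_right_minus_eq)
  then show ?thesis using b(1) by blast
qed

text \<open>On a finite field squaring would be bijective, being surjective by the existence of
  square roots. But 1 and -1 have the same square and differ in characteristic above 2.\<close>

lemma (in algebraically_closed) infinite_carrier:
  assumes "has_char L p" "p > 2" shows "infinite (carrier L)"
proof
  assume fin: "finite (carrier L)"
  let ?f = "\<lambda>b. b [^] (2 :: nat)"
  have "carrier L \<subseteq> ?f ` carrier L" using root_exists[of _ 2] by fastforce
  then have "?f ` carrier L = carrier L" by auto
  then have "inj_on ?f (carrier L)" using fin by (simp add: eq_card_imp_inj_on)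
  moreover have "?f \<one> = ?f (\<ominus> \<one>)" by (simp add: numeral_2_eq_2 l_minus)
  ultimately have "\<one> = \<ominus> \<one>" by (rule inj_onD) auto
  then have "\<one> \<oplus> \<one> = \<zero>" by (metis one_closed r_neg)
  then have "[(2 :: nat)] \<cdot> \<one> = \<zero>" by (simp add: numeral_2_eq_2)
  then have "p dvd 2" using assms(1) unfolding has_char_def by blast
  then show False using assms(2) by (auto dest: dvd_imp_le)
qed

theorem proposition6p3:
  fixes K :: "('a, 'm) ring_scheme" and p k :: nat and d :: "nat multiset"
  defines "S \<equiv> power_series_ring K {1..k}"
  defines "f \<equiv> ps_term K \<one>\<^bsub>K\<^esub> d"
  assumes "algebraically_closed K"
    and "Factorial_Ring.prime p" and "p > 2" and "has_char K p"
    and "k > 2"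
    and "set_mset d \<subseteq> {1..k}" and "size d > 3"
  shows "FFRT p (uv_hypersurface S f) \<and> \<not> finite_CM_type (uv_hypersurface S f)"
proof -
  interpret K: algebraically_closed K by fact
  interpret S: power_series K "{1..k}" by (intro power_series.intro K.is_cring)
  interpret T2: power_series S "{U, V}" unfolding S_def by (intro power_series.intro S.T.is_cring)
  interpret T1: power_series_field K "{1..k + 2}"
    by (intro power_series_field.intro power_series.intro K.is_cring K.field_axioms)
  let ?I = "{1..k + 2}" and ?\<Phi> = "K.split_uv k"
  have f: "f \<in> carrier S" unfolding f_def S_def using assms(8) by (intro S.ps_term_closed) auto
  let ?w = "ps_term S \<one>\<^bsub>S\<^esub> {#U#} \<otimes>\<^bsub>T2.T\<^esub> ps_term S \<one>\<^bsub>S\<^esub> {#V#}"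
  define g where "g = ps_term S f {#} \<oplus>\<^bsub>T2.T\<^esub> ?w"
  have w: "?w \<in> carrier T2.T" by (intro T2.T.m_closed T2.ps_term_closed) auto
  have g: "g \<in> carrier T2.T" unfolding g_def using f w by (intro T2.T.a_closed T2.ps_term_closed) auto
  define G where "G = PIdl\<^bsub>T2.T\<^esub> g"
  have A_eq: "uv_hypersurface S f = T2.T Quot G" by (simp add: uv_hypersurface_def Let_def G_def g_def)
  interpret G: ideal G T2.T unfolding G_def by (rule T2.T.cgenideal_ideal[OF g])
  define F where "F = ps_term K \<one>\<^bsub>K\<^esub> d \<ominus>\<^bsub>T1.T\<^esub> ps_term K \<one>\<^bsub>K\<^esub> {#k + 1, k + 2#}"
  have \<Phi>: "?\<Phi> \<in> ring_hom T1.T T2.T" "bij_betw ?\<Phi> (carrier T1.T) (carrier T2.T)"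
    unfolding S_def by (rule K.split_uv_hom, rule K.split_uv_bij)
  interpret \<Phi>: ring_hom_ring T1.T T2.T ?\<Phi>
    by (rule ring_hom_ringI2[OF T1.T.ring_axioms T2.T.ring_axioms \<Phi>(1)])
  have dI: "set_mset d \<subseteq> ?I" using assms(8) by auto
  have Fc: "ps_term K \<one>\<^bsub>K\<^esub> d \<in> carrier T1.T" "ps_term K \<one>\<^bsub>K\<^esub> {#k + 1, k + 2#} \<in> carrier T1.T"
    by (rule T1.ps_term_closed[OF K.one_closed dI], rule T1.ps_term_closed[OF K.one_closed]) simp
  have F: "F \<in> carrier T1.T" unfolding F_def using Fc by (rule T1.T.minus_closed)
  \<comment> \<open>The sign attached to u turns the product
    \<open>- x\<^sub>k\<^sub>+\<^sub>1 x\<^sub>k\<^sub>+\<^sub>2\<close> into \<open>u v\<close>, so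
    the binomial becomes the given equation \<open>f + u v\<close>.\<close>
  have "?\<Phi> F = g"
  proof -
    have "?\<Phi> (ps_term K \<one>\<^bsub>K\<^esub> (d + enc k {#})) = ps_term S (ps_term K (K.sgn_uv {#} \<otimes>\<^bsub>K\<^esub> \<one>\<^bsub>K\<^esub>) d) {#}"
      unfolding S_def by (rule K.split_uv_term[OF K.one_closed assms(8)])
    then have 1: "?\<Phi> (ps_term K \<one>\<^bsub>K\<^esub> d) = ps_term S f {#}" by (simp add: enc_def f_def)
    have "?\<Phi> (ps_term K (\<ominus>\<^bsub>K\<^esub> \<one>\<^bsub>K\<^esub>) ({#} + enc k {#U, V#}))
        = ps_term S (ps_term K (K.sgn_uv {#U, V#} \<otimes>\<^bsub>K\<^esub> \<ominus>\<^bsub>K\<^esub> \<one>\<^bsub>K\<^esub>) {#}) {#U, V#}"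
      unfolding S_def by (rule K.split_uv_term) simp_all
    moreover have "enc k {#U, V#} = {#k + 1, k + 2#}" by (simp add: enc_def)
    moreover have "ps_term K \<one>\<^bsub>K\<^esub> {#} = \<one>\<^bsub>S\<^esub>" by (auto simp: ps_term_def S_def ps_simps)
    moreover have "?w = ps_term S \<one>\<^bsub>S\<^esub> {#U, V#}" by (subst T2.ps_term_mult) (auto simp: add_mset_commute)
    ultimately have 2: "?\<Phi> (ps_term K (\<ominus>\<^bsub>K\<^esub> \<one>\<^bsub>K\<^esub>) {#k + 1, k + 2#}) = ?w"
      by (simp add: K.l_minus)
    have "\<ominus>\<^bsub>T1.T\<^esub> ps_term K \<one>\<^bsub>K\<^esub> {#k + 1, k + 2#} = ps_term K (\<ominus>\<^bsub>K\<^esub> \<one>\<^bsub>K\<^esub>) {#k + 1, k + 2#}"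
      using T1.coeff_minus[OF Fc(2)] by (intro ext) (simp add: ps_term_def)
    moreover have "ps_term K (\<ominus>\<^bsub>K\<^esub> \<one>\<^bsub>K\<^esub>) {#k + 1, k + 2#} \<in> carrier T1.T" by (intro T1.ps_term_closed) auto
    ultimately show ?thesis
      unfolding F_def g_def T1.T.minus_eq using \<Phi>.hom_add[OF Fc(1)] 1 2 by (simp only:)
  qed
  define \<Theta> where "\<Theta> P = G +>\<^bsub>T2.T\<^esub> ?\<Phi> P" for P
  have \<Theta>_hom: "\<Theta> \<in> ring_hom T1.T (T2.T Quot G)"
    using ring_hom_trans[OF \<Phi>(1) G.rcos_ring_hom] by (simp add: \<Theta>_def[abs_def] comp_def)
  have zero_iff: "\<Theta> P = \<zero>\<^bsub>T2.T Quot G\<^esub> \<longleftrightarrow> (\<exists>H\<in>carrier T1.T. P = H \<otimes>\<^bsub>T1.T\<^esub> F)" if P: "P \<in> carrier T1.T" for P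
  proof -
    have "\<Theta> P = \<zero>\<^bsub>T2.T Quot G\<^esub> \<longleftrightarrow> ?\<Phi> P \<in> G"
      using T2.T.a_rcos_zero[OF G.ideal_axioms, of "?\<Phi> P"] G.rcos_const_imp_mem[of "?\<Phi> P"] \<Phi>.hom_closed[OF P]
      unfolding \<Theta>_def FactRing_def ring.simps by blast
    also have "\<dots> \<longleftrightarrow> (\<exists>W\<in>carrier T2.T. ?\<Phi> P = W \<otimes>\<^bsub>T2.T\<^esub> g)" unfolding G_def cgenideal_def by blast
    also have "\<dots> \<longleftrightarrow> (\<exists>H\<in>carrier T1.T. ?\<Phi> P = ?\<Phi> H \<otimes>\<^bsub>T2.T\<^esub> g)"
      unfolding bij_betw_imp_surj_on[OF \<Phi>(2), symmetric] by (rule bex_simps(7))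
    also have "\<dots> \<longleftrightarrow> (\<exists>H\<in>carrier T1.T. ?\<Phi> P = ?\<Phi> (H \<otimes>\<^bsub>T1.T\<^esub> F))"
      by (intro bex_cong refl) (simp only: \<Phi>.hom_mult F \<open>?\<Phi> F = g\<close>)
    also have "\<dots> \<longleftrightarrow> (\<exists>H\<in>carrier T1.T. P = H \<otimes>\<^bsub>T1.T\<^esub> F)"
      by (intro bex_cong refl inj_on_eq_iff[OF bij_betw_imp_inj_on[OF \<Phi>(2)]] P T1.T.m_closed F)
    finally show ?thesis .
  qed
  interpret B: binomial_hypersurface K ?I "uv_hypersurface S f" \<Theta> d "k + 1" "k + 2"
  proof (intro binomial_hypersurface.intro T1.power_series_field_axioms binomial_hypersurface_axioms.intro)
    show "cring (uv_hypersurface S f)" unfolding A_eq by (rule G.quotient_is_cring[OF T2.T.is_cring])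
    show "\<Theta> \<in> ring_hom T1.T (uv_hypersurface S f)" unfolding A_eq by (rule \<Theta>_hom)
    have "carrier (T2.T Quot G) = (\<lambda>W. G +>\<^bsub>T2.T\<^esub> W) ` carrier T2.T" by (auto simp: FactRing_def A_RCOSETS_def')
    also have "\<dots> = \<Theta> ` carrier T1.T" unfolding bij_betw_imp_surj_on[OF \<Phi>(2), symmetric] by (simp add: image_image \<Theta>_def)
    finally show "\<Theta> ` carrier T1.T = carrier (uv_hypersurface S f)" unfolding A_eq by simp
    show "set_mset d \<subseteq> ?I - {k + 1, k + 2}" using assms(8) by auto
    show "\<Theta> P = \<zero>\<^bsub>uv_hypersurface S f\<^esub> \<longleftrightarrow> (\<exists>H\<in>carrier T1.T.
        P = H \<otimes>\<^bsub>T1.T\<^esub> (ps_term K \<one>\<^bsub>K\<^esub> d \<ominus>\<^bsub>T1.T\<^esub> ps_term K \<one>\<^bsub>K\<^esub> {#k + 1, k + 2#}))" if "P \<in> carrier T1.T" for P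
      unfolding A_eq F_def[symmetric] by (rule zero_iff[OF that])
  qed (use assms(9) in auto)
  show ?thesis
  proof
    show "FFRT p (uv_hypersurface S f)"
      by (rule B.FFRT_A[OF _ assms(4,6) K.root_exists]) (use assms(9) in auto)
    show "\<not> finite_CM_type (uv_hypersurface S f)"
      by (rule B.not_finite_CM_type[of 1 2]) (use assms K.infinite_carrier in auto)
  qed
qed

end
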